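(* Let $\Gamma$ be a $Gr'(1/6)$-labelled graph whose components are finite, labelled by a finite set $\mathcal S$, and assume that $G(\Gamma)$ is infinite. Then there exists an infinite order element $g\in G(\Gamma)$ such that $\langle g\rangle$ is strongly contracting in $\mathrm{Cay}(G(\Gamma),\mathcal S)$.
   Context: Graphical small cancellation. An $\mathcal S$-labelled graph $\Gamma$ is a directed graph with edges labelled by elements of $\mathcal S$; paths may traverse edges backwards, reading inverse labels. The labelling is assumed reduced: no vertex has two outgoing edges with the same label, and no vertex has two incoming edges with the same label. $G(\Gamma)=\langle\mathcal S\mid\mathcal R\rangle$, where $\mathcal R$ is the set of words read on simple cycles of $\Gamma$. A piece is a labelled path graph $p$ with two label-preserving maps $\phi_1,\phi_2\colon p\to\Gamma$ such that no label-preserving automorphism $\psi$ of $\Gamma$ has $\phi_2=\psi\circ\phi_1$. $\Gamma$ is $Gr'(1/6)$-labelled if every piece $p$ contained in a simple cycle $c$ has $|p|<|c|/6$ (with $|\cdot|$ the number of edges). Contraction. Cayley graphs carry the graph metric. A subset $Y$ (here the vertex set $\langle g\rangle$) is strongly contracting if there is a constant $C$ such that, for all $x,x'$, $d(x,x')\le d(x,Y)$ implies $\mathrm{diam}(\pi(x)\cup\pi(x'))\le C$. Here $\pi(x)=\{y\in Y:d(x,y)=d(x,Y)\}$. *)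

theory Defs
  imports Complex_Main
begin

record ('v, 'e, 's) lgraph =
  verts :: "'v set"
  edges :: "'e set"
  src   :: "'e \<Rightarrow> 'v"
  tgt   :: "'e \<Rightarrow> 'v"
  lab   :: "'e \<Rightarrow> 's"

text \<open>An oriented edge (e, True) traverses e forwards, (e, False) backwards
  (reading the inverse label).\<close>

definition ofrom :: "('v, 'e, 's) lgraph \<Rightarrow> 'e \<times> bool \<Rightarrow> 'v" where
  "ofrom G eb = (if snd eb then src G (fst eb) else tgt G (fst eb))"

definition oto :: "('v, 'e, 's) lgraph \<Rightarrow> 'e \<times> bool \<Rightarrow> 'v" where
  "oto G eb = (if snd eb then tgt G (fst eb) else src G (fst eb))"

definition wf_lgraph :: "('v, 'e, 's) lgraph \<Rightarrow> 's set \<Rightarrow> bool" where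
  "wf_lgraph G S \<longleftrightarrow> (\<forall>e\<in>edges G. src G e \<in> verts G \<and> tgt G e \<in> verts G \<and> lab G e \<in> S)"

definition reduced :: "('v, 'e, 's) lgraph \<Rightarrow> bool" where
  "reduced G \<longleftrightarrow>
     (\<forall>e\<in>edges G. \<forall>e'\<in>edges G. src G e = src G e' \<and> lab G e = lab G e' \<longrightarrow> e = e') \<and>
     (\<forall>e\<in>edges G. \<forall>e'\<in>edges G. tgt G e = tgt G e' \<and> lab G e = lab G e' \<longrightarrow> e = e')"

fun walk :: "('v, 'e, 's) lgraph \<Rightarrow> 'v \<Rightarrow> ('e \<times> bool) list \<Rightarrow> bool" where
  "walk G v [] = (v \<in> verts G)"
| "walk G v (eb # es) = (v \<in> verts G \<and> fst eb \<in> edges G \<and> ofrom G eb = v \<and> walk G (oto G eb) es)"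

fun walk_verts :: "('v, 'e, 's) lgraph \<Rightarrow> 'v \<Rightarrow> ('e \<times> bool) list \<Rightarrow> 'v list" where
  "walk_verts G v [] = [v]"
| "walk_verts G v (eb # es) = v # walk_verts G (oto G eb) es"

definition walk_end :: "('v, 'e, 's) lgraph \<Rightarrow> 'v \<Rightarrow> ('e \<times> bool) list \<Rightarrow> 'v" where
  "walk_end G v es = last (walk_verts G v es)"

text \<open>The word read along a walk (letters are (generator, exponent sign)).\<close>
definition read_word :: "('v, 'e, 's) lgraph \<Rightarrow> ('e \<times> bool) list \<Rightarrow> ('s \<times> bool) list" where
  "read_word G es = map (\<lambda>(e, b). (lab G e, b)) es"

definition simple_cycle :: "('v, 'e, 's) lgraph \<Rightarrow> 'v \<Rightarrow> ('e \<times> bool) list \<Rightarrow> bool" where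
  "simple_cycle G v es \<longleftrightarrow> walk G v es \<and> es \<noteq> [] \<and> walk_end G v es = v \<and>
     distinct (butlast (walk_verts G v es)) \<and> distinct (map fst es)"

definition component :: "('v, 'e, 's) lgraph \<Rightarrow> 'v \<Rightarrow> 'v set" where
  "component G v = {u. \<exists>es. walk G v es \<and> walk_end G v es = u}"

definition finite_components :: "('v, 'e, 's) lgraph \<Rightarrow> bool" where
  "finite_components G \<longleftrightarrow>
     (\<forall>v\<in>verts G. finite (component G v) \<and> finite {e\<in>edges G. src G e \<in> component G v})"

definition lab_aut :: "('v, 'e, 's) lgraph \<Rightarrow> ('v \<Rightarrow> 'v) \<Rightarrow> ('e \<Rightarrow> 'e) \<Rightarrow> bool" where
  "lab_aut G fv fe \<longleftrightarrow> bij_betw fv (verts G) (verts G) \<and> bij_betw fe (edges G) (edges G) \<and>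
     (\<forall>e\<in>edges G. src G (fe e) = fv (src G e) \<and> tgt G (fe e) = fv (tgt G e) \<and> lab G (fe e) = lab G e)"

text \<open>A piece: a labelled path graph with two label-preserving maps into the graph,
  i.e. two walks (v1,es1), (v2,es2) with the same orientation pattern and the same
  labels, such that no label-preserving automorphism carries the first to the second.\<close>
definition piece :: "('v, 'e, 's) lgraph \<Rightarrow> 'v \<Rightarrow> ('e \<times> bool) list \<Rightarrow> 'v \<Rightarrow> ('e \<times> bool) list \<Rightarrow> bool" where
  "piece G v1 es1 v2 es2 \<longleftrightarrow> walk G v1 es1 \<and> walk G v2 es2 \<and> length es1 = length es2 \<and>
     map snd es1 = map snd es2 \<and> read_word G es1 = read_word G es2 \<and>
     \<not> (\<exists>fv fe. lab_aut G fv fe \<and> map fv (walk_verts G v1 es1) = walk_verts G v2 es2 \<and>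
                map fe (map fst es1) = map fst es2)"

definition subpath_of_cycle :: "('v, 'e, 's) lgraph \<Rightarrow> 'v \<Rightarrow> ('e \<times> bool) list \<Rightarrow> 'v \<Rightarrow> ('e \<times> bool) list \<Rightarrow> bool" where
  "subpath_of_cycle G v1 es1 v es \<longleftrightarrow>
     (\<exists>k < length es. v1 = walk_verts G v es ! k \<and> es1 = take (length es1) (rotate k es))"

definition Gr_sixth :: "('v, 'e, 's) lgraph \<Rightarrow> bool" where
  "Gr_sixth G \<longleftrightarrow> (\<forall>v es v1 es1 v2 es2. simple_cycle G v es \<and> piece G v1 es1 v2 es2 \<and>
       subpath_of_cycle G v1 es1 v es \<longrightarrow> real (length es1) < real (length es) / 6)"

definition relators :: "('v, 'e, 's) lgraph \<Rightarrow> ('s \<times> bool) list set" where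
  "relators G = {read_word G es | v es. simple_cycle G v es}"

definition words :: "'s set \<Rightarrow> ('s \<times> bool) list set" where
  "words S = {w. \<forall>x\<in>set w. fst x \<in> S}"

definition inv_letter :: "'s \<times> bool \<Rightarrow> 's \<times> bool" where
  "inv_letter x = (fst x, \<not> snd x)"

definition inv_word :: "('s \<times> bool) list \<Rightarrow> ('s \<times> bool) list" where
  "inv_word w = rev (map inv_letter w)"

inductive_set word_eq :: "'s set \<Rightarrow> ('s \<times> bool) list set \<Rightarrow> (('s \<times> bool) list \<times> ('s \<times> bool) list) set"
  for S R where
  refl: "w \<in> words S \<Longrightarrow> (w, w) \<in> word_eq S R"
| sym: "(u, v) \<in> word_eq S R \<Longrightarrow> (v, u) \<in> word_eq S R"
| trans: "(u, v) \<in> word_eq S R \<Longrightarrow> (v, w) \<in> word_eq S R \<Longrightarrow> (u, w) \<in> word_eq S R"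
| cancel: "u \<in> words S \<Longrightarrow> v \<in> words S \<Longrightarrow> fst x \<in> S \<Longrightarrow>
           (u @ [x, inv_letter x] @ v, u @ v) \<in> word_eq S R"
| relator: "u \<in> words S \<Longrightarrow> v \<in> words S \<Longrightarrow> r \<in> R \<Longrightarrow> r \<in> words S \<Longrightarrow>
           (u @ r @ v, u @ v) \<in> word_eq S R"

definition group_elems :: "'s set \<Rightarrow> ('s \<times> bool) list set \<Rightarrow> ('s \<times> bool) list set set" where
  "group_elems S R = words S // word_eq S R"

definition word_zpow :: "('s \<times> bool) list \<Rightarrow> int \<Rightarrow> ('s \<times> bool) list" where
  "word_zpow w k = (if k \<ge> 0 then concat (replicate (nat k) w) else concat (replicate (nat (- k)) (inv_word w)))"

definition infinite_order :: "'s set \<Rightarrow> ('s \<times> bool) list set \<Rightarrow> ('s \<times> bool) list \<Rightarrow> bool" where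
  "infinite_order S R w \<longleftrightarrow> (\<forall>k::int. k \<noteq> 0 \<longrightarrow> (word_zpow w k, []) \<notin> word_eq S R)"

definition cyclic_sub :: "'s set \<Rightarrow> ('s \<times> bool) list set \<Rightarrow> ('s \<times> bool) list \<Rightarrow> ('s \<times> bool) list set" where
  "cyclic_sub S R w = {u \<in> words S. \<exists>k::int. (u, word_zpow w k) \<in> word_eq S R}"

definition cay_dist :: "'s set \<Rightarrow> ('s \<times> bool) list set \<Rightarrow> ('s \<times> bool) list \<Rightarrow> ('s \<times> bool) list \<Rightarrow> nat" where
  "cay_dist S R u v = (LEAST n. \<exists>w\<in>words S. length w = n \<and> (u @ w, v) \<in> word_eq S R)"

definition set_dist :: "'s set \<Rightarrow> ('s \<times> bool) list set \<Rightarrow> ('s \<times> bool) list \<Rightarrow> ('s \<times> bool) list set \<Rightarrow> nat" where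
  "set_dist S R x Y = (LEAST n. \<exists>y\<in>Y. cay_dist S R x y = n)"

definition closest_proj :: "'s set \<Rightarrow> ('s \<times> bool) list set \<Rightarrow> ('s \<times> bool) list set \<Rightarrow> ('s \<times> bool) list \<Rightarrow> ('s \<times> bool) list set" where
  "closest_proj S R Y x = {y \<in> Y. cay_dist S R x y = set_dist S R x Y}"

definition strongly_contracting :: "'s set \<Rightarrow> ('s \<times> bool) list set \<Rightarrow> ('s \<times> bool) list set \<Rightarrow> bool" where
  "strongly_contracting S R Y \<longleftrightarrow> (\<exists>C::nat. \<forall>x\<in>words S. \<forall>x'\<in>words S.
      cay_dist S R x x' \<le> set_dist S R x Y \<longrightarrow>
      (\<forall>y\<in>closest_proj S R Y x \<union> closest_proj S R Y x'.
       \<forall>y'\<in>closest_proj S R Y x \<union> closest_proj S R Y x'. cay_dist S R y y' \<le> C))"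

end

theory Submission
  imports Defs
begin

text \<open>If some generator labels no edge of a simple cycle, it generates a free factor and serves as
  \<open>w\<close>. Otherwise two inequivalent vertices lie on simple cycles, since \<open>G(\<Gamma>)\<close> is infinite. Follow half of a
  shortest cycle through one of them, jump to one that is not equivalent to the vertex reached,
  and repeat: after finitely many states this is periodic, and \<open>w\<close> is the word read in a period. No half
  cycle used is a product of three pieces. Hence in a diagram over \<open>\<Gamma>\<close> that is reduced with respect to the
  automorphisms of \<open>\<Gamma>\<close>, no face contains a full half cycle of the side labelled by a power of \<open>w\<close>, and
  faces along this side have negative curvature unless they also touch another side. If the other sides
  are three geodesics, then all but boundedly many half cycles are close to these.
  Applied to the quadrilateral formed by two points \<open>x\<close>, \<open>x'\<close> with \<open>d(x, x') \<le> d(x, Y)\<close> and their projections,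
  this bounds the distance of the projections.\<close>

subsection \<open>Orbits and planar maps\<close>

text \<open>Three pieces are the right threshold for a half cycle. In a reduced diagram a block of
  the side labelled by the power of \<open>w\<close> may have lost an initial segment to the block
  before it and a final segment to the block after it. Each block starts at a vertex inequivalent to
  the end of the previous one, so both segments are pieces; if the rest lay on one face, it would be
  a third. So a run of a face along this side, away from its ends, consists of at most two pieces,
  which forces \<open>Ni + 2 * Ne \<ge> 7\<close> in the count of arcs, where six would be flat. The
  segments lost at a junction may differ as words and agree only in the group. This is why
  \<open>twogon\<close> comes first: it replaces them by one word read from both vertices. Applied
  to a closed path it shows that components embed, which excludes that an inner face is glued to
  itself by a nontrivial automorphism. Diagrams are permutations of finitely many darts. Since
  surgeries come down to exchanging two values of a permutation, planarity is controlled by counting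
  orbits, and the Jordan curve theorem takes the form of the Euler inequality.\<close>

definition cls :: "('a \<Rightarrow> 'a) set \<Rightarrow> 'a \<Rightarrow> 'a set" where
  "cls Fs x = {y. (x, y) \<in> {(u, f u) | u f. f \<in> Fs}\<^sup>*}"

definition perms :: "'a set \<Rightarrow> ('a \<Rightarrow> 'a) set \<Rightarrow> bool" where
  "perms D Fs \<longleftrightarrow> finite D \<and> (\<forall>f\<in>Fs. bij_betw f D D)"

definition ncl :: "('a \<Rightarrow> 'a) set \<Rightarrow> 'a set \<Rightarrow> nat" where
  "ncl Fs D = card (cls Fs ` D)"

lemma cls_refl [simp]: "x \<in> cls Fs x"
  by (simp add: cls_def)

lemma cls_step: "y \<in> cls Fs x \<Longrightarrow> f \<in> Fs \<Longrightarrow> f y \<in> cls Fs x"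
  unfolding cls_def by (auto intro: rtrancl_into_rtrancl)

lemma cls_least:
  assumes "x \<in> U" "\<And>f u. f \<in> Fs \<Longrightarrow> u \<in> U \<Longrightarrow> f u \<in> U"
  shows "cls Fs x \<subseteq> U"
proof
  fix y assume "y \<in> cls Fs x"
  hence "(x, y) \<in> {(u, f u) | u f. f \<in> Fs}\<^sup>*" by (simp add: cls_def)
  thus "y \<in> U" by (induction rule: rtrancl_induct) (use assms in auto)
qed

lemma cls_trans: "y \<in> cls Fs x \<Longrightarrow> cls Fs y \<subseteq> cls Fs x"
  by (rule cls_least) (auto intro: cls_step)

lemma perms_in: "perms D Fs \<Longrightarrow> f \<in> Fs \<Longrightarrow> x \<in> D \<Longrightarrow> f x \<in> D"
  by (auto simp: perms_def bij_betw_def)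

lemma cls_sub: "perms D Fs \<Longrightarrow> x \<in> D \<Longrightarrow> cls Fs x \<subseteq> D"
  by (rule cls_least) (simp_all add: perms_in[of D Fs])

lemma cls_mono: "Fs \<subseteq> Gs \<Longrightarrow> cls Fs x \<subseteq> cls Gs x"
  by (rule cls_least) (auto intro: cls_step)

text \<open>\<open>cls\<close> only allows forward steps, but on a finite set these are reversible:
  \<open>f\<close> maps the finite set \<open>cls Fs (f x)\<close> injectively into itself, hence
  onto, and by injectivity the preimage of \<open>f x\<close> in it is \<open>x\<close>. So the
  classes are orbits of the generated group.\<close>

lemma cls_back1:
  assumes "perms D Fs" "f \<in> Fs" "x \<in> D"
  shows "x \<in> cls Fs (f x)"
proof -
  let ?U = "cls Fs (f x)"
  have fx: "f x \<in> D" using perms_in[OF assms] .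
  have sub: "?U \<subseteq> D" using cls_sub[OF assms(1) fx] .
  have fin: "finite ?U" using sub assms(1) by (auto simp: perms_def intro: finite_subset)
  have inj: "inj_on f D" using assms by (auto simp: perms_def bij_betw_def)
  have "f ` ?U \<subseteq> ?U" using assms(2) by (auto intro: cls_step)
  hence "f ` ?U = ?U"
    using fin inj sub by (meson card_image card_subset_eq inj_on_subset)
  then obtain u where "u \<in> ?U" "f u = f x" by (metis cls_refl imageE)
  thus ?thesis using inj sub assms(3) by (metis inj_onD subsetD)
qed

lemma cls_sym:
  assumes "perms D Fs" "x \<in> D" "y \<in> cls Fs x"
  shows "x \<in> cls Fs y"
proof -
  let ?U = "{y \<in> D. x \<in> cls Fs y}"
  have "cls Fs x \<subseteq> ?U"
  proof (rule cls_least)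
    show "x \<in> ?U" using assms by simp
    fix f u assume f: "f \<in> Fs" and u: "u \<in> ?U"
    hence "u \<in> cls Fs (f u)" using cls_back1[OF assms(1) f] by blast
    hence "cls Fs u \<subseteq> cls Fs (f u)" by (rule cls_trans)
    hence "x \<in> cls Fs (f u)" using u by blast
    thus "f u \<in> ?U" using u perms_in[OF assms(1) f, of u] by simp
  qed
  thus ?thesis using assms by auto
qed

lemma cls_eq:
  assumes "perms D Fs" "x \<in> D" "y \<in> cls Fs x"
  shows "cls Fs y = cls Fs x"
  using cls_trans[OF cls_sym[OF assms]] cls_trans[OF assms(3)] by (rule equalityI[rotated])

lemma cls_disj:
  assumes "perms D Fs" "x \<in> D" "y \<in> D" "y \<notin> cls Fs x"
  shows "cls Fs x \<inter> cls Fs y = {}"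
  using assms cls_eq by (metis disjoint_iff cls_refl)

lemma perms_closed_compl:
  assumes "perms D Fs" "C \<subseteq> D" "\<forall>f\<in>Fs. \<forall>x\<in>C. f x \<in> C"
  shows "perms C Fs" "perms (D - C) Fs"
proof -
  have fin: "finite D" using assms by (simp add: perms_def)
  hence finC: "finite C" using assms(2) finite_subset by blast
  have b: "bij_betw f C C \<and> bij_betw f (D - C) (D - C)" if f: "f \<in> Fs" for f
  proof -
    have D: "bij_betw f D D" using assms f by (simp add: perms_def)
    hence inj: "inj_on f C" using assms(2) by (auto simp: bij_betw_def intro: inj_on_subset)
    have "f ` C \<subseteq> C" using assms(3) f by auto
    hence "f ` C = C" using inj finC by (meson card_image card_subset_eq)
    hence "bij_betw f C C" using inj by (simp add: bij_betw_def)
    moreover have "f ` (D - C) = D - C"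
      using D \<open>f ` C = C\<close> assms(2) inj_on_image_set_diff[of f D D C] by (auto simp: bij_betw_def)
    moreover have "inj_on f (D - C)" using D by (auto simp: bij_betw_def intro: inj_on_subset)
    ultimately show ?thesis by (simp add: bij_betw_def)
  qed
  show "perms C Fs" "perms (D - C) Fs" using b fin finC by (auto simp: perms_def)
qed

lemma ncl_additive:
  assumes "perms D Fs" "C \<subseteq> D" "\<forall>f\<in>Fs. \<forall>x\<in>C. f x \<in> C"
  shows "ncl Fs D = ncl Fs C + ncl Fs (D - C)"
proof -
  note p = perms_closed_compl[OF assms]
  have fin: "finite D" using assms by (simp add: perms_def)
  have "cls Fs ` D = cls Fs ` C \<union> cls Fs ` (D - C)" using assms(2) by auto
  moreover have "cls Fs ` C \<inter> cls Fs ` (D - C) = {}"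
  proof -
    have "x \<in> cls Fs y \<Longrightarrow> y \<in> C \<Longrightarrow> x \<in> C" for x y
      using cls_sub[OF p(1)] by blast
    hence "cls Fs x \<noteq> cls Fs y" if "x \<in> C" "y \<in> D - C" for x y
      using that cls_refl[of y Fs] by (metis DiffE)
    thus ?thesis by blast
  qed
  ultimately show ?thesis
    using fin finite_subset[OF assms(2)] by (simp add: ncl_def card_Un_disjoint)
qed

text \<open>Abstract form of the counts for surgeries: the classes of \<open>Gs\<close> are those of
  \<open>Fs\<close>, except that the classes of \<open>a\<close> and \<open>b\<close> have become
  one. The hypotheses ask this only of single steps.\<close>

lemma ncl_join:
  assumes F: "perms D Fs" and G: "perms D Gs" and ab: "a \<in> D" "b \<in> D"
    and FG: "\<forall>f\<in>Fs. \<forall>x\<in>D. f x \<in> cls Gs x" and bG: "b \<in> cls Gs a"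
    and GF: "\<forall>g\<in>Gs. \<forall>x\<in>D. g x \<in> cls Fs x \<or>
       (x \<in> cls Fs a \<union> cls Fs b \<and> g x \<in> cls Fs a \<union> cls Fs b)"
  shows "ncl Fs D = ncl Gs D + (if b \<in> cls Fs a then 0 else 1)"
    and "x \<in> D \<Longrightarrow> cls Fs x \<subseteq> cls Gs x"
proof -
  let ?J = "cls Fs a \<union> cls Fs b"
  have JD: "?J \<subseteq> D" using cls_sub[OF F] ab by auto
  have sub: "cls Fs x \<subseteq> cls Gs x" if x: "x \<in> D" for x
  proof -
    have "cls Fs x \<subseteq> cls Gs x \<inter> D"
    proof (rule cls_least)
      show "x \<in> cls Gs x \<inter> D" using x by simp
      fix f u assume "f \<in> Fs" "u \<in> cls Gs x \<inter> D"
      thus "f u \<in> cls Gs x \<inter> D"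
        using FG cls_trans[of u Gs x] perms_in[OF F, of f u] by blast
    qed
    thus ?thesis by blast
  qed
  thus "x \<in> D \<Longrightarrow> cls Fs x \<subseteq> cls Gs x" .
  have J: "cls Gs x = ?J" if x: "x \<in> ?J" for x
  proof
    show "cls Gs x \<subseteq> ?J"
    proof (rule cls_least)
      show "x \<in> ?J" by fact
      fix f u assume "f \<in> Gs" "u \<in> ?J"
      thus "f u \<in> ?J" using GF JD cls_trans[of u Fs a] cls_trans[of u Fs b] by blast
    qed
    have "cls Gs b = cls Gs a" using cls_eq[OF G ab(1) bG] .
    hence "?J \<subseteq> cls Gs a" using sub ab by blast
    moreover have "cls Gs x = cls Gs a" using cls_eq[OF G ab(1)] calculation x by blast
    ultimately show "?J \<subseteq> cls Gs x" by simp
  qed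
  have nJ: "cls Gs x = cls Fs x" if x: "x \<in> D" "x \<notin> ?J" for x
  proof
    have dis: "cls Fs x \<inter> ?J = {}"
      using x cls_disj[OF F ab(1) x(1)] cls_disj[OF F ab(2) x(1)] by blast
    show "cls Gs x \<subseteq> cls Fs x"
    proof (rule cls_least)
      show "x \<in> cls Fs x" by simp
      fix f u assume "f \<in> Gs" "u \<in> cls Fs x"
      thus "f u \<in> cls Fs x"
        using GF dis cls_trans[of u Fs x] cls_sub[OF F x(1)] by blast
    qed
    show "cls Fs x \<subseteq> cls Gs x" using sub x by blast
  qed
  have eq: "cls Gs ` D = insert ?J (cls Fs ` (D - ?J))"
  proof
    show "cls Gs ` D \<subseteq> insert ?J (cls Fs ` (D - ?J))"
    proof
      fix X assume "X \<in> cls Gs ` D"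
      then obtain x where "x \<in> D" "X = cls Gs x" by blast
      thus "X \<in> insert ?J (cls Fs ` (D - ?J))" using J nJ by (cases "x \<in> ?J") auto
    qed
    have "?J = cls Gs a" using J[of a] by simp
    thus "insert ?J (cls Fs ` (D - ?J)) \<subseteq> cls Gs ` D" using nJ ab by auto
  qed
  have eq2: "cls Fs ` D = insert (cls Fs a) (insert (cls Fs b) (cls Fs ` (D - ?J)))"
  proof
    show "cls Fs ` D \<subseteq> insert (cls Fs a) (insert (cls Fs b) (cls Fs ` (D - ?J)))"
    proof
      fix X assume "X \<in> cls Fs ` D"
      then obtain x where "x \<in> D" "X = cls Fs x" by blast
      thus "X \<in> insert (cls Fs a) (insert (cls Fs b) (cls Fs ` (D - ?J)))"
        using cls_eq[OF F ab(1), of x] cls_eq[OF F ab(2), of x] by blast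
    qed
    show "insert (cls Fs a) (insert (cls Fs b) (cls Fs ` (D - ?J))) \<subseteq> cls Fs ` D" using ab by auto
  qed
  have fin: "finite (cls Fs ` (D - ?J))" using F by (simp add: perms_def)
  have n1: "?J \<notin> cls Fs ` (D - ?J)" "cls Fs a \<notin> cls Fs ` (D - ?J)" "cls Fs b \<notin> cls Fs ` (D - ?J)"
  proof -
    have "cls Fs x \<noteq> ?J \<and> cls Fs x \<noteq> cls Fs a \<and> cls Fs x \<noteq> cls Fs b" if "x \<in> D - ?J" for x
    proof -
      have "x \<in> cls Fs x" "x \<notin> ?J" using that by simp_all
      thus ?thesis by (metis UnI1 UnI2)
    qed
    thus "?J \<notin> cls Fs ` (D - ?J)" "cls Fs a \<notin> cls Fs ` (D - ?J)" "cls Fs b \<notin> cls Fs ` (D - ?J)"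
      by (metis imageE)+
  qed
  have n2: "cls Fs a = cls Fs b \<longleftrightarrow> b \<in> cls Fs a" using cls_eq[OF F ab(1)] by (metis cls_refl)
  have aux: "card (insert A (insert B X)) = card (insert J X) + (if A = B then 0 else 1)"
    if "finite X" "J \<notin> X" "A \<notin> X" "B \<notin> X" for A B J :: "'a set" and X
    using that by (simp add: card_insert_if)
  show "ncl Fs D = ncl Gs D + (if b \<in> cls Fs a then 0 else 1)"
    unfolding ncl_def eq eq2 n2[symmetric] by (rule aux[OF fin n1])
qed

section \<open>Exchanging two values of a permutation\<close>

definition tmv :: "('a \<Rightarrow> 'a) \<Rightarrow> 'a \<Rightarrow> 'a \<Rightarrow> 'a \<Rightarrow> 'a" where
  "tmv f a b = f(a := f b, b := f a)"

lemma tmv_perm: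
  assumes "bij_betw f D D" "a \<in> D" "b \<in> D"
  shows "bij_betw (tmv f a b) D D"
proof -
  have inj: "inj_on f D" and im: "f ` D = D" using assms by (auto simp: bij_betw_def)
  have "inj_on (tmv f a b) D"
    using inj assms by (auto simp: tmv_def inj_on_def)
  moreover have "tmv f a b ` D = f ` D"
    using assms by (auto simp: tmv_def image_def)
  ultimately show ?thesis using im by (simp add: bij_betw_def)
qed

lemma tmv_tmv: "tmv (tmv f a b) a b = f"
  by (auto simp: tmv_def fun_eq_iff)

lemma cls_single: "y \<in> cls {f} x \<longleftrightarrow> (\<exists>k. y = (f ^^ k) x)"
proof
  assume "y \<in> cls {f} x"
  moreover have "cls {f} x \<subseteq> {y. \<exists>k. y = (f ^^ k) x}"
  proof (rule cls_least)
    show "x \<in> {y. \<exists>k. y = (f ^^ k) x}" by (auto intro: exI[of _ 0])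
    fix g u assume "g \<in> {f}" "u \<in> {y. \<exists>k. y = (f ^^ k) x}"
    thus "g u \<in> {y. \<exists>k. y = (f ^^ k) x}" by (auto intro: exI[of _ "Suc _"])
  qed
  ultimately show "\<exists>k. y = (f ^^ k) x" by blast
next
  have "(f ^^ k) x \<in> cls {f} x" for k
    by (induction k) (auto intro: cls_step)
  thus "\<exists>k. y = (f ^^ k) x \<Longrightarrow> y \<in> cls {f} x" by blast
qed

text \<open>\<open>tmv f a b\<close> is the composition of \<open>f\<close> with the transposition
  of \<open>a\<close> and \<open>b\<close>, which splits a cycle through both. If \<open>b\<close>
  is first reached from \<open>a\<close> after \<open>k\<close> steps, the arc from
  \<open>f a\<close> to \<open>b\<close> closes up under the new map and avoids
  \<open>a\<close>.\<close>

lemma tmv_split: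
  assumes "perms D {f}" "a \<in> D" "b \<in> D" "a \<noteq> b" "b \<in> cls {f} a"
  shows "b \<notin> cls {tmv f a b} a"
proof -
  have ex: "\<exists>k. b = (f ^^ k) a" using assms(5) by (simp add: cls_single)
  define k where "k = (LEAST k. b = (f ^^ k) a)"
  have k: "b = (f ^^ k) a" unfolding k_def by (rule LeastI_ex[OF ex])
  have min: "b \<noteq> (f ^^ i) a" if "i < k" for i using that not_less_Least k_def by blast
  have k0: "k > 0" using k assms(4) by (cases k) auto
  let ?U = "{(f ^^ i) a | i. 1 \<le> i \<and> i \<le> k}"
  have aU: "a \<notin> ?U"
  proof
    assume "a \<in> ?U"
    then obtain i where i: "1 \<le> i" "i \<le> k" "a = (f ^^ i) a" by auto
    have "(f ^^ (k - i + i)) a = (f ^^ (k - i)) ((f ^^ i) a)" by (simp only: funpow_add comp_apply)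
    hence "b = (f ^^ (k - i)) ((f ^^ i) a)" using k i(2) by simp
    hence "b = (f ^^ (k - i)) a" using i(3) by simp
    thus False using min[of "k - i"] i by simp
  qed
  have bU: "b \<in> ?U" using k k0 by auto
  have "cls {tmv f a b} b \<subseteq> ?U"
  proof (rule cls_least[OF bU])
    fix g u assume "g \<in> {tmv f a b}" and u: "u \<in> ?U"
    hence g: "g = tmv f a b" by simp
    from u obtain i where i: "1 \<le> i" "i \<le> k" "u = (f ^^ i) a" by auto
    show "g u \<in> ?U"
    proof (cases "i = k")
      case True
      hence "u = b" using i k by simp
      hence "g u = f a" using g assms(4) by (simp add: tmv_def)
      thus ?thesis using k0 by (auto intro!: exI[of _ 1])
    next
      case False
      hence "u \<noteq> b" "u \<noteq> a" using min[of i] i aU u by auto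
      hence "g u = (f ^^ Suc i) a" using g i by (simp add: tmv_def)
      thus ?thesis using i False by (auto intro!: exI[of _ "Suc i"] simp del: funpow.simps)
    qed
  qed
  hence "a \<notin> cls {tmv f a b} b" using aU by blast
  moreover have "perms D {tmv f a b}" using assms tmv_perm by (auto simp: perms_def)
  ultimately show ?thesis using cls_sym assms by metis
qed

lemma tmv_merge:
  assumes "perms D {f}" "a \<in> D" "b \<in> D" "a \<noteq> b" "b \<notin> cls {f} a"
  shows "b \<in> cls {tmv f a b} a"
proof -
  let ?g = "tmv f a b"
  have "b \<in> cls {f} (f b)" using cls_back1[OF assms(1), of f b] assms by simp
  then obtain k where "b = (f ^^ k) (f b)" by (auto simp: cls_single)
  hence "b = (f ^^ Suc k) b" by (simp add: funpow_swap1)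
  hence ex: "\<exists>k. b = (f ^^ Suc k) b" by blast
  define k where "k = (LEAST k. b = (f ^^ Suc k) b)"
  have k: "b = (f ^^ Suc k) b" unfolding k_def by (rule LeastI_ex[OF ex])
  have min: "b \<noteq> (f ^^ Suc i) b" if "i < k" for i using that not_less_Least k_def by blast
  have na: "(f ^^ i) b \<noteq> a" for i
  proof
    assume "(f ^^ i) b = a"
    hence "a \<in> cls {f} b" by (metis cls_single)
    thus False using assms cls_sym by metis
  qed
  have "i \<le> k \<Longrightarrow> (f ^^ Suc i) b \<in> cls {?g} a" for i
  proof (induction i)
    case 0
    have "?g a = f b" using assms(4) by (simp add: tmv_def)
    hence "f b \<in> cls {?g} a" using cls_step[OF cls_refl, of ?g "{?g}" a] by simp
    thus ?case by simp
  next
    case (Suc i)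
    hence "(f ^^ Suc i) b \<noteq> b" using min[of i] by simp
    hence "?g ((f ^^ Suc i) b) = (f ^^ Suc (Suc i)) b"
      using na[of "Suc i"] by (simp add: tmv_def)
    thus ?case using cls_step[OF Suc.IH, of ?g] Suc.prems by simp
  qed
  thus ?thesis using k by (metis order_refl)
qed

text \<open>As \<open>a\<close> and \<open>b\<close> lie on different cycles of \<open>f\<close>,
  the exchange joins these into one cycle. So every old step stays inside a new class, and only the
  classes of \<open>a\<close> and \<open>b\<close> can be merged.\<close>

lemma ncl_tmv_aux:
  assumes P: "perms D (insert f H)" and ab: "a \<in> D" "b \<in> D" "a \<noteq> b" and m: "b \<notin> cls {f} a"
  shows "ncl (insert f H) D = ncl (insert (tmv f a b) H) D + (if b \<in> cls (insert f H) a then 0 else 1)"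
    and "x \<in> D \<Longrightarrow> cls (insert f H) x \<subseteq> cls (insert (tmv f a b) H) x"
proof -
  let ?g = "tmv f a b"
  have Pf: "perms D {f}" using P by (simp add: perms_def)
  have PG: "perms D (insert ?g H)" using P ab tmv_perm by (auto simp: perms_def)
  have b1: "b \<in> cls (insert ?g H) a"
    using tmv_merge[OF Pf ab m] cls_mono[of "{?g}" "insert ?g H" a] by auto
  hence a1: "a \<in> cls (insert ?g H) b" using cls_sym[OF PG ab(1)] by blast
  have 1: "h x \<in> cls (insert ?g H) x" if h: "h \<in> insert f H" and x: "x \<in> D" for h x
  proof (cases "h \<in> H")
    case True thus ?thesis by (simp add: cls_step)
  next
    case False
    hence hf: "h = f" using h by simp
    consider "x = a" | "x = b" | "x \<noteq> a" "x \<noteq> b" by blast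
    thus ?thesis
    proof cases
      case 1
      have "?g b = f a" using ab by (simp add: tmv_def)
      thus ?thesis using b1 1 hf by (metis cls_step insertI1)
    next
      case 2
      have "?g a = f b" using ab by (simp add: tmv_def)
      thus ?thesis using a1 2 hf by (metis cls_step insertI1)
    next
      case 3
      hence "?g x = f x" by (simp add: tmv_def)
      thus ?thesis using hf by (metis cls_refl cls_step insertI1)
    qed
  qed
  have 2: "g x \<in> cls (insert f H) x \<or> (x \<in> cls (insert f H) a \<union> cls (insert f H) b \<and>
       g x \<in> cls (insert f H) a \<union> cls (insert f H) b)"
    if g: "g \<in> insert ?g H" and x: "x \<in> D" for g x
  proof (cases "g \<in> H")
    case True thus ?thesis by (simp add: cls_step)
  next
    case False
    hence g: "g = ?g" using g by simp
    show ?thesis unfolding g tmv_def using ab(3) by (auto intro: cls_step)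
  qed
  have FG': "\<forall>h\<in>insert f H. \<forall>x\<in>D. h x \<in> cls (insert ?g H) x"
    by (intro ballI) (rule 1)
  have GF': "\<forall>g\<in>insert ?g H. \<forall>x\<in>D. g x \<in> cls (insert f H) x \<or>
      (x \<in> cls (insert f H) a \<union> cls (insert f H) b \<and> g x \<in> cls (insert f H) a \<union> cls (insert f H) b)"
    by (intro ballI) (rule 2)
  show "ncl (insert f H) D = ncl (insert ?g H) D + (if b \<in> cls (insert f H) a then 0 else 1)"
    using ncl_join(1)[OF P PG ab(1,2) FG' b1 GF'] .
  show "x \<in> D \<Longrightarrow> cls (insert f H) x \<subseteq> cls (insert ?g H) x"
    using ncl_join(2)[OF P PG ab(1,2) FG' b1 GF'] .
qed

lemma ncl_tmv_merge:
  assumes "perms D {f}" "a \<in> D" "b \<in> D" "b \<notin> cls {f} a"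
  shows "ncl {f} D = ncl {tmv f a b} D + 1"
proof -
  have "a \<noteq> b" using assms(4) by auto
  thus ?thesis using ncl_tmv_aux(1)[of D f "{}" a b] assms by auto
qed

lemma ncl_tmv_split:
  assumes "perms D {f}" "a \<in> D" "b \<in> D" "a \<noteq> b" "b \<in> cls {f} a"
  shows "ncl {tmv f a b} D = ncl {f} D + 1"
proof -
  have "perms D {tmv f a b}" using assms tmv_perm by (auto simp: perms_def)
  thus ?thesis
    using ncl_tmv_merge[of D "tmv f a b" a b] tmv_split[OF assms] assms(2,3) by (simp add: tmv_tmv)
qed

text \<open>If \<open>a\<close> and \<open>b\<close> share a cycle of \<open>f\<close>, the exchange
  is its own inverse (\<open>tmv_tmv\<close>) and the way back is a merge, so at most one class is
  gained.\<close>

lemma ncl_tmv_le: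
  assumes P: "perms D (insert f H)" and ab: "a \<in> D" "b \<in> D" "a \<noteq> b"
  shows "ncl (insert (tmv f a b) H) D \<le> ncl (insert f H) D + 1"
    and "b \<notin> cls {f} a \<Longrightarrow> ncl (insert (tmv f a b) H) D \<le> ncl (insert f H) D"
    and "b \<notin> cls (insert f H) a \<Longrightarrow> ncl (insert f H) D = ncl (insert (tmv f a b) H) D + 1"
proof -
  let ?g = "tmv f a b"
  have Pf: "perms D {f}" using P by (simp add: perms_def)
  have PG: "perms D (insert ?g H)" using P ab tmv_perm by (auto simp: perms_def)
  show B: "b \<notin> cls {f} a \<Longrightarrow> ncl (insert ?g H) D \<le> ncl (insert f H) D"
    using ncl_tmv_aux(1)[OF P ab] by auto
  show "ncl (insert ?g H) D \<le> ncl (insert f H) D + 1"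
  proof (cases "b \<in> cls {f} a")
    case True
    hence "b \<notin> cls {?g} a" using tmv_split[OF Pf ab] by simp
    thus ?thesis using ncl_tmv_aux(1)[OF PG ab] by (auto simp: tmv_tmv split: if_splits)
  qed (use B in simp)
  show "b \<notin> cls (insert f H) a \<Longrightarrow> ncl (insert f H) D = ncl (insert ?g H) D + 1"
    using ncl_tmv_aux(1)[OF P ab] cls_mono[of "{f}" "insert f H" a] by auto
qed

lemma ncl_empty [simp]: "ncl Fs {} = 0"
  by (simp add: ncl_def)

lemma ncl_le_card: "finite D \<Longrightarrow> ncl Fs D \<le> card D"
  by (simp add: ncl_def card_image_le)

text \<open>A map on a surface is given by its darts: \<open>al\<close> reverses a dart, the cycles of \<open>ph\<close> are the faces and
  those of \<open>sgm al ph\<close> the vertices.\<close>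

definition pmap :: "'a set \<Rightarrow> ('a \<Rightarrow> 'a) \<Rightarrow> ('a \<Rightarrow> 'a) \<Rightarrow> bool" where
  "pmap D al ph \<longleftrightarrow> finite D \<and> bij_betw ph D D \<and> (\<forall>x\<in>D. al x \<in> D \<and> al x \<noteq> x \<and> al (al x) = x)"

definition sgm :: "('a \<Rightarrow> 'a) \<Rightarrow> ('a \<Rightarrow> 'a) \<Rightarrow> 'a \<Rightarrow> 'a" where
  "sgm al ph x = ph (al x)"

text \<open>With \<open>V\<close>, \<open>F\<close>, \<open>c\<close> the numbers of vertices, faces and components and \<open>card D = 2 * E\<close>,
  this is \<open>V - E + F \<ge> 2 * c\<close>; the reverse inequality always holds (\<open>euler_le\<close> below).\<close>

definition planar :: "'a set \<Rightarrow> ('a \<Rightarrow> 'a) \<Rightarrow> ('a \<Rightarrow> 'a) \<Rightarrow> bool" where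
  "planar D al ph \<longleftrightarrow> card D + 4 * ncl {ph, al} D \<le> 2 * (ncl {sgm al ph} D + ncl {ph} D)"

lemma cls_cong:
  assumes P: "perms D (insert f H)" and fg: "\<forall>x\<in>D. f x = g x" and x: "x \<in> D"
  shows "cls (insert f H) x = cls (insert g H) x"
proof
  have "cls (insert f H) x \<subseteq> cls (insert g H) x \<inter> D"
  proof (rule cls_least)
    show "x \<in> cls (insert g H) x \<inter> D" using x by simp
    fix h u assume h: "h \<in> insert f H" and u: "u \<in> cls (insert g H) x \<inter> D"
    have "h u \<in> D" using perms_in[OF P h, of u] u by blast
    moreover have "h u \<in> cls (insert g H) x"
      using h u fg cls_step[of u "insert g H" x] by (cases "h \<in> H") auto
    ultimately show "h u \<in> cls (insert g H) x \<inter> D" by simp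
  qed
  thus "cls (insert f H) x \<subseteq> cls (insert g H) x" by blast
  have "cls (insert g H) x \<subseteq> cls (insert f H) x \<inter> D"
  proof (rule cls_least)
    show "x \<in> cls (insert f H) x \<inter> D" using x by simp
    fix h u assume h: "h \<in> insert g H" and u: "u \<in> cls (insert f H) x \<inter> D"
    have "h u \<in> cls (insert f H) x"
      using h u fg[rule_format, of u, symmetric] cls_step[of u "insert f H" x] by (cases "h \<in> H") auto
    moreover have "cls (insert f H) x \<subseteq> D" using cls_sub[OF P x] .
    ultimately show "h u \<in> cls (insert f H) x \<inter> D" by blast
  qed
  thus "cls (insert g H) x \<subseteq> cls (insert f H) x" by blast
qed

lemma ncl_cong:
  assumes "perms D (insert f H)" and "\<forall>x\<in>D. f x = g x"
  shows "ncl (insert f H) D = ncl (insert g H) D"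
proof -
  have "cls (insert f H) ` D = cls (insert g H) ` D"
    by (rule image_cong[OF HOL.refl cls_cong[OF assms]])
  thus ?thesis by (simp add: ncl_def)
qed

lemma pmap_al: "pmap D al ph \<Longrightarrow> x \<in> D \<Longrightarrow> al x \<in> D"
  and pmap_al_ne: "pmap D al ph \<Longrightarrow> x \<in> D \<Longrightarrow> al x \<noteq> x"
  and pmap_al_al: "pmap D al ph \<Longrightarrow> x \<in> D \<Longrightarrow> al (al x) = x"
  by (auto simp: pmap_def)

lemma pmap_ph: "pmap D al ph \<Longrightarrow> x \<in> D \<Longrightarrow> ph x \<in> D"
  by (auto simp: pmap_def bij_betw_def)

lemma pmap_inj: "pmap D al ph \<Longrightarrow> x \<in> D \<Longrightarrow> y \<in> D \<Longrightarrow> ph x = ph y \<Longrightarrow> x = y"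
  by (auto simp: pmap_def bij_betw_def dest: inj_onD)

lemma pmap_pred: 
  assumes "pmap D al ph" "x \<in> D" obtains p where "p \<in> D" "ph p = x"
  using assms unfolding pmap_def bij_betw_def by (metis imageE)

lemma pmap_bij_al: "pmap D al ph \<Longrightarrow> bij_betw al D D"
  by (rule bij_betw_byWitness[of _ al]) (auto simp: pmap_def)

lemma pmap_perms:
  assumes "pmap D al ph"
  shows "perms D {ph}" "perms D {ph, al}" "perms D {sgm al ph}" "perms D {sgm al ph, al}"
proof -
  have b: "bij_betw (sgm al ph) D D"
    using bij_betw_trans[OF pmap_bij_al[OF assms], of ph D] assms
    by (simp add: pmap_def sgm_def[abs_def] comp_def)
  thus "perms D {ph}" "perms D {ph, al}" "perms D {sgm al ph}" "perms D {sgm al ph, al}"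
    using assms pmap_bij_al[OF assms] by (auto simp: perms_def pmap_def)
qed

lemma cls_sgm:
  assumes "pmap D al ph" "x \<in> D"
  shows "cls {sgm al ph, al} x = cls {ph, al} x"
proof
  note P = pmap_perms[OF assms(1)]
  show "cls {sgm al ph, al} x \<subseteq> cls {ph, al} x"
  proof (rule cls_least)
    fix f u assume f: "f \<in> {sgm al ph, al}" and u: "u \<in> cls {ph, al} x"
    have a: "al u \<in> cls {ph, al} x" by (rule cls_step[OF u]) simp
    have "ph (al u) \<in> cls {ph, al} x" by (rule cls_step[OF a]) simp
    thus "f u \<in> cls {ph, al} x" using f a by (auto simp: sgm_def)
  qed simp
  have "cls {ph, al} x \<subseteq> cls {sgm al ph, al} x \<inter> D"
  proof (rule cls_least)
    show "x \<in> cls {sgm al ph, al} x \<inter> D" using assms by simp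
    fix f u assume f: "f \<in> {ph, al}" and u: "u \<in> cls {sgm al ph, al} x \<inter> D"
    have a: "al u \<in> cls {sgm al ph, al} x" using u by (auto intro: cls_step)
    hence "sgm al ph (al u) \<in> cls {sgm al ph, al} x" by (auto intro: cls_step)
    hence "ph u \<in> cls {sgm al ph, al} x" using pmap_al_al[OF assms(1), of u] u by (simp add: sgm_def)
    thus "f u \<in> cls {sgm al ph, al} x \<inter> D"
      using f a u perms_in[OF P(2) f, of u] by auto
  qed
  thus "cls {ph, al} x \<subseteq> cls {sgm al ph, al} x" by blast
qed

lemma ncl_sgm:
  assumes "pmap D al ph"
  shows "ncl {sgm al ph, al} D = ncl {ph, al} D"
proof -
  have "cls {sgm al ph, al} ` D = cls {ph, al} ` D"
    by (rule image_cong[OF HOL.refl cls_sgm[OF assms]])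
  thus ?thesis by (simp add: ncl_def)
qed

lemma pmap_tmv:
  assumes "pmap D al ph" "a \<in> D" "b \<in> D"
  shows "pmap D al (tmv ph a b)"
  using assms tmv_perm by (auto simp: pmap_def)

text \<open>An exchange in the faces at \<open>a\<close> and \<open>b\<close> is at the same time
  one in the vertices, at \<open>al a\<close> and \<open>al b\<close>. So both counts change by
  exactly one, and only the number of components needs an estimate.\<close>

lemma tmv_counts:
  assumes M: "pmap D al ph" and ab: "a \<in> D" "b \<in> D" "a \<noteq> b"
  defines "ph' \<equiv> tmv ph a b"
  shows "b \<in> cls {ph} a \<Longrightarrow> ncl {ph'} D = ncl {ph} D + 1"
    and "b \<notin> cls {ph} a \<Longrightarrow> ncl {ph} D = ncl {ph'} D + 1"
    and "al b \<in> cls {sgm al ph} (al a) \<Longrightarrow> ncl {sgm al ph'} D = ncl {sgm al ph} D + 1"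
    and "al b \<notin> cls {sgm al ph} (al a) \<Longrightarrow> ncl {sgm al ph} D = ncl {sgm al ph'} D + 1"
    and "ncl {ph', al} D \<le> ncl {ph, al} D + 1"
    and "b \<notin> cls {ph} a \<Longrightarrow> ncl {ph', al} D \<le> ncl {ph, al} D"
    and "al b \<notin> cls {sgm al ph} (al a) \<Longrightarrow> ncl {ph', al} D \<le> ncl {ph, al} D"
    and "b \<notin> cls {ph, al} a \<Longrightarrow> ncl {ph, al} D = ncl {ph', al} D + 1"
proof -
  note P = pmap_perms[OF M]
  have M': "pmap D al ph'" unfolding ph'_def using pmap_tmv[OF M ab(1,2)] .
  note P' = pmap_perms[OF M']
  note aab = pmap_al[OF M ab(1)] pmap_al[OF M ab(2)]
  have ne: "al a \<noteq> al b" using pmap_al_al[OF M] ab by metis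
  let ?s = "tmv (sgm al ph) (al a) (al b)"
  have s: "\<forall>x\<in>D. sgm al ph' x = ?s x"
  proof
    fix x assume x: "x \<in> D"
    have "x = al a \<longleftrightarrow> al x = a" "x = al b \<longleftrightarrow> al x = b" using x ab pmap_al_al[OF M] by metis+
    thus "sgm al ph' x = ?s x"
      using ne ab pmap_al_al[OF M] by (auto simp: sgm_def tmv_def ph'_def)
  qed
  have s1: "ncl {sgm al ph'} D = ncl {?s} D" using ncl_cong[OF P'(3) s] .
  have s2: "ncl {ph', al} D = ncl {?s, al} D"
    using ncl_cong[OF P'(4) s] ncl_sgm[OF M'] by simp
  show "b \<in> cls {ph} a \<Longrightarrow> ncl {ph'} D = ncl {ph} D + 1"
    unfolding ph'_def using ncl_tmv_split[OF P(1) ab] .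
  show "b \<notin> cls {ph} a \<Longrightarrow> ncl {ph} D = ncl {ph'} D + 1"
    unfolding ph'_def using ncl_tmv_merge[OF P(1) ab(1,2)] .
  show "al b \<in> cls {sgm al ph} (al a) \<Longrightarrow> ncl {sgm al ph'} D = ncl {sgm al ph} D + 1"
    unfolding s1 using ncl_tmv_split[OF P(3) aab ne] .
  show "al b \<notin> cls {sgm al ph} (al a) \<Longrightarrow> ncl {sgm al ph} D = ncl {sgm al ph'} D + 1"
    unfolding s1 using ncl_tmv_merge[OF P(3) aab] .
  show "ncl {ph', al} D \<le> ncl {ph, al} D + 1"
    "b \<notin> cls {ph} a \<Longrightarrow> ncl {ph', al} D \<le> ncl {ph, al} D"
    "b \<notin> cls {ph, al} a \<Longrightarrow> ncl {ph, al} D = ncl {ph', al} D + 1"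
    unfolding ph'_def using ncl_tmv_le[OF P(2) ab] by simp_all
  show "al b \<notin> cls {sgm al ph} (al a) \<Longrightarrow> ncl {ph', al} D \<le> ncl {ph, al} D"
    unfolding s2 using ncl_tmv_le(2)[OF P(4) aab ne] ncl_sgm[OF M] by simp
qed

section \<open>Planarity under surgery, by counting\<close>

lemma planar_split:
  assumes M: "pmap D al ph" and ab: "a \<in> D" "b \<in> D" "a \<noteq> b" and s: "b \<in> cls {ph} a" and p: "planar D al ph"
  shows "planar D al (tmv ph a b)"
  using tmv_counts[OF M ab] s p by (cases "al b \<in> cls {sgm al ph} (al a)") (auto simp: planar_def)

lemma planar_join:
  assumes M: "pmap D al ph" and ab: "a \<in> D" "b \<in> D" and s: "b \<notin> cls {ph, al} a" and p: "planar D al ph"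
  shows "planar D al (tmv ph a b)"
proof -
  have ne: "a \<noteq> b" using s by auto
  have 1: "b \<notin> cls {ph} a" using s cls_mono[of "{ph}" "{ph, al}" a] by auto
  have 2: "al b \<notin> cls {sgm al ph} (al a)"
  proof
    assume "al b \<in> cls {sgm al ph} (al a)"
    hence "al b \<in> cls {sgm al ph, al} (al a)" using cls_mono[of "{sgm al ph}" "{sgm al ph, al}" "al a"] by auto
    hence "al b \<in> cls {ph, al} (al a)" using cls_sgm[OF M pmap_al[OF M ab(1)]] by simp
    hence "al (al b) \<in> cls {ph, al} (al a)" by (auto intro: cls_step)
    moreover have "cls {ph, al} (al a) \<subseteq> cls {ph, al} a" by (rule cls_trans) (auto intro: cls_step)
    ultimately show False using s pmap_al_al[OF M ab(2)] by auto
  qed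
  show ?thesis using tmv_counts[OF M ab ne] 1 2 s p by (auto simp: planar_def)
qed

text \<open>Detaches \<open>d\<close> from its origin, which becomes a vertex of degree one. The
  exchange is made at \<open>al d\<close> and the predecessor \<open>p\<close> of \<open>d\<close>;
  their reverses lie at the same vertex, so \<open>V\<close> grows by one. If \<open>F\<close> grows
  too, the number of components grows by at most one; if \<open>F\<close> drops, it does not grow.
  In both cases planarity passes on and the Euler bound passes back.\<close>

lemma isolate_dart:
  assumes M: "pmap D al ph" and d: "d \<in> D"
  obtains ph1 where "pmap D al ph1" "ph1 (al d) = d"
    "\<forall>x\<in>D. x \<noteq> al d \<longrightarrow> ph1 x = (if ph x = d then ph (al d) else ph x)"
    "planar D al ph \<Longrightarrow> planar D al ph1"
    "2 * (ncl {sgm al ph1} D + ncl {ph1} D) \<le> card D + 4 * ncl {ph1, al} D \<Longrightarrow>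
     2 * (ncl {sgm al ph} D + ncl {ph} D) \<le> card D + 4 * ncl {ph, al} D"
    "ncl {ph} D \<le> ncl {ph1} D + 1"
    "al d \<in> cls {ph} d \<Longrightarrow> ph (al d) \<noteq> d \<Longrightarrow>
      ncl {sgm al ph1} D = ncl {sgm al ph} D + 1 \<and> ncl {ph1} D = ncl {ph} D + 1"
proof (cases "ph (al d) = d")
  case True
  show ?thesis
  proof (rule that[of ph])
    show "\<forall>x\<in>D. x \<noteq> al d \<longrightarrow> ph x = (if ph x = d then ph (al d) else ph x)"
      using True pmap_inj[OF M] pmap_al[OF M d] by auto
  qed (use M True in auto)
next
  case False
  define e where "e = al d"
  have e: "e \<in> D" "al e = d" using pmap_al[OF M d] pmap_al_al[OF M d] by (auto simp: e_def)
  obtain p where p: "p \<in> D" "ph p = d" using pmap_pred[OF M d] by blast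
  have ne: "e \<noteq> p" using False p by (auto simp: e_def)
  note P = pmap_perms[OF M]
  have "d \<in> cls {sgm al ph} (al p)"
    using cls_step[OF cls_refl, of "sgm al ph" "{sgm al ph}" "al p"] p pmap_al_al[OF M p(1)] by (simp add: sgm_def)
  hence v: "al p \<in> cls {sgm al ph} (al e)"
    using cls_sym[OF P(3) pmap_al[OF M p(1)]] e by simp
  note C = tmv_counts[OF M e(1) p(1) ne]
  show ?thesis
  proof (rule that[of "tmv ph e p"])
    show "pmap D al (tmv ph e p)" using pmap_tmv[OF M e(1) p(1)] .
    show "tmv ph e p (al d) = d" using ne p by (simp add: tmv_def e_def)
    show "\<forall>x\<in>D. x \<noteq> al d \<longrightarrow> tmv ph e p x = (if ph x = d then ph (al d) else ph x)"
      using ne p pmap_inj[OF M] by (auto simp: tmv_def e_def)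
    show "planar D al ph \<Longrightarrow> planar D al (tmv ph e p)"
      using C v by (cases "p \<in> cls {ph} e") (auto simp: planar_def)
    show "2 * (ncl {sgm al (tmv ph e p)} D + ncl {tmv ph e p} D) \<le> card D + 4 * ncl {tmv ph e p, al} D \<Longrightarrow>
     2 * (ncl {sgm al ph} D + ncl {ph} D) \<le> card D + 4 * ncl {ph, al} D"
      using C v by (cases "p \<in> cls {ph} e") auto
    show "ncl {ph} D \<le> ncl {tmv ph e p} D + 1"
      using C by (cases "p \<in> cls {ph} e") auto
    assume "al d \<in> cls {ph} d"
    hence "d \<in> cls {ph} e" using cls_sym[OF P(1) d] by (simp add: e_def)
    moreover have "p \<in> cls {ph} d" using cls_back1[OF P(1), of ph p] p by simp
    ultimately have "p \<in> cls {ph} e" using cls_trans[of d "{ph}" e] by blast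
    thus "ncl {sgm al (tmv ph e p)} D = ncl {sgm al ph} D + 1 \<and> ncl {tmv ph e p} D = ncl {ph} D + 1"
      using C v by simp
  qed
qed

lemma isolate_edge:
  assumes M: "pmap D al ph" and d: "d \<in> D"
  defines "p1 \<equiv> (\<lambda>x. if ph x = d then ph (al d) else ph x)"
  obtains ph2 where "pmap D al ph2" "ph2 (al d) = d" "ph2 d = al d"
    "\<forall>x\<in>D - {d, al d}. ph2 x = (if p1 x = al d then p1 d else p1 x)"
    "planar D al ph \<Longrightarrow> planar D al ph2"
    "2 * (ncl {sgm al ph2} D + ncl {ph2} D) \<le> card D + 4 * ncl {ph2, al} D \<Longrightarrow>
     2 * (ncl {sgm al ph} D + ncl {ph} D) \<le> card D + 4 * ncl {ph, al} D"
    "ncl {ph} D \<le> ncl {ph2} D + 2"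
    "al d \<in> cls {ph} d \<Longrightarrow> ph (al d) \<noteq> d \<Longrightarrow> ph d \<noteq> al d \<Longrightarrow>
      ncl {sgm al ph2} D = ncl {sgm al ph} D + 2 \<and> ncl {ph2} D = ncl {ph} D + 2"
proof -
  define e where "e = al d"
  have e: "e \<in> D" "al e = d" "e \<noteq> d"
    using pmap_al[OF M d] pmap_al_al[OF M d] pmap_al_ne[OF M d] by (auto simp: e_def)
  obtain ph1 where 1: "pmap D al ph1" "ph1 (al d) = d"
    "\<forall>x\<in>D. x \<noteq> al d \<longrightarrow> ph1 x = (if ph x = d then ph (al d) else ph x)"
    "planar D al ph \<Longrightarrow> planar D al ph1"
    "2 * (ncl {sgm al ph1} D + ncl {ph1} D) \<le> card D + 4 * ncl {ph1, al} D \<Longrightarrow>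
     2 * (ncl {sgm al ph} D + ncl {ph} D) \<le> card D + 4 * ncl {ph, al} D"
    "ncl {ph} D \<le> ncl {ph1} D + 1"
    "al d \<in> cls {ph} d \<Longrightarrow> ph (al d) \<noteq> d \<Longrightarrow>
      ncl {sgm al ph1} D = ncl {sgm al ph} D + 1 \<and> ncl {ph1} D = ncl {ph} D + 1"
    using isolate_dart[OF M d] by blast
  obtain ph2 where 2: "pmap D al ph2" "ph2 (al e) = e"
    "\<forall>x\<in>D. x \<noteq> al e \<longrightarrow> ph2 x = (if ph1 x = e then ph1 (al e) else ph1 x)"
    "planar D al ph1 \<Longrightarrow> planar D al ph2"
    "2 * (ncl {sgm al ph2} D + ncl {ph2} D) \<le> card D + 4 * ncl {ph2, al} D \<Longrightarrow>
     2 * (ncl {sgm al ph1} D + ncl {ph1} D) \<le> card D + 4 * ncl {ph1, al} D"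
    "ncl {ph1} D \<le> ncl {ph2} D + 1"
    "al e \<in> cls {ph1} e \<Longrightarrow> ph1 (al e) \<noteq> e \<Longrightarrow>
      ncl {sgm al ph2} D = ncl {sgm al ph1} D + 1 \<and> ncl {ph2} D = ncl {ph1} D + 1"
    using isolate_dart[OF 1(1) e(1)] by blast
  have p1: "x \<in> D \<Longrightarrow> x \<noteq> e \<Longrightarrow> ph1 x = p1 x" for x using 1(3) by (simp add: p1_def e_def)
  show ?thesis
  proof (rule that[of ph2])
    show "ph2 (al d) = d" "ph2 d = al d" using 1(2) 2(2,3) e by (auto simp: e_def)
    show "\<forall>x\<in>D - {d, al d}. ph2 x = (if p1 x = al d then p1 d else p1 x)"
      using 2(3) e p1 d by (auto simp: e_def)
    assume a: "al d \<in> cls {ph} d" "ph (al d) \<noteq> d" "ph d \<noteq> al d"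
    have "ph d \<noteq> d"
    proof
      assume "ph d = d"
      hence "cls {ph} d \<subseteq> {d}" by (intro cls_least) auto
      thus False using a(1) e by (auto simp: e_def)
    qed
    hence "ph1 d \<noteq> e" using 1(3) d e a by (auto simp: e_def)
    moreover have "d \<in> cls {ph1} e" using cls_step[OF cls_refl, of ph1 "{ph1}" e] 1(2) by (simp add: e_def)
    ultimately show "ncl {sgm al ph2} D = ncl {sgm al ph} D + 2 \<and> ncl {ph2} D = ncl {ph} D + 2"
      using 1(7) 2(7) a e by simp
  qed (use 1 2 in auto)
qed

lemma pmap_closed:
  assumes M: "pmap D al ph" and C: "C \<subseteq> D" "\<forall>x\<in>C. ph x \<in> C" "\<forall>x\<in>C. al x \<in> C"
  shows "pmap C al ph" "pmap (D - C) al ph"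
    "card D = card C + card (D - C)"
    "ncl {ph} D = ncl {ph} C + ncl {ph} (D - C)"
    "ncl {sgm al ph} D = ncl {sgm al ph} C + ncl {sgm al ph} (D - C)"
    "ncl {ph, al} D = ncl {ph, al} C + ncl {ph, al} (D - C)"
proof -
  note P = pmap_perms[OF M]
  have c1: "\<forall>f\<in>{ph}. \<forall>x\<in>C. f x \<in> C" and c2: "\<forall>f\<in>{sgm al ph}. \<forall>x\<in>C. f x \<in> C"
    and c3: "\<forall>f\<in>{ph, al}. \<forall>x\<in>C. f x \<in> C"
    using C by (auto simp: sgm_def)
  note Q = perms_closed_compl[OF P(2) C(1) c3]
  have "\<forall>x\<in>D - C. al x \<in> D - C" using Q(2) perms_in[OF Q(2), of al] by auto
  thus "pmap C al ph" "pmap (D - C) al ph"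
    using Q M C by (auto simp: pmap_def perms_def)
  have "finite D" using M by (simp add: pmap_def)
  thus "card D = card C + card (D - C)"
    using C(1) by (metis card_Diff_subset card_mono finite_subset le_add_diff_inverse)
  show "ncl {ph} D = ncl {ph} C + ncl {ph} (D - C)" using ncl_additive[OF P(1) C(1) c1] .
  show "ncl {sgm al ph} D = ncl {sgm al ph} C + ncl {sgm al ph} (D - C)" using ncl_additive[OF P(3) C(1) c2] .
  show "ncl {ph, al} D = ncl {ph, al} C + ncl {ph, al} (D - C)" using ncl_additive[OF P(2) C(1) c3] .
qed

lemma single_edge_counts:
  assumes "d \<noteq> e" "al d = e" "al e = d" "ph d = e" "ph e = d"
  shows "ncl {ph} {d, e} = 1" "ncl {sgm al ph} {d, e} = 2" "ncl {ph, al} {d, e} = 1"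
    "pmap {d, e} al ph" "card {d, e} = 2"
proof -
  have 1: "cls Fs d = {d, e} \<and> cls Fs e = {d, e}" if "Fs = {ph} \<or> Fs = {ph, al}" for Fs
  proof -
    have "cls Fs d \<subseteq> {d, e}" by (rule cls_least) (use assms that in auto)
    moreover have "cls Fs e \<subseteq> {d, e}" by (rule cls_least) (use assms that in auto)
    moreover have "e \<in> cls Fs d" using cls_step[OF cls_refl, of ph Fs d] assms that by auto
    moreover have "d \<in> cls Fs e" using cls_step[OF cls_refl, of ph Fs e] assms that by auto
    ultimately show ?thesis by auto
  qed
  have 2: "cls {sgm al ph} d \<subseteq> {d}" "cls {sgm al ph} e \<subseteq> {e}"
    by (rule cls_least; use assms in \<open>auto simp: sgm_def\<close>)+
  hence 2: "cls {sgm al ph} d = {d}" "cls {sgm al ph} e = {e}"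
    by (simp_all add: subset_antisym)
  show "ncl {ph} {d, e} = 1" "ncl {sgm al ph} {d, e} = 2" "ncl {ph, al} {d, e} = 1"
    using 1 2 assms(1) by (auto simp: ncl_def)
  show "pmap {d, e} al ph" using assms by (auto simp: pmap_def bij_betw_def)
  show "card {d, e} = 2" using assms(1) by simp
qed

text \<open>The genus is nonnegative: an edge is isolated at both ends, which reflects the
  inequality, and a separate edge satisfies it with equality.\<close>

lemma euler_le:
  assumes "pmap D al ph"
  shows "2 * (ncl {sgm al ph} D + ncl {ph} D) \<le> card D + 4 * ncl {ph, al} D"
  using assms
proof (induction "card D" arbitrary: D ph rule: less_induct)
  case less
  show ?case
  proof (cases "D = {}")
    case False
    then obtain d where d: "d \<in> D" by blast
    note M = less.prems
    obtain ph2 where 2: "pmap D al ph2" "ph2 (al d) = d" "ph2 d = al d"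
      "2 * (ncl {sgm al ph2} D + ncl {ph2} D) \<le> card D + 4 * ncl {ph2, al} D \<Longrightarrow>
       2 * (ncl {sgm al ph} D + ncl {ph} D) \<le> card D + 4 * ncl {ph, al} D"
      using isolate_edge[OF M d] by blast
    let ?C = "{d, al d}"
    have C: "?C \<subseteq> D" "\<forall>x\<in>?C. ph2 x \<in> ?C" "\<forall>x\<in>?C. al x \<in> ?C"
      using d 2 pmap_al[OF M d] pmap_al_al[OF M d] by auto
    note R = pmap_closed[OF 2(1) C]
    note S = single_edge_counts[of d "al d" al ph2]
    have S: "ncl {ph2} ?C = 1" "ncl {sgm al ph2} ?C = 2" "ncl {ph2, al} ?C = 1" "card ?C = 2"
      using S 2 pmap_al_al[OF M d] pmap_al_ne[OF M d] by auto
    have "card (D - ?C) < card D" using R(3) S(4) by simp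
    from less.hyps[OF this R(2)] have "2 * (ncl {sgm al ph2} D + ncl {ph2} D) \<le> card D + 4 * ncl {ph2, al} D"
      using R(3-) S by simp
    thus ?thesis using 2(4) by simp
  qed simp
qed

text \<open>The defect in the Euler inequality is additive over unions of components and never
  negative, so it vanishes on each part if it vanishes on the whole.\<close>

lemma planar_closed:
  assumes M: "pmap D al ph" and C: "C \<subseteq> D" "\<forall>x\<in>C. ph x \<in> C" "\<forall>x\<in>C. al x \<in> C"
    and p: "planar D al ph"
  shows "planar C al ph"
  using euler_le[OF pmap_closed(2)[OF M C]] pmap_closed(3-6)[OF M C] p by (simp add: planar_def)

lemma pmap_cong:
  assumes "pmap D al ph" "\<forall>x\<in>D. ph x = ph' x"
  shows "pmap D al ph'" "ncl {ph} D = ncl {ph'} D" "planar D al ph \<longleftrightarrow> planar D al ph'"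
    "ncl {ph, al} D = ncl {ph', al} D"
proof -
  have "bij_betw ph' D D" using assms bij_betw_cong[of D ph ph' D] by (simp add: pmap_def)
  thus M': "pmap D al ph'" using assms by (simp add: pmap_def)
  note P = pmap_perms[OF assms(1)]
  show 1: "ncl {ph} D = ncl {ph'} D" "ncl {ph, al} D = ncl {ph', al} D"
    using ncl_cong[OF P(1) assms(2)] ncl_cong[OF P(2) assms(2)] by auto
  have "\<forall>x\<in>D. sgm al ph x = sgm al ph' x" using assms by (auto simp: sgm_def pmap_def)
  from ncl_cong[OF P(3) this] 1 show "planar D al ph \<longleftrightarrow> planar D al ph'"
    by (simp add: planar_def)
qed

text \<open>The face permutation after the deletion of an edge. The darts \<open>d\<close> and
  \<open>al d\<close> are skipped one after the other, so that the case where one of them follows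
  the other is covered.\<close>

definition delph :: "('a \<Rightarrow> 'a) \<Rightarrow> ('a \<Rightarrow> 'a) \<Rightarrow> 'a \<Rightarrow> 'a \<Rightarrow> 'a" where
  "delph al ph d x = (let p1 = \<lambda>x. if ph x = d then ph (al d) else ph x in
     if p1 x = al d then p1 d else p1 x)"

text \<open>The last conclusion is a discrete Jordan curve theorem: an edge with the same face on
  both sides and without a free end is a bridge. Isolating it adds two vertices and two faces, so by
  \<open>euler_le\<close> a planar map must gain two components, one of which is the edge
  itself.\<close>

lemma delete_edge:
  assumes M: "pmap D al ph" and d: "d \<in> D" and p: "planar D al ph"
  shows "pmap (D - {d, al d}) al (delph al ph d)" "planar (D - {d, al d}) al (delph al ph d)"
    "ncl {ph} D \<le> ncl {delph al ph d} (D - {d, al d}) + 3"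
    "card (D - {d, al d}) + 2 = card D"
    "al d \<in> cls {ph} d \<Longrightarrow> ph (al d) \<noteq> d \<Longrightarrow> ph d \<noteq> al d \<Longrightarrow>
     ncl {ph, al} D + 1 \<le> ncl {delph al ph d, al} (D - {d, al d})"
proof -
  obtain ph2 where 2: "pmap D al ph2" "ph2 (al d) = d" "ph2 d = al d"
    "\<forall>x\<in>D - {d, al d}. ph2 x = delph al ph d x"
    "planar D al ph2" "ncl {ph} D \<le> ncl {ph2} D + 2"
    "al d \<in> cls {ph} d \<Longrightarrow> ph (al d) \<noteq> d \<Longrightarrow> ph d \<noteq> al d \<Longrightarrow>
      ncl {sgm al ph2} D = ncl {sgm al ph} D + 2 \<and> ncl {ph2} D = ncl {ph} D + 2"
  proof (rule isolate_edge[OF M d])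
    fix ph2
    assume "pmap D al ph2" "ph2 (al d) = d" "ph2 d = al d"
      and eq: "\<forall>x\<in>D - {d, al d}. ph2 x =
        (if (if ph x = d then ph (al d) else ph x) = al d then if ph d = d then ph (al d) else ph d
         else if ph x = d then ph (al d) else ph x)"
      and pl: "planar D al ph \<Longrightarrow> planar D al ph2" and "ncl {ph} D \<le> ncl {ph2} D + 2"
      and "al d \<in> cls {ph} d \<Longrightarrow> ph (al d) \<noteq> d \<Longrightarrow> ph d \<noteq> al d \<Longrightarrow>
        ncl {sgm al ph2} D = ncl {sgm al ph} D + 2 \<and> ncl {ph2} D = ncl {ph} D + 2"
    moreover have "\<forall>x\<in>D - {d, al d}. ph2 x = delph al ph d x"
      using eq by (simp add: delph_def Let_def)
    ultimately show thesis using that[of ph2] p by blast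
  qed
  let ?C = "{d, al d}"
  have C: "?C \<subseteq> D" "\<forall>x\<in>?C. ph2 x \<in> ?C" "\<forall>x\<in>?C. al x \<in> ?C"
    using d 2 pmap_al[OF M d] pmap_al_al[OF M d] by auto
  note R = pmap_closed[OF 2(1) C]
  have S: "ncl {ph2} ?C = 1" "ncl {sgm al ph2} ?C = 2" "ncl {ph2, al} ?C = 1" "card ?C = 2"
    using single_edge_counts[of d "al d" al ph2] 2 pmap_al_al[OF M d] pmap_al_ne[OF M d] by auto
  note E = pmap_cong[OF R(2) 2(4)]
  show "pmap (D - ?C) al (delph al ph d)" using E by simp
  have "planar (D - ?C) al ph2"
    using R S 2(5) by (simp add: planar_def)
  thus "planar (D - ?C) al (delph al ph d)" using E by simp
  show "ncl {ph} D \<le> ncl {delph al ph d} (D - {d, al d}) + 3"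
    using 2(6) R S E by simp
  show "card (D - {d, al d}) + 2 = card D" using R(3) S(4) by simp
  assume a: "al d \<in> cls {ph} d" "ph (al d) \<noteq> d" "ph d \<noteq> al d"
  have "2 * (ncl {sgm al ph2} D + ncl {ph2} D) \<le> card D + 4 * ncl {ph2, al} D" using euler_le[OF 2(1)] .
  hence "ncl {ph, al} D + 2 \<le> ncl {ph2, al} D" using 2(7)[OF a] p by (simp add: planar_def)
  thus "ncl {ph, al} D + 1 \<le> ncl {delph al ph d, al} (D - {d, al d})"
    using R S E by simp
qed

section \<open>Words and their equality in the group\<close>

lemma inv_letter_inv [simp]: "inv_letter (inv_letter x) = x" "fst (inv_letter x) = fst x"
  "inv_letter x \<noteq> x" "x \<noteq> inv_letter x"
  by (cases x; simp add: inv_letter_def)+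

lemma inv_word_append [simp]: "inv_word (u @ v) = inv_word v @ inv_word u"
  and inv_word_nil [simp]: "inv_word [] = []"
  and inv_word_single [simp]: "inv_word [x] = [inv_letter x]"
  and inv_word_cons: "inv_word (x # w) = inv_word w @ [inv_letter x]"
  and length_inv_word [simp]: "length (inv_word w) = length w"
  by (auto simp: inv_word_def)

lemma inv_word_inv [simp]: "inv_word (inv_word w) = w"
  by (simp add: inv_word_def rev_map comp_def)

lemma words_simps [simp]: "[] \<in> words S" "u @ v \<in> words S \<longleftrightarrow> u \<in> words S \<and> v \<in> words S"
  "x # u \<in> words S \<longleftrightarrow> fst x \<in> S \<and> u \<in> words S" "inv_word u \<in> words S \<longleftrightarrow> u \<in> words S"
  by (auto simp: words_def inv_word_def)

lemma words_take: "w \<in> words S \<Longrightarrow> take k w \<in> words S" "w \<in> words S \<Longrightarrow> drop k w \<in> words S"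
  by (auto simp: words_def dest: in_set_takeD in_set_dropD)

lemma word_eq_words:
  "(u, v) \<in> word_eq S R \<Longrightarrow> u \<in> words S \<and> v \<in> words S"
  by (induction rule: word_eq.induct) (auto simp: inv_letter_inv)

lemma word_eq_ctx:
  assumes "(u, v) \<in> word_eq S R" "a \<in> words S" "b \<in> words S"
  shows "(a @ u @ b, a @ v @ b) \<in> word_eq S R"
  using assms(1)
proof (induction rule: word_eq.induct)
  case (refl w)
  thus ?case using assms by (intro word_eq.refl) simp
next
  case (cancel u v x)
  thus ?case using word_eq.cancel[of "a @ u" S "v @ b" x R] assms by simp
next
  case (relator u v r)
  thus ?case using word_eq.relator[of "a @ u" S "v @ b" r R] assms by simp
qed (auto intro: word_eq.sym word_eq.trans)

lemma word_eq_app: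
  assumes "(u, v) \<in> word_eq S R" "(u', v') \<in> word_eq S R"
  shows "(u @ u', v @ v') \<in> word_eq S R"
proof -
  have w: "u \<in> words S" "v \<in> words S" "u' \<in> words S" "v' \<in> words S"
    using word_eq_words assms by blast+
  have "(u @ u', v @ u') \<in> word_eq S R" using word_eq_ctx[OF assms(1), of "[]" u'] w by simp
  moreover have "(v @ u', v @ v') \<in> word_eq S R" using word_eq_ctx[OF assms(2), of v "[]"] w by simp
  ultimately show ?thesis by (rule word_eq.trans)
qed

lemma word_inv_right: "w \<in> words S \<Longrightarrow> (w @ inv_word w, []) \<in> word_eq S R"
proof (induction w rule: rev_induct)
  case Nil thus ?case by (auto intro: word_eq.refl)
next
  case (snoc x w)
  hence "(w @ [x, inv_letter x] @ inv_word w, w @ inv_word w) \<in> word_eq S R"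
    by (intro word_eq.cancel) auto
  thus ?case using snoc by (auto intro: word_eq.trans)
qed

lemma word_inv_left: "w \<in> words S \<Longrightarrow> (inv_word w @ w, []) \<in> word_eq S R"
  using word_inv_right[of "inv_word w" S R] by simp

lemma word_cancel_left:
  assumes "(a @ u, a @ v) \<in> word_eq S R" shows "(u, v) \<in> word_eq S R"
proof -
  have w: "a \<in> words S" "u \<in> words S" "v \<in> words S" using word_eq_words[OF assms] by auto
  have "(inv_word a @ a @ u, inv_word a @ a @ v) \<in> word_eq S R"
    using word_eq_ctx[OF assms, of "inv_word a" "[]"] w by simp
  moreover have "(inv_word a @ a @ z, z) \<in> word_eq S R" if "z \<in> words S" for z
    using word_eq_ctx[OF word_inv_left[OF w(1)], of "[]" z] that by simp
  ultimately show ?thesis using w by (meson word_eq.sym word_eq.trans)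
qed

lemma word_inv_move:
  assumes "(u @ v, w) \<in> word_eq S R" shows "(u, w @ inv_word v) \<in> word_eq S R"
proof -
  have w: "u \<in> words S" "v \<in> words S" "w \<in> words S" using word_eq_words[OF assms] by auto
  have "((u @ v) @ inv_word v, w @ inv_word v) \<in> word_eq S R"
    using word_eq_app[OF assms word_eq.refl[of "inv_word v"]] w by simp
  moreover have "(u @ v @ inv_word v, u) \<in> word_eq S R"
    using word_eq_ctx[OF word_inv_right[OF w(2)], of u "[]"] w by simp
  ultimately show ?thesis by (metis append.assoc word_eq.sym word_eq.trans)
qed

lemma word_eq_inv:
  assumes "(u, v) \<in> word_eq S R" shows "(inv_word u, inv_word v) \<in> word_eq S R"
proof -
  have w: "u \<in> words S" "v \<in> words S" using word_eq_words[OF assms] by auto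
  have "(v @ inv_word v, []) \<in> word_eq S R" using word_inv_right[OF w(2)] .
  moreover have "(u @ inv_word v, v @ inv_word v) \<in> word_eq S R"
    using word_eq_app[OF assms word_eq.refl] w by simp
  moreover have "(u @ inv_word u, []) \<in> word_eq S R" using word_inv_right[OF w(1)] .
  ultimately have "(u @ inv_word u, u @ inv_word v) \<in> word_eq S R"
    by (meson word_eq.sym word_eq.trans)
  thus ?thesis by (rule word_cancel_left)
qed

section \<open>Cycles of a permutation as lists\<close>

definition cyc :: "('a \<Rightarrow> 'a) \<Rightarrow> 'a list \<Rightarrow> bool" where
  "cyc f xs \<longleftrightarrow> xs \<noteq> [] \<and> distinct xs \<and> map f xs = rotate1 xs"

lemma cyc_Cons: "cyc f (x # xs) \<longleftrightarrow> distinct (x # xs) \<and> map f (x # xs) = xs @ [x]"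
  by (auto simp: cyc_def)

lemma cyc_rot: "cyc f (A @ B) \<Longrightarrow> cyc f (B @ A)"
proof -
  assume a: "cyc f (A @ B)"
  have "map f (rotate (length A) (A @ B)) = rotate1 (rotate (length A) (A @ B))"
    using a by (simp only: cyc_def rotate_map[symmetric] rotate1_rotate_swap)
  thus ?thesis using a by (simp only: rotate_append) (auto simp: cyc_def)
qed

lemma cyc_set:
  assumes "cyc f xs" "x \<in> set xs" shows "f x \<in> set xs"
proof -
  have "f x \<in> set (map f xs)" using assms by auto
  moreover have "set (map f xs) = set xs" using assms by (metis cyc_def set_rotate1)
  ultimately show ?thesis by blast
qed

lemma cyc_cls:
  assumes "cyc f xs" "x \<in> set xs" shows "cls {f} x = set xs"
proof
  show "cls {f} x \<subseteq> set xs" by (rule cls_least) (use assms cyc_set in auto)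
  obtain A B where "xs = A @ x # B" using assms(2) by (auto simp: in_set_conv_decomp)
  hence c: "cyc f (x # B @ A)" using cyc_rot[of f A "x # B"] assms by simp
  have eq: "set xs = set (x # B @ A)" using \<open>xs = _\<close> by auto
  have "ys = zs @ ws \<Longrightarrow> map f (x # ys) = ys @ [x] \<Longrightarrow> set zs \<subseteq> cls {f} x" for ys zs ws
  proof (induction zs arbitrary: ws rule: rev_induct)
    case (snoc z zs)
    hence IH: "set zs \<subseteq> cls {f} x" by simp
    have "map f (x # zs @ z # ws) = zs @ z # ws @ [x]" using snoc by simp
    hence "map f (x # zs) @ map f (z # ws) = (zs @ [z]) @ (ws @ [x])" by simp
    hence "map f (x # zs) = zs @ [z]" by (subst (asm) append_eq_append_conv) auto
    hence "f (last (x # zs)) = z" by (metis last_map last_snoc list.distinct(1))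
    moreover have "last (x # zs) \<in> cls {f} x" using IH by (auto split: if_splits)
    ultimately show ?case using IH by (auto intro: cls_step)
  qed simp
  from this[of "B @ A" "B @ A" "[]"] c have "set (B @ A) \<subseteq> cls {f} x" by (simp add: cyc_Cons)
  thus "set xs \<subseteq> cls {f} x" unfolding eq by simp
qed

lemma cyc_exists:
  assumes "perms D {f}" "x \<in> D"
  obtains xs where "cyc f (x # xs)" "set (x # xs) = cls {f} x"
proof -
  have "x \<in> cls {f} (f x)" using cls_back1[OF assms(1)] assms(2) by simp
  then obtain k where "x = (f ^^ k) (f x)" by (auto simp: cls_single)
  hence "x = (f ^^ Suc k) x" by (simp add: funpow_swap1)
  hence ex: "\<exists>k. x = (f ^^ Suc k) x" by blast
  define k where "k = (LEAST k. x = (f ^^ Suc k) x)"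
  have k: "x = (f ^^ Suc k) x" unfolding k_def by (rule LeastI_ex[OF ex])
  have min: "x \<noteq> (f ^^ Suc i) x" if "i < k" for i using that not_less_Least k_def by blast
  let ?xs = "map (\<lambda>i. (f ^^ i) x) [0..<Suc k]"
  have inD: "(f ^^ i) x \<in> D" for i using assms perms_in[OF assms(1)] by (induction i) auto
  have inj: "inj_on f D" using assms by (auto simp: perms_def bij_betw_def)
  have noeq: "(f ^^ i) x \<noteq> (f ^^ j) x" if "i < j" "j \<le> k" for i j
    using that
  proof (induction i arbitrary: j)
    case 0
    thus ?case using min[of "j - 1"] by (cases j) auto
  next
    case (Suc i)
    then obtain j' where j: "j = Suc j'" by (cases j) auto
    hence "(f ^^ i) x \<noteq> (f ^^ j') x" using Suc by auto
    thus ?case using j inj inD by (auto dest: inj_onD)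
  qed
  have "i = j" if "i \<le> k" "j \<le> k" "(f ^^ i) x = (f ^^ j) x" for i j
    using noeq[of i j] noeq[of j i] that by (metis linorder_neqE_nat)
  hence "inj_on (\<lambda>i. (f ^^ i) x) (set [0..<Suc k])" unfolding inj_on_def by auto
  hence d: "distinct ?xs" unfolding distinct_map by simp
  have m: "map f ?xs = rotate1 ?xs"
  proof (rule nth_equalityI)
    fix i assume "i < length (map f ?xs)"
    hence i: "i < Suc k" by simp
    have "rotate1 ?xs ! i = ?xs ! (Suc i mod Suc k)" using i by (simp add: nth_rotate1)
    also have "\<dots> = f (?xs ! i)"
    proof (cases "i = k")
      case True thus ?thesis using k by (simp add: nth_append)
    next
      case False
      hence "Suc i mod Suc k = Suc i" using i by simp
      moreover have "?xs ! Suc i = (f ^^ Suc i) x" "?xs ! i = (f ^^ i) x" using i False by (simp_all add: nth_map_upt del: upt_Suc)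
      ultimately show ?thesis by (simp del: upt_Suc)
    qed
    finally show "map f ?xs ! i = rotate1 ?xs ! i" using i by (simp del: upt_Suc)
  qed simp
  have h: "?xs = x # map (\<lambda>i. (f ^^ i) x) [1..<Suc k]" by (simp add: upt_conv_Cons del: upt_Suc)
  have c: "cyc f (x # map (\<lambda>i. (f ^^ i) x) [1..<Suc k])"
    using d m h by (simp add: cyc_def del: upt_Suc)
  show ?thesis using that[OF c] cyc_cls[OF c, of x] by simp
qed

lemma cyc_tmv_split:
  assumes "cyc f (A @ B)" "A \<noteq> []" "B \<noteq> []"
  shows "cyc (tmv f (last A) (last B)) A"
proof -
  obtain a A' where A: "A = A' @ [a]" using assms(2) by (metis rev_exhaust)
  obtain b B' where B: "B = B' @ [b]" using assms(3) by (metis rev_exhaust)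
  obtain h T where H: "A = h # T" using assms(2) by (cases A) auto
  let ?g = "tmv f (last A) (last B)"
  have d: "distinct (A @ B)" and m: "map f (A @ B) = tl A @ B @ [h]" using assms H by (auto simp: cyc_def)
  have "map f A' @ f a # map f B' @ [f b] = tl A @ B @ [h]" using m A B by simp
  moreover have "length (map f A') = length (tl A)" using A by simp
  ultimately have "map f A' = tl A" "f b = h" by auto
  moreover have "map ?g A' = map f A'" using d A B by (auto simp: tmv_def)
  moreover have "?g a = f b" using d A B by (auto simp: tmv_def)
  ultimately have "map ?g A' = tl A" "?g a = h" by simp_all
  moreover have "map ?g A = map ?g A' @ [?g a]" using arg_cong[OF A, of "map ?g"] by simp
  moreover have "rotate1 A = tl A @ [h]" using H by simp
  ultimately have "map ?g A = rotate1 A" by simp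
  thus ?thesis using d assms(2) by (simp add: cyc_def)
qed

lemma cyc_cong: "cyc f xs \<Longrightarrow> (\<And>x. x \<in> set xs \<Longrightarrow> f x = g x) \<Longrightarrow> cyc g xs"
  unfolding cyc_def by (metis map_cong)

text \<open>Geometrically a bridge is removed and its face falls into two. In
  \<open>cyc_delph_diff\<close> the edge lies between two faces, which become one.\<close>

lemma cyc_delph_same:
  assumes c: "cyc ph (d # X @ al d # Y)" and X: "X \<noteq> []"
  shows "cyc (delph al ph d) X"
proof -
  obtain x X' where XX: "X = x # X'" using X by (cases X) auto
  have d: "distinct (d # x # X' @ al d # Y)" and m: "map ph (d # x # X' @ al d # Y) = x # X' @ al d # Y @ [d]"
    using c XX by (auto simp: cyc_Cons)
  have phd: "ph d = x" using m by simp
  have "map ph (x # X') @ map ph (al d # Y) = (X' @ [al d]) @ (Y @ [d])" using m by simp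
  hence mX: "map ph (x # X') = X' @ [al d]" by (subst (asm) append_eq_append_conv) auto
  have "map (delph al ph d) (x # X') = map (\<lambda>z. if z = al d then x else z) (map ph (x # X'))"
  proof -
    have "delph al ph d y = (if ph y = al d then x else ph y)" if "y \<in> set (x # X')" for y
    proof -
      have "ph y \<in> set (X' @ [al d])" using that mX by (metis image_eqI set_map)
      hence "ph y \<noteq> d" using d by auto
      thus ?thesis using phd d by (auto simp: delph_def)
    qed
    thus ?thesis by auto
  qed
  also have "\<dots> = X' @ [x]" unfolding mX using d by (auto intro!: map_idI)
  finally show ?thesis using d unfolding XX cyc_Cons by simp
qed

lemma cyc_delph_diff:
  assumes c: "cyc ph (d # X)" "cyc ph (al d # Y)" and dis: "set (d # X) \<inter> set (al d # Y) = {}"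
    and XY: "X @ Y \<noteq> []"
  shows "cyc (delph al ph d) (X @ Y)"
proof -
  let ?g = "delph al ph d" and ?e = "al d"
  have d: "distinct (d # X)" "distinct (?e # Y)" and m: "map ph (d # X) = X @ [d]" "map ph (?e # Y) = Y @ [?e]"
    using c by (auto simp: cyc_Cons)
  have mX: "map ph X = tl (X @ [d])" and mY: "map ph Y = tl (Y @ [?e])"
    and hX: "ph d = hd (X @ [d])" and hY: "ph ?e = hd (Y @ [?e])"
    using m by (metis list.sel(1,3) list.simps(9))+
  have gX: "?g y = (if ph y = d then hd (Y @ X) else ph y)" if "y \<in> set X" for y
  proof -
    have "ph y \<in> set (X @ [d])" using that m by (metis image_eqI list.set_intros(2) set_map)
    hence ne: "ph y \<noteq> ?e" using dis by auto
    show ?thesis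
    proof (cases "ph y = d")
      case True
      show ?thesis
      proof (cases Y)
        case Nil
        thus ?thesis using True hX hY that dis d by (cases X) (auto simp: delph_def)
      next
        case (Cons z Z)
        thus ?thesis using True hX hY that d by (auto simp: delph_def)
      qed
    qed (use ne in \<open>simp add: delph_def\<close>)
  qed
  have gY: "?g y = (if ph y = ?e then hd (X @ Y) else ph y)" if "y \<in> set Y" for y
  proof -
    have "ph y \<in> set (Y @ [?e])" using that m by (metis image_eqI list.set_intros(2) set_map)
    hence ne: "ph y \<noteq> d" using dis by auto
    show ?thesis
    proof (cases "ph y = ?e")
      case True
      show ?thesis
      proof (cases X)
        case Nil
        thus ?thesis using True hX hY that dis ne by (cases Y) (auto simp: delph_def)
      next
        case (Cons z Z)
        thus ?thesis using True hX hY that d dis by (auto simp: delph_def)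
      qed
    qed (use ne in \<open>simp add: delph_def\<close>)
  qed
  have X1: "map ?g X = tl X @ [hd (Y @ X)]" if "X \<noteq> []"
  proof -
    have "map ?g X = map (\<lambda>z. if z = d then hd (Y @ X) else z) (map ph X)" using gX by auto
    also have "\<dots> = tl X @ [hd (Y @ X)]" unfolding mX using that d by (cases X) (auto intro!: map_idI)
    finally show ?thesis .
  qed
  have Y1: "map ?g Y = tl Y @ [hd (X @ Y)]" if "Y \<noteq> []"
  proof -
    have "map ?g Y = map (\<lambda>z. if z = ?e then hd (X @ Y) else z) (map ph Y)" using gY by auto
    also have "\<dots> = tl Y @ [hd (X @ Y)]" unfolding mY using that d by (cases Y) (auto intro!: map_idI)
    finally show ?thesis .
  qed
  have "map ?g (X @ Y) = rotate1 (X @ Y)"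
    using X1 Y1 XY by (cases X; cases Y) auto
  thus ?thesis using XY d dis by (auto simp: cyc_def)
qed

lemma cyc_delph_other:
  assumes c: "cyc ph Z" and "d \<notin> set Z" "al d \<notin> set Z"
  shows "cyc (delph al ph d) Z"
proof (rule cyc_cong[OF c])
  fix x assume "x \<in> set Z"
  hence "ph x \<in> set Z" using cyc_set[OF c] by blast
  thus "ph x = delph al ph d x" using assms by (auto simp: delph_def)
qed

subsection \<open>Diagrams over a labelled graph\<close>

primrec rd :: "('v \<Rightarrow> 'x \<Rightarrow> 'v \<Rightarrow> bool) \<Rightarrow> 'v \<Rightarrow> 'x list \<Rightarrow> 'v \<Rightarrow> bool" where
  "rd st v [] u \<longleftrightarrow> v = u"
| "rd st v (x # w) u \<longleftrightarrow> (\<exists>z. st v x z \<and> rd st z w u)"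

text \<open>Simple cycles in terms of the words that they read. The last clause excludes the walk
  along an edge and back, which repeats no vertex before it closes; loops and cycles of two
  different edges remain.\<close>

definition scyc :: "('v \<Rightarrow> 's \<times> bool \<Rightarrow> 'v \<Rightarrow> bool) \<Rightarrow> 'v \<Rightarrow> ('s \<times> bool) list \<Rightarrow> bool" where
  "scyc st v w \<longleftrightarrow> w \<noteq> [] \<and> rd st v w v \<and>
     (\<forall>i j u. i < j \<longrightarrow> j < length w \<longrightarrow> rd st v (take i w) u \<longrightarrow> \<not> rd st v (take j w) u) \<and>
     (\<forall>x. w \<noteq> [x, inv_letter x])"

definition veq :: "('v \<Rightarrow> 'v) set \<Rightarrow> 'v \<Rightarrow> 'v \<Rightarrow> bool" where
  "veq aut u v \<longleftrightarrow> (\<exists>f\<in>aut. f u = v)"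

lemma rd_append: "rd st v (w1 @ w2) u \<longleftrightarrow> (\<exists>z. rd st v w1 z \<and> rd st z w2 u)"
  by (induction w1 arbitrary: v) auto

text \<open>An abstract labelled graph: \<open>st v x u\<close> says that the letter \<open>x\<close> leads from \<open>v\<close> to \<open>u\<close>.\<close>

locale scg =
  fixes st :: "'v \<Rightarrow> 's \<times> bool \<Rightarrow> 'v \<Rightarrow> bool" and aut :: "('v \<Rightarrow> 'v) set"
    and S :: "'s set" and R :: "('s \<times> bool) list set"
  assumes st_S: "st v x u \<Longrightarrow> fst x \<in> S"
    and st_inv: "st v x u \<Longrightarrow> st u (inv_letter x) v"
    and st_det: "st v x u \<Longrightarrow> st v x u' \<Longrightarrow> u = u'"
    and aut_id: "(\<lambda>v. v) \<in> aut"
    and aut_comp: "f \<in> aut \<Longrightarrow> g \<in> aut \<Longrightarrow> (\<lambda>v. f (g v)) \<in> aut"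
    and aut_inv: "f \<in> aut \<Longrightarrow> \<exists>g\<in>aut. \<forall>v. g (f v) = v"
    and aut_st: "f \<in> aut \<Longrightarrow> st v x u \<Longrightarrow> st (f v) x (f u)"
    and rel_rd: "r \<in> R \<Longrightarrow> \<exists>v. rd st v r v"
    and scyc_rel: "scyc st v w \<Longrightarrow> w \<in> R"
    and small: "scyc st v (w1 @ w2) \<Longrightarrow> rd st v w1 u \<Longrightarrow> rd st v2 w1 u2 \<Longrightarrow> \<not> veq aut v v2 \<Longrightarrow>
      6 * length w1 < length (w1 @ w2)"
    and fin: "finite {u. \<exists>w. rd st v w u}"
begin

definition eqw (infix "\<approx>" 50) where "u \<approx> v \<longleftrightarrow> (u, v) \<in> word_eq S R"
abbreviation "rdd \<equiv> rd st"
abbreviation "vq \<equiv> veq aut"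

lemma eq_sym: "u \<approx> v \<Longrightarrow> v \<approx> u"
  and eq_trans [trans]: "u \<approx> v \<Longrightarrow> v \<approx> w \<Longrightarrow> u \<approx> w"
  and eq_refl: "u \<in> words S \<Longrightarrow> u \<approx> u"
  unfolding eqw_def by (rule word_eq.sym, assumption, rule word_eq.trans, assumption+, rule word_eq.refl)

lemma eq_words: "u \<approx> v \<Longrightarrow> u \<in> words S" "u \<approx> v \<Longrightarrow> v \<in> words S"
  unfolding eqw_def using word_eq_words by blast+

lemma eq_ctx: "u \<approx> v \<Longrightarrow> a \<in> words S \<Longrightarrow> b \<in> words S \<Longrightarrow> a @ u @ b \<approx> a @ v @ b"
  and eq_app: "u \<approx> v \<Longrightarrow> u' \<approx> v' \<Longrightarrow> u @ u' \<approx> v @ v'"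
  and eq_inv_right: "w \<in> words S \<Longrightarrow> w @ inv_word w \<approx> []"
  and eq_inv_left: "w \<in> words S \<Longrightarrow> inv_word w @ w \<approx> []"
  and eq_cancel_left: "a @ u \<approx> a @ v \<Longrightarrow> u \<approx> v"
  and eq_inv_move: "u @ v \<approx> w \<Longrightarrow> u \<approx> w @ inv_word v"
  and eq_inv: "u \<approx> v \<Longrightarrow> inv_word u \<approx> inv_word v"
  unfolding eqw_def
  by (rule word_eq_ctx word_eq_app word_inv_right word_inv_left word_cancel_left word_inv_move word_eq_inv;
      assumption)+

lemma vq_refl [simp]: "vq v v" using aut_id by (auto simp: veq_def)
lemma vq_sym: "vq u v \<Longrightarrow> vq v u" unfolding veq_def using aut_inv by metis
lemma vq_trans: "vq u v \<Longrightarrow> vq v w \<Longrightarrow> vq u w" unfolding veq_def using aut_comp by metis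

lemma rd_det: "rdd v w u \<Longrightarrow> rdd v w u' \<Longrightarrow> u = u'"
  by (induction w arbitrary: v) (auto dest: st_det)

lemma rd_words: "rdd v w u \<Longrightarrow> w \<in> words S"
  by (induction w arbitrary: v) (auto dest: st_S)

lemma rd_inv: "rdd v w u \<Longrightarrow> rdd u (inv_word w) v"
  by (induction w arbitrary: v) (auto simp: inv_word_cons rd_append intro: st_inv)

lemma rd_aut: "f \<in> aut \<Longrightarrow> rdd v w u \<Longrightarrow> rdd (f v) w (f u)"
  by (induction w arbitrary: v) (auto intro: aut_st)

lemma rd_vq: "vq v v2 \<Longrightarrow> rdd v w u \<Longrightarrow> \<exists>u2. rdd v2 w u2 \<and> vq u u2"
  unfolding veq_def by (metis rd_aut)

lemma rd_vq_end: "rdd v w u \<Longrightarrow> rdd v2 w u2 \<Longrightarrow> vq u u2 \<longleftrightarrow> vq v v2"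
  using rd_vq[of v v2 w u] rd_vq[of u u2 "inv_word w" v] rd_inv rd_det by metis

text \<open>A closed path that is neither a simple cycle nor a backtrack has a proper closed
  subpath, and both this and the path without it are shorter.\<close>

lemma closed_trivial: "rdd v w v \<Longrightarrow> w \<approx> []"
proof (induction "length w" arbitrary: v w rule: less_induct)
  case less
  have wS: "w \<in> words S" using rd_words less.prems by blast
  show ?case
  proof (cases "scyc st v w")
    case True
    hence "w \<in> R" by (rule scyc_rel)
    thus ?thesis using word_eq.relator[of "[]" S "[]" w R] wS by (simp add: eqw_def)
  next
    case False
    show ?thesis
    proof (cases "w = []")
      case True thus ?thesis by (simp add: eq_refl)
    next
      case wne: False
      show ?thesis
      proof (cases "\<exists>x. w = [x, inv_letter x]")
        case True
        thus ?thesis using word_eq.cancel[of "[]" S "[]" _ R] wS by (auto simp: eqw_def)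
      next
        case nb: False
        then obtain i j u where ij: "i < j" "j < length w" "rdd v (take i w) u" "rdd v (take j w) u"
          using False wne less.prems by (auto simp: scyc_def)
        let ?a = "take i w" and ?b = "take (j - i) (drop i w)" and ?c = "drop j w"
        have tj: "take j w = ?a @ ?b"
          using ij by (metis le_add_diff_inverse less_or_eq_imp_le take_add)
        have w: "w = ?a @ ?b @ ?c" using tj by (metis append.assoc append_take_drop_id)
        have b: "rdd u ?b u" using ij(3,4) unfolding tj rd_append by (metis rd_det)
        have "rdd v (take j w @ ?c) v" using less.prems by simp
        hence c: "rdd u ?c v" unfolding rd_append using ij(4) rd_det by metis
        have "rdd v (?a @ ?c) v" using ij(3) c by (auto simp: rd_append)
        hence 1: "?a @ ?c \<approx> []" using less.hyps[of "?a @ ?c"] ij by simp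
        have 2: "?b \<approx> []" using less.hyps[of ?b u] b ij by simp
        have "?a \<in> words S" "?c \<in> words S" using wS words_take by blast+
        hence "?a @ ?b @ ?c \<approx> ?a @ [] @ ?c" using eq_ctx[OF 2] by blast
        also have "\<dots> \<approx> []" using 1 by simp
        finally show ?thesis using w by simp
      qed
    qed
  qed
qed

lemma rd_same_eq: "rdd v w u \<Longrightarrow> rdd v w' u \<Longrightarrow> w \<approx> w'"
proof -
  assume a: "rdd v w u" "rdd v w' u"
  have "rdd v (w @ inv_word w') v" using a rd_inv rd_append by metis
  hence "w @ inv_word w' \<approx> []" by (rule closed_trivial)
  from eq_inv_move[OF this] show "w \<approx> w'" by simp
qed

text \<open>Diagrams over the graph: \<open>lb\<close> labels darts, \<open>ps\<close> places their origins in the Cayley graph,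
  \<open>lv\<close> lifts the origins of the darts of inner faces to the labelled graph, and \<open>os\<close> lists the darts
  of the outer face.\<close>

definition pdg :: "nat set \<Rightarrow> (nat \<Rightarrow> nat) \<Rightarrow> (nat \<Rightarrow> nat) \<Rightarrow> (nat \<Rightarrow> 's \<times> bool) \<Rightarrow> (nat \<Rightarrow> ('s \<times> bool) list) \<Rightarrow> bool" where
  "pdg D al ph lb ps \<longleftrightarrow> pmap D al ph \<and> planar D al ph \<and>
     (\<forall>x\<in>D. lb (al x) = inv_letter (lb x) \<and> fst (lb x) \<in> S \<and> ps x \<in> words S \<and>
       ps (ph x) \<approx> ps x @ [lb x] \<and> ps (al x) \<approx> ps x @ [lb x])"

text \<open>No continuity of \<open>lv\<close> is asked along the outer face: its sides are lifted
  separately, by \<open>kp\<close>.\<close>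

definition dg :: "nat set \<Rightarrow> (nat \<Rightarrow> nat) \<Rightarrow> (nat \<Rightarrow> nat) \<Rightarrow> (nat \<Rightarrow> 's \<times> bool) \<Rightarrow> (nat \<Rightarrow> ('s \<times> bool) list) \<Rightarrow>
    (nat \<Rightarrow> 'v) \<Rightarrow> nat list \<Rightarrow> bool" where
  "dg D al ph lb ps lv os \<longleftrightarrow> pdg D al ph lb ps \<and> cyc ph os \<and> set os \<subseteq> D \<and>
     (\<forall>x\<in>D. cls {ph, al} x = D) \<and> (\<forall>x\<in>D - set os. st (lv x) (lb x) (lv (ph x)))"

text \<open>The measure that every reduction lowers. Splitting a face lowers it by one; deleting an
  edge removes two darts and at most three faces (\<open>delete_edge\<close>), which the factor 2
  outweighs.\<close>

definition mu :: "nat set \<Rightarrow> (nat \<Rightarrow> nat) \<Rightarrow> nat" where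
  "mu D ph = 2 * card D - ncl {ph} D"

text \<open>A lifted side of a diagram. The end of the last dart is the free parameter
  \<open>u\<close>, so that the lift may jump from one side to the next.\<close>

primrec kp :: "(nat \<Rightarrow> 's \<times> bool) \<Rightarrow> (nat \<Rightarrow> 'v) \<Rightarrow> nat list \<Rightarrow> 'v \<Rightarrow> 'v \<Rightarrow> bool" where
  "kp lb lv [] v u \<longleftrightarrow> v = u"
| "kp lb lv (x # xs) v u \<longleftrightarrow> v = lv x \<and> (\<exists>z. st (lv x) (lb x) z \<and> kp lb lv xs z u)"

lemma kp_append: "kp lb lv (xs @ ys) v u \<longleftrightarrow> (\<exists>z. kp lb lv xs v z \<and> kp lb lv ys z u)"
  by (induction xs arbitrary: v) auto

lemma kp_rd: "kp lb lv xs v u \<Longrightarrow> rdd v (map lb xs) u"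
  by (induction xs arbitrary: v) auto

lemma kp_cong: "(\<And>x. x \<in> set xs \<Longrightarrow> lv x = lv' x) \<Longrightarrow> kp lb lv xs v u \<longleftrightarrow> kp lb lv' xs v u"
  by (induction xs arbitrary: v) auto

lemma kp_chain:
  assumes "xs \<noteq> []" "map ph xs = tl xs @ [z]" "\<forall>x\<in>set xs. st (lv x) (lb x) (lv (ph x))"
  shows "kp lb lv xs (lv (hd xs)) (lv z)"
  using assms
proof (induction xs)
  case (Cons x xs)
  show ?case
  proof (cases xs)
    case Nil thus ?thesis using Cons.prems by simp
  next
    case (Cons y ys)
    hence "map ph xs = tl xs @ [z]" "ph x = y" using Cons.prems by auto
    hence "kp lb lv xs (lv (hd xs)) (lv z)" using Cons.IH Cons.prems Cons by auto
    thus ?thesis using Cons.prems Cons \<open>ph x = y\<close> by auto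
  qed
qed simp

lemma pdgD:
  assumes "pdg D al ph lb ps"
  shows "pmap D al ph" "planar D al ph" "x \<in> D \<Longrightarrow> lb (al x) = inv_letter (lb x)" "x \<in> D \<Longrightarrow> fst (lb x) \<in> S"
    "x \<in> D \<Longrightarrow> ps x \<in> words S" "x \<in> D \<Longrightarrow> ps (ph x) \<approx> ps x @ [lb x]" "x \<in> D \<Longrightarrow> ps (al x) \<approx> ps x @ [lb x]"
  using assms by (auto simp: pdg_def)

lemma dgD:
  assumes "dg D al ph lb ps lv os"
  shows "pdg D al ph lb ps" "cyc ph os" "set os \<subseteq> D" "x \<in> D \<Longrightarrow> cls {ph, al} x = D"
    "x \<in> D \<Longrightarrow> x \<notin> set os \<Longrightarrow> st (lv x) (lb x) (lv (ph x))" "pmap D al ph" "planar D al ph" "finite D"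
  using assms by (auto simp: dg_def pdg_def pmap_def)

text \<open>After a surgery only the component that carries the outer face is kept. Dropping the
  others does not raise \<open>mu\<close>, as they have no more faces than darts.\<close>

lemma mk_dg:
  assumes P: "pdg D al ph lb ps" and c: "cyc ph os" and o: "set os \<subseteq> D"
    and st: "\<forall>x\<in>cls {ph, al} (hd os) - set os. st (lv x) (lb x) (lv (ph x))"
  obtains C where "C = cls {ph, al} (hd os)" "dg C al ph lb ps lv os" "mu C ph \<le> mu D ph" "C \<subseteq> D"
proof -
  define C where "C = cls {ph, al} (hd os)"
  note M = pdgD(1)[OF P]
  have h: "hd os \<in> set os" "hd os \<in> D" using c o by (auto simp: cyc_def)
  have CD: "C \<subseteq> D" unfolding C_def using cls_sub[OF pmap_perms(2)[OF M] h(2)] .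
  have cl: "\<forall>x\<in>C. ph x \<in> C" "\<forall>x\<in>C. al x \<in> C" unfolding C_def by (auto intro: cls_step)
  note Q = pmap_closed[OF M CD cl]
  have "planar C al ph" using planar_closed[OF M CD cl pdgD(2)[OF P]] .
  hence "pdg C al ph lb ps" using P CD Q(1) unfolding pdg_def by blast
  moreover have "set os \<subseteq> C"
    using cyc_cls[OF c h(1)] cls_mono[of "{ph}" "{ph, al}" "hd os"] unfolding C_def by auto
  moreover have "\<forall>x\<in>C. cls {ph, al} x = C" unfolding C_def using cls_eq[OF pmap_perms(2)[OF M] h(2)] by blast
  ultimately have "dg C al ph lb ps lv os" using c st unfolding dg_def C_def by blast
  moreover have "mu C ph \<le> mu D ph"
  proof -
    have "ncl {ph} (D - C) \<le> card (D - C)" using M by (intro ncl_le_card) (auto simp: pmap_def)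
    moreover have "ncl {ph} C \<le> card C" using Q(1) by (intro ncl_le_card) (auto simp: pmap_def)
    ultimately show ?thesis using Q(3,4) by (simp add: mu_def)
  qed
  ultimately show ?thesis using that C_def CD by blast
qed

lemma inner_closed:
  assumes "dg D al ph lb ps lv os" "x \<in> D - set os"
  shows "ph x \<in> D - set os" "cls {ph} x \<subseteq> D - set os"
proof -
  note M = dgD(6)[OF assms(1)]
  have 1: "ph x \<in> D - set os" if x: "x \<in> D - set os" for x
  proof -
    have "ph x \<notin> set os"
    proof
      assume a: "ph x \<in> set os"
      have "x \<in> cls {ph} (ph x)" using cls_back1[OF pmap_perms(1)[OF M], of ph x] x by simp
      thus False using cyc_cls[OF dgD(2)[OF assms(1)] a] x by simp
    qed
    thus ?thesis using pmap_ph[OF M] x by blast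
  qed
  thus "ph x \<in> D - set os" using assms(2) .
  show "cls {ph} x \<subseteq> D - set os" by (rule cls_least) (use 1 assms(2) in auto)
qed

text \<open>Along an inner face the lift and the position move by the same word; with
  \<open>closed_trivial\<close>, corners with the same lift have the same position.\<close>

lemma face_rd:
  assumes d: "dg D al ph lb ps lv os" and x: "x \<in> D - set os" and y: "y \<in> cls {ph} x"
  shows "\<exists>w. rdd (lv x) w (lv y) \<and> ps y \<approx> ps x @ w"
proof -
  let ?U = "{y \<in> D - set os. \<exists>w. rdd (lv x) w (lv y) \<and> ps y \<approx> ps x @ w}"
  note P = dgD(1)[OF d]
  have "cls {ph} x \<subseteq> ?U"
  proof (rule cls_least)
    show "x \<in> ?U" using x eq_refl[OF pdgD(5)[OF P]] by (auto intro!: exI[of _ "[]"])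
    fix f u assume f: "f \<in> {ph}" and "u \<in> ?U"
    then obtain w where u: "u \<in> D - set os" "rdd (lv x) w (lv u)" "ps u \<approx> ps x @ w" by auto
    have "rdd (lv x) (w @ [lb u]) (lv (ph u))" using u dgD(5)[OF d] by (auto simp: rd_append)
    moreover have "ps (ph u) \<approx> ps x @ w @ [lb u]"
    proof -
      have "ps (ph u) \<approx> ps u @ [lb u]" using pdgD(6)[OF P] u by blast
      also have "\<dots> \<approx> (ps x @ w) @ [lb u]"
        using eq_app[OF u(3) eq_refl[of "[lb u]"]] pdgD(4)[OF P] u by simp
      finally show ?thesis by simp
    qed
    ultimately show "f u \<in> ?U" using f inner_closed(1)[OF d u(1)] by blast
  qed
  thus ?thesis using y by blast
qed

section \<open>Surgery on diagrams\<close>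

lemma mu_pos: "pmap D al ph \<Longrightarrow> ncl {ph} D \<le> card D"
  by (rule ncl_le_card) (simp add: pmap_def)

text \<open>A face that visits a vertex of the graph twice is pinched there. The arc between the two
  corners is closed in the graph, so they have the same position and may be identified.\<close>

lemma split_inner:
  assumes d: "dg D al ph lb ps lv os" and a: "a \<in> D - set os" and b: "b \<in> cls {ph} a" and ne: "a \<noteq> b"
    and lv: "lv (ph a) = lv (ph b)"
  obtains D' where "dg D' al (tmv ph a b) lb ps lv os" "mu D' (tmv ph a b) < mu D ph"
proof -
  let ?p = "tmv ph a b"
  note P = dgD(1)[OF d] and M = dgD(6)[OF d]
  have b': "b \<in> D - set os" using inner_closed(2)[OF d a] b by blast
  have aD: "a \<in> D" and bD: "b \<in> D" using a b' by auto
  have pa: "ph a \<in> D - set os" using inner_closed(1)[OF d a] .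
  have "cls {ph} (ph a) = cls {ph} a"
    using cls_eq[OF pmap_perms(1)[OF M] aD cls_step[OF cls_refl, of ph]] by simp
  hence "ph b \<in> cls {ph} (ph a)" using cls_step[OF b, of ph] by simp
  then obtain w where w: "rdd (lv (ph a)) w (lv (ph b))" "ps (ph b) \<approx> ps (ph a) @ w"
    using face_rd[OF d pa] by blast
  have "w \<approx> []" using closed_trivial w lv by simp
  hence "ps (ph a) @ w \<approx> ps (ph a)" using eq_ctx[of w "[]" "ps (ph a)" "[]"] pdgD(5)[OF P] pa by simp
  hence pab: "ps (ph b) \<approx> ps (ph a)" using w(2) eq_trans by blast
  have "pdg D al ?p lb ps"
    unfolding pdg_def
  proof (intro conjI ballI)
    show "pmap D al ?p" using pmap_tmv[OF M aD bD] .
    show "planar D al ?p" using planar_split[OF M aD bD ne b dgD(7)[OF d]] .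
    fix x assume x: "x \<in> D"
    show "ps (?p x) \<approx> ps x @ [lb x]"
      using pdgD(6)[OF P x] pab eq_sym[OF pab] ne by (auto simp: tmv_def intro: eq_trans)
  qed (use pdgD[OF P] in auto)
  moreover have "cyc ?p os" by (rule cyc_cong[OF dgD(2)[OF d]]) (use a b' in \<open>auto simp: tmv_def\<close>)
  moreover have st: "\<forall>x\<in>D - set os. st (lv x) (lb x) (lv (?p x))"
    using dgD(5)[OF d] dgD(5)[OF d, of a] dgD(5)[OF d, of b] a b' lv[symmetric] by (auto simp: tmv_def)
  moreover have "cls {?p, al} (hd os) \<subseteq> D"
  proof -
    have "hd os \<in> D" using dgD(2,3)[OF d] by (auto simp: cyc_def)
    thus ?thesis using cls_sub[OF pmap_perms(2)[OF pmap_tmv[OF M aD bD]]] by blast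
  qed
  ultimately have 1: "pdg D al ?p lb ps" "cyc ?p os" "\<forall>x\<in>cls {?p, al} (hd os) - set os. st (lv x) (lb x) (lv (?p x))"
    by blast+
  obtain C where C: "dg C al ?p lb ps lv os" "mu C ?p \<le> mu D ?p"
    using mk_dg[OF 1(1,2) dgD(3)[OF d] 1(3)] by metis
  have "ncl {?p} D = ncl {ph} D + 1" using tmv_counts(1)[OF M aD bD ne b] .
  moreover have "card D > 0" using aD dgD(8)[OF d] by (auto simp: card_gt_0_iff)
  ultimately have "mu D ?p < mu D ph" using mu_pos[OF M] by (simp add: mu_def)
  thus ?thesis using that C by (meson le_less_trans)
qed

lemma ncl_restrict:
  assumes "D' \<subseteq> D" "\<forall>x\<in>D'. cls G x = cls F x \<inter> D'" "\<forall>x\<in>D. \<exists>y\<in>D'. cls F x = cls F y"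
  shows "ncl G D' = ncl F D"
proof -
  have "cls F ` D = cls F ` D'" using assms by auto
  moreover have "cls G ` D' = (\<lambda>X. X \<inter> D') ` (cls F ` D')" using assms(2) by (auto simp: image_iff)
  moreover have "inj_on (\<lambda>X. X \<inter> D') (cls F ` D')"
  proof (rule inj_onI)
    fix X Y assume "X \<in> cls F ` D'" "Y \<in> cls F ` D'" and e: "X \<inter> D' = Y \<inter> D'"
    then obtain x y where x: "x \<in> D'" "X = cls F x" and y: "y \<in> D'" "Y = cls F y" by blast
    have "x \<in> cls F x" "y \<in> cls F y" by simp_all
    hence "x \<in> cls F y" "y \<in> cls F x" using e x y by blast+
    thus "X = Y" using cls_trans[of x F y] cls_trans[of y F x] x y by blast
  qed
  ultimately show ?thesis by (simp add: ncl_def card_image)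
qed

text \<open>A face that runs along an edge and back is collapsed: the darts behind its two sides
  become reverses of each other. Vertices and components survive, as their classes are only
  restricted to \<open>D'\<close>, while one face and two darts disappear.\<close>

lemma digon_pdg:
  assumes P: "pdg D al ph lb ps" and d1: "d1 \<in> D" and ph: "ph d1 = d2" "ph d2 = d1" "d1 \<noteq> d2"
    and nal: "al d1 \<noteq> d2" and lb: "lb d2 = inv_letter (lb d1)"
  defines "D' \<equiv> D - {d1, d2}" and "al' \<equiv> al(al d1 := al d2, al d2 := al d1)"
  shows "pdg D' al' ph lb ps" "mu D' ph < mu D ph"
proof -
  note M = pdgD(1)[OF P]
  have d2: "d2 \<in> D" using pmap_ph[OF M d1] ph by simp
  define e1 where "e1 = al d1"
  define e2 where "e2 = al d2"
  have al'_def: "al' = al(e1 := e2, e2 := e1)" by (simp add: al'_def e1_def e2_def)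
  have finD: "finite D" using M by (simp add: pmap_def)
  have aa: "al (al x) = x" "al x \<in> D" "al x \<noteq> x" if "x \<in> D" for x
    using pmap_al_al[OF M that] pmap_al[OF M that] pmap_al_ne[OF M that] by auto
  have e: "al e1 = d1" "al e2 = d2" "e1 \<in> D" "e2 \<in> D" "e1 \<noteq> d1" "e2 \<noteq> d2" using d1 d2 aa by (auto simp: e1_def e2_def)
  have e1d2: "e1 \<noteq> d2" using nal by (simp add: e1_def)
  have e2d1: "e2 \<noteq> d1" using e1d2 e e1_def by auto
  have e12: "e1 \<noteq> e2" using e ph(3) by auto
  have eD': "e1 \<in> D'" "e2 \<in> D'" using e e1d2 e2d1 by (auto simp: D'_def)
  have D'D: "D' \<subseteq> D" by (auto simp: D'_def)
  have phD': "ph x \<in> D'" if "x \<in> D'" for x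
    using that pmap_ph[OF M, of x] pmap_inj[OF M, of x d1] pmap_inj[OF M, of x d2] ph d1 d2 by (auto simp: D'_def)
  have alD': "al x \<in> D'" if "x \<in> D'" "x \<noteq> e1" "x \<noteq> e2" for x
    using that aa[of x] by (auto simp: D'_def e1_def e2_def)
  have M': "pmap D' al' ph"
    unfolding pmap_def
  proof (intro conjI ballI)
    show "finite D'" using finD D'D finite_subset by blast
    have cl: "\<forall>f\<in>{ph}. \<forall>x\<in>{d1, d2}. f x \<in> {d1, d2}" using ph by auto
    show "bij_betw ph D' D'"
      using perms_closed_compl(2)[OF pmap_perms(1)[OF M] _ cl] d1 d2 by (auto simp: perms_def D'_def)
    fix x assume x: "x \<in> D'"
    show "al' x \<in> D'" using x alD' eD' by (auto simp: al'_def)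
    show "al' x \<noteq> x" using x aa D'D e12 by (auto simp: al'_def)
    show "al' (al' x) = x"
    proof (cases "x = e1 \<or> x = e2")
      case True thus ?thesis using e12 by (auto simp: al'_def)
    next
      case False
      have "al x \<noteq> e1 \<and> al x \<noteq> e2"
      proof -
        have "al x \<noteq> e1" using aa[of x] e x by (auto simp: D'_def)
        moreover have "al x \<noteq> e2" using aa[of x] e x by (auto simp: D'_def)
        ultimately show ?thesis by blast
      qed
      thus ?thesis using False aa x D'D by (auto simp: al'_def)
    qed
  qed
  let ?f = "sgm al ph" and ?g = "sgm al' ph"
  have fe: "?f e1 = d2" "?f e2 = d1" "?f d1 = ph e1" "?f d2 = ph e2" using e ph by (auto simp: sgm_def e1_def e2_def)
  have ge: "?g e1 = ph e2" "?g e2 = ph e1" using e12 by (auto simp: sgm_def al'_def)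
  have gf: "?g x = ?f x" if "x \<noteq> e1" "x \<noteq> e2" for x using that by (simp add: sgm_def al'_def)
  note PM = pmap_perms[OF M] and PM' = pmap_perms[OF M']
  have V: "ncl {?g} D' = ncl {?f} D"
  proof (rule ncl_restrict[OF D'D]; intro ballI)
    fix x assume x: "x \<in> D'"
    show "cls {?g} x = cls {?f} x \<inter> D'"
    proof
      have "cls {?g} x \<subseteq> cls {?f} x"
      proof (rule cls_least)
        fix h u assume h: "h \<in> {?g}" and u: "u \<in> cls {?f} x"
        have 1: "?f u \<in> cls {?f} x" by (rule cls_step[OF u]) simp
        have 2: "?f (?f u) \<in> cls {?f} x" by (rule cls_step[OF 1]) simp
        show "h u \<in> cls {?f} x" using h 1 2 fe ge gf[of u] by (cases "u = e1 \<or> u = e2") auto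
      qed simp
      thus "cls {?g} x \<subseteq> cls {?f} x \<inter> D'" using cls_sub[OF PM'(3) x] by blast
      let ?U = "cls {?g} x \<union> {y. y = d2 \<and> e1 \<in> cls {?g} x} \<union> {y. y = d1 \<and> e2 \<in> cls {?g} x}"
      have "cls {?f} x \<subseteq> ?U"
      proof (rule cls_least)
        fix h u assume h: "h \<in> {?f}" and u: "u \<in> ?U"
        have s: "y \<in> cls {?g} x \<Longrightarrow> ?g y \<in> cls {?g} x" for y by (erule cls_step) simp
        consider "u = d2" "e1 \<in> cls {?g} x" | "u = d1" "e2 \<in> cls {?g} x" | "u \<in> cls {?g} x" using u by blast
        thus "h u \<in> ?U"
        proof cases
          case 1 thus ?thesis using h fe ge s[of e1] by simp
        next
          case 2 thus ?thesis using h fe ge s[of e2] by simp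
        next
          case 3
          thus ?thesis using h fe ge gf[of u] s[of u] by (cases "u = e1"; cases "u = e2") auto
        qed
      qed simp
      thus "cls {?f} x \<inter> D' \<subseteq> cls {?g} x" by (auto simp: D'_def)
    qed
  next
    fix x assume x: "x \<in> D"
    have "cls {?f} (?f y) = cls {?f} y" if "y \<in> D" for y
      by (rule cls_eq[OF PM(3) that cls_step[OF cls_refl]]) simp
    from this[of e1] this[of e2] have "cls {?f} d2 = cls {?f} e1" "cls {?f} d1 = cls {?f} e2" using fe e by auto
    moreover have "x = d1 \<or> x = d2 \<or> x \<in> D'" using x by (auto simp: D'_def)
    ultimately show "\<exists>y\<in>D'. cls {?f} x = cls {?f} y" using eD' by blast
  qed
  have Cc: "ncl {ph, al'} D' = ncl {ph, al} D"
  proof (rule ncl_restrict[OF D'D]; intro ballI)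
    fix x assume x: "x \<in> D'"
    show "cls {ph, al'} x = cls {ph, al} x \<inter> D'"
    proof
      have "cls {ph, al'} x \<subseteq> cls {ph, al} x"
      proof (rule cls_least)
        fix h u assume h: "h \<in> {ph, al'}" and u: "u \<in> cls {ph, al} x"
        have s: "al y \<in> cls {ph, al} x \<and> ph y \<in> cls {ph, al} x" if "y \<in> cls {ph, al} x" for y
          using cls_step[OF that, of ph] cls_step[OF that, of al] by simp
        have "al (ph (al u)) \<in> cls {ph, al} x" using s u by blast
        thus "h u \<in> cls {ph, al} x" using h s[OF u] e ph by (auto simp: al'_def e1_def e2_def)
      qed simp
      thus "cls {ph, al'} x \<subseteq> cls {ph, al} x \<inter> D'" using cls_sub[OF PM'(2) x] by blast
      let ?U = "cls {ph, al'} x \<union> {y. (y = d2 \<or> y = d1) \<and> e1 \<in> cls {ph, al'} x}"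
      have "cls {ph, al} x \<subseteq> ?U"
      proof (rule cls_least)
        fix h u assume h: "h \<in> {ph, al}" and u: "u \<in> ?U"
        have s: "al' y \<in> cls {ph, al'} x \<and> ph y \<in> cls {ph, al'} x" if "y \<in> cls {ph, al'} x" for y
          using cls_step[OF that, of ph] cls_step[OF that, of al'] by simp
        have s1: "e2 \<in> cls {ph, al'} x \<longleftrightarrow> e1 \<in> cls {ph, al'} x" using s[of e1] s[of e2] e12 by (auto simp: al'_def)
        consider "u = d2 \<or> u = d1" "e1 \<in> cls {ph, al'} x" | "u \<in> cls {ph, al'} x" using u by blast
        thus "h u \<in> ?U"
        proof cases
          case 1 thus ?thesis using h ph e s1 by (auto simp: e1_def e2_def)
        next
          case 2
          hence "al u \<in> ?U" using s[of u] s1 e by (cases "u = e1"; cases "u = e2") (auto simp: al'_def)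
          thus ?thesis using h s[OF 2] by auto
        qed
      qed simp
      thus "cls {ph, al} x \<inter> D' \<subseteq> cls {ph, al'} x" by (auto simp: D'_def)
    qed
  next
    fix x assume x: "x \<in> D"
    have "cls {ph, al} (al y) = cls {ph, al} y" if "y \<in> D" for y
      by (rule cls_eq[OF PM(2) that cls_step[OF cls_refl]]) simp
    from this[of d1] this[of d2] have "cls {ph, al} d1 = cls {ph, al} e1" "cls {ph, al} d2 = cls {ph, al} e2"
      using d1 d2 by (auto simp: e1_def e2_def)
    moreover have "x = d1 \<or> x = d2 \<or> x \<in> D'" using x by (auto simp: D'_def)
    ultimately show "\<exists>y\<in>D'. cls {ph, al} x = cls {ph, al} y" using eD' by blast
  qed
  have F: "ncl {ph} D = ncl {ph} D' + 1"
  proof -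
    have "{d1, d2} \<subseteq> D" "\<forall>f\<in>{ph}. \<forall>x\<in>{d1, d2}. f x \<in> {d1, d2}" using d1 d2 ph by auto
    from ncl_additive[OF PM(1) this] have "ncl {ph} D = ncl {ph} {d1, d2} + ncl {ph} D'" by (simp add: D'_def)
    moreover have "cls {ph} d1 = cls {ph} d2"
      using cls_eq[OF PM(1), of d1 d2] d1 ph cls_step[OF cls_refl, of ph "{ph}" d1] by auto
    ultimately show ?thesis by (simp add: ncl_def)
  qed
  have cD: "card D = card D' + 2"
  proof -
    have "card {d1, d2} \<le> card D" using d1 d2 finD by (intro card_mono) auto
    thus ?thesis using d1 d2 ph(3) unfolding D'_def by (simp add: card_Diff_subset)
  qed
  have pl: "planar D' al' ph" using pdgD(2)[OF P] V Cc F cD by (simp add: planar_def)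
  show "pdg D' al' ph lb ps"
    unfolding pdg_def
  proof (intro conjI ballI)
    fix x assume x: "x \<in> D'"
    hence xD: "x \<in> D" using D'D by blast
    note Px = pdgD[OF P]
    have lbe: "lb e1 = inv_letter (lb d1)" "lb e2 = inv_letter (lb d2)"
      using Px(3)[of d1] Px(3)[of d2] d1 d2 by (auto simp: e1_def e2_def)
    show "lb (al' x) = inv_letter (lb x)" using Px(3)[OF xD] lbe lb by (auto simp: al'_def)
    have pd1: "ps d1 \<approx> ps e1 @ [lb e1]" and pd2: "ps d2 \<approx> ps e2 @ [lb e2]"
      using Px(7)[of e1] Px(7)[of e2] e by auto
    have b1: "ps e2 \<approx> ps d2 @ [lb d2]" "ps e1 \<approx> ps d1 @ [lb d1]"
      using Px(7)[of d1] Px(7)[of d2] d1 d2 by (auto simp: e1_def e2_def)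
    have b2: "ps d2 \<approx> ps d1 @ [lb d1]" using Px(6)[of d1] d1 ph by auto
    have b3: "ps e1 \<approx> ps d2" using b1(2) b2 eq_sym eq_trans by blast
    have b4: "ps d1 \<approx> ps d2 @ [lb d2]" using Px(6)[of d2] d2 ph by auto
    have b5: "ps e2 \<approx> ps d1" using b1(1) b4 eq_sym eq_trans by blast
    have "ps e2 \<approx> ps e1 @ [lb e1]" "ps e1 \<approx> ps e2 @ [lb e2]"
      using b5 pd1 b3 pd2 eq_trans by blast+
    thus "ps (al' x) \<approx> ps x @ [lb x]" using Px(7)[OF xD] by (auto simp: al'_def)
  qed (use M' pl pdgD[OF P] D'D in auto)
  show "mu D' ph < mu D ph" using F cD mu_pos[OF M'] by (simp add: mu_def)
qed

lemma fold_digon: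
  assumes d: "dg D al ph lb ps lv os" and d1: "d1 \<in> D - set os" and ph: "ph d1 = d2" "ph d2 = d1" "d1 \<noteq> d2"
    and lb: "lb d2 = inv_letter (lb d1)"
  obtains D' al' where "dg D' al' ph lb ps lv os" "mu D' ph < mu D ph"
proof -
  note P = dgD(1)[OF d]
  have d2: "d2 \<in> D - set os" using inner_closed(1)[OF d d1] ph by simp
  have hD: "hd os \<in> D" "hd os \<in> set os" using dgD(2,3)[OF d] by (auto simp: cyc_def)
  have nal: "al d1 \<noteq> d2"
  proof
    assume a: "al d1 = d2"
    have "al d2 = d1" using pmap_al_al[OF dgD(6)[OF d]] a d1 by auto
    hence "cls {ph, al} d1 \<subseteq> {d1, d2}" by (intro cls_least) (use a ph in auto)
    hence "D \<subseteq> {d1, d2}" using dgD(4)[OF d, of d1] d1 by simp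
    thus False using hD d1 d2 by auto
  qed
  have d1D: "d1 \<in> D" using d1 by blast
  let ?D = "D - {d1, d2}" and ?al = "al(al d1 := al d2, al d2 := al d1)"
  note Q = digon_pdg[OF P d1D ph nal lb]
  have o: "set os \<subseteq> ?D" using dgD(3)[OF d] d1 d2 by auto
  have "cls {ph, ?al} (hd os) \<subseteq> ?D" using cls_sub[OF pmap_perms(2)[OF pdgD(1)[OF Q(1)]]] o hD by blast
  hence "\<forall>x\<in>cls {ph, ?al} (hd os) - set os. st (lv x) (lb x) (lv (ph x))" using dgD(5)[OF d] by blast
  from mk_dg[OF Q(1) dgD(2)[OF d] o this] obtain C where "dg C ?al ph lb ps lv os" "mu C ph \<le> mu ?D ph" by metis
  thus ?thesis using that Q(2) by (meson le_less_trans)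
qed

end

lemma delph_inv:
  assumes "g (ph (al d)) = g d" "g (ph d) = g (al d)"
  shows "g (delph al ph d x) = g (ph x)"
  using assms by (auto simp: delph_def Let_def)

context scg
begin

lemma pdg_delete:
  assumes P: "pdg D al ph lb ps" and d: "d \<in> D"
  shows "pdg (D - {d, al d}) al (delph al ph d) lb ps"
    "mu (D - {d, al d}) (delph al ph d) < mu D ph"
proof -
  note M = pdgD(1)[OF P]
  let ?q = "delph al ph d" and ?D = "D - {d, al d}"
  note E = delete_edge[OF M d pdgD(2)[OF P]]
  have e: "al d \<in> D" "al (al d) = d" using pmap_al[OF M d] pmap_al_al[OF M d] by auto
  define g where "g x = {w. ps x \<approx> w}" for x
  have gI: "g x = g y" if "ps x \<approx> ps y" for x y
    using that unfolding g_def by (auto intro: eq_trans eq_sym)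
  have gD: "ps x \<approx> ps y" if "g x = g y" "ps y \<in> words S" for x y
    using that eq_refl[of "ps y"] unfolding g_def by blast
  have ge: "g (ph x) = g (al x)" if x: "x \<in> D" for x
    using pdgD(6,7)[OF P x] by (intro gI) (metis eq_sym eq_trans)
  have 1: "g (ph d) = g (al d)" "g (ph (al d)) = g d" using ge[OF d] ge[OF e(1)] e by auto
  have gq: "g (?q x) = g (ph x)" for x by (rule delph_inv[of g]) (use 1 in auto)
  show "pdg ?D al ?q lb ps"
    unfolding pdg_def
  proof (intro conjI ballI)
    fix x assume "x \<in> ?D"
    hence x: "x \<in> D" by blast
    have "ps (?q x) \<approx> ps (ph x)" using gD[OF gq] pdgD(5)[OF P pmap_ph[OF M x]] by blast
    also have "\<dots> \<approx> ps x @ [lb x]" using pdgD(6)[OF P x] .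
    finally show "ps (?q x) \<approx> ps x @ [lb x]" .
  qed (use E(1,2) pdgD[OF P] in auto)
  show "mu ?D ?q < mu D ph"
    using E(3,4) mu_pos[OF M] mu_pos[OF E(1)] by (simp add: mu_def)
qed

text \<open>The faces on the two sides of the edge agree across it up to the automorphism
  \<open>f\<close>. Once \<open>f\<close> is applied to the lift of one of them, the edge can be
  deleted and they form one face. Where this reduction does not apply, the two sides of an inner
  edge are inequivalent, which is what makes inner runs pieces.\<close>

lemma merge_inner:
  assumes d: "dg D al ph lb ps lv os" and d1: "d \<in> D - set os" and e1: "al d \<in> D - set os"
    and dif: "al d \<notin> cls {ph} d" and f: "f \<in> aut" and fl: "f (lv (ph d)) = lv (al d)"
  obtains D' ph' lv' where "dg D' al ph' lb ps lv' os" "mu D' ph' < mu D ph" "\<forall>y\<in>set os. lv' y = lv y"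
proof -
  note P = dgD(1)[OF d] and M = dgD(6)[OF d]
  have dD: "d \<in> D" using d1 by blast
  let ?q = "delph al ph d" and ?D = "D - {d, al d}"
  note Q = pdg_delete[OF P dD]
  define lv' where "lv' x = (if x \<in> cls {ph} d then f (lv x) else lv x)" for x
  have clph: "ph x \<in> cls {ph} d \<longleftrightarrow> x \<in> cls {ph} d" if x: "x \<in> D" for x
  proof
    assume "ph x \<in> cls {ph} d"
    moreover have "x \<in> cls {ph} (ph x)" using cls_back1[OF pmap_perms(1)[OF M]] x by simp
    ultimately show "x \<in> cls {ph} d" using cls_trans[of "ph x" "{ph}" d] by blast
  next
    assume "x \<in> cls {ph} d"
    from cls_step[OF this, of ph] show "ph x \<in> cls {ph} d" by simp
  qed
  have eD: "al d \<in> D" using e1 by blast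
  have st': "st (lv' x) (lb x) (lv' (ph x))" if x: "x \<in> D - set os" for x
    using dgD(5)[OF d, of x] x aut_st[OF f] clph[of x] by (auto simp: lv'_def)
  have 1: "lv' (ph d) = lv' (al d)" using clph[OF dD] dif fl by (simp add: lv'_def)
  have "st (lv' d) (lb d) (lv' (al d))" using st'[OF d1] 1 by simp
  moreover have "st (lv' (al d)) (inv_letter (lb d)) (lv' (ph (al d)))"
    using st'[OF e1] pdgD(3)[OF P dD] by simp
  ultimately have 2: "lv' (ph (al d)) = lv' d" using st_inv st_det by blast
  have q: "lv' (?q x) = lv' (ph x)" for x by (rule delph_inv[of lv']) (use 1 2 in auto)
  have c: "cyc ?q os" by (rule cyc_delph_other[OF dgD(2)[OF d]]) (use d1 e1 in auto)
  have o: "set os \<subseteq> ?D" using dgD(3)[OF d] d1 e1 by auto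
  have "\<forall>x\<in>cls {?q, al} (hd os) - set os. st (lv' x) (lb x) (lv' (?q x))"
  proof
    fix x assume x: "x \<in> cls {?q, al} (hd os) - set os"
    have "hd os \<in> ?D" using c o hd_in_set[of os] unfolding cyc_def by blast
    hence "x \<in> D - set os" using x cls_sub[OF pmap_perms(2)[OF pdgD(1)[OF Q(1)]]] by blast
    thus "st (lv' x) (lb x) (lv' (?q x))" using st' q by simp
  qed
  from mk_dg[OF Q(1) c o this] obtain C where C: "dg C al ?q lb ps lv' os" "mu C ?q \<le> mu ?D ?q" by metis
  moreover have "\<forall>y\<in>set os. lv' y = lv y" using inner_closed(2)[OF d d1] by (auto simp: lv'_def)
  ultimately show ?thesis using that Q(2) by (meson le_less_trans)
qed

text \<open>The analogue of \<open>merge_inner\<close> at the boundary: the face behind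
  \<open>d\<close> continues the lift of the outer path, so \<open>d\<close> is deleted and the path
  is rerouted along the rest \<open>X\<close> of that face. The first case is that nothing remains
  of the outer path.\<close>

lemma absorb_outer:
  assumes d: "dg D al ph lb ps lv (A @ d # B)" and e1: "al d \<in> D - set (A @ d # B)"
    and f: "f \<in> aut" and fl: "f (lv (ph (al d))) = lv d" and st: "st (lv d) (lb d) z"
  obtains X where "A @ X @ B = [] \<Longrightarrow> z = lv d"
    "A @ X @ B \<noteq> [] \<Longrightarrow> \<exists>D' ph' lv'. dg D' al ph' lb ps lv' (A @ X @ B) \<and> mu D' ph' < mu D ph \<and>
      (\<forall>y\<in>set A \<union> set B. lv' y = lv y) \<and> kp lb lv' X (lv d) z"
proof -
  note P = dgD(1)[OF d] and M = dgD(6)[OF d]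
  let ?os = "A @ d # B"
  have dD: "d \<in> D" using dgD(3)[OF d] by auto
  have eD: "al d \<in> D" using e1 by blast
  obtain X where X: "cyc ph (al d # X)" "set (al d # X) = cls {ph} (al d)"
    using cyc_exists[OF pmap_perms(1)[OF M] eD] by blast
  have inn: "set (al d # X) \<subseteq> D - set ?os" using inner_closed(2)[OF d e1] X(2) by simp
  let ?q = "delph al ph d" and ?D = "D - {d, al d}"
  note Q = pdg_delete[OF P dD]
  define lv' where "lv' x = (if x \<in> set (al d # X) then f (lv x) else lv x)" for x
  have stf: "st (lv' x) (lb x) (lv' (ph x))" if x: "x \<in> set (al d # X)" for x
  proof -
    have "x \<in> D" "x \<notin> set ?os" using x inn by blast+
    hence "st (f (lv x)) (lb x) (f (lv (ph x)))" using dgD(5)[OF d] aut_st[OF f] by blast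
    thus ?thesis using x cyc_set[OF X(1) x] unfolding lv'_def by (simp only: if_True)
  qed
  have "st (lv' (al d)) (inv_letter (lb d)) (lv' (ph (al d)))" using stf[of "al d"] pdgD(3)[OF P dD] by simp
  moreover have "ph (al d) \<in> set (al d # X)" using cyc_set[OF X(1)] by simp
  hence h: "lv' (ph (al d)) = lv d" using fl by (simp only: lv'_def if_True)
  ultimately have z: "z = lv' (al d)" using st st_det st_inv by (metis inv_letter_inv(1))
  have mX: "map ph (al d # X) = X @ [al d]" using X(1) by (simp add: cyc_Cons)
  have kpX: "kp lb lv' X (lv d) z"
  proof (cases X)
    case Nil
    hence "ph (al d) = al d" using mX by simp
    thus ?thesis using Nil h z by simp
  next
    case (Cons x X')
    hence "ph (al d) = x" "map ph X = tl X @ [al d]" using mX by auto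
    thus ?thesis using kp_chain[of X ph "al d" lv' lb] stf Cons h z by auto
  qed
  have c1: "cyc ph (d # B @ A)" using cyc_rot[of ph A "d # B"] dgD(2)[OF d] by simp
  show ?thesis
  proof (rule that[of X])
    assume n: "A @ X @ B = []"
    hence "ph (al d) = al d" using mX by simp
    thus "z = lv d" using h z by simp
  next
    assume n: "A @ X @ B \<noteq> []"
    have "cyc ?q ((B @ A) @ X)" by (rule cyc_delph_diff[where al = al, OF c1 X(1)]) (use n inn in auto)
    hence c: "cyc ?q (A @ X @ B)" using cyc_rot[of ?q B "A @ X"] by simp
    have dis: "distinct (d # B @ A)" "distinct (al d # X)" using c1 X(1) by (auto simp: cyc_def)
    have o: "set (A @ X @ B) \<subseteq> ?D" using dgD(3)[OF d] inn dis by auto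
    have "\<forall>x\<in>cls {?q, al} (hd (A @ X @ B)) - set (A @ X @ B). st (lv' x) (lb x) (lv' (?q x))"
    proof
      fix x assume x: "x \<in> cls {?q, al} (hd (A @ X @ B)) - set (A @ X @ B)"
      have "hd (A @ X @ B) \<in> ?D" using n o hd_in_set by blast
      hence "x \<in> ?D" using x cls_sub[OF pmap_perms(2)[OF pdgD(1)[OF Q(1)]]] by blast
      hence x': "x \<in> D - set ?os" "x \<notin> set (al d # X)" using x by auto
      have px: "ph x \<in> D - set ?os" using inner_closed(1)[OF d x'(1)] .
      have nf: "ph x \<notin> set (al d # X)"
      proof
        assume a: "ph x \<in> set (al d # X)"
        have "x \<in> cls {ph} (ph x)" using cls_back1[OF pmap_perms(1)[OF M]] x'(1) by simp
        thus False using cyc_cls[OF X(1) a] x' by simp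
      qed
      hence "ph x \<noteq> d" "ph x \<noteq> al d" using px by auto
      hence "?q x = ph x" by (simp add: delph_def)
      thus "st (lv' x) (lb x) (lv' (?q x))" using dgD(5)[OF d, of x] x' nf by (simp add: lv'_def)
    qed
    from mk_dg[OF Q(1) c o this] obtain C where C: "dg C al ?q lb ps lv' (A @ X @ B)" "mu C ?q \<le> mu ?D ?q" by metis
    moreover have "\<forall>y\<in>set A \<union> set B. lv' y = lv y" using inn by (auto simp: lv'_def)
    ultimately show "\<exists>D' ph' lv'. dg D' al ph' lb ps lv' (A @ X @ B) \<and> mu D' ph' < mu D ph \<and>
      (\<forall>y\<in>set A \<union> set B. lv' y = lv y) \<and> kp lb lv' X (lv d) z"
      using kpX Q(2) by (meson le_less_trans)
  qed
qed

text \<open>Planarity enters through \<open>delete_edge\<close>: if the two arcs were still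
  connected, all remaining darts would be, whereas the number of components has to grow.\<close>

lemma separate:
  assumes P: "pdg D al ph lb ps" and conn: "\<forall>x\<in>D. cls {ph, al} x = D" and dD: "d \<in> D"
    and c: "cyc ph (d # X @ al d # Y)" and XY: "X \<noteq> []" "Y \<noteq> []"
  shows "set Y \<inter> cls {delph al ph d, al} (hd X) = {}"
proof (rule ccontr)
  assume "set Y \<inter> cls {delph al ph d, al} (hd X) \<noteq> {}"
  then obtain y where y: "y \<in> set Y" "y \<in> cls {delph al ph d, al} (hd X)" by blast
  note M = pdgD(1)[OF P]
  let ?q = "delph al ph d" and ?D = "D - {d, al d}"
  let ?C = "cls {?q, al} (hd X)"
  note E = delete_edge[OF M dD pdgD(2)[OF P]]
  have dis: "distinct (d # X @ al d # Y)" using c by (simp add: cyc_def)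
  have sub: "set (d # X @ al d # Y) \<subseteq> D"
    using cyc_cls[OF c, of d] cls_sub[OF pmap_perms(1)[OF M] dD] by simp
  have eD: "al d \<in> D" "al (al d) = d" using pmap_al[OF M dD] pmap_al_al[OF M dD] by auto
  have m: "map ph (d # X @ al d # Y) = X @ al d # Y @ [d]" using c by (simp add: cyc_Cons)
  have phd: "ph d = hd X" using m XY by (cases X) auto
  have "map ph (d # X) @ map ph (al d # Y) = (X @ [al d]) @ (Y @ [d])" using m by simp
  hence "map ph (al d # Y) = Y @ [d]" by (subst (asm) append_eq_append_conv) auto
  hence phe: "ph (al d) = hd Y" using XY by (cases Y) auto
  have hX: "hd X \<in> set X" "hd X \<in> ?D" and hY: "hd Y \<in> set Y" using XY sub dis by (cases X; cases Y; auto)+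
  have eq: "al d \<in> cls {ph} d" using cyc_cls[OF c, of d] by simp
  have "ph (al d) \<noteq> d" "ph d \<noteq> al d" using phd phe hX hY dis by auto
  from E(5)[OF eq this] have c2: "ncl {ph, al} D + 1 \<le> ncl {?q, al} ?D" .
  have "cyc ph (al d # Y @ d # X)" using cyc_rot[of ph "d # X" "al d # Y"] c by simp
  hence "cyc ph ((al d # Y) @ d # X)" by simp
  have q1: "ph x \<in> {d, al d} \<or> ?q x = ph x" for x by (auto simp: delph_def)
  have cY: "hd Y \<in> ?C"
  proof -
    have "cyc ph (al d # Y @ al (al d) # X)" using \<open>cyc ph (al d # Y @ d # X)\<close> eD by simp
    from cyc_delph_same[where al = al, OF this XY(2)] have 1: "cyc (delph al ph (al d)) Y" .
    have "delph al ph (al d) x = ?q x" if "x \<in> set Y" for x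
    proof -
      have "ph x \<in> set (Y @ [d])" using that \<open>map ph (al d # Y) = Y @ [d]\<close>
        by (metis image_eqI list.set_intros(2) set_map)
      hence "ph x \<noteq> al d" using dis by auto
      thus ?thesis using phd phe eD hX hY dis by (auto simp: delph_def)
    qed
    from cyc_cong[OF 1 this] have cy: "cyc ?q Y" by simp
    have "cls {?q} y \<subseteq> cls {?q, al} y" by (rule cls_mono) simp
    also have "\<dots> \<subseteq> ?C" using cls_trans[OF y(2)] .
    finally show ?thesis using cyc_cls[OF cy y(1)] hY by blast
  qed
  have "cls {ph, al} d \<subseteq> ?C \<union> {d, al d}"
  proof (rule cls_least)
    fix f u assume f: "f \<in> {ph, al}" and u: "u \<in> ?C \<union> {d, al d}"
    have a: "x \<in> ?C \<Longrightarrow> al x \<in> ?C" "x \<in> ?C \<Longrightarrow> ?q x \<in> ?C" for x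
      by (erule cls_step; simp)+
    show "f u \<in> ?C \<union> {d, al d}"
    proof (cases "u \<in> {d, al d}")
      case True
      thus ?thesis using f eD phd phe cY by auto
    next
      case False
      hence "u \<in> ?C" using u by blast
      thus ?thesis using f a[of u] q1[of u] by auto
    qed
  qed simp
  hence "?D \<subseteq> ?C" using conn dD by blast
  hence "cls {?q, al} ` ?D \<subseteq> {?C}"
    using cls_eq[OF pmap_perms(2)[OF E(1)] hX(2)] by blast
  hence "ncl {?q, al} ?D \<le> 1" unfolding ncl_def
    by (metis card.empty card_insert_le_m1 card_mono finite.emptyI finite.insertI card_1_singleton_iff One_nat_def)
  moreover have "ncl {ph, al} D \<ge> 1"
    using dD M by (auto simp: ncl_def pmap_def Suc_le_eq card_gt_0_iff)
  ultimately show False using c2 by simp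
qed

text \<open>Keeps one side of a bridge, with the arc \<open>X\<close> as its new outer face. The
  hypotheses \<open>so\<close> and \<open>so2\<close> cover both uses: the bridge lies on the outer
  face, or it lies on an inner face and the old outer face is on the other side.\<close>

lemma cut_half:
  assumes d: "dg D al ph lb ps lv os" and c: "cyc ph (d # X @ al d # Y)" and X: "X \<noteq> []"
    and so: "set os \<subseteq> set (d # X @ al d # Y) \<or> hd os \<notin> cls {delph al ph d, al} (hd X)"
    and dD: "d \<in> D" and so2: "set (d # X @ al d # Y) \<inter> set os = {} \<or> set (d # X @ al d # Y) = set os"
  obtains D' ph' where "dg D' al ph' lb ps lv X" "mu D' ph' < mu D ph"
proof -
  note P = dgD(1)[OF d] and M = dgD(6)[OF d]
  let ?q = "delph al ph d" and ?D = "D - {d, al d}"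
  let ?C = "cls {?q, al} (hd X)"
  note Q = pdg_delete[OF P dD]
  have dis: "distinct (d # X @ al d # Y)" using c by (simp add: cyc_def)
  have sub: "set (d # X @ al d # Y) \<subseteq> D"
    using cyc_cls[OF c, of d] cls_sub[OF pmap_perms(1)[OF M] dD] by simp
  have cX: "cyc ?q X" using cyc_delph_same[where al = al, OF c X] .
  have o: "set X \<subseteq> ?D" using sub dis by auto
  have sY: "set Y \<inter> ?C = {}"
  proof (cases "Y = []")
    case False
    show ?thesis by (rule separate[OF P _ dD c X False]) (use dgD(4)[OF d] in blast)
  qed simp
  have hX: "hd X \<in> ?D" using X o hd_in_set by blast
  have CD: "?C \<subseteq> ?D" using cls_sub[OF pmap_perms(2)[OF pdgD(1)[OF Q(1)]] hX] .
  have nos: "(?C - set X) \<inter> set os = {}"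
  proof (cases "set os \<subseteq> set (d # X @ al d # Y)")
    case True
    thus ?thesis using CD sY by auto
  next
    case False
    hence h: "hd os \<notin> ?C" and so3: "set (d # X @ al d # Y) \<inter> set os = {}" using so so2 by auto
    have co: "cyc ?q os" by (rule cyc_delph_other[OF dgD(2)[OF d]]) (use so3 in auto)
    have "x \<notin> ?C" if x: "x \<in> set os" for x
    proof
      assume a: "x \<in> ?C"
      have "hd os \<in> cls {?q} x" using cyc_cls[OF co x] co by (simp add: cyc_def)
      hence "hd os \<in> cls {?q, al} x" using cls_mono[of "{?q}" "{?q, al}" x] by blast
      thus False using cls_trans[OF a] h by blast
    qed
    thus ?thesis by blast
  qed
  have "\<forall>x\<in>?C - set X. st (lv x) (lb x) (lv (?q x))"
  proof
    fix x assume x: "x \<in> ?C - set X"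
    hence xi: "x \<in> D - set os" using CD nos by blast
    have nx: "x \<notin> set (d # X @ al d # Y)" using x CD sY by auto
    have "ph x \<notin> set (d # X @ al d # Y)"
    proof
      assume a: "ph x \<in> set (d # X @ al d # Y)"
      have "x \<in> cls {ph} (ph x)" using cls_back1[OF pmap_perms(1)[OF M]] xi by simp
      thus False using cyc_cls[OF c a] nx by simp
    qed
    hence "?q x = ph x" by (simp add: delph_def)
    thus "st (lv x) (lb x) (lv (?q x))" using dgD(5)[OF d] xi by simp
  qed
  from mk_dg[OF Q(1) cX o this] obtain C where C: "dg C al ?q lb ps lv X" "mu C ?q \<le> mu ?D ?q" by metis
  thus ?thesis using that Q(2) by (meson le_less_trans)
qed

lemma cut_outer:
  assumes d: "dg D al ph lb ps lv (A @ d # B @ al d # C)"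
  shows "A @ C \<noteq> [] \<Longrightarrow> \<exists>D' ph'. dg D' al ph' lb ps lv (A @ C) \<and> mu D' ph' < mu D ph"
    and "B \<noteq> [] \<Longrightarrow> \<exists>D' ph'. dg D' al ph' lb ps lv B \<and> mu D' ph' < mu D ph"
proof -
  note M = dgD(6)[OF d]
  let ?os = "A @ d # B @ al d # C"
  have dD: "d \<in> D" "al d \<in> D" using dgD(3)[OF d] by auto
  have aa: "al (al d) = d" using pmap_al_al[OF M dD(1)] .
  have c1: "cyc ph (d # B @ al d # (C @ A))" using cyc_rot[of ph A "d # B @ al d # C"] dgD(2)[OF d] by simp
  have c2: "cyc ph (al d # (C @ A) @ al (al d) # B)"
    using cyc_rot[of ph "d # B" "al d # (C @ A)"] c1 aa by simp
  show "B \<noteq> [] \<Longrightarrow> \<exists>D' ph'. dg D' al ph' lb ps lv B \<and> mu D' ph' < mu D ph"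
  proof -
    assume B: "B \<noteq> []"
    have so: "set (d # B @ al d # (C @ A)) = set ?os" by auto
    show ?thesis
    proof (rule cut_half[OF d c1 B _ dD(1)])
      show "set ?os \<subseteq> set (d # B @ al d # (C @ A)) \<or> hd ?os \<notin> cls {delph al ph d, al} (hd B)"
        "set (d # B @ al d # (C @ A)) \<inter> set ?os = {} \<or> set (d # B @ al d # (C @ A)) = set ?os"
        unfolding so by simp_all
    qed blast
  qed
  assume ne: "A @ C \<noteq> []"
  have se: "set ?os = set (al d # (C @ A) @ al (al d) # B)" using aa by auto
  obtain D' ph' where D': "dg D' al ph' lb ps lv (C @ A)" "mu D' ph' < mu D ph"
  proof (rule cut_half[OF d c2 _ _ dD(2)])
    show "C @ A \<noteq> []" using ne by auto
    show "set ?os \<subseteq> set (al d # (C @ A) @ al (al d) # B) \<or> hd ?os \<notin> cls {delph al ph (al d), al} (hd (C @ A))"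
      "set (al d # (C @ A) @ al (al d) # B) \<inter> set ?os = {} \<or> set (al d # (C @ A) @ al (al d) # B) = set ?os"
      unfolding se by simp_all
  qed blast
  have c: "cyc ph' (A @ C)" using cyc_rot[OF dgD(2)[OF D'(1)]] .
  have "dg D' al ph' lb ps lv (A @ C)" using D'(1) c unfolding dg_def by auto
  thus "\<exists>D' ph'. dg D' al ph' lb ps lv (A @ C) \<and> mu D' ph' < mu D ph" using D'(2) by blast
qed

text \<open>The old outer face lies on one side of the bridge only, so the other side is a diagram
  whose outer face is an arc of what used to be an inner face.\<close>

lemma cut_inner:
  assumes d: "dg D al ph lb ps lv os" and di: "d \<in> D - set os" and c: "cyc ph (d # X @ al d # Y)"
    and XY: "X \<noteq> []" "Y \<noteq> []"
  shows "(\<exists>D' ph'. dg D' al ph' lb ps lv X \<and> mu D' ph' < mu D ph) \<or>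
         (\<exists>D' ph'. dg D' al ph' lb ps lv Y \<and> mu D' ph' < mu D ph)"
proof -
  note M = dgD(6)[OF d] and P = dgD(1)[OF d]
  have dD: "d \<in> D" "al d \<in> D" using di pmap_al[OF M] by auto
  have aa: "al (al d) = d" using pmap_al_al[OF M dD(1)] .
  have c2: "cyc ph (al d # Y @ al (al d) # X)"
    using cyc_rot[of ph "d # X" "al d # Y"] c aa by simp
  have "set (d # X @ al d # Y) = cls {ph} d" using cyc_cls[OF c, of d] by simp
  hence dis: "set (d # X @ al d # Y) \<inter> set os = {}" using inner_closed(2)[OF d di] by blast
  show ?thesis
  proof (cases "hd os \<in> cls {delph al ph d, al} (hd X)")
    case False
    thus ?thesis using cut_half[OF d c XY(1) _ dD(1)] dis by metis
  next
    case True
    have q: "delph al ph (al d) x = delph al ph d x" if x: "x \<in> D - {d, al d}" for x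
    proof -
      have d1: "distinct (d # X @ al d # Y)" using c by (simp add: cyc_def)
      have m: "map ph (d # X @ al d # Y) = X @ al d # Y @ [d]" using c by (simp add: cyc_Cons)
      have "map ph (d # X) @ map ph (al d # Y) = (X @ [al d]) @ (Y @ [d])" using m by simp
      hence m2: "map ph (d # X) = X @ [al d]" "map ph (al d # Y) = Y @ [d]"
        by (subst (asm) append_eq_append_conv, auto)+
      have "ph d = hd X" "ph (al d) = hd Y" using m2 XY by (cases X; cases Y; auto)+
      hence "ph d \<notin> {d, al d}" "ph (al d) \<notin> {d, al d}" using d1 XY by (cases X; cases Y; auto)+
      thus ?thesis using aa by (auto simp: delph_def)
    qed
    have M': "pmap (D - {d, al d}) al (delph al ph d)" using delete_edge(1)[OF M dD(1) dgD(7)[OF d]] .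
    have M2: "pmap (D - {d, al d}) al (delph al ph (al d))"
      using delete_edge(1)[OF M dD(2) dgD(7)[OF d]] aa by (simp add: insert_commute)
    have "set (d # X @ al d # Y) \<subseteq> D"
      using cyc_cls[OF c, of d] cls_sub[OF pmap_perms(1)[OF M] dD(1)] by simp
    moreover have "distinct (d # X @ al d # Y)" using c by (simp add: cyc_def)
    ultimately have hXY: "hd X \<in> D - {d, al d}" "hd Y \<in> D - {d, al d}" "hd Y \<in> set Y"
      using XY by (cases X; cases Y; auto)+
    have "set Y \<inter> cls {delph al ph d, al} (hd X) = {}"
      by (rule separate[OF P _ dD(1) c XY]) (use dgD(4)[OF d] in blast)
    hence "hd Y \<notin> cls {delph al ph d, al} (hd X)" using hXY by blast
    hence "cls {delph al ph d, al} (hd X) \<inter> cls {delph al ph d, al} (hd Y) = {}"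
      using cls_disj[OF pmap_perms(2)[OF M'] hXY(1,2)] by blast
    moreover have "cls {delph al ph (al d), al} (hd Y) = cls {delph al ph d, al} (hd Y)"
      using cls_cong[OF pmap_perms(2)[OF M2] _ hXY(2)] q by blast
    ultimately have "hd os \<notin> cls {delph al ph (al d), al} (hd Y)" using True by blast
    moreover have "set (al d # Y @ al (al d) # X) \<inter> set os = {}" using dis aa by auto
    ultimately show ?thesis using cut_half[OF d c2 XY(2) _ dD(2)] by metis
  qed
qed

end

lemma tmv_commute: "tmv f a b = tmv f b a"
  by (auto simp: tmv_def fun_eq_iff)

context scg
begin

section \<open>Existence of diagrams\<close>

definition hasd :: "('s \<times> bool) list \<Rightarrow> bool" where
  "hasd w \<longleftrightarrow> w = [] \<or> (\<exists>D al ph lb ps lv os. dg D al ph lb ps lv os \<and> map lb os = w)"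

lemma assign_lift:
  assumes "rdd v (map lb C) u" "distinct C"
  obtains g where "kp lb g C v u" "\<forall>x. x \<notin> set C \<longrightarrow> g x = lv x"
  using assms
proof (induction C arbitrary: v thesis)
  case Nil thus ?case by auto
next
  case (Cons x C)
  then obtain z where z: "st v (lb x) z" "rdd z (map lb C) u" by auto
  obtain g where g: "kp lb g C z u" "\<forall>x. x \<notin> set C \<longrightarrow> g x = lv x"
    using Cons.IH[OF _ z(2)] Cons.prems(3) by auto
  let ?g = "g(x := v)"
  have "kp lb ?g C z u \<longleftrightarrow> kp lb g C z u" by (rule kp_cong) (use Cons.prems(3) in auto)
  hence "kp lb ?g C z u" using g(1) by simp
  hence k: "kp lb ?g (x # C) v u" using z(1) by (simp only: kp.simps fun_upd_same) blast
  show ?case by (rule Cons.prems(1)[OF k]) (use g(2) in auto)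
qed

lemma path_ps:
  assumes "\<forall>x\<in>set xs. ps (ph x) \<approx> ps x @ [lb x]" "map ph xs = tl xs @ [z]" "xs \<noteq> []"
  shows "ps z \<approx> ps (hd xs) @ map lb xs"
  using assms
proof (induction xs)
  case (Cons x xs)
  show ?case
  proof (cases xs)
    case Nil thus ?thesis using Cons.prems by simp
  next
    case (Cons y ys)
    hence "ph x = y" "map ph xs = tl xs @ [z]" using Cons.prems by auto
    hence 1: "ps z \<approx> ps y @ map lb xs" using Cons.IH Cons.prems Cons by auto
    have "ps y \<approx> ps x @ [lb x]" using Cons.prems(1) \<open>ph x = y\<close> by auto
    moreover have "map lb xs \<in> words S" using eq_words(2)[OF 1] by simp
    ultimately have "ps y @ map lb xs \<approx> (ps x @ [lb x]) @ map lb xs" using eq_app eq_refl by blast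
    with 1 show ?thesis using eq_trans by auto
  qed
qed simp

lemma cyc_prefix: "cyc ph (A @ y # B) \<Longrightarrow> A \<noteq> [] \<Longrightarrow> map ph A = tl A @ [y]"
proof -
  assume c: "cyc ph (A @ y # B)" and A: "A \<noteq> []"
  have "map ph (A @ y # B) = tl (A @ y # B) @ [hd A]" using c A by (cases A) (auto simp: cyc_def)
  hence "map ph A @ map ph (y # B) = (tl A @ [y]) @ (B @ [hd A])" using A by simp
  thus ?thesis using A by (subst (asm) append_eq_append_conv) auto
qed

lemma dg_pos:
  assumes d: "dg D al ph lb ps lv os" and c: "cyc ph (A @ y # B)" "set (A @ y # B) \<subseteq> D"
  shows "ps y \<approx> ps (hd (A @ y # B)) @ map lb A"
proof (cases "A = []")
  case True
  thus ?thesis using c(2) eq_refl[OF pdgD(5)[OF dgD(1)[OF d]]] by simp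
next
  case False
  have "\<forall>z\<in>set A. ps (ph z) \<approx> ps z @ [lb z]" using pdgD(6)[OF dgD(1)[OF d]] c(2) by auto
  from path_ps[OF this cyc_prefix[OF c(1) False] False] show ?thesis using False by simp
qed

lemma path_st:
  assumes "kp lb g xs v u" "map ph xs = tl xs @ [z]" "g z = u" "xs \<noteq> []"
  shows "\<forall>x\<in>set xs. st (g x) (lb x) (g (ph x))"
  using assms
proof (induction xs arbitrary: v)
  case (Cons x xs)
  show ?case
  proof (cases xs)
    case Nil thus ?thesis using Cons.prems by auto
  next
    case (Cons y ys)
    obtain z' where z': "st (g x) (lb x) z'" "kp lb g xs z' u" using Cons.prems by auto
    have "ph x = y" "map ph xs = tl xs @ [z]" using Cons.prems Cons by auto
    moreover have "z' = g y" using z'(2) Cons by simp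
    ultimately show ?thesis using Cons.IH[OF z'(2)] Cons.prems Cons z'(1) by auto
  qed
qed simp

text \<open>Existence is proved by following the boundary word through the moves that define
  \<open>word_eq\<close>. Here an arc of the outer face whose ends have the same position is closed
  up and becomes an inner face: the word gets shorter while the diagram gains a face.\<close>

lemma hasd_face:
  assumes "hasd (a @ r @ b)" "rdd v r v"
  shows "hasd (a @ b)"
proof (cases "a @ b = [] \<or> r = []")
  case True thus ?thesis using assms by (auto simp: hasd_def)
next
  case False
  then obtain D al ph lb ps lv os where d: "dg D al ph lb ps lv os" and os: "map lb os = a @ r @ b"
    using assms(1) by (auto simp: hasd_def)
  obtain A T where AT: "os = A @ T" "map lb A = a" "map lb T = r @ b"
    using iffD1[OF map_eq_append_conv os] by metis
  obtain C B where "T = C @ B" "map lb C = r" "map lb B = b"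
    using iffD1[OF map_eq_append_conv AT(3)] by metis
  with AT have ABC: "os = A @ C @ B" "map lb A = a" "map lb C = r" "map lb B = b" by simp_all
  note P = dgD(1)[OF d] and M = dgD(6)[OF d]
  have C: "C \<noteq> []" "B @ A \<noteq> []" using False ABC by auto
  have "cyc ph ((C @ B) @ A)" using cyc_rot[of ph A "C @ B"] dgD(2)[OF d] ABC by simp
  hence c: "cyc ph (C @ B @ A)" by simp
  let ?a = "last C" and ?b = "last (B @ A)"
  let ?p = "tmv ph ?a ?b"
  have c1: "cyc ?p C" using cyc_tmv_split[OF c C] .
  have "cyc ?p (B @ A)" using cyc_tmv_split[OF cyc_rot[OF c] C(2,1)] by (simp add: tmv_commute)
  hence c2: "cyc ?p (A @ B)" by (rule cyc_rot)
  have dis: "distinct (C @ B @ A)" using c by (simp add: cyc_def)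
  have inD: "set (C @ B @ A) \<subseteq> D" using dgD(3)[OF d] ABC by auto
  have ab: "?a \<in> set C" "?b \<in> set (B @ A)" using C by (metis last_in_set)+
  hence abD: "?a \<in> D" "?b \<in> D" "?a \<noteq> ?b" using inD dis by auto
  have "?b \<in> cls {ph} ?a" using cyc_cls[OF c, of ?a] ab by auto
  hence pl: "planar D al ?p" using planar_split[OF M abD _ dgD(7)[OF d]] by blast
  have pph: "ps (ph x) \<approx> ps x @ [lb x]" if "x \<in> D" for x using pdgD(6)[OF P that] .
  have phb: "?p ?a = ph ?b" "?p ?b = ph ?a" by (auto simp: tmv_def)
  have hC: "ph ?b = hd C"
  proof -
    have "?p ?a = hd C" using c1 C(1) unfolding cyc_def
      by (metis hd_append2 last_map last_snoc list.sel(1) list.exhaust rotate1.simps(2))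
    thus ?thesis using phb by simp
  qed
  have key: "ps (ph ?a) \<approx> ps (ph ?b)"
  proof -
    have mm: "map ph C = tl C @ [ph ?a]"
    proof -
      have "map ph (C @ B @ A) = tl C @ (B @ A) @ [hd C]" using c C(1) by (cases C) (auto simp: cyc_def)
      hence "map ph C @ map ph (B @ A) = (tl C @ [hd (B @ A)]) @ (tl (B @ A) @ [hd C])"
        using C(2) by (metis append.assoc append_Cons append_Nil list.collapse map_append)
      moreover have "length (map ph C) = length (tl C @ [hd (B @ A)])" using C(1) by (cases C) auto
      ultimately have e: "map ph C = tl C @ [hd (B @ A)]" by (metis append_eq_append_conv)
      hence "ph ?a = hd (B @ A)" by (metis C(1) last_map last_snoc)
      with e show ?thesis by simp
    qed
    have "ps (ph ?a) \<approx> ps (hd C) @ map lb C" by (rule path_ps[OF _ mm C(1)]) (use pph inD in auto)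
    moreover have "r \<approx> []" using closed_trivial[OF assms(2)] .
    hence "ps (hd C) @ r @ [] \<approx> ps (hd C) @ [] @ []"
    proof (rule eq_ctx)
      have "hd C \<in> D" using C(1) inD hd_in_set[of C] by auto
      thus "ps (hd C) \<in> words S" using pdgD(5)[OF P] by blast
    qed simp
    ultimately show ?thesis using hC ABC(3) eq_trans by auto
  qed
  have Q: "pdg D al ?p lb ps"
    unfolding pdg_def
  proof (intro conjI ballI)
    fix x assume x: "x \<in> D"
    show "ps (?p x) \<approx> ps x @ [lb x]"
      using pph[OF x] key eq_sym[OF key] by (auto simp: tmv_def intro: eq_trans)
  qed (use pmap_tmv[OF M abD(1,2)] pl pdgD[OF P] in auto)
  obtain g where g: "kp lb g C v v" "\<forall>x. x \<notin> set C \<longrightarrow> g x = lv x"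
    using assign_lift[of v lb C v lv] assms(2) ABC(3) dis by auto
  have "g (hd C) = v" using g(1) C(1) by (cases C) auto
  hence stC: "\<forall>x\<in>set C. st (g x) (lb x) (g (?p x))"
    using path_st[OF g(1) _ _ C(1), of ?p "hd C"] c1 C(1) by (cases C) (auto simp: cyc_def)
  have o: "set (A @ B) \<subseteq> D" using inD by auto
  have "hd (A @ B) \<in> D" using o C(2) by (metis Nil_is_append_conv hd_in_set subsetD)
  hence CD: "cls {?p, al} (hd (A @ B)) \<subseteq> D" using cls_sub[OF pmap_perms(2)[OF pdgD(1)[OF Q]]] by blast
  have "\<forall>x\<in>cls {?p, al} (hd (A @ B)) - set (A @ B). st (g x) (lb x) (g (?p x))"
  proof
    fix x assume x: "x \<in> cls {?p, al} (hd (A @ B)) - set (A @ B)"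
    show "st (g x) (lb x) (g (?p x))"
    proof (cases "x \<in> set C")
      case False
      hence xi: "x \<in> D - set os" using x CD ABC by auto
      have "ph x \<in> D - set os" using inner_closed(1)[OF d xi] .
      moreover have "?p x = ph x" using xi ab ABC by (auto simp: tmv_def)
      ultimately show ?thesis using False g(2) dgD(5)[OF d] xi ABC by auto
    qed (use stC in blast)
  qed
  from mk_dg[OF Q c2 o this] show ?thesis using ABC unfolding hasd_def by (metis map_append)
qed

text \<open>The arc of two darts is split off as a face with two sides and folded. If the darts are
  already reverses of each other, the split makes them a separate component, which is
  dropped.\<close>

lemma hasd_cancel:
  assumes "hasd (a @ [x, inv_letter x] @ b)"
  shows "hasd (a @ b)"
proof (cases "a @ b = []")
  case True thus ?thesis by (simp add: hasd_def)
next
  case False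
  then obtain D al ph lb ps lv os where d: "dg D al ph lb ps lv os" and os: "map lb os = a @ [x, inv_letter x] @ b"
    using assms(1) by (auto simp: hasd_def)
  obtain A T where AT: "os = A @ T" "map lb A = a" "map lb T = [x, inv_letter x] @ b"
    using iffD1[OF map_eq_append_conv os] by metis
  obtain C B where "T = C @ B" "map lb C = [x, inv_letter x]" "map lb B = b"
    using iffD1[OF map_eq_append_conv AT(3)] by metis
  with AT have ABC: "os = A @ C @ B" "map lb A = a" "map lb C = [x, inv_letter x]" "map lb B = b" by simp_all
  then obtain d1 d2 where C: "C = [d1, d2]" "lb d1 = x" "lb d2 = inv_letter x" by auto
  note P = dgD(1)[OF d] and M = dgD(6)[OF d]
  have ne: "B @ A \<noteq> []" using False ABC by auto
  have "cyc ph ((C @ B) @ A)" using cyc_rot[of ph A "C @ B"] dgD(2)[OF d] ABC by simp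
  hence c: "cyc ph (C @ B @ A)" by simp
  let ?b = "last (B @ A)"
  let ?p = "tmv ph d2 ?b"
  have lc: "last C = d2" "C \<noteq> []" using C by auto
  have c1: "cyc ?p C" using cyc_tmv_split[OF c lc(2) ne] lc by simp
  have "cyc ?p (B @ A)" using cyc_tmv_split[OF cyc_rot[OF c] ne lc(2)] lc by (simp add: tmv_commute)
  hence c2: "cyc ?p (A @ B)" by (rule cyc_rot)
  have dis: "distinct (C @ B @ A)" using c by (simp add: cyc_def)
  have inD: "set (C @ B @ A) \<subseteq> D" using dgD(3)[OF d] ABC by auto
  have b: "?b \<in> set (B @ A)" using ne by (metis last_in_set)
  hence abD: "d1 \<in> D" "d2 \<in> D" "?b \<in> D" "d2 \<noteq> ?b" "d1 \<noteq> d2" "d1 \<noteq> ?b" using inD dis C by auto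
  have "?b \<in> cls {ph} d2" using cyc_cls[OF c, of d2] b C by auto
  hence pl: "planar D al ?p" using planar_split[OF M abD(2-4) _ dgD(7)[OF d]] by blast
  have pd: "?p d1 = d2" "?p d2 = d1" using c1 C by (auto simp: cyc_def)
  have ph1: "ph d1 = d2" "ph ?b = d1" using pd abD by (auto simp: tmv_def split: if_splits)
  have pph: "ps (ph x) \<approx> ps x @ [lb x]" if "x \<in> D" for x using pdgD(6)[OF P that] .
  have "ps (ph d2) \<approx> ps d2 @ [inv_letter x]" using pph[OF abD(2)] C by simp
  also have "ps d2 @ [inv_letter x] \<approx> (ps d1 @ [x]) @ [inv_letter x]"
  proof (rule eq_app)
    show "ps d2 \<approx> ps d1 @ [x]" using pph[OF abD(1)] ph1 C by simp
    show "[inv_letter x] \<approx> [inv_letter x]" using pdgD(4)[OF P abD(2)] C by (intro eq_refl) simp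
  qed
  also have "(ps d1 @ [x]) @ [inv_letter x] \<approx> ps d1"
    using eq_ctx[OF eq_inv_right[of "[x]"], of "ps d1" "[]"] pdgD(4,5)[OF P abD(1)] C by simp
  finally have key: "ps (ph d2) \<approx> ps (ph ?b)" using ph1 by simp
  have Q: "pdg D al ?p lb ps"
    unfolding pdg_def
  proof (intro conjI ballI)
    fix y assume y: "y \<in> D"
    show "ps (?p y) \<approx> ps y @ [lb y]"
      using pph[OF y] key eq_sym[OF key] by (auto simp: tmv_def intro: eq_trans)
  qed (use pmap_tmv[OF M abD(2,3)] pl pdgD[OF P] in auto)
  have stq: "st (lv x) (lb x) (lv (?p x))" if "x \<in> D - set os" for x
  proof -
    have "?p x = ph x" using that b ABC C by (auto simp: tmv_def)
    thus ?thesis using dgD(5)[OF d] that by simp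
  qed
  have h: "hd (A @ B) \<in> set (A @ B)" using ne by (intro hd_in_set) auto
  obtain D2 al2 where Q2: "pdg D2 al2 ?p lb ps" "set (A @ B) \<subseteq> D2" "D2 \<subseteq> D"
    "cls {?p, al2} (hd (A @ B)) \<subseteq> D - {d1, d2}"
  proof (cases "al d1 = d2")
    case True
    have "al d2 = d1" using pmap_al_al[OF M abD(1)] True by simp
    have "cls {?p, al} (hd (A @ B)) \<inter> {d1, d2} = {}"
    proof (rule ccontr)
      assume "cls {?p, al} (hd (A @ B)) \<inter> {d1, d2} \<noteq> {}"
      then obtain z where z: "z \<in> {d1, d2}" "z \<in> cls {?p, al} (hd (A @ B))" by blast
      have "hd (A @ B) \<in> D" using h inD by auto
      hence "hd (A @ B) \<in> cls {?p, al} z" using cls_sym[OF pmap_perms(2)[OF pdgD(1)[OF Q]]] z(2) by blast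
      moreover have "cls {?p, al} z \<subseteq> {d1, d2}"
        by (rule cls_least) (use z(1) pd True \<open>al d2 = d1\<close> in auto)
      ultimately show False using h dis C by auto
    qed
    moreover have "cls {?p, al} (hd (A @ B)) \<subseteq> D"
      using cls_sub[OF pmap_perms(2)[OF pdgD(1)[OF Q]]] h inD by auto
    ultimately have "cls {?p, al} (hd (A @ B)) \<subseteq> D - {d1, d2}" by blast
    thus ?thesis using that[of D al] Q inD by auto
  next
    case False
    have "lb d2 = inv_letter (lb d1)" using C by simp
    note Z = digon_pdg(1)[OF Q abD(1) pd abD(5) False this]
    have o: "set (A @ B) \<subseteq> D - {d1, d2}" using inD dis C by auto
    hence "hd (A @ B) \<in> D - {d1, d2}" using h by blast
    thus ?thesis using that[OF Z o] cls_sub[OF pmap_perms(2)[OF pdgD(1)[OF Z]]] by blast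
  qed
  have "\<forall>y\<in>cls {?p, al2} (hd (A @ B)) - set (A @ B). st (lv y) (lb y) (lv (?p y))"
    using stq Q2(4) ABC(1) C(1) by auto
  from mk_dg[OF Q2(1) c2 Q2(2) this] show ?thesis using ABC unfolding hasd_def by (metis map_append)
qed

text \<open>An edge on two fresh darts is attached at a corner of the outer face. The empty word has
  no diagram with an outer face, hence the separate construction of a single edge.\<close>

lemma hasd_spur:
  assumes "hasd (a @ b)" "fst x \<in> S"
  shows "hasd (a @ [x, inv_letter x] @ b)"
proof (cases "a @ b = []")
  case True
  define al :: "nat \<Rightarrow> nat" where "al = (\<lambda>n. if n = 0 then Suc 0 else 0)"
  define lb where "lb = (\<lambda>n::nat. if n = 0 then x else inv_letter x)"
  define ps where "ps = (\<lambda>n::nat. if n = 0 then [] else [x])"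
  have E: "al 0 = 1" "al 1 = 0" by (auto simp: al_def)
  note Z = single_edge_counts[of 0 "1::nat" al al, simplified E, simplified]
  have c: "cyc al [0, 1]" using E by (simp add: cyc_def)
  have x1: "[x] \<approx> [x]" using assms(2) by (intro eq_refl) simp
  have x2: "[] \<approx> [x, inv_letter x]" using eq_sym[OF eq_inv_right[of "[x]"]] assms(2) by simp
  have "pdg {0, 1} al al lb ps"
    unfolding pdg_def using Z assms(2) x1 x2 E by (auto simp: planar_def lb_def ps_def)
  moreover have "cls {al, al} y = {0, 1}" if "y \<in> {0, 1}" for y
  proof
    show "cls {al, al} y \<subseteq> {0, 1}" by (rule cls_least) (use that E in auto)
    have "al y \<in> cls {al, al} y" by (rule cls_step) auto
    thus "{0, 1} \<subseteq> cls {al, al} y" using that E cls_refl[of y "{al, al}"] by auto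
  qed
  ultimately have "dg {0, 1} al al lb ps (\<lambda>_. undefined) [0, 1]" using c by (auto simp: dg_def)
  moreover have "map lb [0, 1] = a @ [x, inv_letter x] @ b" using True by (simp add: lb_def)
  ultimately show ?thesis unfolding hasd_def by blast
next
  case False
  then obtain D al ph lb ps lv os where d: "dg D al ph lb ps lv os" and os: "map lb os = a @ b"
    using assms(1) by (auto simp: hasd_def)
  obtain A B where AB: "os = A @ B" "map lb A = a" "map lb B = b"
    using iffD1[OF map_eq_append_conv os] by metis
  note P = dgD(1)[OF d] and M = dgD(6)[OF d]
  let ?W = "B @ A"
  have W: "?W \<noteq> []" using False AB by auto
  have c: "cyc ph ?W" using cyc_rot dgD(2)[OF d] AB by blast
  have finD: "finite D" using dgD(8)[OF d] .
  obtain n1 where n1: "n1 \<notin> D" using ex_new_if_finite[OF infinite_UNIV_nat finD] by blast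
  obtain n2 where n2: "n2 \<notin> insert n1 D" using ex_new_if_finite[OF infinite_UNIV_nat, of "insert n1 D"] finD by auto
  have n12: "n1 \<noteq> n2" "n2 \<notin> D" using n2 by auto
  let ?D = "D \<union> {n1, n2}"
  define al1 where "al1 = al(n1 := n2, n2 := n1)"
  define ph0 where "ph0 = ph(n1 := n2, n2 := n1)"
  have on: "al1 x = al x" "ph0 x = ph x" if "x \<in> D" for x using that n1 n12 by (auto simp: al1_def ph0_def)
  have nn: "al1 n1 = n2" "al1 n2 = n1" "ph0 n1 = n2" "ph0 n2 = n1" using n12 by (auto simp: al1_def ph0_def)
  have M0: "pmap D al1 ph0"
    using pmap_cong(1)[OF M, of ph0] on pmap_al[OF M] unfolding pmap_def by auto
  have pl0: "planar D al1 ph0"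
  proof -
    have "planar D al ph0" using pmap_cong(3)[OF M, of ph0] on dgD(7)[OF d] by auto
    moreover have M1: "pmap D al ph0" using pmap_cong(1)[OF M, of ph0] on by auto
    have "ncl {sgm al1 ph0} D = ncl {sgm al ph0} D"
      using ncl_cong[of D "sgm al ph0" "{}" "sgm al1 ph0"] pmap_perms(3)[OF M1] on by (simp add: sgm_def)
    moreover have "ncl {al1, ph0} D = ncl {al, ph0} D"
      using ncl_cong[of D al "{ph0}" al1] pmap_perms(2)[OF M1] on by (simp add: insert_commute)
    ultimately show ?thesis by (simp add: planar_def insert_commute)
  qed
  note S = single_edge_counts[OF n12(1) nn]
  have M1: "pmap ?D al1 ph0"
  proof -
    have "bij_betw ph0 ?D (D \<union> {n1, n2})"
      by (rule bij_betw_combine) (use M0 S(4) n1 n12 in \<open>auto simp: pmap_def\<close>)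
    thus ?thesis using M0 S(4) by (auto simp: pmap_def)
  qed
  have cl: "D \<subseteq> ?D" "\<forall>x\<in>D. ph0 x \<in> D" "\<forall>x\<in>D. al1 x \<in> D"
    using M0 pmap_ph[OF M0] pmap_al[OF M0] by auto
  have DD: "?D - D = {n1, n2}" using n1 n12 by auto
  have pl1: "planar ?D al1 ph0"
    using pmap_closed(3-6)[OF M1 cl] pl0 S unfolding planar_def DD by simp
  let ?l = "last ?W"
  have lW: "?l \<in> set ?W" using W last_in_set by blast
  have WD: "set ?W \<subseteq> D" using dgD(3)[OF d] AB by auto
  have lD: "?l \<in> D" using lW WD by blast
  let ?p = "tmv ph0 ?l n2"
  have "cls {ph0, al1} ?l \<subseteq> D" using cls_sub[OF pmap_perms(2)[OF M0] lD] .
  hence nin: "n2 \<notin> cls {ph0, al1} ?l" using n12 by blast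
  have inD: "?l \<in> ?D" "n2 \<in> ?D" using lD by auto
  have pl: "planar ?D al1 ?p" using planar_join[OF M1 inD nin pl1] .
  have Mp: "pmap ?D al1 ?p" using pmap_tmv[OF M1 inD] .
  have pv: "?p ?l = n1" "?p n1 = n2" "?p n2 = ph ?l" "\<And>y. y \<in> D \<Longrightarrow> y \<noteq> ?l \<Longrightarrow> ?p y = ph y"
    using n1 n12 lD nn on by (auto simp: tmv_def)
  have cW: "cyc ?p (?W @ [n1, n2])"
  proof -
    have m: "map ph ?W = tl ?W @ [hd ?W]" using c W by (cases ?W) (auto simp: cyc_def)
    have sp: "?W = butlast ?W @ [?l]" using W by simp
    have d1: "distinct ?W" using c by (simp add: cyc_def)
    have "map ph (butlast ?W) @ [ph ?l] = tl ?W @ [hd ?W]" using m sp by (metis list.simps(8,9) map_append)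
    hence m1: "map ph (butlast ?W) = tl ?W" "ph ?l = hd ?W" by auto
    have "map ?p (butlast ?W) = map ph (butlast ?W)"
    proof (rule map_cong[OF HOL.refl])
      fix y assume y: "y \<in> set (butlast ?W)"
      hence "y \<noteq> ?l" using d1 sp by (metis (no_types, lifting) distinct.simps(2) distinct_append distinct_butlast in_set_conv_decomp not_distinct_conv_prefix)
      thus "?p y = ph y" using pv(4) y WD by (meson in_set_butlastD subsetD)
    qed
    hence "map ?p (butlast ?W @ [?l] @ [n1, n2]) = tl ?W @ [n1, n2, hd ?W]" using m1 pv by simp
    moreover have "rotate1 (?W @ [n1, n2]) = tl ?W @ [n1, n2, hd ?W]" using W by (cases ?W) auto
    moreover have "butlast ?W @ [?l] @ [n1, n2] = ?W @ [n1, n2]" using sp by (metis append.assoc)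
    ultimately have "map ?p (?W @ [n1, n2]) = rotate1 (?W @ [n1, n2])" by metis
    thus ?thesis using d1 WD n1 n12 unfolding cyc_def by auto
  qed
  have cO: "cyc ?p (A @ [n1, n2] @ B)" using cyc_rot[of ?p B "A @ [n1, n2]"] cW by simp
  define lb' where "lb' = lb(n1 := x, n2 := inv_letter x)"
  define ps' where "ps' = ps(n1 := ps (ph ?l), n2 := ps (ph ?l) @ [x])"
  have on': "lb' y = lb y" "ps' y = ps y" if "y \<in> D" for y using that n1 n12 by (auto simp: lb'_def ps'_def)
  have nn': "lb' n1 = x" "lb' n2 = inv_letter x" "ps' n1 = ps (ph ?l)" "ps' n2 = ps (ph ?l) @ [x]"
    using n12 by (auto simp: lb'_def ps'_def)
  have phl: "ph ?l \<in> D" using pmap_ph[OF M lD] .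
  have psl: "ps (ph ?l) \<in> words S" using pdgD(5)[OF P phl] .
  have r1: "ps (ph ?l) @ [x] \<approx> ps (ph ?l) @ [x]" using psl assms(2) by (intro eq_refl) simp
  have r2: "ps (ph ?l) \<approx> (ps (ph ?l) @ [x]) @ [inv_letter x]"
    using eq_sym[OF eq_ctx[OF eq_inv_right[of "[x]"], of "ps (ph ?l)" "[]"]] psl assms(2) by simp
  have Q: "pdg ?D al1 ?p lb' ps'"
    unfolding pdg_def
  proof (intro conjI ballI)
    fix y assume y: "y \<in> ?D"
    hence yc: "y \<in> D \<or> y = n1 \<or> y = n2" by blast
    then consider "y \<in> D" | "y = n1" | "y = n2" by blast
    thus "lb' (al1 y) = inv_letter (lb' y)" "fst (lb' y) \<in> S" "ps' y \<in> words S"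
      using on on' nn nn' pmap_al[OF M] pdgD(3-5)[OF P] psl assms(2) by (cases; auto)+
    from yc show "ps' (al1 y) \<approx> ps' y @ [lb' y]"
      using on on' nn nn' pmap_al[OF M] pdgD(7)[OF P] r1 r2 by (elim disjE) simp_all
    from yc show "ps' (?p y) \<approx> ps' y @ [lb' y]"
    proof (elim disjE)
      assume yD: "y \<in> D"
      show ?thesis
      proof (cases "y = ?l")
        case True
        thus ?thesis using pv(1) nn'(3) on'[OF yD] pdgD(6)[OF P yD] by simp
      next
        case False
        thus ?thesis using pv(4)[OF yD False] on'[OF yD] on'[OF pmap_ph[OF M yD]] pdgD(6)[OF P yD] by simp
      qed
    next
      assume "y = n1"
      thus ?thesis using pv(2) nn' r1 by simp
    next
      assume "y = n2"
      thus ?thesis using pv(3) nn' r2 on'[OF phl] by simp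
    qed
  qed (use Mp pl in auto)
  let ?os = "A @ [n1, n2] @ B"
  have o: "set ?os \<subseteq> ?D" using WD by auto
  have "\<forall>y\<in>cls {?p, al1} (hd ?os) - set ?os. st (lv y) (lb' y) (lv (?p y))"
  proof
    fix y assume y: "y \<in> cls {?p, al1} (hd ?os) - set ?os"
    have "hd ?os \<in> ?D" using o hd_in_set[of ?os] by blast
    hence "y \<in> ?D" using y cls_sub[OF pmap_perms(2)[OF Mp]] by blast
    hence yD: "y \<in> D - set os" using y AB(1) by auto
    hence "y \<noteq> ?l" using lW AB(1) by auto
    thus "st (lv y) (lb' y) (lv (?p y))" using dgD(5)[OF d] yD pv(4) on' by auto
  qed
  from mk_dg[OF Q cO o this] obtain C where "dg C al1 ?p lb' ps' lv ?os" by metis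
  moreover have "map lb' ?os = a @ [x, inv_letter x] @ b"
  proof -
    have "map lb' A = map lb A" "map lb' B = map lb B" using WD on' by (auto intro!: map_cong)
    thus ?thesis using AB nn' by simp
  qed
  ultimately show ?thesis unfolding hasd_def by blast
qed

lemma hasd_inv_pair: "hasd (a @ b) \<Longrightarrow> w \<in> words S \<Longrightarrow> hasd (a @ w @ inv_word w @ b)"
proof (induction w arbitrary: a b)
  case (Cons x w)
  have "hasd ((a @ [x]) @ ([inv_letter x] @ b))" using hasd_spur[OF Cons.prems(1)] Cons.prems(2) by simp
  from Cons.IH[OF this] show ?case using Cons.prems(2) by (simp add: inv_word_cons)
qed simp

text \<open>Inserting a relator \<open>r\<close> is reduced to the other moves:
  \<open>r @ inv_word r\<close> is inserted as spurs, and its second half is closed up as a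
  face.\<close>

lemma hasd_iff:
  assumes "(u, v) \<in> word_eq S R" "a \<in> words S" "b \<in> words S"
  shows "hasd (a @ u @ b) \<longleftrightarrow> hasd (a @ v @ b)"
  using assms
proof (induction arbitrary: a b rule: word_eq.induct)
  case (cancel u v x)
  thus ?case using hasd_cancel[of "a @ u" x "v @ b"] hasd_spur[of "a @ u" "v @ b" x] by auto
next
  case (relator u v r)
  obtain z where z: "rdd z r z" using rel_rd[OF relator(3)] by blast
  have "hasd ((a @ u) @ v @ b)" if h: "hasd ((a @ u) @ r @ (v @ b))"
    using hasd_face[OF h z] by simp
  moreover have "hasd ((a @ u) @ r @ (v @ b))" if h: "hasd ((a @ u) @ v @ b)"
  proof -
    have "hasd ((a @ u) @ r @ inv_word r @ (v @ b))" using hasd_inv_pair[of "a @ u" "v @ b" r] h relator(4) by simp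
    hence "hasd (((a @ u) @ r) @ inv_word r @ (v @ b))" by simp
    from hasd_face[OF this rd_inv[OF z]] show ?thesis by simp
  qed
  ultimately show ?case by auto
qed auto

theorem diagram_exists:
  assumes "w \<approx> []" "w \<noteq> []"
  obtains D al ph lb ps lv os where "dg D al ph lb ps lv os" "map lb os = w"
proof -
  have "hasd ([] @ w @ []) \<longleftrightarrow> hasd ([] @ [] @ [])" using hasd_iff[of w "[]" "[]" "[]"] assms by (simp add: eqw_def)
  moreover have "hasd []" by (simp add: hasd_def)
  ultimately have "hasd w" by simp
  hence "\<exists>D al ph lb ps lv os. dg D al ph lb ps lv os \<and> map lb os = w"
    using assms(2) unfolding hasd_def by blast
  thus ?thesis using that by blast
qed

end

subsection \<open>Curvature\<close>

lemma sum_cls: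
  fixes h :: "'a \<Rightarrow> real"
  assumes P: "perms D Fs"
  shows "sum h D = (\<Sum>X\<in>cls Fs ` D. sum h X)"
proof -
  have fin: "finite D" using P by (simp add: perms_def)
  have "sum h D = (\<Sum>X\<in>cls Fs ` D. sum h {x \<in> D. cls Fs x = X})" using sum.image_gen[OF fin, of h "cls Fs"] by simp
  also have "\<dots> = (\<Sum>X\<in>cls Fs ` D. sum h X)"
  proof (rule sum.cong[OF HOL.refl])
    fix X assume "X \<in> cls Fs ` D"
    then obtain y where y: "y \<in> D" "X = cls Fs y" by blast
    have "{x \<in> D. cls Fs x = X} = X"
    proof
      show "{x \<in> D. cls Fs x = X} \<subseteq> X" by auto
      show "X \<subseteq> {x \<in> D. cls Fs x = X}"
      proof
        fix x assume "x \<in> X"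
        hence x: "x \<in> cls Fs y" using y by simp
        hence "x \<in> D" using cls_sub[OF P y(1)] by blast
        thus "x \<in> {x \<in> D. cls Fs x = X}" using cls_eq[OF P y(1) x] y(2) by simp
      qed
    qed
    thus "sum h {x \<in> D. cls Fs x = X} = sum h X" by simp
  qed
  finally show ?thesis .
qed

definition dgr :: "('a \<Rightarrow> 'a) \<Rightarrow> ('a \<Rightarrow> 'a) \<Rightarrow> 'a \<Rightarrow> nat" where
  "dgr al ph x = card (cls {sgm al ph} x)"

text \<open>The curvature of a vertex is distributed evenly among its inner corners.\<close>

definition wgt :: "('a \<Rightarrow> 'a) \<Rightarrow> ('a \<Rightarrow> 'a) \<Rightarrow> 'a set \<Rightarrow> 'a \<Rightarrow> real" where
  "wgt al ph I x = (real (dgr al ph x) - 2) / (2 * real (card (cls {sgm al ph} x \<inter> I)))"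

text \<open>The Gauss-Bonnet formula. A vertex of degree \<open>k\<close> carries
  \<open>(k - 2) / 2\<close>, and these numbers sum to \<open>E - V\<close>. A vertex with inner
  corners passes its share on to the faces; of the others only those of degree one count negatively,
  and these are the ends of spurs.\<close>

lemma curvature:
  assumes M: "pmap D al ph" and pl: "planar D al ph" and conn: "\<forall>x\<in>D. cls {ph, al} x = D"
    and c: "cyc ph os" and o: "set os \<subseteq> D" and I: "I = D - set os"
    and deg: "\<forall>x\<in>I. ph (al x) \<noteq> x"
  shows "(\<Sum>f\<in>cls {ph} ` I. 1 - (\<Sum>x\<in>f. wgt al ph I x)) \<ge> 1 - real (card {x \<in> set os. ph (al x) = x}) / 2"
proof -
  note P = pmap_perms[OF M]
  have fin: "finite D" using M by (simp add: pmap_def)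
  have h: "hd os \<in> set os" "hd os \<in> D" using c o by (auto simp: cyc_def)
  have "cls {ph, al} ` D = {D}" using conn h by blast
  hence nc: "ncl {ph, al} D = 1" by (simp add: ncl_def)
  have clo: "\<forall>f\<in>{ph}. \<forall>x\<in>set os. f x \<in> set os" using cyc_set[OF c] by blast
  have "cls {ph} ` set os = {set os}" using cyc_cls[OF c] h by auto
  hence "ncl {ph} (set os) = 1" by (simp add: ncl_def)
  hence F: "ncl {ph} D = 1 + card (cls {ph} ` I)"
    using ncl_additive[OF P(1) o clo] I by (simp add: ncl_def)
  note PI = perms_closed_compl(2)[OF P(1) o clo, folded I]
  let ?d = "\<lambda>x. real (dgr al ph x)"
  let ?s = "cls {sgm al ph}"
  have finX: "finite X" "X \<subseteq> D" "X \<noteq> {}" "\<And>x. x \<in> X \<Longrightarrow> ?s x = X" if XD: "X \<in> ?s ` D" for X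
  proof -
    obtain y where y: "y \<in> D" "X = ?s y" using XD by blast
    show "X \<subseteq> D" using y cls_sub[OF P(3) y(1)] by simp
    thus "finite X" using fin finite_subset by blast
    have "y \<in> X" using y(2) by simp
    thus "X \<noteq> {}" by blast
    show "\<And>x. x \<in> X \<Longrightarrow> ?s x = X" using y(2) cls_eq[OF P(3) y(1)] by blast
  qed
  have V: "(\<Sum>x\<in>D. 1 / ?d x) = real (ncl {sgm al ph} D)"
  proof -
    have "(\<Sum>x\<in>X. 1 / ?d x) = 1" if X: "X \<in> ?s ` D" for X
    proof -
      have "(\<Sum>x\<in>X. 1 / ?d x) = (\<Sum>x\<in>X. 1 / real (card X))"
        using finX(4)[OF X] by (intro sum.cong) (auto simp: dgr_def)
      also have "\<dots> = 1" using finX(1,3)[OF X] by (simp add: card_gt_0_iff)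
      finally show ?thesis .
    qed
    thus ?thesis using sum_cls[OF P(3), of "\<lambda>x. 1 / ?d x"] by (simp add: ncl_def)
  qed
  let ?t = "\<lambda>x. if x \<in> set os \<and> ph (al x) = x then 1 / 2 else (0::real)"
  let ?w = "\<lambda>x. if x \<in> I then wgt al ph I x else 0"
  have cell: "(\<Sum>x\<in>X. 1 / 2 - 1 / ?d x) \<ge> (\<Sum>x\<in>X. ?w x - ?t x)" if X: "X \<in> ?s ` D" for X
  proof -
    let ?c = "real (card X)"
    have c0: "?c > 0" using finX(1,3)[OF X] by (simp add: card_gt_0_iff)
    have "(\<Sum>x\<in>X. 1 / 2 - 1 / ?d x) = (\<Sum>x\<in>X. 1 / 2 - 1 / ?c)"
      using finX(4)[OF X] by (intro sum.cong) (auto simp: dgr_def)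
    also have "\<dots> = (?c - 2) / 2" using c0 by (simp add: field_simps)
    finally have L: "(\<Sum>x\<in>X. 1 / 2 - 1 / ?d x) = (?c - 2) / 2" .
    have "(\<Sum>x\<in>X. ?w x) = (\<Sum>x\<in>X \<inter> I. wgt al ph I x)"
      using finX(1)[OF X] by (simp add: sum.inter_restrict)
    also have "\<dots> = (\<Sum>x\<in>X \<inter> I. (?c - 2) / (2 * real (card (X \<inter> I))))"
      using finX(4)[OF X] by (intro sum.cong) (auto simp: dgr_def wgt_def)
    also have "\<dots> = (if X \<inter> I = {} then 0 else (?c - 2) / 2)"
      using finX(1)[OF X] by (auto simp: field_simps)
    finally have W: "(\<Sum>x\<in>X. ?w x) = (if X \<inter> I = {} then 0 else (?c - 2) / 2)" .
    have T: "(\<Sum>x\<in>X. ?t x) \<ge> 0" by (intro sum_nonneg) auto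
    have T1: "(\<Sum>x\<in>X. ?t x) \<ge> 1 / 2" if Xe: "X \<inter> I = {}" and X1: "card X = 1"
    proof -
      obtain x where x: "X = {x}" using X1 card_1_singletonE by blast
      have "sgm al ph x \<in> ?s x" by (rule cls_step) auto
      hence "ph (al x) = x" using finX(4)[OF X] x by (auto simp: sgm_def)
      moreover have "x \<in> set os" using x Xe finX(2)[OF X] I by auto
      ultimately show ?thesis using x by simp
    qed
    have "(?c - 2) / 2 \<ge> - (\<Sum>x\<in>X. ?t x)" if Xe: "X \<inter> I = {}"
    proof (cases "card X = 1")
      case False
      hence "card X \<ge> 2" using c0 by linarith
      thus ?thesis using T by simp
    qed (use T1[OF Xe] in simp)
    hence "(?c - 2) / 2 \<ge> (\<Sum>x\<in>X. ?w x) - (\<Sum>x\<in>X. ?t x)"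
      using W T by (cases "X \<inter> I = {}") auto
    thus ?thesis unfolding L by (simp add: sum_subtractf)
  qed
  have "(\<Sum>x\<in>D. 1 / 2 - 1 / ?d x) \<ge> (\<Sum>x\<in>D. ?w x - ?t x)"
    using sum_mono[of "?s ` D", OF cell] sum_cls[OF P(3)] by simp
  moreover have "(\<Sum>x\<in>D. ?w x) = (\<Sum>x\<in>I. wgt al ph I x)"
  proof -
    have "D \<inter> I = I" using I by auto
    thus ?thesis using sum.inter_restrict[OF fin, of "wgt al ph I" I] by simp
  qed
  moreover have "(\<Sum>x\<in>D. ?t x) = real (card {x \<in> set os. ph (al x) = x}) / 2"
  proof -
    have "(\<Sum>x\<in>D. ?t x) = (\<Sum>x\<in>D \<inter> {x. x \<in> set os \<and> ph (al x) = x}. 1 / 2)"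
      using sum.inter_restrict[OF fin, of "\<lambda>_. 1 / 2 :: real" "{x. x \<in> set os \<and> ph (al x) = x}"] by simp
    moreover have "D \<inter> {x. x \<in> set os \<and> ph (al x) = x} = {x \<in> set os. ph (al x) = x}" using o by auto
    ultimately show ?thesis by simp
  qed
  moreover have "(\<Sum>x\<in>D. 1 / 2 - 1 / ?d x) = real (card D) / 2 - real (ncl {sgm al ph} D)"
    using V by (simp add: sum_subtractf)
  moreover have "real (card D) + 4 \<le> 2 * (real (ncl {sgm al ph} D) + (1 + real (card (cls {ph} ` I))))"
  proof -
    have "card D + 4 \<le> 2 * (ncl {sgm al ph} D + (1 + card (cls {ph} ` I)))"
      using pl nc F unfolding planar_def by simp
    hence "real (card D + 4) \<le> real (2 * (ncl {sgm al ph} D + (1 + card (cls {ph} ` I))))"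
      by (simp only: of_nat_le_iff)
    thus ?thesis by simp
  qed
  moreover have "(\<Sum>f\<in>cls {ph} ` I. 1 - (\<Sum>x\<in>f. wgt al ph I x)) = real (card (cls {ph} ` I)) - (\<Sum>x\<in>I. wgt al ph I x)"
    using sum_cls[OF PI, of "wgt al ph I"] by (simp add: sum_subtractf)
  ultimately show ?thesis by (simp add: sum_subtractf)
qed

text \<open>At degree \<open>d\<close> with \<open>m\<close> inner corners the weight is
  \<open>(d - 2) / (2 * m)\<close>, and every outer corner lowers \<open>m\<close>. For
  \<open>d \<ge> 3\<close> the minima are 1/6, 1/4 and 1/2 if none, one or both sides of the corner
  are on the outer face; the formula interpolates these values.\<close>

lemma corner_weight:
  assumes M: "pmap D al ph" and O: "\<forall>x\<in>Od. ph x \<in> Od" "Od \<subseteq> D" and I: "I = D - Od"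
    and p: "p \<in> I" "ph p \<in> I" and deg: "ph (al (ph p)) \<noteq> ph p"
  shows "dgr al ph (ph p) \<noteq> 2 \<Longrightarrow> wgt al ph I (ph p) \<ge> 1 / 6 + (of_bool (al (ph p) \<in> Od) + of_bool (al p \<in> Od)) / 12
      + of_bool (al (ph p) \<in> Od \<and> al p \<in> Od) / 6"
    and "dgr al ph (ph p) = 2 \<Longrightarrow> wgt al ph I (ph p) = 0"
    and "dgr al ph (ph p) = 2 \<Longrightarrow> ph (al (ph p)) = al p"
proof -
  note P = pmap_perms[OF M]
  have fin: "finite D" using M by (simp add: pmap_def)
  have pD: "p \<in> D" "ph p \<in> D" using p I by auto
  let ?x = "ph p" and ?X = "cls {sgm al ph} (ph p)"
  have XD: "?X \<subseteq> D" using cls_sub[OF P(3) pD(2)] .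
  have finX: "finite ?X" using XD fin finite_subset by blast
  have aa: "sgm al ph (al p) = ?x" using pmap_al_al[OF M pD(1)] by (simp add: sgm_def)
  have a1: "al p \<in> ?X" using cls_back1[OF P(3), of "sgm al ph" "al p"] aa pmap_al[OF M pD(1)] by simp
  have a2: "ph (al ?x) \<in> ?X" using cls_step[OF cls_refl, of "sgm al ph" "{sgm al ph}" ?x] by (simp add: sgm_def)
  have x: "?x \<in> ?X" by simp
  have n1: "al p \<noteq> ?x"
  proof
    assume "al p = ?x"
    hence "ph (al ?x) = ?x" using pmap_al_al[OF M pD(1)] by simp
    thus False using deg by simp
  qed
  have c2: "card ?X \<ge> 2"
  proof -
    have "card {?x, al p} \<le> card ?X" using a1 x finX by (intro card_mono) auto
    thus ?thesis using n1 by simp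
  qed
  show "dgr al ph ?x = 2 \<Longrightarrow> wgt al ph I ?x = 0" by (simp add: wgt_def)
  show 2: "ph (al ?x) = al p" if "dgr al ph ?x = 2"
  proof -
    have "card ?X = 2" using that by (simp add: dgr_def)
    hence "{?x, al p} = ?X" using a1 n1 finX by (intro card_subset_eq) auto
    thus ?thesis using a2 deg by auto
  qed
  assume d3: "dgr al ph ?x \<noteq> 2"
  define d where "d = card ?X"
  define m where "m = card (?X \<inter> I)"
  have d: "d \<ge> 3" using d3 c2 by (simp add: d_def dgr_def)
  have "ph p \<in> ?X \<inter> I" using p(2) by simp
  hence "?X \<inter> I \<noteq> {}" by blast
  hence m1: "m \<ge> 1" using finX by (simp add: m_def Suc_le_eq card_gt_0_iff)
  have out: "m + card (?X \<inter> Od) \<le> d"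
  proof -
    have "card (?X \<inter> I) + card (?X \<inter> Od) = card ((?X \<inter> I) \<union> (?X \<inter> Od))"
      using finX I by (intro card_Un_disjoint[symmetric]) auto
    also have "\<dots> \<le> card ?X" using finX by (intro card_mono) auto
    finally show ?thesis by (simp add: m_def d_def)
  qed
  have b1: "al p \<in> Od \<Longrightarrow> card (?X \<inter> Od) \<ge> 1" using a1 finX by (auto simp: Suc_le_eq card_gt_0_iff)
  have b2: "al ?x \<in> Od \<Longrightarrow> card (?X \<inter> Od) \<ge> 1" using a2 finX O(1) by (auto simp: Suc_le_eq card_gt_0_iff)
  have b3: "card (?X \<inter> Od) \<ge> 2" if ap: "al p \<in> Od" and ax: "al ?x \<in> Od"
  proof -
    have "ph (al ?x) \<noteq> al p"
    proof
      assume e: "ph (al ?x) = al p"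
      have "?X \<subseteq> {?x, al p}"
        by (rule cls_least) (use e aa in \<open>auto simp: sgm_def\<close>)
      hence "card ?X \<le> card {?x, al p}" by (intro card_mono) auto
      hence "card ?X \<le> 2" using n1 by simp
      thus False using d d_def by simp
    qed
    hence "card {ph (al ?x), al p} = 2" by simp
    moreover have "card {ph (al ?x), al p} \<le> card (?X \<inter> Od)"
      using a1 a2 O(1) ap ax finX by (intro card_mono) auto
    ultimately show ?thesis by simp
  qed
  have w: "wgt al ph I ?x = (real d - 2) / (2 * real m)" by (simp add: wgt_def dgr_def d_def m_def)
  have key: "(real d - 2) / (2 * real m) \<ge> (real d - 2) / (2 * real (d - k))" if "m + k \<le> d" for k
    using that m1 d by (intro divide_left_mono) auto
  have k0: "(real d - 2) / (2 * real (d - 0)) \<ge> 1 / 6" using d by (simp add: field_simps)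
  have k1: "(real d - 2) / (2 * real (d - 1)) \<ge> 1 / 4" using d by (simp add: field_simps of_nat_diff)
  have k2: "(real d - 2) / (2 * real (d - 2)) = 1 / 2" using d by (simp add: field_simps of_nat_diff)
  show "wgt al ph I ?x \<ge> 1 / 6 + (of_bool (al ?x \<in> Od) + of_bool (al p \<in> Od)) / 12
      + of_bool (al ?x \<in> Od \<and> al p \<in> Od) / 6"
  proof (cases "al ?x \<in> Od")
    case True
    show ?thesis
    proof (cases "al p \<in> Od")
      case T2: True
      hence "m + 2 \<le> d" using b3 True out by linarith
      hence "wgt al ph I ?x \<ge> 1 / 2" using key k2 w by metis
      thus ?thesis using True T2 by simp
    next
      case False
      hence "m + 1 \<le> d" using b2 True out by linarith
      hence "wgt al ph I ?x \<ge> 1 / 4" using key k1 w order_trans by metis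
      thus ?thesis using True False by simp
    qed
  next
    case F: False
    show ?thesis
    proof (cases "al p \<in> Od")
      case T2: True
      hence "m + 1 \<le> d" using b1 out by linarith
      hence "wgt al ph I ?x \<ge> 1 / 4" using key k1 w order_trans by metis
      thus ?thesis using F T2 by simp
    next
      case False
      have "m + 0 \<le> d" using out by linarith
      hence "wgt al ph I ?x \<ge> 1 / 6" using key k0 w order_trans by metis
      thus ?thesis using F False by simp
    qed
  qed
qed

text \<open>\<open>Ne\<close> and \<open>Ni\<close> count the arcs between branch vertices with the
  outer face and with an inner face behind them, each arc at its first dart. An outer arc adds 1/12
  at each end to the 1/6 of every corner. For the second bound, an outer arc ends where an inner arc
  begins or at a corner with both sides outer, and such a corner gains another 1/6.\<close>

lemma face_weight:
  assumes M: "pmap D al ph" and O: "\<forall>x\<in>Od. ph x \<in> Od" "Od \<subseteq> D" and I: "I = D - Od"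
    and deg: "\<forall>x\<in>I. ph (al x) \<noteq> x" and f: "f = cls {ph} x0" "x0 \<in> I"
  defines "Ne \<equiv> card {x \<in> f. dgr al ph x \<noteq> 2 \<and> al x \<in> Od}"
    and "Ni \<equiv> card {x \<in> f. dgr al ph x \<noteq> 2 \<and> al x \<notin> Od}"
  shows "(\<Sum>x\<in>f. wgt al ph I x) \<ge> real Ne / 3 + real Ni / 6"
    and "(\<Sum>x\<in>f. wgt al ph I x) \<ge> real Ne / 2"
    and "card {p \<in> f. dgr al ph (ph p) \<noteq> 2 \<and> al p \<in> Od} = Ne"
proof -
  note P = pmap_perms[OF M]
  have clo: "\<forall>f\<in>{ph}. \<forall>x\<in>Od. f x \<in> Od" using O by blast
  note PI = perms_closed_compl(2)[OF P(1) O(2) clo, folded I]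
  have fI: "f \<subseteq> I" using cls_sub[OF PI f(2)] f(1) by simp
  have finI: "finite I" using PI by (simp add: perms_def)
  hence fin: "finite f" using fI finite_subset by blast
  have clf: "\<forall>h\<in>{ph}. \<forall>x\<in>f. h x \<in> f" using f by (auto intro: cls_step)
  hence bij: "bij_betw ph f f" using perms_closed_compl(1)[OF PI fI clf] by (simp add: perms_def)
  define e :: "'a \<Rightarrow> real" where "e x = of_bool (al x \<in> Od)" for x
  define b :: "'a \<Rightarrow> real" where "b x = of_bool (dgr al ph x \<noteq> 2)" for x
  have nb: "e (ph p) = e p" if "p \<in> f" "dgr al ph (ph p) = 2" for p
  proof -
    have pI: "p \<in> I" "ph p \<in> I" using that clf fI by auto
    have "ph (al (ph p)) = al p"
      using corner_weight(3)[OF M O I pI _ that(2)] deg pI by blast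
    moreover have "al (ph p) \<in> Od \<longleftrightarrow> ph (al (ph p)) \<in> Od"
    proof
      assume a: "ph (al (ph p)) \<in> Od"
      have "al (ph p) \<in> D" using pI I pmap_al[OF M] by auto
      moreover have "bij_betw ph Od Od" using perms_closed_compl(1)[OF P(1) O(2) clo] by (simp add: perms_def)
      then obtain z where "z \<in> Od" "ph z = ph (al (ph p))" using a by (metis bij_betw_imp_surj_on imageE)
      ultimately show "al (ph p) \<in> Od" using pmap_inj[OF M] O(2) by blast
    qed (use O in blast)
    ultimately show ?thesis by (simp add: e_def)
  qed
  have wt: "wgt al ph I (ph p) \<ge> b (ph p) * (1 / 6 + (e (ph p) + e p) / 12 + e (ph p) * e p / 6)" if "p \<in> f" for p
  proof -
    have pI: "p \<in> I" "ph p \<in> I" using that clf fI by auto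
    note C = corner_weight[OF M O I pI deg[rule_format, OF pI(2)]]
    show ?thesis using C(1,2) by (cases "dgr al ph (ph p) = 2") (auto simp: b_def e_def)
  qed
  have S: "(\<Sum>x\<in>f. wgt al ph I x) = (\<Sum>p\<in>f. wgt al ph I (ph p))"
    using sum.reindex_bij_betw[OF bij, of "wgt al ph I"] by simp
  have be: "(\<Sum>p\<in>f. b (ph p) * e (ph p)) = real Ne"
  proof -
    have "(\<Sum>p\<in>f. b (ph p) * e (ph p)) = (\<Sum>x\<in>f. b x * e x)"
      using sum.reindex_bij_betw[OF bij, of "\<lambda>x. b x * e x"] by simp
    also have "\<dots> = (\<Sum>x\<in>f. of_bool (dgr al ph x \<noteq> 2 \<and> al x \<in> Od))" by (intro sum.cong) (auto simp: b_def e_def)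
    finally show ?thesis using fin by (simp add: Ne_def Int_def)
  qed
  have bi: "(\<Sum>p\<in>f. b (ph p) * (1 - e (ph p))) = real Ni"
  proof -
    have "(\<Sum>p\<in>f. b (ph p) * (1 - e (ph p))) = (\<Sum>x\<in>f. b x * (1 - e x))"
      using sum.reindex_bij_betw[OF bij, of "\<lambda>x. b x * (1 - e x)"] by simp
    also have "\<dots> = (\<Sum>x\<in>f. of_bool (dgr al ph x \<noteq> 2 \<and> al x \<notin> Od))" by (intro sum.cong) (auto simp: b_def e_def)
    finally show ?thesis using fin by (simp add: Ni_def Int_def)
  qed
  have bp: "(\<Sum>p\<in>f. b (ph p) * e p) = real Ne"
  proof -
    have "(\<Sum>p\<in>f. e (ph p)) = (\<Sum>p\<in>f. e p)" using sum.reindex_bij_betw[OF bij, of e] by simp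
    moreover have "(\<Sum>p\<in>f. (1 - b (ph p)) * e (ph p)) = (\<Sum>p\<in>f. (1 - b (ph p)) * e p)"
      by (intro sum.cong) (auto simp: b_def nb)
    ultimately have "(\<Sum>p\<in>f. e (ph p)) - (\<Sum>p\<in>f. (1 - b (ph p)) * e (ph p)) = (\<Sum>p\<in>f. e p) - (\<Sum>p\<in>f. (1 - b (ph p)) * e p)"
      by simp
    hence "(\<Sum>p\<in>f. b (ph p) * e (ph p)) = (\<Sum>p\<in>f. b (ph p) * e p)"
      by (simp only: sum_subtractf[symmetric]) (simp add: algebra_simps)
    thus ?thesis using be by simp
  qed
  show "card {p \<in> f. dgr al ph (ph p) \<noteq> 2 \<and> al p \<in> Od} = Ne"
  proof -
    have "(\<Sum>p\<in>f. b (ph p) * e p) = (\<Sum>p\<in>f. of_bool (dgr al ph (ph p) \<noteq> 2 \<and> al p \<in> Od))"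
      by (intro sum.cong) (auto simp: b_def e_def)
    thus ?thesis using bp fin by (simp add: Int_def)
  qed
  have "(\<Sum>x\<in>f. wgt al ph I x) \<ge> (\<Sum>p\<in>f. b (ph p) * (1 / 6 + (e (ph p) + e p) / 12 + e (ph p) * e p / 6))"
    unfolding S by (rule sum_mono) (rule wt)
  also have "(\<Sum>p\<in>f. b (ph p) * (1 / 6 + (e (ph p) + e p) / 12 + e (ph p) * e p / 6)) =
      (\<Sum>p\<in>f. b (ph p) * e (ph p) / 4 + b (ph p) * (1 - e (ph p)) / 6 + b (ph p) * e p / 12
        + b (ph p) * e (ph p) * e p / 6)"
    by (intro sum.cong) (auto simp: field_simps)
  finally have 1: "(\<Sum>x\<in>f. wgt al ph I x) \<ge> real Ne / 4 + real Ni / 6 + real Ne / 12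
      + (\<Sum>p\<in>f. b (ph p) * e (ph p) * e p) / 6"
    using be bi bp by (simp add: sum.distrib sum_divide_distrib[symmetric])
  have nn: "(\<Sum>p\<in>f. b (ph p) * e (ph p) * e p) \<ge> 0" by (intro sum_nonneg) (auto simp: b_def e_def)
  thus "(\<Sum>x\<in>f. wgt al ph I x) \<ge> real Ne / 3 + real Ni / 6" using 1 by simp
  have "(\<Sum>p\<in>f. b (ph p) * e p) \<le> (\<Sum>p\<in>f. b (ph p) * e (ph p) * e p + b (ph p) * (1 - e (ph p)))"
    by (intro sum_mono) (auto simp: b_def e_def)
  hence "real Ne \<le> (\<Sum>p\<in>f. b (ph p) * e (ph p) * e p) + real Ni"
    using bp bi by (simp add: sum.distrib)
  thus "(\<Sum>x\<in>f. wgt al ph I x) \<ge> real Ne / 2" using 1 by simp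
qed

section \<open>Runs along vertices of degree two\<close>

definition run :: "('a \<Rightarrow> 'a) \<Rightarrow> ('a \<Rightarrow> 'a) \<Rightarrow> 'a list \<Rightarrow> bool" where
  "run al ph zs \<longleftrightarrow> zs \<noteq> [] \<and> distinct zs \<and> successively (\<lambda>a b. b = ph a \<and> dgr al ph b = 2) zs"

lemma run_segments:
  fixes H :: "'a \<Rightarrow> real"
  assumes "distinct (x # xs)" "successively (\<lambda>a b. b = ph a) (x # xs)"
    and "\<And>zs. run al ph zs \<Longrightarrow> set zs \<subseteq> set (x # xs) \<Longrightarrow> real (length zs) \<le> H (hd zs)"
  shows "real (length (x # xs)) \<le> H x + (\<Sum>y\<in>{y \<in> set xs. dgr al ph y \<noteq> 2}. H y)"
  using assms
proof (induction "length xs" arbitrary: x xs rule: less_induct)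
  case less
  let ?Q = "\<lambda>y. dgr al ph y = 2"
  let ?a = "takeWhile ?Q xs" and ?b = "dropWhile ?Q xs"
  have xs: "xs = ?a @ ?b" by simp
  have sp: "x # xs = (x # ?a) @ ?b" by simp
  have aQ: "\<forall>y\<in>set ?a. ?Q y" by (auto dest: set_takeWhileD)
  have suc: "successively (\<lambda>a b. b = ph a) (x # ?a)"
    using less.prems(2) unfolding sp successively_append_iff by blast
  have "successively (\<lambda>a b. b = ph a \<and> ?Q b) (x # zs)" if "successively (\<lambda>a b. b = ph a) (x # zs)" "\<forall>y\<in>set zs. ?Q y" for x zs
    using that by (induction zs arbitrary: x) auto
  from this[OF suc aQ] have "run al ph (x # ?a)"
    using less.prems(1) unfolding run_def sp distinct_append by blast
  hence 1: "real (length (x # ?a)) \<le> H x"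
    using less.prems(3)[of "x # ?a"] by (auto dest: set_takeWhileD)
  show ?case
  proof (cases ?b)
    case Nil
    hence "xs = ?a" using xs by (metis append_Nil2)
    hence "{y \<in> set xs. \<not> ?Q y} = {}" using aQ by (metis (mono_tags, lifting) Collect_empty_eq)
    thus ?thesis using 1 \<open>xs = ?a\<close> by (metis add.right_neutral sum.empty)
  next
    case (Cons y ys)
    have nQ: "\<not> ?Q y" using hd_dropWhile[of ?Q xs] Cons by simp
    have setxs: "set xs = set ?a \<union> set ?b" by (simp flip: set_append)
    have sub: "set (y # ys) \<subseteq> set (x # xs)" using setxs Cons by auto
    have dis: "distinct (x # ?a @ y # ys)" using less.prems(1) unfolding sp Cons by simp
    have sucy: "successively (\<lambda>a b. b = ph a) (y # ys)"
      using less.prems(2) unfolding sp successively_append_iff Cons by blast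
    have len: "length xs = length ?a + Suc (length ys)" using arg_cong[OF xs, of length] unfolding length_append Cons by simp
    have "real (length (y # ys)) \<le> H y + (\<Sum>y\<in>{y \<in> set ys. \<not> ?Q y}. H y)"
    proof (rule less.hyps)
      show "length ys < length xs" using len by simp
      show "distinct (y # ys)" using dis by simp
      fix zs assume "run al ph zs" "set zs \<subseteq> set (y # ys)"
      thus "real (length zs) \<le> H (hd zs)" using less.prems(3) sub by blast
    qed (fact sucy)
    moreover have "{y \<in> set xs. \<not> ?Q y} = insert y {y \<in> set ys. \<not> ?Q y}"
    proof -
      have "set xs = set ?a \<union> insert y (set ys)" using setxs Cons by simp
      thus ?thesis using aQ nQ by auto
    qed
    moreover have "y \<notin> set ys" using dis by simp
    ultimately have "real (length (y # ys)) \<le> (\<Sum>y\<in>{y \<in> set xs. \<not> ?Q y}. H y)" by simp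
    thus ?thesis using 1 len by simp
  qed
qed

lemma cyc_successively: "cyc ph xs \<Longrightarrow> successively (\<lambda>a b. b = ph a) xs"
proof -
  have "map ph xs = tl xs @ [z] \<Longrightarrow> successively (\<lambda>a b. b = ph a) xs" for z
  proof (induction xs)
    case (Cons x xs) thus ?case by (cases xs) auto
  qed simp
  moreover assume "cyc ph xs"
  hence "map ph xs = tl xs @ [hd xs]" by (cases xs) (auto simp: cyc_def)
  ultimately show ?thesis by blast
qed

text \<open>A face without branch vertices is one run, whichever dart it is started from; otherwise
  its branch vertices cut the boundary into runs.\<close>

lemma face_length:
  fixes H :: "'a \<Rightarrow> real"
  assumes P: "perms D {ph}" and x0: "x0 \<in> D" "f = cls {ph} x0"
    and H: "\<And>zs. run al ph zs \<Longrightarrow> set zs \<subseteq> f \<Longrightarrow> real (length zs) \<le> H (hd zs)"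
  shows "(\<exists>y\<in>f. real (card f) \<le> H y) \<and> (\<forall>y\<in>f. dgr al ph y = 2) \<or>
    (\<exists>y\<in>f. dgr al ph y \<noteq> 2) \<and> real (card f) \<le> (\<Sum>y\<in>{y \<in> f. dgr al ph y \<noteq> 2}. H y)"
proof -
  obtain y where y: "y \<in> f" "(\<forall>y\<in>f. dgr al ph y = 2) \<or> dgr al ph y \<noteq> 2"
  proof (cases "\<forall>y\<in>f. dgr al ph y = 2")
    case True
    have "x0 \<in> f" using x0(2) by simp
    thus thesis using that[of x0] True by simp
  next
    case False
    then obtain z where "z \<in> f" "dgr al ph z \<noteq> 2" by blast
    thus thesis using that[of z] by simp
  qed
  have yD: "y \<in> D" using y(1) x0(2) cls_sub[OF P x0(1)] by blast
  have "y \<in> cls {ph} x0" using y(1) x0(2) by simp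
  from cls_eq[OF P x0(1) this] have fy: "cls {ph} y = f" using x0(2) by simp
  obtain xs where xs: "cyc ph (y # xs)" "set (y # xs) = cls {ph} y" using cyc_exists[OF P yD] by blast
  hence xs: "cyc ph (y # xs)" "set (y # xs) = f" using fy by simp_all
  have dis: "distinct (y # xs)" using xs(1) by (simp add: cyc_def)
  have len: "card f = length (y # xs)" using distinct_card[OF dis] xs(2) by simp
  have "real (length (y # xs)) \<le> H y + (\<Sum>y\<in>{y \<in> set xs. dgr al ph y \<noteq> 2}. H y)"
    by (rule run_segments[OF dis cyc_successively[OF xs(1)]]) (use H xs(2) in blast)
  hence 1: "real (card f) \<le> H y + (\<Sum>y\<in>{y \<in> set xs. dgr al ph y \<noteq> 2}. H y)" using len by simp
  show ?thesis
  proof (cases "\<forall>y\<in>f. dgr al ph y = 2")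
    case True
    hence "{y \<in> set xs. dgr al ph y \<noteq> 2} = {}" using xs(2) by auto
    hence "real (card f) \<le> H y" using 1 by (metis add.right_neutral sum.empty)
    thus ?thesis using True y by blast
  next
    case False
    hence yb: "dgr al ph y \<noteq> 2" using y by blast
    have e: "{y \<in> f. dgr al ph y \<noteq> 2} = insert y {y \<in> set xs. dgr al ph y \<noteq> 2}" using xs(2) yb by auto
    have "y \<notin> set xs" using dis by simp
    hence "real (card f) \<le> (\<Sum>y\<in>{y \<in> f. dgr al ph y \<noteq> 2}. H y)" unfolding e using 1 by simp
    thus ?thesis using yb y by blast
  qed
qed

lemma cyc_next: "cyc f (P @ x # y # Q) \<Longrightarrow> f x = y"
proof -
  assume c: "cyc f (P @ x # y # Q)"
  have "cyc f ((x # y # Q) @ P)" by (rule cyc_rot[OF c])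
  thus ?thesis by (simp add: cyc_Cons)
qed

lemma cyc_wrap: "cyc f (P @ [x]) \<Longrightarrow> f x = hd (P @ [x])"
proof -
  assume c: "cyc f (P @ [x])"
  have "cyc f ([x] @ P)" by (rule cyc_rot[OF c])
  thus ?thesis by (cases P) (simp_all add: cyc_Cons)
qed

lemma cyc_nth: "cyc f xs \<Longrightarrow> i < length xs \<Longrightarrow> f (xs ! i) = xs ! (Suc i mod length xs)"
  unfolding cyc_def by (metis nth_map nth_rotate1)

lemma successively_const: "successively (\<lambda>a b. P a = P b) zs \<Longrightarrow> z \<in> set zs \<Longrightarrow> P z = P (hd zs)"
proof (induction zs)
  case (Cons a zs) thus ?case by (cases zs) auto
qed simp

lemma run_prefix:
  assumes "zs \<noteq> []" "distinct zs" "successively (\<lambda>a b. b = f a) zs" "cyc f xs" "hd xs = hd zs"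
  shows "\<exists>r. xs = zs @ r"
  using assms(1,2,3,5)
proof (induction zs rule: rev_induct)
  case (snoc z zs)
  show ?case
  proof (cases zs)
    case Nil
    thus ?thesis using snoc.prems assms(4) by (cases xs) (auto simp: cyc_def)
  next
    case (Cons a as)
    have zne: "zs \<noteq> []" using Cons by simp
    have "successively (\<lambda>a b. b = f a) zs" "z = f (last zs)"
      using snoc.prems(3) zne unfolding successively_append_iff by auto
    then obtain r where r: "xs = zs @ r" using snoc Cons by auto
    have z0: "zs = butlast zs @ [last zs]" using Cons by simp
    show ?thesis
    proof (cases r)
      case Nil
      hence "xs = butlast zs @ [last zs]" using r z0 by simp
      hence "z = hd xs" using cyc_wrap[of f "butlast zs" "last zs"] assms(4) \<open>z = f (last zs)\<close> by simp
      thus ?thesis using snoc.prems(2,4) Cons by auto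
    next
      case (Cons b bs)
      hence "xs = butlast zs @ last zs # b # bs" using r z0 by (metis append.assoc append_Cons append_Nil)
      hence "z = b" using cyc_next[of f "butlast zs" "last zs" b bs] assms(4) \<open>z = f (last zs)\<close> by simp
      thus ?thesis using r Cons by auto
    qed
  qed
qed simp

text \<open>Meant for runs that pass points of the outer path where the lift jumps: the run is cut
  at the marks and each part is bounded separately.\<close>

lemma marks_length:
  assumes "distinct zs" "zs \<noteq> []"
    and "\<And>A B C. zs = A @ B @ C \<Longrightarrow> B \<noteq> [] \<Longrightarrow> \<forall>b\<in>set (butlast B). \<not> mk b \<Longrightarrow> length B \<le> L"
  shows "length zs \<le> L * Suc (card {z \<in> set (butlast zs). mk z})"
  using assms
proof (induction "length zs" arbitrary: zs rule: less_induct)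
  case less
  show ?case
  proof (cases "\<exists>z\<in>set (butlast zs). mk z")
    case False
    hence "length zs \<le> L" using less.prems(3)[of "[]" zs "[]"] less.prems(2) by auto
    thus ?thesis by (simp add: trans_le_add1)
  next
    case True
    then obtain A z B where s: "butlast zs = A @ z # B" "mk z" "\<forall>y\<in>set A. \<not> mk y"
      using split_list_first_prop[of "butlast zs" mk] by blast
    have zs: "zs = A @ z # B @ [last zs]" using less.prems(2) s(1) by (metis append.assoc append_Cons append_butlast_last_id)
    let ?B = "B @ [last zs]"
    have "length (A @ [z]) \<le> L" using less.prems(3)[of "[]" "A @ [z]" ?B] zs s(3) by simp
    moreover have "length ?B \<le> L * Suc (card {z \<in> set (butlast ?B). mk z})"
    proof (rule less.hyps)
      show "length ?B < length zs" using arg_cong[OF zs, of length] by simp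
      show "distinct ?B" using less.prems(1) zs by (metis distinct.simps(2) distinct_append)
      fix A' B' C' assume "?B = A' @ B' @ C'" "B' \<noteq> []" "\<forall>b\<in>set (butlast B'). \<not> mk b"
      moreover have "zs = ((A @ [z]) @ A') @ B' @ C'" using zs calculation(1) by simp
      ultimately show "length B' \<le> L" using less.prems(3) by blast
    qed simp
    moreover have "card {z \<in> set (butlast zs). mk z} = Suc (card {z \<in> set (butlast ?B). mk z})"
    proof -
      have "{y \<in> set (butlast zs). mk y} = insert z {y \<in> set B. mk y}" using s by auto
      moreover have "z \<notin> set B" using less.prems(1) zs by (metis distinct.simps(2) distinct_append UnI1 set_append)
      ultimately show ?thesis by simp
    qed
    moreover have "length zs = length (A @ [z]) + length ?B" using arg_cong[OF zs, of length] by simp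
    ultimately show ?thesis by simp
  qed
qed

context scg
begin

section \<open>Faces of reduced diagrams\<close>

lemma dg_rot: "dg D al ph lb ps lv (A @ B) \<Longrightarrow> dg D al ph lb ps lv (B @ A)"
  using cyc_rot[of ph A B] unfolding dg_def by auto

lemma kp_block:
  assumes "cyc ph (P @ C @ Q)" "kp lb lv C v u" "x \<in> set C"
  obtains z where "st (lv x) (lb x) z" "x \<noteq> last C \<Longrightarrow> lv (ph x) = z \<and> ph x \<in> set C"
proof -
  obtain C1 C2 where C: "C = C1 @ x # C2" using assms(3) by (auto simp: in_set_conv_decomp)
  then obtain z where z: "st (lv x) (lb x) z" "kp lb lv C2 z u" using assms(2) by (auto simp: kp_append)
  show ?thesis
  proof (rule that[OF z(1)])
    assume "x \<noteq> last C"
    then obtain y Y where y: "C2 = y # Y" using C by (cases C2) auto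
    hence "ph x = y" using assms(1) C cyc_next[of ph "P @ C1" x y "Y @ Q"] by simp
    thus "lv (ph x) = z \<and> ph x \<in> set C" using z(2) y C by simp
  qed
qed

definition inner_ok where
  "inner_ok D ph lb lv os \<longleftrightarrow> (\<forall>x xs. x \<in> D - set os \<longrightarrow> cyc ph (x # xs) \<longrightarrow> scyc st (lv x) (map lb (x # xs)))"

lemma face_cls:
  assumes "dg D al ph lb ps lv os" "x \<in> D - set os" "y \<in> cls {ph} x"
  shows "cls {ph} y = cls {ph} x"
  using cls_eq[OF pmap_perms(1)[OF dgD(6)[OF assms(1)]] _ assms(3)] assms(2) by simp

lemma face_nth_rd:
  assumes d: "dg D al ph lb ps lv os" and x: "x \<in> D - set os" and c: "cyc ph (x # xs)"
  shows "j < length (x # xs) \<Longrightarrow> rdd (lv x) (take j (map lb (x # xs))) (lv ((x # xs) ! j))"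
    "rdd (lv x) (map lb (x # xs)) (lv x)"
proof -
  let ?L = "x # xs"
  have inn: "set ?L \<subseteq> D - set os" using inner_closed(2)[OF d x] cyc_cls[OF c, of x] by simp
  have s: "st (lv (?L ! j)) (lb (?L ! j)) (lv (?L ! (Suc j mod length ?L)))" if "j < length ?L" for j
  proof -
    have "?L ! j \<in> D - set os" using inn nth_mem[OF that] by blast
    thus ?thesis using dgD(5)[OF d, of "?L ! j"] cyc_nth[OF c that] by simp
  qed
  have 1: "j < length ?L \<Longrightarrow> rdd (lv x) (take j (map lb ?L)) (lv (?L ! j))" for j
  proof (induction j)
    case (Suc j)
    hence "take (Suc j) (map lb ?L) = take j (map lb ?L) @ [lb (?L ! j)]"
      by (subst take_Suc_conv_app_nth) (auto simp del: list.map)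
    moreover have "Suc j mod length ?L = Suc j" using Suc.prems by simp
    ultimately show ?case using Suc s[of j] by (auto simp: rd_append)
  qed simp
  show "j < length ?L \<Longrightarrow> rdd (lv x) (take j (map lb ?L)) (lv (?L ! j))" by (rule 1)
  have "take (Suc (length xs)) (map lb ?L) = take (length xs) (map lb ?L) @ [map lb ?L ! length xs]"
    by (rule take_Suc_conv_app_nth) simp
  hence ml: "map lb ?L = take (length xs) (map lb ?L) @ [lb (?L ! length xs)]"
    by (simp add: nth_map[of _ ?L] del: list.map nth_Cons_Suc)
  have "Suc (length xs) mod length ?L = 0" by simp
  show "rdd (lv x) (map lb ?L) (lv x)"
  proof -
    have "rdd (lv x) (take (length xs) (map lb ?L)) (lv (?L ! length xs))" using 1[of "length xs"] by simp
    moreover have "st (lv (?L ! length xs)) (lb (?L ! length xs)) (lv x)" using s[of "length xs"] by simp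
    ultimately have "rdd (lv x) (take (length xs) (map lb ?L) @ [lb (?L ! length xs)]) (lv x)"
      unfolding rd_append rd.simps by blast
    thus ?thesis unfolding ml[symmetric] .
  qed
qed

lemma simple_or_reduce:
  assumes d: "dg D al ph lb ps lv os" and n: "\<not> inner_ok D ph lb lv os"
  obtains D' al' ph' where "dg D' al' ph' lb ps lv os" "mu D' ph' < mu D ph"
proof -
  obtain x xs where x: "x \<in> D - set os" and c: "cyc ph (x # xs)" and ns: "\<not> scyc st (lv x) (map lb (x # xs))"
    using n by (auto simp: inner_ok_def simp del: list.map)
  let ?L = "x # xs"
  have inn: "set ?L \<subseteq> D - set os" using inner_closed(2)[OF d x] cyc_cls[OF c, of x] by simp
  have dis: "distinct ?L" using c by (simp add: cyc_def)
  note r = face_nth_rd[OF d x c]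
  consider (pinch) i j u where "i < j" "j < length ?L" "rdd (lv x) (take i (map lb ?L)) u" "rdd (lv x) (take j (map lb ?L)) u"
    | (digon) y where "map lb ?L = [y, inv_letter y]"
  proof -
    have mne: "map lb ?L \<noteq> []" by simp
    have "(\<exists>i j u. i < j \<and> j < length (map lb ?L) \<and> rdd (lv x) (take i (map lb ?L)) u \<and> rdd (lv x) (take j (map lb ?L)) u)
        \<or> (\<exists>y. map lb ?L = [y, inv_letter y])"
      using ns r(2) mne unfolding scyc_def by metis
    thus thesis using pinch digon unfolding length_map by metis
  qed
  thus ?thesis
  proof cases
    case pinch
    have e: "lv (?L ! i) = lv (?L ! j)" using r(1)[of i] r(1)[of j] pinch rd_det by (metis less_trans)
    have ij: "?L ! i \<in> set ?L" "?L ! j \<in> set ?L" "?L ! i \<noteq> ?L ! j"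
    proof -
      have il: "i < length ?L" using pinch by linarith
      show "?L ! i \<in> set ?L" by (rule nth_mem[OF il])
      show "?L ! j \<in> set ?L" by (rule nth_mem[OF pinch(2)])
      show "?L ! i \<noteq> ?L ! j" unfolding nth_eq_iff_index_eq[OF dis il pinch(2)] using pinch(1) by simp
    qed
    have ex: "\<exists>a\<in>set ?L. ph a = b" if "b \<in> set ?L" for b
    proof -
      have "set (map ph ?L) = set ?L" using c unfolding cyc_def by (metis set_rotate1)
      thus ?thesis using that by (metis imageE set_map)
    qed
    obtain a b where ab: "a \<in> set ?L" "ph a = ?L ! i" "b \<in> set ?L" "ph b = ?L ! j" using ex ij by metis
    have "b \<in> cls {ph} a" using cyc_cls[OF c ab(1)] ab(3) by blast
    moreover have "a \<noteq> b" using ab ij by auto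
    moreover have "lv (ph a) = lv (ph b)" using ab e by simp
    ultimately show ?thesis using split_inner[OF d, of a b] ab(1) inn that by (metis subsetD)
  next
    case digon
    then obtain z where z: "xs = [z]" "lb z = inv_letter (lb x)" by auto
    hence "ph x = z" "ph z = x" "x \<noteq> z" using c by (auto simp: cyc_Cons)
    thus ?thesis using fold_digon[OF d x _ _ _ z(2)] that by blast
  qed
qed

lemma face_lv_inj:
  assumes d: "dg D al ph lb ps lv os" and ok: "inner_ok D ph lb lv os" and x: "x \<in> D - set os"
    and y: "y \<in> cls {ph} x" and e: "lv x = lv y"
  shows "x = y"
proof (rule ccontr)
  assume ne: "x \<noteq> y"
  obtain xs where xs: "cyc ph (x # xs)" "set (x # xs) = cls {ph} x"
    using cyc_exists[OF pmap_perms(1)[OF dgD(6)[OF d]]] x by blast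
  obtain j where j: "j < length (x # xs)" "(x # xs) ! j = y" using y xs(2) by (metis in_set_conv_nth)
  have "j \<noteq> 0" using j ne by (cases j) auto
  hence "0 < j" by simp
  moreover have "rdd (lv x) (take j (map lb (x # xs))) (lv x)" using face_nth_rd(1)[OF d x xs(1) j(1)] j(2) e by simp
  moreover have "scyc st (lv x) (map lb (x # xs))" using ok x xs(1) unfolding inner_ok_def by blast
  ultimately show False using j(1) unfolding scyc_def by (metis length_map rd.simps(1) take0)
qed

text \<open>At an inner vertex of degree one the face would run along an edge and back. The lifts
  then agree so far that the face consists of this backtrack only, which is no simple cycle.\<close>

lemma inner_deg:
  assumes d: "dg D al ph lb ps lv os" and ok: "inner_ok D ph lb lv os" and x: "x \<in> D - set os"
  shows "ph (al x) \<noteq> x"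
proof
  assume a: "ph (al x) = x"
  note M = dgD(6)[OF d] and P = dgD(1)[OF d]
  have xD: "x \<in> D" "al x \<in> D" using x pmap_al[OF M] by auto
  have alc: "x \<in> cls {ph} (al x)" using cls_step[OF cls_refl, of ph "{ph}" "al x"] a by simp
  hence ax: "al x \<in> cls {ph} x" using cls_sym[OF pmap_perms(1)[OF M] xD(2)] by blast
  hence axI: "al x \<in> D - set os" using inner_closed(2)[OF d x] by blast
  have s1: "st (lv (al x)) (inv_letter (lb x)) (lv x)" using dgD(5)[OF d, of "al x"] axI a pdgD(3)[OF P xD(1)] by simp
  have s2: "st (lv x) (lb x) (lv (ph x))" using dgD(5)[OF d, of x] x by simp
  have "lv (ph x) = lv (al x)" using s1 s2 st_inv st_det by (metis inv_letter_inv(1))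
  moreover have "ph x \<in> cls {ph} (al x)" using cls_step[OF alc, of ph] by simp
  ultimately have e: "ph x = al x" using face_lv_inj[OF d ok axI] by metis
  have "cyc ph [x, al x]" using e a pmap_al_ne[OF M xD(1)] by (auto simp: cyc_def)
  hence "scyc st (lv x) (map lb [x, al x])" using ok x unfolding inner_ok_def by blast
  thus False using pdgD(3)[OF P xD(1)] by (simp add: scyc_def)
qed

text \<open>A run of a face along which the other side also lifts, but not to an equivalent place, is a piece.\<close>

lemma run_piece:
  assumes d: "dg D al ph lb ps lv os" and ok: "inner_ok D ph lb lv os" and r: "run al ph zs"
    and x: "hd zs \<in> D - set os"
    and c1: "\<exists>u. st (lv (al (hd zs))) (lb (al (hd zs))) u"
    and c2: "successively (\<lambda>a b. st (lv (al b)) (lb (al b)) (lv (al a))) zs"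
    and ne: "\<not> vq (lv (ph (last zs))) (lv (al (last zs)))"
  shows "6 * length zs < card (cls {ph} (hd zs))"
proof -
  note M = dgD(6)[OF d] and P = dgD(1)[OF d]
  have zs: "zs \<noteq> []" "distinct zs" "successively (\<lambda>a b. b = ph a) zs"
    using r by (auto simp: run_def elim: successively_mono)
  have hD: "hd zs \<in> D" using x by blast
  obtain xs where xs: "cyc ph (hd zs # xs)" "set (hd zs # xs) = cls {ph} (hd zs)"
    using cyc_exists[OF pmap_perms(1)[OF M] hD] by blast
  obtain rest where rest: "hd zs # xs = zs @ rest" using run_prefix[OF zs xs(1)] by auto
  have sc: "scyc st (lv (hd zs)) (map lb zs @ map lb rest)"
    using ok x xs(1) rest unfolding inner_ok_def by (metis map_append)
  have inn: "set zs \<subseteq> D - set os" using inner_closed(2)[OF d x] xs(2) rest by (metis Un_subset_iff set_append subset_trans order_refl)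
  have m: "map ph zs = tl zs @ [ph (last zs)]"
    using zs(1,3)
  proof (induction zs)
    case (Cons z zs) thus ?case by (cases zs) auto
  qed simp
  have "kp lb lv zs (lv (hd zs)) (lv (ph (last zs)))"
    by (rule kp_chain[OF zs(1) m]) (use dgD(5)[OF d] inn in blast)
  hence r1: "rdd (lv (hd zs)) (map lb zs) (lv (ph (last zs)))" by (rule kp_rd)
  have lz: "lb (al z) = inv_letter (lb z)" if "z \<in> set zs" for z using pdgD(3)[OF P] inn that by blast
  obtain u2 where "st (lv (al (hd zs))) (lb (al (hd zs))) u2" using c1 by auto
  hence "st u2 (lb (hd zs)) (lv (al (hd zs)))"
    using lz[of "hd zs"] zs(1) st_inv by (metis inv_letter_inv(1) hd_in_set)
  hence u2: "rdd u2 (map lb zs) (lv (al (last zs)))"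
    using zs(1) c2 lz
  proof (induction zs arbitrary: u2)
    case (Cons z zs)
    show ?case
    proof (cases zs)
      case Nil thus ?thesis using Cons.prems by auto
    next
      case C: (Cons y ys)
      hence "st (lv (al y)) (lb (al y)) (lv (al z))" using Cons.prems(3) by simp
      moreover have "lb (al y) = inv_letter (lb y)" using Cons.prems(4) C by simp
      ultimately have "st (lv (al z)) (lb y) (lv (al y))" using st_inv by (metis inv_letter_inv(1))
      hence "rdd (lv (al z)) (map lb zs) (lv (al (last zs)))"
        using Cons.IH[of "lv (al z)"] Cons.prems C by auto
      moreover have "last (z # zs) = last zs" using C by simp
      ultimately show ?thesis using Cons.prems(1) by (simp only: list.map rd.simps list.sel) blast
    qed
  qed simp
  have "\<not> vq (lv (hd zs)) u2" using rd_vq_end[OF r1 u2] ne by simp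
  hence "6 * length (map lb zs) < length (map lb zs @ map lb rest)" using small[OF sc r1 u2] by blast
  moreover have "card (cls {ph} (hd zs)) = length (zs @ rest)"
    using xs rest distinct_card[of "zs @ rest"] by (auto simp: cyc_def)
  ultimately show ?thesis by simp
qed


text \<open>At a vertex of degree two there is only one way to continue on the other side as well,
  so the darts behind a run form a path along one face, traversed in the opposite direction.\<close>

lemma run_link:
  assumes d: "dg D al ph lb ps lv os" and ok: "inner_ok D ph lb lv os" and r: "run al ph zs"
    and I: "set zs \<subseteq> D - set os"
  shows "successively (\<lambda>a b. ph (al b) = al a \<and> (al a \<in> set os \<longleftrightarrow> al b \<in> set os)) zs"
proof -
  note M = dgD(6)[OF d]
  have O: "\<forall>x\<in>set os. ph x \<in> set os" "set os \<subseteq> D" using cyc_set[OF dgD(2)[OF d]] dgD(3)[OF d] by auto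
  have s: "successively (\<lambda>a b. b = ph a \<and> dgr al ph b = 2) zs" using r by (simp add: run_def)
  have key: "ph (al b) = al a \<and> (al a \<in> set os \<longleftrightarrow> al b \<in> set os)"
    if "b = ph a" "dgr al ph b = 2" "a \<in> D - set os" "b \<in> D - set os" for a b
  proof -
    have e: "ph (al b) = al a"
      using corner_weight(3)[OF M O HOL.refl that(3), unfolded that(1)[symmetric], OF that(4) inner_deg[OF d ok that(4)] that(2)] .
    moreover have "al b \<in> D" using that(4) pmap_al[OF M] by blast
    ultimately show ?thesis using O(1) inner_closed(1)[OF d, of "al b"] by auto
  qed
  show ?thesis
    using s I
  proof (induction zs)
    case (Cons a zs)
    thus ?case using key by (cases zs) auto
  qed simp
qed

lemma run_outer:
  assumes "dg D al ph lb ps lv os" "inner_ok D ph lb lv os" "run al ph zs" "set zs \<subseteq> D - set os" "z \<in> set zs"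
  shows "al z \<in> set os \<longleftrightarrow> al (hd zs) \<in> set os"
proof -
  have "successively (\<lambda>a b. (al a \<in> set os) = (al b \<in> set os)) zs"
    by (rule successively_mono[OF run_link[OF assms(1-4)]]) simp
  thus ?thesis using successively_const[of "\<lambda>z. al z \<in> set os" zs] assms(5) by blast
qed

lemma run_card: "run al ph zs \<Longrightarrow> set zs \<subseteq> f \<Longrightarrow> finite f \<Longrightarrow> length zs \<le> card f"
  by (metis card_mono distinct_card run_def)

text \<open>The counting form of small cancellation. By \<open>R2\<close> every inner run is a
  piece, so six times its length is at most \<open>card f - 1\<close>; for runs along the outer face
  the bound \<open>Hx\<close> is left open, since it depends on the side. The first alternative is a
  face with a single outer run all around it.\<close>

lemma face_count:
  assumes d: "dg D al ph lb ps lv os" and ok: "inner_ok D ph lb lv os"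
    and R2: "\<forall>x\<in>D - set os. al x \<in> D - set os \<longrightarrow> \<not> vq (lv (ph x)) (lv (al x))"
    and x0: "x0 \<in> D - set os" and f: "f = cls {ph} x0"
    and ext: "\<And>zs. run al ph zs \<Longrightarrow> set zs \<subseteq> f \<Longrightarrow> al (hd zs) \<in> set os \<Longrightarrow> 6 * length zs \<le> Hx (hd zs)"
  defines "Ne \<equiv> card {x \<in> f. dgr al ph x \<noteq> 2 \<and> al x \<in> set os}"
    and "Ni \<equiv> card {x \<in> f. dgr al ph x \<noteq> 2 \<and> al x \<notin> set os}"
    and "W \<equiv> \<Sum>x\<in>f. wgt al ph (D - set os) x"
  shows "card f > 0" "W \<ge> real Ne / 3 + real Ni / 6" "W \<ge> real Ne / 2"
    "card {p \<in> f. dgr al ph (ph p) \<noteq> 2 \<and> al p \<in> set os} = Ne"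
    "(\<exists>y\<in>f. al y \<in> set os \<and> 6 * card f \<le> Hx y) \<and> (\<forall>y\<in>f. dgr al ph y = 2) \<or>
     (\<exists>y\<in>f. dgr al ph y \<noteq> 2) \<and> 6 * card f \<le> Ni * (card f - 1) + (\<Sum>y\<in>{y \<in> f. dgr al ph y \<noteq> 2 \<and> al y \<in> set os}. Hx y)"
proof -
  note M = dgD(6)[OF d]
  have O: "\<forall>x\<in>set os. ph x \<in> set os" "set os \<subseteq> D" using cyc_set[OF dgD(2)[OF d]] dgD(3)[OF d] by auto
  have deg: "\<forall>x\<in>D - set os. ph (al x) \<noteq> x" using inner_deg[OF d ok] by blast
  note FW = face_weight[OF M O HOL.refl deg f x0]
  show "W \<ge> real Ne / 3 + real Ni / 6" "W \<ge> real Ne / 2"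
    "card {p \<in> f. dgr al ph (ph p) \<noteq> 2 \<and> al p \<in> set os} = Ne"
    unfolding W_def Ne_def Ni_def by (fact FW)+
  have fI: "f \<subseteq> D - set os" using inner_closed(2)[OF d x0] f by simp
  have finf: "finite f" using fI dgD(8)[OF d] finite_subset by blast
  have "x0 \<in> f" using f by simp
  thus n0: "card f > 0" using finf by (auto simp: card_gt_0_iff)
  define H where "H y = (if al y \<in> set os then real (Hx y) / 6 else real (card f - 1) / 6)" for y
  have run: "real (length zs) \<le> H (hd zs)" if r: "run al ph zs" and sub: "set zs \<subseteq> f" for zs
  proof (cases "al (hd zs) \<in> set os")
    case True
    thus ?thesis using ext[OF r sub] by (simp add: H_def)
  next
    case False
    have zne: "zs \<noteq> []" using r by (simp add: run_def)
    hence hz: "hd zs \<in> f" using sub by (meson hd_in_set subsetD)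
    have hI: "hd zs \<in> D - set os" using hz fI by blast
    have zI: "set zs \<subseteq> D - set os" using sub fI by blast
    note lk = run_link[OF d ok r zI]
    have alI: "\<forall>z\<in>set zs. al z \<in> D - set os" using run_outer[OF d ok r zI] False zI pmap_al[OF M] by blast
    have c1: "\<exists>u. st (lv (al (hd zs))) (lb (al (hd zs))) u" using alI zne dgD(5)[OF d, of "al (hd zs)"] by auto
    have c2: "successively (\<lambda>a b. st (lv (al b)) (lb (al b)) (lv (al a))) zs"
      using lk alI
    proof (induction zs)
      case (Cons a zs)
      show ?case
      proof (cases zs)
        case C: (Cons b bs)
        have "st (lv (al b)) (lb (al b)) (lv (ph (al b)))" using dgD(5)[OF d, of "al b"] Cons.prems(2) C by simp
        thus ?thesis using Cons C by auto
      qed simp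
    qed simp
    have "last zs \<in> set zs" using zne by simp
    hence "last zs \<in> D - set os" "al (last zs) \<in> D - set os" using zI alI by blast+
    hence ne: "\<not> vq (lv (ph (last zs))) (lv (al (last zs)))" using R2 by blast
    have "cls {ph} (hd zs) = f" using face_cls[OF d x0] hz f by blast
    hence "6 * length zs < card f" using run_piece[OF d ok r hI c1 c2 ne] by simp
    hence "6 * length zs \<le> card f - 1" by simp
    hence "real (6 * length zs) \<le> real (card f - 1)" by (simp only: of_nat_le_iff)
    thus ?thesis using False by (simp add: H_def)
  qed
  have x0D: "x0 \<in> D" using x0 by blast
  from face_length[OF pmap_perms(1)[OF M] x0D f run]
  consider (nb) y where "y \<in> f" "real (card f) \<le> H y" "\<forall>y\<in>f. dgr al ph y = 2"
    | (br) "\<exists>y\<in>f. dgr al ph y \<noteq> 2" "real (card f) \<le> (\<Sum>y\<in>{y \<in> f. dgr al ph y \<noteq> 2}. H y)" by blast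
  thus "(\<exists>y\<in>f. al y \<in> set os \<and> 6 * card f \<le> Hx y) \<and> (\<forall>y\<in>f. dgr al ph y = 2) \<or>
     (\<exists>y\<in>f. dgr al ph y \<noteq> 2) \<and> 6 * card f \<le> Ni * (card f - 1) + (\<Sum>y\<in>{y \<in> f. dgr al ph y \<noteq> 2 \<and> al y \<in> set os}. Hx y)"
  proof cases
    case nb
    have "al y \<in> set os"
    proof (rule ccontr)
      assume "al y \<notin> set os"
      hence "real (card f) \<le> real (card f - 1) / 6" using nb(2) by (simp add: H_def)
      thus False using n0 by simp
    qed
    moreover from this have "6 * card f \<le> Hx y" using nb(2) by (simp add: H_def)
    ultimately show ?thesis using nb by blast
  next
    case br
    let ?B = "{y \<in> f. dgr al ph y \<noteq> 2}"
    let ?E = "{y \<in> f. dgr al ph y \<noteq> 2 \<and> al y \<in> set os}" and ?J = "{y \<in> f. dgr al ph y \<noteq> 2 \<and> al y \<notin> set os}"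
    have B: "?B = ?E \<union> ?J" "?E \<inter> ?J = {}" "finite ?E" "finite ?J" using finf by auto
    have "(\<Sum>y\<in>?B. H y) = (\<Sum>y\<in>?E. H y) + (\<Sum>y\<in>?J. H y)" unfolding B(1) using B by (intro sum.union_disjoint) auto
    moreover have "(\<Sum>y\<in>?J. H y) = real Ni * real (card f - 1) / 6" by (simp add: H_def Ni_def)
    moreover have "(\<Sum>y\<in>?E. H y) = (\<Sum>y\<in>?E. real (Hx y)) / 6" by (simp add: H_def sum_divide_distrib)
    ultimately have "6 * real (card f) \<le> real Ni * real (card f - 1) + (\<Sum>y\<in>?E. real (Hx y))" using br by simp
    hence "real (6 * card f) \<le> real (Ni * (card f - 1) + (\<Sum>y\<in>?E. Hx y))" by simp
    hence "6 * card f \<le> Ni * (card f - 1) + (\<Sum>y\<in>?E. Hx y)" by (simp only: of_nat_le_iff)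
    thus ?thesis using br by blast
  qed
qed

lemma dg_curvature:
  assumes d: "dg D al ph lb ps lv os" and ok: "inner_ok D ph lb lv os"
  shows "(\<Sum>f\<in>cls {ph} ` (D - set os). 1 - (\<Sum>x\<in>f. wgt al ph (D - set os) x))
    \<ge> 1 - real (card {x \<in> set os. ph (al x) = x}) / 2"
  by (rule curvature[OF dgD(6)[OF d] dgD(7)[OF d] _ dgD(2)[OF d] dgD(3)[OF d] HOL.refl])
    (use dgD(4)[OF d] inner_deg[OF d ok] in blast)+

lemma spur_matched:
  assumes d: "dg D al ph lb ps lv os" and x: "x \<in> set os" "ph (al x) = x"
  shows "al x \<in> set os"
proof (rule ccontr)
  assume n: "al x \<notin> set os"
  have "al x \<in> D" using pmap_al[OF dgD(6)[OF d]] dgD(3)[OF d] x by blast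
  hence "ph (al x) \<in> D - set os" using inner_closed(1)[OF d] n by blast
  thus False using x by simp
qed

end

section \<open>Paths with the same value in the group\<close>

lemma two_in_list:
  assumes "x \<in> set A" "y \<in> set A" "x \<noteq> y"
  shows "(\<exists>P Q T. A = P @ x # Q @ y # T) \<or> (\<exists>P Q T. A = P @ y # Q @ x # T)"
proof -
  obtain P Q where A: "A = P @ x # Q" using assms(1) by (auto simp: in_set_conv_decomp)
  then consider "y \<in> set P" | "y \<in> set Q" using assms by auto
  thus ?thesis
  proof cases
    case 1
    then obtain P1 P2 where "P = P1 @ y # P2" by (auto simp: in_set_conv_decomp)
    hence "A = P1 @ y # P2 @ x # Q" using A by simp
    thus ?thesis by blast
  next
    case 2
    then obtain Q1 Q2 where "Q = Q1 @ y # Q2" by (auto simp: in_set_conv_decomp)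
    hence "A = P @ x # Q1 @ y # Q2" using A by simp
    thus ?thesis by blast
  qed
qed

context scg
begin

lemma kp_change: "kp lb lv xs v u \<Longrightarrow> \<forall>x\<in>set xs. lv' x = lv x \<Longrightarrow> kp lb lv' xs v u"
  by (induction xs arbitrary: v) auto

lemma kp_mid:
  assumes "kp lb lv (P @ x # Q) v u"
  obtains z where "kp lb lv P v (lv x)" "st (lv x) (lb x) z" "kp lb lv Q z u"
  using assms by (auto simp: kp_append)

text \<open>Self-gluing of an inner face up to a nontrivial automorphism produces a shorter closed word,
  which is excluded by hypothesis; other gluings are merged.\<close>

lemma inner_reduce:
  assumes d: "dg D al ph lb ps lv os" and ok: "inner_ok D ph lb lv os" and x: "x \<in> D - set os" "al x \<in> D - set os"
    and vq: "vq (lv (ph x)) (lv (al x))"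
    and loop: "\<And>X v v'. set X \<subseteq> D - set os \<Longrightarrow> X \<noteq> [] \<Longrightarrow> kp lb lv X v v' \<Longrightarrow>
       (\<exists>D' ph'. dg D' al ph' lb ps lv X \<and> mu D' ph' < mu D ph) \<Longrightarrow> v = v'"
  obtains D' ph' lv' where "dg D' al ph' lb ps lv' os" "mu D' ph' < mu D ph" "\<forall>y\<in>set os. lv' y = lv y"
proof -
  note M = dgD(6)[OF d] and P = dgD(1)[OF d]
  obtain f where f: "f \<in> aut" "f (lv (ph x)) = lv (al x)" using vq by (auto simp: veq_def)
  show ?thesis
  proof (cases "al x \<in> cls {ph} x")
    case False
    thus ?thesis using merge_inner[OF d x False f] that by blast
  next
    case True
    have xD: "x \<in> D" using x by blast
    have aa: "al (al x) = x" using pmap_al_al[OF M xD] .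
    have s: "st (lv y) (lb y) (lv (ph y))" if "y \<in> D - set os" for y using dgD(5)[OF d, of y] that by simp
    have lbx: "lb (al x) = inv_letter (lb x)" using pdgD(3)[OF P xD] .
    have sx: "st (lv (al x)) (inv_letter (lb x)) (lv (ph (al x)))" using s[OF x(2)] lbx by simp
    have "st (lv (ph x)) (inv_letter (lb x)) (lv x)" using s[OF x(1)] st_inv by blast
    hence fx: "f (lv x) = lv (ph (al x))" using aut_st[OF f(1)] f(2) sx st_det by metis
    have fix1: "lv (ph x) = lv (al x)" if "lv (ph (al x)) = lv x"
      using that sx s[OF x(1)] st_inv st_det by (metis inv_letter_inv(1))
    obtain xs where xs: "cyc ph (x # xs)" "set (x # xs) = cls {ph} x"
      using cyc_exists[OF pmap_perms(1)[OF M] xD] by blast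
    have "al x \<in> set xs" using True xs(2) pmap_al_ne[OF M xD] by auto
    then obtain X Y where XY: "xs = X @ al x # Y" by (auto simp: in_set_conv_decomp)
    have c: "cyc ph (x # X @ al x # Y)" using xs(1) XY by simp
    have c': "cyc ph (al x # Y @ x # X)" using cyc_rot[of ph "x # X" "al x # Y"] c by simp
    have inn: "set (x # X @ al x # Y) \<subseteq> D - set os" using inner_closed(2)[OF d x(1)] xs(2) XY by simp
    have m: "map ph (x # X @ al x # Y) = X @ al x # Y @ [x]" using c by (simp add: cyc_Cons)
    have "map ph (x # X) @ map ph (al x # Y) = (X @ [al x]) @ (Y @ [x])" using m by simp
    hence m2: "map ph (x # X) = X @ [al x]" "map ph (al x # Y) = Y @ [x]"
      by (subst (asm) append_eq_append_conv, auto)+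
    have h1: "X \<noteq> [] \<Longrightarrow> ph x = hd X \<and> map ph X = tl X @ [al x]" using m2 by (cases X) auto
    have h2: "Y \<noteq> [] \<Longrightarrow> ph (al x) = hd Y \<and> map ph Y = tl Y @ [x]" using m2 by (cases Y) auto
    \<comment> \<open>The automorphism is shown to be trivial at this place. If an arc is empty,
      this is immediate or follows from a fixed vertex; otherwise one of the arcs bounds a smaller
      diagram, so by \<open>loop\<close> it is closed in the graph. The simple face would then
      consist of the edge in both directions, against \<open>inner_deg\<close>.\<close>
    have "lv (ph x) = lv (al x)"
    proof -
      consider "X = []" | "Y = []" | "X \<noteq> []" "Y \<noteq> []" by blast
      thus ?thesis
      proof cases
        case 1
        thus ?thesis using m2 by simp
      next
        case 2
        hence "f (lv x) = lv x" using m2 fx by simp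
        thus ?thesis using fx fix1 by simp
      next
        case 3
        have kX: "kp lb lv X (lv (ph x)) (lv (al x))"
          using kp_chain[OF 3(1), of ph "al x" lv lb] h1[OF 3(1)] s inn by auto
        have kY: "kp lb lv Y (lv (ph (al x))) (lv x)"
          using kp_chain[OF 3(2), of ph x lv lb] h2[OF 3(2)] s inn by auto
        from cut_inner[OF d x(1) c 3] consider "\<exists>D' ph'. dg D' al ph' lb ps lv X \<and> mu D' ph' < mu D ph"
          | "\<exists>D' ph'. dg D' al ph' lb ps lv Y \<and> mu D' ph' < mu D ph" by blast
        thus ?thesis
        proof cases
          case a: 1
          thus ?thesis using loop[OF _ 3(1) kX a] inn by auto
        next
          case a: 2
          thus ?thesis using loop[OF _ 3(2) kY a] inn fix1 by auto
        qed
      qed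
    qed
    moreover have "ph x \<in> cls {ph} x" by (rule cls_step[OF cls_refl]) simp
    hence "al x \<in> cls {ph} (ph x)" using True cls_eq[OF pmap_perms(1)[OF M] xD] by blast
    ultimately have e: "ph x = al x" using face_lv_inj[OF d ok inner_closed(1)[OF d x(1)]] by blast
    have "st (lv (al x)) (inv_letter (lb x)) (lv x)" using s[OF x(1)] e st_inv by metis
    hence "lv (ph (al x)) = lv x" using sx st_det by blast
    moreover have "ph (al x) \<in> cls {ph} x" using cls_step[OF True, of ph] by simp
    ultimately have "x = ph (al x)" using face_lv_inj[OF d ok x(1)] by metis
    thus ?thesis using inner_deg[OF d ok x(1)] by simp
  qed
qed

text \<open>The rerouted block keeps the ends \<open>v\<close> and \<open>v'\<close> of its lift,
  and these are all that the arguments about sides of diagrams record of it.\<close>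

lemma block_absorb:
  assumes d: "dg D al ph lb ps lv (L @ C @ Q)" and k: "kp lb lv C v v'"
    and y: "y \<in> set C" "al y \<notin> set (L @ C @ Q)" "vq (lv y) (lv (ph (al y)))"
  obtains C' lv' where "kp lb lv' C' v v'" "\<forall>x\<in>set L \<union> set Q. lv' x = lv x"
    "L @ C' @ Q = [] \<or> (\<exists>D' al' ph'. dg D' al' ph' lb ps lv' (L @ C' @ Q) \<and> mu D' ph' < mu D ph)"
proof -
  obtain f where f: "f \<in> aut" "f (lv (ph (al y))) = lv y" using vq_sym[OF y(3)] by (auto simp: veq_def)
  obtain A B where C: "C = A @ y # B" using y(1) by (auto simp: in_set_conv_decomp)
  obtain z where z: "kp lb lv A v (lv y)" "st (lv y) (lb y) z" "kp lb lv B z v'" using k C kp_mid by metis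
  have d': "dg D al ph lb ps lv ((L @ A) @ y # (B @ Q))" using d C by simp
  have aI: "al y \<in> D - set ((L @ A) @ y # (B @ Q))"
    using y(2) C dgD(3)[OF d'] pmap_al[OF dgD(6)[OF d], of y] by auto
  obtain X where X: "(L @ A) @ X @ (B @ Q) = [] \<Longrightarrow> z = lv y"
    "(L @ A) @ X @ (B @ Q) \<noteq> [] \<Longrightarrow> \<exists>D' ph' lv'. dg D' al ph' lb ps lv' ((L @ A) @ X @ (B @ Q)) \<and> mu D' ph' < mu D ph \<and>
      (\<forall>x\<in>set (L @ A) \<union> set (B @ Q). lv' x = lv x) \<and> kp lb lv' X (lv y) z"
    using absorb_outer[OF d' aI f z(2)] by blast
  show thesis
  proof (cases "(L @ A) @ X @ (B @ Q) = []")
    case True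
    hence "kp lb lv [] v v'" using z X(1) by simp
    thus thesis using that[of lv "[]"] True by simp
  next
    case False
    obtain D' ph' lv' where D': "dg D' al ph' lb ps lv' ((L @ A) @ X @ (B @ Q))" "mu D' ph' < mu D ph"
      "\<forall>x\<in>set (L @ A) \<union> set (B @ Q). lv' x = lv x" "kp lb lv' X (lv y) z" using X(2)[OF False] by blast
    have "kp lb lv' A v (lv y)" "kp lb lv' B z v'" using z D'(3) by (auto elim!: kp_change)
    hence "kp lb lv' (A @ X @ B) v v'" using D'(4) by (auto simp: kp_append)
    moreover have "dg D' al ph' lb ps lv' (L @ (A @ X @ B) @ Q)" using D'(1) by simp
    ultimately show thesis using that[of lv' "A @ X @ B"] D'(2,3) by auto
  qed
qed

text \<open>The part between the two traversals of the edge bounds a diagram, hence is closed in the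
  graph by \<open>loop\<close>. So it can be removed together with the edge without moving the ends
  of the lift.\<close>

lemma block_cut:
  assumes d: "dg D al ph lb ps lv (L @ C @ Q)" and k: "kp lb lv C v v'" and y: "y \<in> set C" "al y \<in> set C"
    and loop: "\<And>X z z'. kp lb lv X z z' \<Longrightarrow> X \<noteq> [] \<Longrightarrow> (\<exists>D' ph'. dg D' al ph' lb ps lv X \<and> mu D' ph' < mu D ph) \<Longrightarrow> z = z'"
  obtains C' where "kp lb lv C' v v'"
    "L @ C' @ Q = [] \<or> (\<exists>D' al' ph'. dg D' al' ph' lb ps lv (L @ C' @ Q) \<and> mu D' ph' < mu D ph)"
proof -
  note M = dgD(6)[OF d]
  have yD: "y \<in> D" using y(1) dgD(3)[OF d] by auto
  obtain x A X B where C: "C = A @ x # X @ al x # B" and xD: "x \<in> D"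
  proof -
    from two_in_list[OF y] pmap_al_ne[OF M yD] consider A X B where "C = A @ y # X @ al y # B"
      | A X B where "C = A @ al y # X @ y # B" by metis
    thus thesis
    proof cases
      case 1 thus thesis using that yD by blast
    next
      case 2 thus thesis using that[of A "al y" X B] pmap_al_al[OF M yD] pmap_al[OF M yD] by simp
    qed
  qed
  obtain z where z: "kp lb lv A v (lv x)" "st (lv x) (lb x) z" "kp lb lv (X @ al x # B) z v'" using k C kp_mid by blast
  then obtain z2 where z2: "kp lb lv X z (lv (al x))" "st (lv (al x)) (lb (al x)) z2" "kp lb lv B z2 v'" using kp_mid by blast
  have d': "dg D al ph lb ps lv ((L @ A) @ x # X @ al x # (B @ Q))" using d C by simp
  note cut = cut_outer[OF d']
  have "z = lv (al x)" using loop[OF z2(1)] cut(2) z2(1) by (cases "X = []") auto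
  hence "z2 = lv x" using z(2) z2(2) pdgD(3)[OF dgD(1)[OF d] xD] st_inv st_det by metis
  hence "kp lb lv (A @ B) v v'" using z(1) z2(3) by (auto simp: kp_append)
  moreover have "L @ (A @ B) @ Q = [] \<or> (\<exists>D' ph'. dg D' al ph' lb ps lv (L @ (A @ B) @ Q) \<and> mu D' ph' < mu D ph)"
    using cut(1) by auto
  ultimately show thesis using that by blast
qed

text \<open>Two paths of the labelled graph that have the same value in the group agree up to paths with the
  same label: the images of two components in the Cayley graph meet in a connected set.\<close>

lemma twogon_dg:
  "dg D al ph lb ps lv (A @ B) \<Longrightarrow> kp lb lv A v v' \<Longrightarrow> kp lb lv B u' u \<Longrightarrow> \<exists>w. rdd v w v' \<and> rdd u w u'"
proof (induction "mu D ph" arbitrary: D al ph lv A B v v' u u' rule: less_induct)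
  case less
  have IH: "\<exists>w. rdd a w a' \<and> rdd b w b'"
    if "A' @ B' = [] \<or> (\<exists>D' al' ph'. dg D' al' ph' lb ps lv' (A' @ B') \<and> mu D' ph' < mu D ph)"
      "kp lb lv' A' a a'" "kp lb lv' B' b' b" for A' B' a a' b b' lv'
    using that(1)
  proof
    assume "A' @ B' = []"
    thus ?thesis using that(2,3) by (intro exI[of _ "[]"]) auto
  next
    assume "\<exists>D' al' ph'. dg D' al' ph' lb ps lv' (A' @ B') \<and> mu D' ph' < mu D ph"
    thus ?thesis using less.hyps that(2,3) by blast
  qed
  \<comment> \<open>The case of an empty second side: the common word leads from \<open>a\<close> to
    \<open>a'\<close> and also from \<open>a\<close> to \<open>a\<close>.\<close>
  have loop: "a = a'" if "kp lb lv' X a a'"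
    "X = [] \<or> (\<exists>D' al' ph'. dg D' al' ph' lb ps lv' X \<and> mu D' ph' < mu D ph)" for X a a' lv'
  proof -
    have "\<exists>w. rdd a w a' \<and> rdd a w a" using IH[of X "[]" lv' a a' a a] that by auto
    thus ?thesis using rd_det by blast
  qed
  show ?case
  proof (rule ccontr)
    assume neg: "\<nexists>w. rdd v w v' \<and> rdd u w u'"
    note d = less.prems(1)
    let ?os = "A @ B"
    note M = dgD(6)[OF d] and P = dgD(1)[OF d]
    have ok: "inner_ok D ph lb lv ?os"
    proof (rule ccontr)
      assume "\<not> inner_ok D ph lb lv ?os"
      from simple_or_reduce[OF d this] obtain D' al' ph' where "dg D' al' ph' lb ps lv ?os" "mu D' ph' < mu D ph" by metis
      thus False using IH[of A B lv v v' u' u] less.prems(2,3) neg by blast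
    qed
    have R2: "\<forall>x\<in>D - set ?os. al x \<in> D - set ?os \<longrightarrow> \<not> vq (lv (ph x)) (lv (al x))"
    proof (intro ballI impI notI)
      fix x assume x: "x \<in> D - set ?os" "al x \<in> D - set ?os" and vq: "vq (lv (ph x)) (lv (al x))"
      obtain D' ph' lv' where D': "dg D' al ph' lb ps lv' ?os" "mu D' ph' < mu D ph" "\<forall>y\<in>set ?os. lv' y = lv y"
        by (rule inner_reduce[OF d ok x vq]) (use loop in blast)+
      have "kp lb lv' A v v'" "kp lb lv' B u' u"
        using less.prems(2,3) D'(3) by (auto elim!: kp_change)
      thus False using IH[of A B lv' v v' u' u] D'(1,2) neg by blast
    qed
    \<comment> \<open>stated for both orders of the two sides\<close>
    have R3: "\<not> vq (lv y) (lv (ph (al y)))"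
      if d: "dg D al ph lb ps lv (A @ B)" and kA: "kp lb lv A v v'" and kB: "kp lb lv B u' u"
        and neg: "\<nexists>w. rdd v w v' \<and> rdd u w u'" and y: "y \<in> set A" "al y \<notin> set (A @ B)" for A B v v' u u' y
    proof
      assume vq: "vq (lv y) (lv (ph (al y)))"
      have d': "dg D al ph lb ps lv ([] @ A @ B)" "al y \<notin> set ([] @ A @ B)" using d y by simp_all
      obtain A' lv' where A': "kp lb lv' A' v v'" "\<forall>x\<in>set [] \<union> set B. lv' x = lv x"
        "[] @ A' @ B = [] \<or> (\<exists>D' al' ph'. dg D' al' ph' lb ps lv' ([] @ A' @ B) \<and> mu D' ph' < mu D ph)"
        by (rule block_absorb[OF d'(1) kA y(1) d'(2) vq])
      have "kp lb lv' B u' u" using kB A'(2) by (auto elim!: kp_change)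
      thus False using IH[of A' B lv' v v' u' u] A'(1,3) neg by auto
    qed
    have R4: "al y \<notin> set (A @ B)"
      if d: "dg D al ph lb ps lv (A @ B)" and kA: "kp lb lv A v v'" and kB: "kp lb lv B u' u"
        and neg: "\<nexists>w. rdd v w v' \<and> rdd u w u'" and y: "y \<in> set A" for A B v v' u u' y
    proof
      assume a: "al y \<in> set (A @ B)"
      have yD: "y \<in> D" using y dgD(3)[OF d] by auto
      have lby: "lb (al y) = inv_letter (lb y)" using pdgD(3)[OF P yD] .
      show False
      proof (cases "al y \<in> set A")
        case True
        have d': "dg D al ph lb ps lv ([] @ A @ B)" using d by simp
        have lp: "z = z'" if "kp lb lv X z z'" "X \<noteq> []" "\<exists>D' ph'. dg D' al ph' lb ps lv X \<and> mu D' ph' < mu D ph" for X z z'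
          using loop[OF that(1)] that(3) by blast
        obtain A' where A': "kp lb lv A' v v'"
          "[] @ A' @ B = [] \<or> (\<exists>D' al' ph'. dg D' al' ph' lb ps lv ([] @ A' @ B) \<and> mu D' ph' < mu D ph)"
          by (rule block_cut[OF d' kA y True lp])
        thus False using IH[of A' B lv v v' u' u] kB neg by auto
      next
        case False
        hence yB: "al y \<in> set B" using a by simp
        obtain A1 A2 where A: "A = A1 @ y # A2" using y by (auto simp: in_set_conv_decomp)
        obtain B1 B2 where B: "B = B1 @ al y # B2" using yB by (auto simp: in_set_conv_decomp)
        obtain z where z: "kp lb lv A1 v (lv y)" "st (lv y) (lb y) z" "kp lb lv A2 z v'" using kA A kp_mid by blast
        obtain z2 where z2: "kp lb lv B1 u' (lv (al y))" "st (lv (al y)) (lb (al y)) z2" "kp lb lv B2 z2 u"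
          using kB B kp_mid by blast
        have d': "dg D al ph lb ps lv (A1 @ y # (A2 @ B1) @ al y # B2)" using d A B by simp
        note cut = cut_outer[OF d']
        \<comment> \<open>The edge cuts the two-sided polygon into two smaller ones. Induction gives
          a common word for each, and the letter of the edge joins them.\<close>
        have "\<exists>w. rdd z w v' \<and> rdd (lv (al y)) w u'"
          using IH[of A2 B1 lv z v' u' "lv (al y)"] z(3) z2(1) cut(2) by blast
        moreover have "\<exists>w. rdd v w (lv y) \<and> rdd u w z2"
          using IH[of A1 B2 lv v "lv y" z2 u] z(1) z2(3) cut(1) by blast
        ultimately obtain w1 w2 where w: "rdd z w1 v'" "rdd (lv (al y)) w1 u'" "rdd v w2 (lv y)" "rdd u w2 z2" by blast
        have "st z2 (lb y) (lv (al y))" using z2(2) lby st_inv by (metis inv_letter_inv(1))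
        hence "rdd u (w2 @ lb y # w1) u'" using w by (auto simp: rd_append)
        moreover have "rdd v (w2 @ lb y # w1) v'" using w z(2) by (auto simp: rd_append)
        ultimately show False using neg by blast
      qed
    qed
    have d2: "dg D al ph lb ps lv (B @ A)" using dg_rot[OF d] .
    have neg2: "\<nexists>w. rdd u' w u \<and> rdd v' w v" using neg rd_inv by blast
    have nm: "al y \<notin> set ?os" if "y \<in> set ?os" for y
      using R4[OF d less.prems(2,3) neg] R4[OF d2 less.prems(3,2) neg2] that by auto
    have nq: "\<not> vq (lv y) (lv (ph (al y)))" if "y \<in> set ?os" for y
      using R3[OF d less.prems(2,3) neg] R3[OF d2 less.prems(3,2) neg2] that nm[OF that] by auto
    \<comment> \<open>The lift of the outer path jumps at most at the two ends of the sides. A run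
      passes at most two marks, so it consists of at most three pieces.\<close>
    define mk where "mk z \<longleftrightarrow> al z = hd (A @ B) \<or> al z = hd (B @ A)" for z
    have cont: "\<exists>z. st (lv y) (lb y) z \<and> (ph y \<noteq> hd (A @ B) \<and> ph y \<noteq> hd (B @ A) \<longrightarrow> lv (ph y) = z)"
      if y: "y \<in> set ?os" for y
    proof -
      have c: "cyc ph (A @ B)" "cyc ph (B @ A)" using dgD(2)[OF d] dgD(2)[OF d2] by auto
      consider "y \<in> set A" | "y \<in> set B" using y by auto
      thus ?thesis
      proof cases
        case 1
        obtain z where z: "st (lv y) (lb y) z" "y \<noteq> last A \<Longrightarrow> lv (ph y) = z \<and> ph y \<in> set A"
          using kp_block[of ph "[]" A B lb lv v v' y] c less.prems(2) 1 by auto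
        have "ph y = hd (B @ A)" if "y = last A"
        proof -
          have "A = butlast A @ [y]" using 1 that by (metis append_butlast_last_id list.set_sel(1) empty_iff empty_set)
          hence "cyc ph (B @ butlast A @ [y])" "B @ A = B @ butlast A @ [y]" using c(2) by auto
          thus ?thesis using cyc_wrap[of ph "B @ butlast A" y] by simp
        qed
        thus ?thesis using z by blast
      next
        case 2
        obtain z where z: "st (lv y) (lb y) z" "y \<noteq> last B \<Longrightarrow> lv (ph y) = z \<and> ph y \<in> set B"
          using kp_block[of ph "[]" B A lb lv u' u y] c less.prems(3) 2 by auto
        have "ph y = hd (A @ B)" if "y = last B"
        proof -
          have "B = butlast B @ [y]" using 2 that by (metis append_butlast_last_id list.set_sel(1) empty_iff empty_set)
          hence "cyc ph (A @ butlast B @ [y])" "A @ B = A @ butlast B @ [y]" using c(1) by auto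
          thus ?thesis using cyc_wrap[of ph "A @ butlast B" y] by simp
        qed
        thus ?thesis using z by blast
      qed
    qed
    have face: "(\<Sum>x\<in>f. wgt al ph (D - set ?os) x) \<ge> 1" if fF: "f \<in> cls {ph} ` (D - set ?os)" for f
    proof -
      obtain x0 where x0: "x0 \<in> D - set ?os" "f = cls {ph} x0" using fF by blast
      have fI: "f \<subseteq> D - set ?os" using inner_closed(2)[OF d x0(1)] x0(2) by simp
      have ext: "6 * length zs \<le> 3 * (card f - 1)"
        if r: "run al ph zs" and sub: "set zs \<subseteq> f" and e: "al (hd zs) \<in> set ?os" for zs
      proof -
        have zI: "set zs \<subseteq> D - set ?os" using sub fI by blast
        note lk = run_link[OF d ok r zI]
        have alO: "\<forall>z\<in>set zs. al z \<in> set ?os" using run_outer[OF d ok r zI] e by blast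
        have "length zs \<le> (card f - 1) div 6 * Suc (card {z \<in> set (butlast zs). mk z})"
        proof (rule marks_length)
          show "distinct zs" "zs \<noteq> []" using r by (auto simp: run_def)
          fix A' B' C' assume zs: "zs = A' @ B' @ C'" and Bne: "B' \<noteq> []" and cl: "\<forall>b\<in>set (butlast B'). \<not> mk b"
          have rB: "run al ph B'" using r Bne zs by (auto simp: run_def successively_append_iff)
          have lkB: "successively (\<lambda>a b. ph (al b) = al a \<and> (al a \<in> set ?os \<longleftrightarrow> al b \<in> set ?os)) B'"
            using lk zs by (auto simp: successively_append_iff)
          have BI: "set B' \<subseteq> D - set ?os" "set B' \<subseteq> f" "\<forall>z\<in>set B'. al z \<in> set ?os" using zs zI sub alO by auto
          have c1: "\<exists>u. st (lv (al (hd B'))) (lb (al (hd B'))) u" using cont BI(3) Bne by (meson hd_in_set)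
          have c2: "successively (\<lambda>a b. st (lv (al b)) (lb (al b)) (lv (al a))) B'"
            using lkB BI(3) cl
          proof (induction B')
            case (Cons a B')
            show ?case
            proof (cases B')
              case C: (Cons b bs)
              have "ph (al b) = al a" "al b \<in> set ?os" "\<not> mk a" using Cons.prems C by auto
              hence "st (lv (al b)) (lb (al b)) (lv (al a))" using cont[of "al b"] by (auto simp: mk_def)
              thus ?thesis using Cons C by auto
            qed simp
          qed simp
          have lB: "last B' \<in> set B'" using Bne by simp
          hence "al (al (last B')) = last B'" using pmap_al_al[OF M] BI(1) by blast
          hence ne: "\<not> vq (lv (ph (last B'))) (lv (al (last B')))" using nq[of "al (last B')"] BI(3) lB vq_sym by metis
          have hB: "hd B' \<in> D - set ?os" "hd B' \<in> f" using BI Bne by (meson hd_in_set subsetD)+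
          have "cls {ph} (hd B') = f" using face_cls[OF d x0(1)] x0(2) hB(2) by blast
          hence "6 * length B' < card f" using run_piece[OF d ok rB hB(1) c1 c2 ne] by simp
          thus "length B' \<le> (card f - 1) div 6" by linarith
        qed
        also have "\<dots> \<le> (card f - 1) div 6 * 3"
        proof -
          have "card {z \<in> set (butlast zs). mk z} \<le> card {hd (A @ B), hd (B @ A)}"
          proof (rule card_inj_on_le[of al])
            have "inj_on al D" by (rule inj_onI) (metis pmap_al_al[OF M])
            moreover have "{z \<in> set (butlast zs). mk z} \<subseteq> D" using zI by (auto dest: in_set_butlastD)
            ultimately show "inj_on al {z \<in> set (butlast zs). mk z}" by (rule inj_on_subset)
            show "al ` {z \<in> set (butlast zs). mk z} \<subseteq> {hd (A @ B), hd (B @ A)}" by (auto simp: mk_def)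
          qed simp
          also have "\<dots> \<le> 2" by (simp add: card_insert_if)
          finally show ?thesis by (intro mult_le_mono2) simp
        qed
        finally show ?thesis by linarith
      qed
      note FC = face_count[OF d ok R2 x0, of "\<lambda>_. 3 * (card f - 1)", OF ext]
      let ?Ne = "card {x \<in> f. dgr al ph x \<noteq> 2 \<and> al x \<in> set ?os}"
      let ?Ni = "card {x \<in> f. dgr al ph x \<noteq> 2 \<and> al x \<notin> set ?os}"
      have "6 * card f \<le> ?Ni * (card f - 1) + ?Ne * (3 * (card f - 1))" using FC(5) FC(1) by (simp only: sum_constant) auto
      hence "6 * card f \<le> (?Ni + 3 * ?Ne) * (card f - 1)" by (simp add: algebra_simps)
      hence "?Ni + 3 * ?Ne \<ge> 7"
      proof -
        assume a: "6 * card f \<le> (?Ni + 3 * ?Ne) * (card f - 1)"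
        show ?thesis
        proof (rule ccontr)
          assume "\<not> ?Ni + 3 * ?Ne \<ge> 7"
          hence "(?Ni + 3 * ?Ne) * (card f - 1) \<le> 6 * (card f - 1)" by (intro mult_le_mono1) simp
          thus False using a FC(1) by linarith
        qed
      qed
      \<comment> \<open>These cases exhaust \<open>Ni + 3 * Ne \<ge> 7\<close>. The weight is at
        least 1 by \<open>Ne / 2\<close> in the first and by \<open>Ne / 3 + Ni / 6\<close> in the
        others. As there are no spurs, this contradicts total curvature at least 1.\<close>
      then consider "?Ne \<ge> 2" | "?Ne = 1" "?Ni \<ge> 4" | "?Ne = 0" "?Ni \<ge> 7" by linarith
      thus ?thesis using FC(2,3) by cases auto
    qed
    have "{x \<in> set ?os. ph (al x) = x} = {}" using spur_matched[OF d] nm by blast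
    hence "(\<Sum>f\<in>cls {ph} ` (D - set ?os). 1 - (\<Sum>x\<in>f. wgt al ph (D - set ?os) x)) \<ge> 1"
      using dg_curvature[OF d ok] by (simp only:) simp
    moreover have "(\<Sum>f\<in>cls {ph} ` (D - set ?os). 1 - (\<Sum>x\<in>f. wgt al ph (D - set ?os) x)) \<le> 0"
      by (rule sum_nonpos) (use face in auto)
    ultimately show False by linarith
  qed
qed

theorem twogon:
  assumes "rdd v p v'" "rdd u p' u'" "p \<approx> p'"
  shows "\<exists>w. rdd v w v' \<and> rdd u w u'"
proof (cases "p @ inv_word p' = []")
  case True
  hence "p = []" "p' = []" by (auto simp: inv_word_def)
  thus ?thesis using assms by (intro exI[of _ "[]"]) auto
next
  case False
  have "p @ inv_word p' \<approx> p' @ inv_word p'" using eq_app[OF assms(3) eq_refl] rd_words[OF assms(2)] by simp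
  also have "p' @ inv_word p' \<approx> []" using eq_inv_right rd_words[OF assms(2)] by blast
  finally obtain D al ph lb ps lv os where d: "dg D al ph lb ps lv os" and os: "map lb os = p @ inv_word p'"
    using diagram_exists[OF _ False] by metis
  obtain A B where AB: "os = A @ B" "map lb A = p" "map lb B = inv_word p'"
    using iffD1[OF map_eq_append_conv os] by metis
  have dis: "distinct (A @ B)" using dgD(2)[OF d] AB by (simp add: cyc_def)
  obtain g where g: "kp lb g A v v'" "\<forall>x. x \<notin> set A \<longrightarrow> g x = lv x"
    using assign_lift[of v lb A v' lv] assms(1) AB dis by auto
  have "rdd u' (map lb B) u" using rd_inv[OF assms(2)] AB by simp
  then obtain h where h: "kp lb h B u' u" "\<forall>x. x \<notin> set B \<longrightarrow> h x = g x"
    using assign_lift[of u' lb B u g] dis by auto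
  have "kp lb h A v v'" using g(1) by (rule kp_change) (use h(2) dis in auto)
  moreover have "dg D al ph lb ps h (A @ B)"
  proof -
    have "h x = lv x" if "x \<notin> set (A @ B)" for x using that g(2) h(2) by auto
    moreover have "ph x \<in> D - set os" if "x \<in> D - set os" for x using inner_closed(1)[OF d that] .
    ultimately show ?thesis using d AB(1) unfolding dg_def by auto
  qed
  ultimately show ?thesis using twogon_dg h(1) by blast
qed

end

section \<open>Contiguous segments of cyclic lists and of concatenations\<close>

lemma cyc_contig:
  assumes c: "cyc ph os" and ys: "ys \<noteq> []" "distinct ys" "successively (\<lambda>a b. b = ph a) ys"
    and sub: "set ys \<subseteq> set os" and h: "hd os \<notin> set (tl ys)"
  shows "\<exists>P Q. os = P @ ys @ Q"
proof -
  have "hd ys \<in> set os" using sub ys(1) by (meson hd_in_set subsetD)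
  then obtain P R where os: "os = P @ hd ys # R" by (auto simp: in_set_conv_decomp)
  hence "cyc ph ((hd ys # R) @ P)" using cyc_rot[of ph P "hd ys # R"] c by simp
  then obtain r where r: "(hd ys # R) @ P = ys @ r" using run_prefix[OF ys(1,2,3), of "(hd ys # R) @ P"] by auto
  obtain us where "hd ys # R = ys @ us \<or> (hd ys # R) @ us = ys \<and> P = us @ r"
    using iffD1[OF append_eq_append_conv2 r] by blast
  then consider us where "hd ys # R = ys @ us" | us where "(hd ys # R) @ us = ys" "P = us @ r"
    by blast
  thus ?thesis
  proof cases
    case 1
    thus ?thesis using os by auto
  next
    case 2
    have "us = []"
    proof (rule ccontr)
      assume "us \<noteq> []"
      hence "hd os = hd us" "hd us \<in> set us" using 2 os by auto
      moreover have "tl ys = R @ us" using 2(1) by (metis append_Cons list.sel(3))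
      ultimately show False using h by auto
    qed
    hence "os = P @ ys @ []" using os 2 by simp
    thus ?thesis by blast
  qed
qed

text \<open>If the segment began and ended in lists that are not neighbours, a list strictly between
  them would be contained in it as a whole.\<close>

lemma concat_contig:
  assumes "concat bs = P @ ys @ Q"
    and full: "\<And>m Y1 Y2. 0 < m \<Longrightarrow> Suc m < length bs \<Longrightarrow> ys \<noteq> Y1 @ bs ! m @ Y2"
  shows "\<exists>y1 y2 p q A B A' B'. ys = y1 @ y2 \<and> (y1 = [] \<or> p \<in> set bs \<and> p = A @ y1 @ B) \<and> (y2 = [] \<or> q \<in> set bs \<and> q = A' @ y2 @ B')"
proof (cases "bs = []")
  case True thus ?thesis using assms(1) by (intro exI[of _ "[]"]) auto
next
  case False
  then obtain B1 p1 p2 B2 where 1: "bs = B1 @ (p1 @ p2) # B2" "ys @ Q = p2 @ concat B2"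
    using assms(1) concat_eq_append_conv[of bs P "ys @ Q"] by auto
  have inb: "p1 @ p2 \<in> set bs" using 1 by simp
  from 1(2) consider us where "p2 = ys @ us" | us where "ys = p2 @ us" "us @ Q = concat B2"
    by (auto simp: append_eq_append_conv2)
  thus ?thesis
  proof cases
    case a: 1
    have "ys = ys @ []" "p1 @ p2 = p1 @ ys @ us" using a by auto
    thus ?thesis using inb by blast
  next
    case 2
    show ?thesis
    proof (cases "B2 = []")
      case True
      hence "ys = p2 @ []" "p1 @ p2 = p1 @ p2 @ []" using 2 by auto
      thus ?thesis using inb by blast
    next
      case B2: False
      then obtain B3 q1 q2 B4 where 3: "B2 = B3 @ (q1 @ q2) # B4" "us = concat B3 @ q1"
        using 2(2) concat_eq_append_conv[of B2 us Q] by auto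
      show ?thesis
      proof (cases B3)
        case Nil
        hence "ys = p2 @ q1" "p1 @ p2 = p1 @ p2 @ []" "q1 @ q2 = [] @ q1 @ q2" "q1 @ q2 \<in> set bs"
          using 2 3 1 by auto
        thus ?thesis using inb by blast
      next
        case (Cons c B5)
        have "bs ! Suc (length B1) = c" using 1 3 Cons by (simp add: nth_append)
        moreover have "Suc (Suc (length B1)) < length bs" using 1 3 Cons by simp
        moreover have "ys = p2 @ c @ (concat B5 @ q1)" using 2 3 Cons by simp
        ultimately have False using full[of "Suc (length B1)" p2 "concat B5 @ q1"] by simp
        thus ?thesis ..
      qed
    qed
  qed
qed

lemma concat_upd:
  "i < length oss \<Longrightarrow> concat (oss[i := p]) = concat (take i oss) @ p @ concat (drop (Suc i) oss)"
  by (simp add: upd_conv_take_nth_drop)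

lemma concat_nth:
  "i < length oss \<Longrightarrow> concat oss = concat (take i oss) @ oss ! i @ concat (drop (Suc i) oss)"
  using concat_upd[of i oss "oss ! i"] by simp

lemma concat_upd2:
  assumes "Suc i < length oss"
  shows "concat (oss[i := p, Suc i := q]) = concat (take i oss) @ p @ q @ concat (drop (Suc (Suc i)) oss)"
    "concat oss = concat (take i oss) @ oss ! i @ oss ! Suc i @ concat (drop (Suc (Suc i)) oss)"
proof -
  have 1: "concat (xs[i := p, Suc i := q]) = concat (take i xs) @ p @ q @ concat (drop (Suc (Suc i)) xs)"
    if "Suc i < length xs" for xs :: "'a list list" and p q
    using that
  proof (induction i arbitrary: xs)
    case 0 thus ?case by (cases xs; cases "tl xs"; auto)
  next
    case (Suc i) thus ?case by (cases xs) auto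
  qed
  show "concat (oss[i := p, Suc i := q]) = concat (take i oss) @ p @ q @ concat (drop (Suc (Suc i)) oss)"
    using 1 assms .
  show "concat oss = concat (take i oss) @ oss ! i @ oss ! Suc i @ concat (drop (Suc (Suc i)) oss)"
    using 1[OF assms, of "oss ! i" "oss ! Suc i"] by simp
qed

subsection \<open>Chains of blocks\<close>

text \<open>The word \<open>u j\<close> is read from \<open>a j\<close> to \<open>b j\<close>, and in the Cayley graph the lift of block \<open>j\<close> ends where that of
  block \<open>Suc j\<close> starts. By \<open>no_short\<close>, a block remains nontrivial, and is not a piece, if initial and
  final segments that it shares with its neighbours are removed.\<close>

locale chain = scg +
  fixes a b :: "nat \<Rightarrow> 'a" and u :: "nat \<Rightarrow> ('b \<times> bool) list"
  assumes ub: "rdd (a j) (u j) (b j)"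
    and no_short: "\<lbrakk>rdd (b j) w1 x0; rdd (a (Suc j)) w1 x1; rdd x1 w2 x2; w2 = [] \<or> (\<exists>y1 y2. \<not> vq x1 y1 \<and> rdd y1 w2 y2);
       rdd (b (Suc j)) w3 x2; rdd (a (Suc (Suc j))) w3 x3\<rbrakk> \<Longrightarrow> False"
begin

text \<open>At the junction after block \<open>j\<close> the vertices \<open>x\<close> and
  \<open>y\<close> lie over the same point of the Cayley graph: one word leads to them from
  \<open>b j\<close> and from \<open>a (Suc j)\<close>.\<close>

definition jn :: "nat \<Rightarrow> 'a \<Rightarrow> 'a \<Rightarrow> bool" where
  "jn j x y \<longleftrightarrow> (\<exists>w. rdd (b j) w x \<and> rdd (a (Suc j)) w y)"

text \<open>The side of a diagram that carries the blocks \<open>s\<close>, \<open>s + 1\<close>, \<dots>, possibly shortened at the junctions.\<close>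

definition chainp where
  "chainp lb lv s oss e x \<longleftrightarrow> (\<forall>i<length oss. kp lb lv (oss ! i) (e i) (x i)) \<and>
     (\<forall>i. Suc i < length oss \<longrightarrow> jn (s + i) (x i) (e (Suc i)))"

lemma chainpD:
  assumes "chainp lb lv s oss e x"
  shows "i < length oss \<Longrightarrow> kp lb lv (oss ! i) (e i) (x i)" "Suc i < length oss \<Longrightarrow> jn (s + i) (x i) (e (Suc i))"
  using assms by (auto simp: chainp_def)

text \<open>The words at the two junctions of block \<open>i\<close> are the segments that
  \<open>no_short\<close> allows to be removed. The first and the last block have only one junction,
  so nothing is claimed about them.\<close>

lemma chain_no_short:
  assumes c: "chainp lb lv s oss e x" and i: "0 < i" "Suc i < length oss"
    and p: "oss ! i = [] \<or> (\<exists>y1 y2. \<not> vq (e i) y1 \<and> rdd y1 (map lb (oss ! i)) y2)"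
  shows False
proof -
  obtain i' where i': "i = Suc i'" using i(1) by (cases i) auto
  obtain w1 where w1: "rdd (b (s + i')) w1 (x i')" "rdd (a (Suc (s + i'))) w1 (e i)"
    using chainpD(2)[OF c, of i'] i i' by (auto simp: jn_def)
  obtain w3 where w3: "rdd (b (s + i)) w3 (x i)" "rdd (a (Suc (s + i))) w3 (e (Suc i))"
    using chainpD(2)[OF c, of i] i by (auto simp: jn_def)
  have "rdd (e i) (map lb (oss ! i)) (x i)" using chainpD(1)[OF c, of i] i kp_rd by auto
  thus False using no_short[of "s + i'" w1 "x i'" "e i" "map lb (oss ! i)" "x i" w3] w1 w3 p i' by auto
qed

lemma chain_mid_ne:
  assumes "chainp lb lv s oss e x" "0 < i" "Suc i < length oss"
  shows "oss ! i \<noteq> []"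
  using chain_no_short[OF assms] by blast

lemma chain_ne:
  assumes "chainp lb lv s oss e x" "length oss \<ge> 3"
  shows "concat oss \<noteq> []"
proof -
  have "oss ! 1 \<noteq> []" "oss ! 1 \<in> set oss" using chain_mid_ne[OF assms(1), of 1] assms(2) by (auto intro!: nth_mem)
  thus ?thesis by auto
qed

text \<open>None of the reductions applies. Edges shared by blocks at distance at least two are
  tolerated here, since cutting along one of them leads to a closed chain, which is excluded
  separately.\<close>

definition cgood where
  "cgood D al ph lb lv os oss \<longleftrightarrow> inner_ok D ph lb lv os \<and>
     (\<forall>x\<in>D - set os. al x \<in> D - set os \<longrightarrow> \<not> vq (lv (ph x)) (lv (al x))) \<and>
     (\<forall>y\<in>set (concat oss). al y \<notin> set os \<longrightarrow> \<not> vq (lv y) (lv (ph (al y)))) \<and>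
     (\<forall>i<length oss. \<forall>j<length oss. \<forall>y\<in>set (oss ! i). al y \<in> set (oss ! j) \<longrightarrow> i + 2 \<le> j \<or> j + 2 \<le> i)"

lemma dg_outer_trivial:
  assumes d: "dg D al ph lb ps lv os" shows "map lb os \<approx> []"
proof -
  note P = dgD(1)[OF d]
  have ne: "os \<noteq> []" using dgD(2)[OF d] by (simp add: cyc_def)
  have m: "map ph os = tl os @ [hd os]" using dgD(2)[OF d] by (cases os) (auto simp: cyc_def)
  have "ps (hd os) \<approx> ps (hd os) @ map lb os"
    by (rule path_ps[OF _ m ne]) (use pdgD(6)[OF P] dgD(3)[OF d] in blast)
  hence "ps (hd os) @ map lb os \<approx> ps (hd os) @ []" using eq_sym by simp
  thus ?thesis by (rule eq_cancel_left)
qed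

text \<open>Components embed into the Cayley graph; this is \<open>twogon\<close> with an empty
  second path.\<close>

lemma loop_closed: "rdd v w v' \<Longrightarrow> w \<approx> [] \<Longrightarrow> v = v'"
  using twogon[of v w v' v "[]" v] rd_det by auto

text \<open>Each clause of \<open>cgood\<close> that fails offers a reduction. By
  \<open>no_short\<close> the middle blocks never become empty, so an outer face always remains. The
  two outermost ends of the lift are preserved, so that the reduced chain can still be compared with
  the original word.\<close>

lemma chain_reduce:
  assumes d: "dg D al ph lb ps lv (concat oss @ gs)" and c: "chainp lb lv s oss e x" and k: "length oss \<ge> 3"
    and ng: "\<not> cgood D al ph lb lv (concat oss @ gs) oss"
  obtains D' al' ph' lv' oss' e' x' where "dg D' al' ph' lb ps lv' (concat oss' @ gs)" "chainp lb lv' s oss' e' x'"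
    "length oss' = length oss" "e' 0 = e 0" "x' (length oss - 1) = x (length oss - 1)" "mu D' ph' < mu D ph"
proof -
  let ?os = "concat oss @ gs"
  let ?goal = "\<exists>D' al' ph' lv' oss' e' x'. dg D' al' ph' lb ps lv' (concat oss' @ gs) \<and> chainp lb lv' s oss' e' x' \<and>
    length oss' = length oss \<and> e' 0 = e 0 \<and> x' (length oss - 1) = x (length oss - 1) \<and> mu D' ph' < mu D ph"
  note M = dgD(6)[OF d] and P = dgD(1)[OF d]
  have kpi: "kp lb lv (oss ! i) (e i) (x i)" if "i < length oss" for i using chainpD(1)[OF c that] .
  have chg: "chainp lb lv' s oss e x" if "\<forall>y\<in>set ?os. lv' y = lv y" for lv'
    unfolding chainp_def
  proof (intro conjI allI impI)
    fix i assume i: "i < length oss"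
    have "set (oss ! i) \<subseteq> set ?os" using i by (auto intro!: bexI[of _ "oss ! i"])
    thus "kp lb lv' (oss ! i) (e i) (x i)" using kpi[OF i] that by (auto elim!: kp_change)
  qed (use chainpD(2)[OF c] in blast)
  have ?goal
  proof (cases "inner_ok D ph lb lv ?os")
    case False
    from simple_or_reduce[OF d this] obtain D' al' ph' where "dg D' al' ph' lb ps lv ?os" "mu D' ph' < mu D ph" by metis
    thus ?thesis using c by blast
  next
    case ok: True
    show ?thesis
    proof (cases "\<exists>y\<in>D - set ?os. al y \<in> D - set ?os \<and> vq (lv (ph y)) (lv (al y))")
      case True
      then obtain y where y: "y \<in> D - set ?os" "al y \<in> D - set ?os" "vq (lv (ph y)) (lv (al y))" by blast
      obtain D' ph' lv' where D': "dg D' al ph' lb ps lv' ?os" "mu D' ph' < mu D ph" "\<forall>y\<in>set ?os. lv' y = lv y"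
      proof (rule inner_reduce[OF d ok y])
        fix X v v' assume "kp lb lv X v v'" "\<exists>D' ph'. dg D' al ph' lb ps lv X \<and> mu D' ph' < mu D ph"
        thus "v = v'" using dg_outer_trivial kp_rd loop_closed by blast
      qed blast
      thus ?thesis using chg by blast
    next
      case R2: False
      show ?thesis
      proof (cases "\<exists>y\<in>set (concat oss). al y \<notin> set ?os \<and> vq (lv y) (lv (ph (al y)))")
        case True
        then obtain y i where i: "i < length oss" "y \<in> set (oss ! i)" and y: "al y \<notin> set ?os" "vq (lv y) (lv (ph (al y)))"
          by (auto simp: in_set_conv_nth) (metis nth_mem)
        let ?L = "concat (take i oss)" and ?Rr = "concat (drop (Suc i) oss) @ gs"
        have os: "?os = ?L @ oss ! i @ ?Rr" using concat_nth[OF i(1)] by simp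
        have y': "al y \<notin> set (?L @ oss ! i @ ?Rr)" using y(1) unfolding os .
        have inos: "set (oss ! j) \<subseteq> set ?L \<union> set ?Rr" if j: "j < length oss" "j \<noteq> i" for j
        proof -
          have "oss ! j \<in> set (take i oss) \<or> oss ! j \<in> set (drop (Suc i) oss)"
          proof (cases "j < i")
            case True
            hence "oss ! j = take i oss ! j" "j < length (take i oss)" using i j by auto
            thus ?thesis by (metis nth_mem)
          next
            case False
            hence "oss ! j = drop (Suc i) oss ! (j - Suc i)" "j - Suc i < length (drop (Suc i) oss)" using i j by auto
            thus ?thesis by (metis nth_mem)
          qed
          thus ?thesis by auto
        qed
        obtain C' lv' where C': "kp lb lv' C' (e i) (x i)" "\<forall>x\<in>set ?L \<union> set ?Rr. lv' x = lv x"
          "?L @ C' @ ?Rr = [] \<or> (\<exists>D' al' ph'. dg D' al' ph' lb ps lv' (?L @ C' @ ?Rr) \<and> mu D' ph' < mu D ph)"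
          by (rule block_absorb[OF d[unfolded os] kpi[OF i(1)] i(2) y' y(2)])
        have chn: "chainp lb lv' s (oss[i := C']) e x"
          unfolding chainp_def
        proof (intro conjI allI impI)
          fix j assume j: "j < length (oss[i := C'])"
          show "kp lb lv' (oss[i := C'] ! j) (e j) (x j)"
          proof (cases "j = i")
            case False
            hence "kp lb lv' (oss ! j) (e j) (x j)" using kpi[of j] inos[of j] j C'(2) by (auto elim!: kp_change)
            thus ?thesis using False by simp
          qed (use C'(1) i(1) in simp)
        qed (use chainpD(2)[OF c] in auto)
        have cc: "concat (oss[i := C']) @ gs = ?L @ C' @ ?Rr" using concat_upd[OF i(1)] by simp
        have "?L @ C' @ ?Rr \<noteq> []" using chain_ne[OF chn] k cc by (metis append_is_Nil_conv length_list_update)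
        thus ?thesis using C'(3) chn cc by (metis length_list_update)
      next
        case R3: False
        then obtain i j y where ij: "i < length oss" "j < length oss" "y \<in> set (oss ! i)" "al y \<in> set (oss ! j)"
          "\<not> (i + 2 \<le> j \<or> j + 2 \<le> i)" using ng ok R2 unfolding cgood_def by blast
        have sub: "set (oss ! i) \<subseteq> D" if "i < length oss" for i
          using dgD(3)[OF d] nth_mem[OF that] by auto
        have yD: "y \<in> D" using sub ij by blast
        consider "i = j" | "j = Suc i" | "i = Suc j" using ij(5) by linarith
        then consider "i = j" | i j y where "i < length oss" "j = Suc i" "j < length oss" "y \<in> set (oss ! i)" "al y \<in> set (oss ! j)" "y \<in> D"
        proof cases
          case 3
          thus thesis using that(2)[of j i "al y"] ij yD pmap_al[OF M yD] pmap_al_al[OF M yD] by auto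
        qed (use ij yD that in blast)+
        thus ?thesis
        proof cases
          case 1
          let ?L = "concat (take i oss)" and ?Rr = "concat (drop (Suc i) oss) @ gs"
          have os: "?os = ?L @ oss ! i @ ?Rr" using concat_nth[OF ij(1)] by simp
          have y': "y \<in> set (oss ! i)" "al y \<in> set (oss ! i)" using ij 1 by auto
          have lp: "z = z'" if "kp lb lv X z z'" "X \<noteq> []" "\<exists>D' ph'. dg D' al ph' lb ps lv X \<and> mu D' ph' < mu D ph" for X z z'
            using loop_closed[OF kp_rd[OF that(1)]] that(3) dg_outer_trivial by blast
          obtain C' where C': "kp lb lv C' (e i) (x i)"
            "?L @ C' @ ?Rr = [] \<or> (\<exists>D' al' ph'. dg D' al' ph' lb ps lv (?L @ C' @ ?Rr) \<and> mu D' ph' < mu D ph)"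
            by (rule block_cut[OF d[unfolded os] kpi[OF ij(1)] y' lp])
          have chn: "chainp lb lv s (oss[i := C']) e x"
            unfolding chainp_def using ij(1) C'(1) kpi chainpD(2)[OF c] by (auto simp: nth_list_update)
          have cc: "concat (oss[i := C']) @ gs = ?L @ C' @ ?Rr" using concat_upd[OF ij(1)] by simp
          have "?L @ C' @ ?Rr \<noteq> []" using chain_ne[OF chn] k cc by (metis append_is_Nil_conv length_list_update)
          thus ?thesis using C'(2) chn cc by (metis length_list_update)
        next
          case (2 i j y)
          note ij = 2
          have yD: "y \<in> D" using ij by simp
          have i1: "Suc i < length oss" using ij by simp
          obtain A B1 where A: "oss ! i = A @ y # B1" using ij by (auto simp: in_set_conv_decomp)
          obtain B2 C where C: "oss ! Suc i = B2 @ al y # C" using ij by (auto simp: in_set_conv_decomp)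
          let ?L = "concat (take i oss)" and ?Rr = "concat (drop (Suc (Suc i)) oss)"
          have os: "?os = (?L @ A) @ y # (B1 @ B2) @ al y # (C @ ?Rr @ gs)" using concat_upd2(2)[OF i1] A C by simp
          have d': "dg D al ph lb ps lv ((?L @ A) @ y # (B1 @ B2) @ al y # (C @ ?Rr @ gs))" using d os by simp
          note cut = cut_outer[OF d']
          obtain z where z: "kp lb lv A (e i) (lv y)" "st (lv y) (lb y) z" "kp lb lv B1 z (x i)"
            using kpi[OF ij(1)] A kp_mid by metis
          obtain z2 where z2: "kp lb lv B2 (e (Suc i)) (lv (al y))" "st (lv (al y)) (lb (al y)) z2" "kp lb lv C z2 (x (Suc i))"
            using kpi[OF i1] C kp_mid by metis
          obtain w where w: "rdd (b (s + i)) w (x i)" "rdd (a (Suc (s + i))) w (e (Suc i))"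
            using chainpD(2)[OF c i1] by (auto simp: jn_def)
          \<comment> \<open>Two neighbouring blocks share the edge \<open>y\<close>. What lies
            between its two traversals is trivial in the group, but its halves are read in different
            lifts. \<open>twogon\<close> turns the old junction word, continued along these halves
            and across the edge, into one common word, so the junction moves back over the
            edge.\<close>
          have tr: "map lb B1 @ map lb B2 \<approx> []"
          proof (cases "B1 @ B2 = []")
            case True thus ?thesis by (simp add: eq_refl)
          next
            case False thus ?thesis using cut(2)[OF False] dg_outer_trivial by fastforce
          qed
          have "map lb B1 \<approx> inv_word (map lb B2)" using eq_inv_move[OF tr] by simp
          hence e1: "inv_word (map lb B1) \<approx> map lb B2" using eq_inv by fastforce
          have r1: "rdd (b (s + i)) (w @ inv_word (map lb B1) @ [inv_letter (lb y)]) (lv y)"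
            using w(1) rd_inv[OF kp_rd[OF z(3)]] st_inv[OF z(2)] by (auto simp: rd_append)
          have r2: "rdd (a (Suc (s + i))) (w @ map lb B2 @ [inv_letter (lb y)]) z2"
            using w(2) kp_rd[OF z2(1)] z2(2) pdgD(3)[OF P yD] by (auto simp: rd_append)
          have "w @ inv_word (map lb B1) @ [inv_letter (lb y)] \<approx> w @ map lb B2 @ [inv_letter (lb y)]"
            by (rule eq_ctx[OF e1]) (use rd_words[OF w(1)] pdgD(4)[OF P yD] in auto)
          from twogon[OF r1 r2 this] have J: "jn (s + i) (lv y) z2" by (auto simp: jn_def)
          let ?oss = "oss[i := A, Suc i := C]"
          let ?x = "x(i := lv y)" and ?e = "e(Suc i := z2)"
          have chn: "chainp lb lv s ?oss ?e ?x"
            unfolding chainp_def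
          proof (intro conjI allI impI)
            fix j assume "j < length ?oss"
            thus "kp lb lv (?oss ! j) (?e j) (?x j)"
              using kpi[of j] z(1) z2(3) ij i1 by (auto simp: nth_list_update)
          next
            fix j assume "Suc j < length ?oss"
            thus "jn (s + j) (?x j) (?e (Suc j))" using chainpD(2)[OF c, of j] J by auto
          qed
          have cc: "concat ?oss @ gs = (?L @ A) @ (C @ ?Rr @ gs)" using concat_upd2(1)[OF i1] by simp
          have "concat ?oss \<noteq> []" using chain_ne[OF chn] k by simp
          hence "(?L @ A) @ (C @ ?Rr @ gs) \<noteq> []" using cc by (metis append_is_Nil_conv)
          from cut(1)[OF this] obtain D' ph' where D': "dg D' al ph' lb ps lv (concat ?oss @ gs)" "mu D' ph' < mu D ph"
            unfolding cc by blast
          have "?e 0 = e 0" "?x (length oss - 1) = x (length oss - 1)" "length ?oss = length oss" using i1 by auto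
          thus ?thesis using D' chn by blast
        qed
      qed
    qed
  qed
  thus ?thesis using that by blast
qed

end

context chain
begin

text \<open>The edge is a bridge, and what lies between its traversals is a shorter chain that
  bounds a diagram alone. Distance at least two leaves a whole block in the middle, hence the length
  at least 3.\<close>

lemma matched_sub:
  assumes d: "dg D al ph lb ps lv (concat oss @ gs)" and c: "chainp lb lv s oss e x"
    and ij: "i + 2 \<le> j" "j < length oss" "y \<in> set (oss ! i)" "al y \<in> set (oss ! j)"
  shows "\<exists>D' ph' oss' s' e' x'. dg D' al ph' lb ps lv (concat oss') \<and> chainp lb lv s' oss' e' x' \<and> length oss' \<ge> 3 \<and> mu D' ph' < mu D ph"
proof -
  obtain A B1 where A: "oss ! i = A @ y # B1" using ij by (auto simp: in_set_conv_decomp)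
  obtain B2 C where C: "oss ! j = B2 @ al y # C" using ij by (auto simp: in_set_conv_decomp)
  define mid where "mid = map (\<lambda>k. oss ! (i + Suc k)) [0..<j - Suc i]"
  define oss' where "oss' = B1 # mid @ [B2]"
  have lm: "length mid = j - Suc i" by (simp add: mid_def)
  have li: "i < length oss" using ij by simp
  obtain z where z: "kp lb lv A (e i) (lv y)" "st (lv y) (lb y) z" "kp lb lv B1 z (x i)"
    using chainpD(1)[OF c li] A kp_mid by metis
  obtain z2 where z2: "kp lb lv B2 (e j) (lv (al y))" "st (lv (al y)) (lb (al y)) z2" "kp lb lv C z2 (x j)"
    using chainpD(1)[OF c ij(2)] C kp_mid by metis
  let ?e = "\<lambda>k. if k = 0 then z else e (i + k)" and ?x = "\<lambda>k. if k = j - i then lv (al y) else x (i + k)"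
  have nth: "oss' ! k = (if k = 0 then B1 else if k < j - i then oss ! (i + k) else B2)" if "k \<le> j - i" for k
  proof (cases k)
    case (Suc k')
    have "oss' ! k = (mid @ [B2]) ! k'" using Suc by (simp add: oss'_def)
    also have "\<dots> = (if k' < j - Suc i then mid ! k' else B2)" using that Suc lm by (auto simp: nth_append)
    finally show ?thesis using Suc by (auto simp: mid_def)
  qed (simp add: oss'_def)
  have len: "length oss' = Suc (j - i)" using lm ij by (simp add: oss'_def)
  have chn: "chainp lb lv (s + i) oss' ?e ?x"
    unfolding chainp_def
  proof (intro conjI allI impI)
    fix k assume k: "k < length oss'"
    show "kp lb lv (oss' ! k) (?e k) (?x k)"
      using nth[of k] k len ij z(3) z2(1) chainpD(1)[OF c, of "i + k"] by auto
  next
    fix k assume k: "Suc k < length oss'"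
    thus "jn (s + i + k) (?x k) (?e (Suc k))" using chainpD(2)[OF c, of "i + k"] len ij by (auto simp: add.assoc)
  qed
  have drop: "concat (drop i oss) = oss ! i @ concat mid @ oss ! j @ concat (drop (Suc j) oss)"
  proof -
    have "drop i oss = oss ! i # drop (Suc i) oss" using li by (simp add: Cons_nth_drop_Suc)
    moreover have "drop (Suc i) oss = take (j - Suc i) (drop (Suc i) oss) @ drop j oss"
      using ij append_take_drop_id[of "j - Suc i" "drop (Suc i) oss"] by simp
    moreover have "take (j - Suc i) (drop (Suc i) oss) = mid"
      using ij by (intro nth_equalityI) (auto simp: mid_def)
    moreover have "drop j oss = oss ! j # drop (Suc j) oss" using ij by (simp add: Cons_nth_drop_Suc)
    ultimately show ?thesis by simp
  qed
  have "concat oss = concat (take i oss) @ concat (drop i oss)" by (simp flip: concat_append)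
  hence os: "concat oss @ gs = (concat (take i oss) @ A) @ y # concat oss' @ al y # (C @ concat (drop (Suc j) oss) @ gs)"
    unfolding drop A C by (simp add: oss'_def)
  have l3: "length oss' \<ge> 3" using len ij by simp
  have ne: "concat oss' \<noteq> []" using chain_ne[OF chn l3] .
  have "dg D al ph lb ps lv ((concat (take i oss) @ A) @ y # concat oss' @ al y # (C @ concat (drop (Suc j) oss) @ gs))"
    using d os by simp
  from cut_outer(2)[OF this ne] obtain D' ph' where "dg D' al ph' lb ps lv (concat oss')" "mu D' ph' < mu D ph" by blast
  thus ?thesis using chn l3 by blast
qed

end

section \<open>Reduced diagrams with a chain on the boundary\<close>

locale chain_diagram = chain +
  fixes D al ph lb ps lv s oss e x gs
  assumes d: "dg D al ph lb ps lv (concat oss @ gs)" and ch: "chainp lb lv s oss e x"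
    and good: "cgood D al ph lb lv (concat oss @ gs) oss" and k3: "length oss \<ge> 3"
begin

abbreviation "os \<equiv> concat oss @ gs"
abbreviation "inn \<equiv> D - set os"

lemmas M = dgD(6)[OF d] and P = dgD(1)[OF d] and cyco = dgD(2)[OF d]

lemma ok: "inner_ok D ph lb lv os"
  and R2: "\<forall>x\<in>inn. al x \<in> inn \<longrightarrow> \<not> vq (lv (ph x)) (lv (al x))"
  and R3: "y \<in> set (concat oss) \<Longrightarrow> al y \<notin> set os \<Longrightarrow> \<not> vq (lv y) (lv (ph (al y)))"
  using good by (auto simp: cgood_def)

lemma osD: "y \<in> set os \<Longrightarrow> y \<in> D" using dgD(3)[OF d] by blast

lemma dist_os: "distinct os" using cyco by (simp add: cyc_def)

lemma block_sub: "i < length oss \<Longrightarrow> set (oss ! i) \<subseteq> set (concat oss)" by (auto intro: nth_mem)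

lemma alal: "y \<in> D \<Longrightarrow> al (al y) = y" using pmap_al_al[OF M] .

lemma al_inj: "inj_on al D" by (rule inj_onI) (metis alal)

lemma lb_al: "y \<in> D \<Longrightarrow> lb (al y) = inv_letter (lb y)" using pdgD(3)[OF P] .

lemma al_step: "y \<in> D \<Longrightarrow> al y \<in> inn \<Longrightarrow> st (lv (ph (al y))) (lb y) (lv (al y))"
  using dgD(5)[OF d, of "al y"] lb_al st_inv by fastforce

lemma back_word:
  assumes "B \<noteq> []" "\<forall>y\<in>set B. y \<in> D \<and> al y \<in> inn" "successively (\<lambda>y y'. ph (al y') = al y) B"
  shows "rdd (lv (ph (al (hd B)))) (map lb B) (lv (al (last B)))"
  using assms
proof (induction B rule: list_nonempty_induct)
  case (single y) thus ?case using al_step by simp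
next
  case (cons y B)
  hence "rdd (lv (al y)) (map lb B) (lv (al (last B)))" by (cases B) auto
  moreover have "st (lv (ph (al y))) (lb y) (lv (al y))" using al_step cons by simp
  ultimately show ?case using cons.hyps by auto
qed

text \<open>The lift of a face behind the whole block would give a second reading of the block
  (\<open>back_word\<close>), from a vertex that is inequivalent by \<open>R3\<close>. The block
  would be a piece, against \<open>chain_no_short\<close>.\<close>

lemma full_block:
  assumes m: "0 < m" "Suc m < length oss" and i: "\<forall>y\<in>set (oss ! m). al y \<in> inn"
    and s: "successively (\<lambda>y y'. ph (al y') = al y) (oss ! m)"
  shows False
proof (rule chain_no_short[OF ch m])
  have ne: "oss ! m \<noteq> []" using chain_mid_ne[OF ch m] .
  hence h: "hd (oss ! m) \<in> set (oss ! m)" by simp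
  have sub: "set (oss ! m) \<subseteq> set (concat oss)" using m block_sub by simp
  have "kp lb lv (oss ! m) (e m) (x m)" using chainpD(1)[OF ch] m by simp
  hence "e m = lv (hd (oss ! m))" using ne by (cases "oss ! m") auto
  moreover have "\<not> vq (lv (hd (oss ! m))) (lv (ph (al (hd (oss ! m)))))" using R3 h sub i by blast
  moreover have "rdd (lv (ph (al (hd (oss ! m))))) (map lb (oss ! m)) (lv (al (last (oss ! m))))"
    by (rule back_word[OF ne _ s]) (use i sub osD in \<open>metis Un_iff set_append subsetD\<close>)
  ultimately show "oss ! m = [] \<or> (\<exists>y1 y2. \<not> vq (e m) y1 \<and> rdd y1 (map lb (oss ! m)) y2)" by auto
qed

lemma kp_rev_succ:
  "kp lb lv (rev (map al zs)) v v' \<Longrightarrow> successively (\<lambda>a b. st (lv (al b)) (lb (al b)) (lv (al a))) zs"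
proof (induction zs arbitrary: v')
  case (Cons a zs) thus ?case by (cases zs) (auto simp: kp_append)
qed simp

lemma piece_len:
  assumes r: "run al ph zs" and I: "set zs \<subseteq> inn" and i: "i < length oss" "oss ! i = A @ rev (map al zs) @ B"
  shows "6 * length zs < card (cls {ph} (hd zs))"
proof -
  have ne: "zs \<noteq> []" using r by (simp add: run_def)
  obtain v v' where k: "kp lb lv (rev (map al zs)) v v'" using chainpD(1)[OF ch i(1)] i(2) by (auto simp: kp_append)
  have hI: "hd zs \<in> inn" using I ne by (meson hd_in_set subsetD)
  have lI: "last zs \<in> inn" using I ne by (meson last_in_set subsetD)
  show ?thesis
  proof (rule run_piece[OF d ok r hI _ kp_rev_succ[OF k]])
    have "rev (map al zs) = rev (map al (tl zs)) @ al (hd zs) # []" using ne by (cases zs) auto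
    thus "\<exists>u. st (lv (al (hd zs))) (lb (al (hd zs))) u" using k by (auto simp: kp_append)
    have "al (last zs) \<in> set (oss ! i)" using i(2) ne by auto
    hence "al (last zs) \<in> set (concat oss)" using block_sub i(1) by blast
    moreover have "al (al (last zs)) = last zs" using alal lI by blast
    ultimately show "\<not> vq (lv (ph (last zs))) (lv (al (last zs)))"
      using R3[of "al (last zs)"] lI vq_sym by auto
  qed
qed

lemma run_rev_succ:
  assumes r: "run al ph zs" and I: "set zs \<subseteq> inn"
  shows "successively (\<lambda>a b. b = ph a) (rev (map al zs))"
proof -
  have "successively (\<lambda>a b. ph (al b) = al a) zs" by (rule successively_mono[OF run_link[OF d ok r I]]) simp
  hence "successively (\<lambda>a b. al a = ph (al b)) zs" by (rule successively_mono) simp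
  hence "successively (\<lambda>a b. a = ph b) (map al zs)" by (simp add: successively_map)
  thus ?thesis by (simp add: successively_rev)
qed

lemma run_contig:
  assumes r: "run al ph zs" and I: "set zs \<subseteq> inn" and o: "al ` set zs \<subseteq> set os" and h: "hd os \<notin> al ` set (butlast zs)"
  shows "\<exists>P Q. os = P @ rev (map al zs) @ Q"
proof (rule cyc_contig[OF cyco])
  have zs: "zs \<noteq> []" "distinct zs" using r by (auto simp: run_def)
  have "inj_on al (set zs)" using al_inj I by (meson Diff_subset inj_on_subset)
  thus "distinct (rev (map al zs))" using zs by (simp add: distinct_map)
  show "successively (\<lambda>a b. b = ph a) (rev (map al zs))" using run_rev_succ[OF r I] .
  have "tl (rev (map al zs)) = rev (map al (butlast zs))" using zs(1) by (cases zs rule: rev_cases) auto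
  thus "hd os \<notin> set (tl (rev (map al zs)))" using h by simp
qed (use r o in \<open>auto simp: run_def\<close>)

text \<open>By \<open>full_block\<close> the run contains no whole middle block, so by
  \<open>concat_contig\<close> it meets at most two blocks. The hypothesis \<open>h\<close> keeps it
  from passing the start of the list \<open>os\<close>, and the reversal is due to the opposite
  directions of a face and the outer path.\<close>

lemma two_pieces:
  assumes r: "run al ph zs" and I: "set zs \<subseteq> inn" and o: "al ` set zs \<subseteq> set (concat oss)" and h: "hd os \<notin> al ` set (butlast zs)"
  shows "\<exists>z1 z2 i j A B A' B'. zs = z1 @ z2 \<and> (z1 = [] \<or> i < length oss \<and> oss ! i = A @ rev (map al z1) @ B) \<and>
    (z2 = [] \<or> j < length oss \<and> oss ! j = A' @ rev (map al z2) @ B')"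
proof -
  let ?ys = "rev (map al zs)"
  have zs: "zs \<noteq> []" "distinct zs" using r by (auto simp: run_def)
  have sys: "set ?ys \<subseteq> set (concat oss)" using o by auto
  obtain P0 Q0 where PQ: "concat oss @ gs = P0 @ ?ys @ Q0" proof -
    have "al ` set zs \<subseteq> set os" using o by auto
    from run_contig[OF r I this h] that show thesis by auto
  qed
  obtain Q where Q: "concat oss = P0 @ ?ys @ Q"
  proof -
    have "concat oss @ gs = (P0 @ ?ys) @ Q0" using PQ by simp
    from iffD1[OF append_eq_append_conv2 this] obtain us where
      "concat oss = (P0 @ ?ys) @ us \<or> concat oss @ us = P0 @ ?ys \<and> gs = us @ Q0" by blast
    thus thesis
    proof
      assume a: "concat oss @ us = P0 @ ?ys \<and> gs = us @ Q0"
      have "us = []"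
      proof (rule ccontr)
        assume n: "us \<noteq> []"
        have "last (concat oss @ us) = last (P0 @ ?ys)" using a by simp
        hence "last us = last ?ys" using n zs(1) by simp
        moreover have "last ?ys \<in> set ?ys" using zs(1) by (intro last_in_set) simp
        moreover have "last us \<in> set gs" using n a by simp
        ultimately have "last us \<in> set (concat oss) \<inter> set gs" using sys by auto
        thus False using dist_os by auto
      qed
      thus thesis using that[of "[]"] a by simp
    qed (use that[of us] in simp)
  qed
  have full: "?ys \<noteq> Y1 @ oss ! m @ Y2" if m: "0 < m" "Suc m < length oss" for m Y1 Y2
  proof
    assume y: "?ys = Y1 @ oss ! m @ Y2"
    have "set (oss ! m) \<subseteq> al ` set zs" using arg_cong[OF y, of set] by auto
    have 1: "\<forall>y\<in>set (oss ! m). al y \<in> inn"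
    proof
      fix y assume "y \<in> set (oss ! m)"
      then obtain z where "z \<in> set zs" "y = al z" using \<open>set (oss ! m) \<subseteq> al ` set zs\<close> by blast
      hence "z \<in> inn" "al y = z" using I alal[of z] by blast+
      thus "al y \<in> inn" by simp
    qed
    have aa: "al (al x) = x" if "x \<in> set zs" for x using I alal that by blast
    have "successively (\<lambda>a b. ph (al (al a)) = al (al b)) zs"
    proof (rule successively_mono)
      show "successively (\<lambda>a b. b = ph a \<and> dgr al ph b = 2) zs" using r by (simp add: run_def)
    qed (simp add: aa)
    hence "successively (\<lambda>y y'. ph (al y') = al y) ?ys" by (simp add: successively_rev successively_map)
    hence "successively (\<lambda>y y'. ph (al y') = al y) (oss ! m)" unfolding y by (auto simp: successively_append_iff)
    thus False using full_block[OF m 1] by blast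
  qed
  from concat_contig[OF Q full] obtain y1 y2 p q A B A' B' where
    ys: "?ys = y1 @ y2" and 1: "y1 = [] \<or> p \<in> set oss \<and> p = A @ y1 @ B" and 2: "y2 = [] \<or> q \<in> set oss \<and> q = A' @ y2 @ B'" by metis
  define z1 z2 where "z1 = take (length y2) zs" and "z2 = drop (length y2) zs"
  have z: "zs = z1 @ z2" by (simp add: z1_def z2_def)
  have "length zs = length y1 + length y2" using arg_cong[OF ys, of length] by simp
  hence len: "length z2 = length y1" by (simp add: z2_def)
  have "rev (map al z2) @ rev (map al z1) = y1 @ y2" using ys z by simp
  hence "rev (map al z2) = y1" "rev (map al z1) = y2" using len by (auto simp: append_eq_append_conv)
  hence a: "z1 = [] \<or> q \<in> set oss \<and> q = A' @ rev (map al z1) @ B'" "z2 = [] \<or> p \<in> set oss \<and> p = A @ rev (map al z2) @ B"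
    using 1 2 by auto
  have bl: "\<exists>i. z = [] \<or> i < length oss \<and> oss ! i = A @ rev (map al z) @ B"
    if "z = [] \<or> p \<in> set oss \<and> p = A @ rev (map al z) @ B" for z p A B using that by (metis in_set_conv_nth)
  obtain i where i: "z1 = [] \<or> i < length oss \<and> oss ! i = A' @ rev (map al z1) @ B'" using bl[OF a(1)] by (elim exE)
  obtain j where j: "z2 = [] \<or> j < length oss \<and> oss ! j = A @ rev (map al z2) @ B" using bl[OF a(2)] by (elim exE)
  show ?thesis using z i j by (intro exI conjI)
qed

lemma no_matched:
  assumes y: "y \<in> set (concat oss)"
    and IH: "\<And>D' ph' oss' s' e' x'. dg D' al ph' lb ps lv (concat oss') \<Longrightarrow> chainp lb lv s' oss' e' x' \<Longrightarrow>
      length oss' \<ge> 3 \<Longrightarrow> mu D' ph' < mu D ph \<Longrightarrow> False"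
  shows "al y \<notin> set (concat oss)"
proof
  assume "al y \<in> set (concat oss)"
  then obtain i j where ij: "i < length oss" "j < length oss" "y \<in> set (oss ! i)" "al y \<in> set (oss ! j)"
    using y by (auto simp: in_set_conv_nth) (metis nth_mem)
  hence "i + 2 \<le> j \<or> j + 2 \<le> i" using good unfolding cgood_def by blast
  moreover have "y \<in> D" using y osD by simp
  ultimately obtain i j y where ij: "i + 2 \<le> j" "j < length oss" "y \<in> set (oss ! i)" "al y \<in> set (oss ! j)"
    using ij alal by metis
  show False using matched_sub[OF d ch ij] IH by blast
qed

text \<open>Without an outer arc that begins at a branch vertex, the face follows the outer path at
  every vertex and lies behind all of it. In particular it lies behind the middle block
  \<open>oss ! 1\<close>, against \<open>full_block\<close>.\<close>

lemma nowrap: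
  assumes x0: "x0 \<in> inn" and f: "f = cls {ph} x0" and y: "y \<in> f" "al y \<in> set os"
  shows "\<exists>x\<in>f. dgr al ph x \<noteq> 2 \<and> al x \<in> set os"
proof (rule ccontr)
  assume n: "\<not> (\<exists>x\<in>f. dgr al ph x \<noteq> 2 \<and> al x \<in> set os)"
  have fI: "f \<subseteq> inn" using inner_closed(2)[OF d x0] f by simp
  have finf: "finite f" using fI dgD(8)[OF d] by (meson finite_Diff finite_subset)
  have O: "\<forall>x\<in>set os. ph x \<in> set os" "set os \<subseteq> D" using cyc_set[OF cyco] dgD(3)[OF d] by blast+
  have "card {p \<in> f. dgr al ph (ph p) \<noteq> 2 \<and> al p \<in> set os} = card {x \<in> f. dgr al ph x \<noteq> 2 \<and> al x \<in> set os}"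
  proof (rule face_count(4)[OF d ok R2 x0 f, of "\<lambda>_. 6 * card f"])
    fix zs assume "run al ph zs" "set zs \<subseteq> f"
    hence "length zs \<le> card f" using run_card finf by blast
    thus "6 * length zs \<le> 6 * card f" by simp
  qed
  moreover have "{x \<in> f. dgr al ph x \<noteq> 2 \<and> al x \<in> set os} = {}" using n by blast
  ultimately have "card {p \<in> f. dgr al ph (ph p) \<noteq> 2 \<and> al p \<in> set os} = 0" by (simp only: card.empty)
  moreover have "finite {p \<in> f. dgr al ph (ph p) \<noteq> 2 \<and> al p \<in> set os}" by (rule finite_subset[OF _ finf]) blast
  ultimately have "{p \<in> f. dgr al ph (ph p) \<noteq> 2 \<and> al p \<in> set os} = {}" by (simp only: card_0_eq)
  hence two: "dgr al ph (ph p) = 2" if "p \<in> f" "al p \<in> set os" for p using that by blast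
  have phf: "ph p \<in> f" if "p \<in> f" for p using cls_step[of p "{ph}" x0 ph] that f by simp
  have bk: "al q' \<in> f \<and> ph (al (ph q')) = al q'" if q': "q' \<in> set os" "al (ph q') \<in> f" for q'
  proof -
    define p where "p = al (ph q')"
    have D: "q' \<in> D" "ph q' \<in> D" using q' O by auto
    have p: "p \<in> f" "al p = ph q'" using q' alal[OF D(2)] by (auto simp: p_def)
    have pI: "p \<in> inn" "ph p \<in> inn" using p phf fI by auto
    have "ph (al (ph p)) = al p"
      using corner_weight(3)[OF M O HOL.refl pI inner_deg[OF d ok pI(2)]] two[OF p(1)] p O(1) q'(1) by auto
    hence "al (ph p) = q'" using pmap_inj[OF M, of "al (ph p)" q'] p(2) D pI pmap_al[OF M] by auto
    hence "al q' = ph p" using alal pI by auto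
    thus ?thesis using phf p p_def by simp
  qed
  have all: "al q' \<in> f" if q': "q' \<in> set os" for q'
  proof (rule ccontr)
    assume no: "al q' \<notin> f"
    have "cls {ph} q' \<subseteq> {z \<in> set os. al z \<notin> f}"
      by (rule cls_least) (use no q' bk O(1) in auto)
    hence "set os \<subseteq> {z \<in> set os. al z \<notin> f}" using cyc_cls[OF cyco q'] by simp
    moreover have "al (al y) = y" using alal fI y by auto
    ultimately show False using y by auto
  qed
  have m: "0 < (1::nat)" "Suc 1 < length oss" using k3 by auto
  have l1: "1 < length oss" using k3 by simp
  have sub: "set (oss ! 1) \<subseteq> set os" using block_sub[OF l1] by auto
  have "successively (\<lambda>a b. b = ph a) os" by (rule cyc_successively[OF cyco])
  hence "successively (\<lambda>a b. b = ph a) (oss ! 1)"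
    unfolding concat_nth[OF l1] by (auto simp: successively_append_iff)
  hence "successively (\<lambda>y y'. ph (al y') = al y) (oss ! 1)"
  proof (rule successively_mono)
    fix a b assume ab: "a \<in> set (oss ! 1)" "b \<in> set (oss ! 1)" "b = ph a"
    hence "a \<in> set os" "ph a \<in> set os" using sub by auto
    thus "ph (al b) = al a" using bk[of a] all[of "ph a"] ab(3) by simp
  qed
  thus False using full_block[OF m] all sub fI by blast
qed

lemma clean_run:
  assumes r: "run al ph zs" and f: "f = cls {ph} x0" "x0 \<in> inn" "set zs \<subseteq> f"
    and o: "al ` set zs \<subseteq> set (concat oss)" and h: "hd os \<notin> al ` set (butlast zs)"
  shows "6 * length zs \<le> 2 * (card f - 1)"
proof -
  have fI: "f \<subseteq> inn" using inner_closed(2)[OF d f(2)] f(1) by simp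
  hence I: "set zs \<subseteq> inn" using f by blast
  have cl: "6 * length z \<le> card f - 1" if z: "zs = A @ z @ B" "z = [] \<or> i < length oss \<and> oss ! i = A' @ rev (map al z) @ B'"
    for z A B i A' B'
  proof (cases "z = []")
    case False
    have zf: "set z \<subseteq> f" using z(1) f(3) by auto
    have "run al ph z" using r False z(1) by (auto simp: run_def successively_append_iff)
    hence "6 * length z < card (cls {ph} (hd z))" using piece_len[of z i A' B'] zf fI z(2) False by blast
    moreover have "hd z \<in> f" using zf False by (meson hd_in_set subsetD)
    hence "cls {ph} (hd z) = f" using face_cls[OF d f(2)] f(1) by blast
    ultimately show ?thesis by simp
  qed simp
  obtain z1 z2 i j A B A' B' where z: "zs = z1 @ z2" and
    1: "z1 = [] \<or> i < length oss \<and> oss ! i = A @ rev (map al z1) @ B" and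
    2: "z2 = [] \<or> j < length oss \<and> oss ! j = A' @ rev (map al z2) @ B'" using two_pieces[OF r I o h] by metis
  have "6 * length z1 \<le> card f - 1" using cl[OF _ 1, of "[]" z2] z by simp
  moreover have "6 * length z2 \<le> card f - 1" using cl[OF _ 2, of z1 "[]"] z by simp
  ultimately show ?thesis using z by simp
qed

end

context chain
begin

lemma face_arith0:
  assumes "6 * n \<le> Ni * (n - 1) + Ne * (2 * (n - 1))" "(n::nat) > 0"
  shows "Ni + 2 * Ne \<ge> 7"
proof (rule ccontr)
  assume "\<not> Ni + 2 * Ne \<ge> 7"
  hence "(Ni + 2 * Ne) * (n - 1) \<le> 6 * (n - 1)" by (intro mult_le_mono1) simp
  thus False using assms by (simp add: algebra_simps)
qed

text \<open>A run along the chain is made of at most two pieces, so a face satisfies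
  \<open>Ni + 2 * Ne \<ge> 7\<close> and has weight at least 7/6. Only the face behind the first
  dart escapes this count, as the chain has no junction where it closes up; by \<open>nowrap\<close>
  its weight is still 1/2. The curvature then sums to at most 1/2, whereas it is at least 1 without
  spurs.\<close>

lemma chain_closed_dg:
  "dg D al ph lb ps lv (concat oss) \<Longrightarrow> chainp lb lv s oss e x \<Longrightarrow> length oss \<ge> 3 \<Longrightarrow> False"
proof (induction "mu D ph" arbitrary: D al ph lv oss s e x rule: less_induct)
  case less
  have d: "dg D al ph lb ps lv (concat oss @ [])" using less.prems(1) by simp
  have good: "cgood D al ph lb lv (concat oss @ []) oss"
  proof (rule ccontr)
    assume ng: "\<not> cgood D al ph lb lv (concat oss @ []) oss"
    obtain D' al' ph' lv' oss' e' x' where "dg D' al' ph' lb ps lv' (concat oss' @ [])" "chainp lb lv' s oss' e' x'"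
      "length oss' = length oss" "mu D' ph' < mu D ph"
      using chain_reduce[OF d less.prems(2,3) ng] by metis
    thus False using less.hyps[of D' ph' al' lv' oss' s e' x'] less.prems(3) by simp
  qed
  interpret C: chain_diagram st aut S R a b u D al ph lb ps lv s oss e x "[]"
    by unfold_locales (use d good less.prems in auto)
  let ?os = "concat oss @ []"
  have nm: "al y \<notin> set ?os" if y: "y \<in> set ?os" for y
  proof -
    have "al y \<notin> set (concat oss)" by (rule C.no_matched) (use y less.hyps in auto)
    thus ?thesis by simp
  qed
  define h where "h = al (hd ?os)"
  have one: "(\<Sum>y\<in>f. wgt al ph (D - set ?os) y) \<ge> (if h \<in> f then 1 / 2 else 1)" if fF: "f \<in> cls {ph} ` (D - set ?os)" for f
  proof -
    obtain x0 where x0: "x0 \<in> D - set ?os" "f = cls {ph} x0" using fF by blast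
    have fI: "f \<subseteq> D - set ?os" using inner_closed(2)[OF d x0(1)] x0(2) by simp
    have hO: "hd ?os \<in> set ?os" using C.cyco by (intro hd_in_set) (auto simp: cyc_def)
    have hh: "al h = hd ?os" using C.alal[OF C.osD[OF hO]] by (simp add: h_def)
    \<comment> \<open>At the exceptional face the bound is the trivial one, as only
      \<open>W \<ge> Ne / 2\<close> is taken from \<open>face_count\<close> there.\<close>
    define Hx where "Hx = (if h \<in> f then 6 * card f else 2 * (card f - 1))"
    have ext: "6 * length zs \<le> Hx" if r: "run al ph zs" and sub: "set zs \<subseteq> f" and eo: "al (hd zs) \<in> set ?os" for zs
    proof (cases "h \<in> f")
      case True
      have "finite f" using fI dgD(8)[OF d] by (meson finite_Diff finite_subset)
      thus ?thesis using run_card[OF r sub] True by (simp add: Hx_def)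
    next
      case False
      have zI: "set zs \<subseteq> D - set ?os" using sub fI by blast
      have "\<forall>z\<in>set zs. al z \<in> set ?os" using run_outer[OF d C.ok r zI] eo by blast
      hence o: "al ` set zs \<subseteq> set (concat oss)" by auto
      have "hd ?os \<notin> al ` set (butlast zs)"
      proof
        assume "hd ?os \<in> al ` set (butlast zs)"
        then obtain z where z: "z \<in> set zs" "al z = hd ?os" by (auto dest: in_set_butlastD)
        hence "h = z" using C.alal zI unfolding h_def by (metis DiffD1 subsetD)
        thus False using False z(1) sub by blast
      qed
      from C.clean_run[OF r x0(2,1) sub o this] show ?thesis using False by (simp add: Hx_def)
    qed
    note FC = face_count[OF d C.ok C.R2 x0, of "\<lambda>_. Hx", OF ext]
    let ?Ne = "card {x \<in> f. dgr al ph x \<noteq> 2 \<and> al x \<in> set ?os}"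
    let ?Ni = "card {x \<in> f. dgr al ph x \<noteq> 2 \<and> al x \<notin> set ?os}"
    show ?thesis
    proof (cases "h \<in> f")
      case True
      have "{x \<in> f. dgr al ph x \<noteq> 2 \<and> al x \<in> set ?os} \<noteq> {}" using C.nowrap[OF x0 True] hh hO by auto
      moreover have "finite f" using FC(1) card_ge_0_finite by blast
      ultimately have "?Ne \<ge> 1" by (simp add: Suc_le_eq card_gt_0_iff)
      thus ?thesis using True FC(3) by simp
    next
      case False
      hence "6 * card f \<le> ?Ni * (card f - 1) + ?Ne * (2 * (card f - 1))"
        using FC(5) FC(1) by (simp only: sum_constant Hx_def if_False) auto
      from face_arith0[OF this FC(1)] have "?Ni + 2 * ?Ne \<ge> 7" .
      thus ?thesis using False FC(2) by simp
    qed
  qed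
  have "{x \<in> set ?os. ph (al x) = x} = {}" using spur_matched[OF d] nm by blast
  hence S: "(\<Sum>f\<in>cls {ph} ` (D - set ?os). 1 - (\<Sum>x\<in>f. wgt al ph (D - set ?os) x)) \<ge> 1"
    using dg_curvature[OF d C.ok] by (simp only:) simp
  have "(\<Sum>f\<in>cls {ph} ` (D - set ?os). 1 - (\<Sum>x\<in>f. wgt al ph (D - set ?os) x)) \<le>
     (\<Sum>f\<in>cls {ph} ` (D - set ?os). if h \<in> f then 1 / 2 else 0)"
  proof (rule sum_mono)
    fix f assume "f \<in> cls {ph} ` (D - set ?os)"
    from one[OF this] show "1 - (\<Sum>x\<in>f. wgt al ph (D - set ?os) x) \<le> (if h \<in> f then 1 / 2 else 0)"
      by (cases "h \<in> f") simp_all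
  qed
  also have "\<dots> = (\<Sum>f\<in>{f \<in> cls {ph} ` (D - set ?os). h \<in> f}. 1 / 2)"
    using dgD(8)[OF d] by (intro sum.inter_filter[THEN HOL.sym]) simp
  also have "\<dots> \<le> (\<Sum>f\<in>{cls {ph} h}. 1 / 2 :: real)"
  proof (rule sum_mono2)
    show "{f \<in> cls {ph} ` (D - set ?os). h \<in> f} \<subseteq> {cls {ph} h}"
    proof
      fix f assume "f \<in> {f \<in> cls {ph} ` (D - set ?os). h \<in> f}"
      then obtain x0 where x0: "x0 \<in> D - set ?os" "f = cls {ph} x0" "h \<in> cls {ph} x0" by blast
      have "cls {ph} h = f" using face_cls[OF d x0(1,3)] x0(2) by simp
      thus "f \<in> {cls {ph} h}" by simp
    qed
  qed auto
  finally show False using S by simp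
qed

end

subsection \<open>Polygons with three geodesic sides\<close>

lemma seg_contig:
  assumes "concat segs = P @ ys @ Q" "ys \<noteq> []" "\<forall>q\<in>set segs. q \<noteq> [] \<longrightarrow> hd q \<notin> set (tl ys)"
  shows "\<exists>q\<in>set segs. \<exists>A B. q = A @ ys @ B"
  using assms
proof (induction segs arbitrary: P)
  case (Cons q segs)
  have IH: "\<exists>q\<in>set (q # segs). \<exists>A B. q = A @ ys @ B" if "concat segs = P' @ ys @ Q" for P'
    using Cons.IH[OF that] Cons.prems by auto
  have "q @ concat segs = P @ (ys @ Q)" using Cons.prems(1) by simp
  from iffD1[OF append_eq_append_conv2 this] obtain us where
    "q = P @ us \<and> us @ concat segs = ys @ Q \<or> q @ us = P \<and> concat segs = us @ ys @ Q" by blast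
  then consider "q = P @ us" "us @ concat segs = ys @ Q" | "concat segs = us @ ys @ Q" by blast
  thus ?case
  proof cases
    case 1
    from iffD1[OF append_eq_append_conv2 1(2)] obtain vs where
      "us = ys @ vs \<or> us @ vs = ys \<and> concat segs = vs @ Q" by blast
    thus ?thesis
    proof
      assume "us = ys @ vs" thus ?thesis using 1(1) by auto
    next
      assume v: "us @ vs = ys \<and> concat segs = vs @ Q"
      consider "us = []" | "vs = []" | "us \<noteq> []" "vs \<noteq> []" by blast
      thus ?thesis
      proof cases
        case a: 1 thus ?thesis using IH[of "[]"] v by simp
      next
        case 2 hence "q = P @ ys @ []" using v 1(1) by simp
        thus ?thesis by (metis list.set_intros(1))
      next
        case 3
        have hc: "xs \<noteq> [] \<Longrightarrow> concat ss = xs @ Q \<Longrightarrow> \<exists>q\<in>set ss. q \<noteq> [] \<and> hd q = hd xs" for xs ss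
        proof (induction ss)
          case (Cons r ss) thus ?case by (cases r) (auto simp: Cons_eq_append_conv)
        qed simp
        obtain r where "r \<in> set segs" "r \<noteq> []" "hd r = hd vs" using hc[OF 3(2)] v by blast
        moreover have "hd vs \<in> set (tl ys)" using 3 v by (metis hd_in_set in_set_conv_decomp tl_append2 Un_iff set_append)
        ultimately show ?thesis using Cons.prems(3) by (metis list.set_intros(2))
      qed
    qed
  next
    case 2 thus ?thesis by (rule IH)
  qed
qed simp

lemma map_split_concat:
  "map f xs = concat ws @ g \<Longrightarrow> \<exists>oss gs. xs = concat oss @ gs \<and> map (map f) oss = ws \<and> map f gs = g"
proof (induction ws arbitrary: xs)
  case Nil thus ?case by (intro exI[of _ "[]"] exI[of _ xs]) auto
next
  case (Cons w ws)
  hence "map f xs = w @ (concat ws @ g)" by simp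
  from iffD1[OF map_eq_append_conv this] obtain A B where "xs = A @ B" "w = map f A" "map f B = concat ws @ g" by metis
  moreover from Cons.IH[OF this(3)] obtain oss gs where "B = concat oss @ gs" "map (map f) oss = ws" "map f gs = g" by blast
  ultimately show ?case by (intro exI[of _ "A # oss"]) auto
qed

lemma not_successively: "\<not> successively P xs \<Longrightarrow> \<exists>A a b B. xs = A @ a # b # B \<and> \<not> P a b"
proof (induction xs)
  case (Cons x xs)
  show ?case
  proof (cases xs)
    case C: (Cons y ys)
    show ?thesis
    proof (cases "P x y")
      case True
      hence "\<not> successively P xs" using Cons.prems C by simp
      then obtain A a b B where "xs = A @ a # b # B" "\<not> P a b" using Cons.IH by blast
      thus ?thesis by (intro exI[of _ "x # A"]) auto
    next
      case False thus ?thesis using C by (intro exI[of _ "[]"]) auto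
    qed
  qed (use Cons.prems in simp)
qed simp

context scg
begin

definition geodesic :: "('s \<times> bool) list \<Rightarrow> bool" where
  "geodesic w \<longleftrightarrow> (\<forall>w'. w' \<approx> w \<longrightarrow> length w \<le> length w')"

end

context chain
begin

definition Uw :: "nat \<Rightarrow> nat \<Rightarrow> ('b \<times> bool) list" where "Uw s k = concat (map u [s..<s + k])"

lemma Uw_simps [simp]: "Uw s 0 = []" "Uw s (Suc k) = Uw s k @ u (s + k)" by (auto simp: Uw_def)

lemma Uw_words: "Uw s k \<in> words S" by (induction k) (use rd_words[OF ub] in auto)

lemma assign_chain:
  assumes "distinct (concat oss)" "\<forall>i<length oss. map lb (oss ! i) = u (s + i)"
  shows "\<exists>g. (\<forall>i<length oss. kp lb g (oss ! i) (a (s + i)) (b (s + i))) \<and> (\<forall>y. y \<notin> set (concat oss) \<longrightarrow> g y = lv y)"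
  using assms
proof (induction oss rule: rev_induct)
  case (snoc X oss)
  have "\<forall>i<length oss. map lb (oss ! i) = u (s + i)"
  proof (intro allI impI)
    fix i assume "i < length oss"
    thus "map lb (oss ! i) = u (s + i)" using snoc.prems(2)[rule_format, of i] by (simp add: nth_append)
  qed
  then obtain g where g: "\<forall>i<length oss. kp lb g (oss ! i) (a (s + i)) (b (s + i))" "\<forall>y. y \<notin> set (concat oss) \<longrightarrow> g y = lv y"
    using snoc by auto
  have "map lb X = u (s + length oss)" using snoc.prems(2)[rule_format, of "length oss"] by simp
  then obtain h where h: "kp lb h X (a (s + length oss)) (b (s + length oss))" "\<forall>y. y \<notin> set X \<longrightarrow> h y = g y"
    using assign_lift[of "a (s + length oss)" lb X "b (s + length oss)" g] ub snoc.prems(1) by auto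
  have "kp lb h (oss ! i) (a (s + i)) (b (s + i))" if i: "i < length oss" for i
  proof (rule kp_change[OF g(1)[rule_format, OF i]])
    have "set (oss ! i) \<inter> set X = {}" using snoc.prems(1) i by (auto dest: nth_mem)
    thus "\<forall>x\<in>set (oss ! i). h x = g x" using h(2) by auto
  qed
  thus ?case using h g(2) by (intro exI[of _ h]) (auto simp: nth_append less_Suc_eq)
qed auto

lemma chain_dg:
  assumes w: "Uw s k @ g \<approx> []" "Uw s k @ g \<noteq> []" and k: "k > 0"
  obtains D al ph lb ps lv oss gs e x where "dg D al ph lb ps lv (concat oss @ gs)" "chainp lb lv s oss e x"
    "length oss = k" "e 0 = a s" "x (k - 1) = b (s + (k - 1))" "map lb gs = g"
proof -
  obtain D al ph lb ps lv os where d: "dg D al ph lb ps lv os" and os: "map lb os = Uw s k @ g"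
    using diagram_exists[OF w] by metis
  obtain oss gs where og: "os = concat oss @ gs" "map (map lb) oss = map u [s..<s + k]" "map lb gs = g"
    using map_split_concat[of lb os "map u [s..<s + k]" g] os by (auto simp: Uw_def)
  have len: "length oss = k" using arg_cong[OF og(2), of length] by simp
  have dis: "distinct (concat oss @ gs)" using dgD(2)[OF d] og by (simp add: cyc_def)
  have "\<forall>i<length oss. map lb (oss ! i) = u (s + i)"
  proof (intro allI impI)
    fix i assume i: "i < length oss"
    hence "map lb (oss ! i) = map (map lb) oss ! i" by simp
    also have "\<dots> = u (s + i)" using og(2) i len by simp
    finally show "map lb (oss ! i) = u (s + i)" .
  qed
  then obtain h where h: "\<forall>i<length oss. kp lb h (oss ! i) (a (s + i)) (b (s + i))" "\<forall>y. y \<notin> set (concat oss) \<longrightarrow> h y = lv y"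
    using assign_chain[of oss lb s lv] dis by auto
  have "dg D al ph lb ps h (concat oss @ gs)"
  proof -
    have "h x = lv x" if "x \<notin> set (concat oss @ gs)" for x using that h(2) by auto
    moreover have "ph x \<in> D - set os" if "x \<in> D - set os" for x using inner_closed(1)[OF d that] .
    ultimately show ?thesis using d og(1) unfolding dg_def by auto
  qed
  moreover have "chainp lb h s oss (\<lambda>i. a (s + i)) (\<lambda>i. b (s + i))"
    unfolding chainp_def jn_def using h(1) by (auto intro!: exI[of _ "[]"])
  ultimately show ?thesis using that len og(3) by simp
qed

lemma u_ne: "u (Suc j) \<noteq> []"
proof
  assume "u (Suc j) = []"
  hence "a (Suc j) = b (Suc j)" using ub[of "Suc j"] by simp
  thus False using no_short[of j "[]" "b j" "a (Suc j)" "[]" "a (Suc j)" "[]" "a (Suc (Suc j))"] by simp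
qed

lemma Uw_ne: "k \<ge> 2 \<Longrightarrow> Uw s k \<noteq> []"
proof -
  assume "k \<ge> 2"
  then obtain k' where "k = Suc (Suc k')" by (metis add_2_eq_Suc less_eqE)
  thus ?thesis using u_ne[of "s + k'"] by simp
qed

theorem chain_closed: "k \<ge> 3 \<Longrightarrow> \<not> Uw s k \<approx> []"
proof
  assume k: "k \<ge> 3" and w: "Uw s k \<approx> []"
  obtain D al ph lb ps lv oss gs e x where "dg D al ph lb ps lv (concat oss @ gs)" "chainp lb lv s oss e x"
    "length oss = k" "map lb gs = []"
    using chain_dg[of s k "[]"] w Uw_ne[of k s] k by (metis append_Nil2 le_trans not_gr_zero not_numeral_le_zero numeral_le_iff semiring_norm(68) semiring_norm(72))
  thus False using chain_closed_dg[of D al ph lb ps lv oss s e x] k by simp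
qed

end

text \<open>Three geodesics, because in a quadrilateral of two points and their projections the
  fourth side runs along the subgroup. \<open>Bd\<close> bounds both the number of vertices
  reachable from \<open>a j\<close> and the length of words that reach them.\<close>

locale polygon = chain_diagram +
  fixes g1 g2 g3 :: "nat list" and Bd :: nat
  assumes gs: "gs = g1 @ g2 @ g3" and geo: "geodesic (map lb g1)" "geodesic (map lb g2)" "geodesic (map lb g3)"
    and s0: "s = 0" and e0: "e 0 = a 0" and xk: "x (length oss - 1) = b (length oss - 1)"
    and Bd: "rdd (a j) w v \<Longrightarrow> \<exists>w'. length w' \<le> Bd \<and> rdd (a j) w' v" "card {v. \<exists>w. rdd (a j) w v} \<le> Bd"
begin

lemma unmatched: "y \<in> set (concat oss) \<Longrightarrow> al y \<notin> set (concat oss)"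
  using no_matched chain_closed_dg by blast

lemma lbS: "set A \<subseteq> D \<Longrightarrow> map lb A \<in> words S"
  using pdgD(4)[OF P] by (auto simp: words_def)

lemma pos: "os = A @ y # B \<Longrightarrow> ps y \<approx> ps (hd os) @ map lb A"
  using dg_pos[OF d, of A y B] cyco dgD(3)[OF d] by simp

lemma hd_words: "ps (hd os) \<in> words S"
proof -
  have "hd os \<in> set os" using cyco by (intro hd_in_set) (simp add: cyc_def)
  thus ?thesis using pdgD(5)[OF P] osD by blast
qed

text \<open>The reductions change the blocks, but block \<open>i\<close> still starts at a point of
  the copy of the component at \<open>Uw 0 i\<close>: the difference is a word read from
  \<open>a i\<close>. This ties the positions in the reduced diagram to the original power.\<close>

lemma chain_words:
  "i < length oss \<Longrightarrow> \<exists>al'. rdd (a i) al' (e i) \<and> map lb (concat (take i oss)) \<approx> Uw 0 i @ al'"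
proof (induction i)
  case 0 thus ?case using e0 by (intro exI[of _ "[]"]) (simp add: eq_refl)
next
  case (Suc i)
  then obtain al' where al': "rdd (a i) al' (e i)" "map lb (concat (take i oss)) \<approx> Uw 0 i @ al'" by auto
  have k: "rdd (e i) (map lb (oss ! i)) (x i)" using chainpD(1)[OF ch, of i] Suc.prems kp_rd by simp
  obtain w where w: "rdd (b i) w (x i)" "rdd (a (Suc i)) w (e (Suc i))" using chainpD(2)[OF ch Suc.prems] s0 by (auto simp: jn_def)
  have "al' @ map lb (oss ! i) \<approx> u i @ w"
    by (rule rd_same_eq[of "a i" _ "x i"]) (use al' k ub[of i] w in \<open>auto simp: rd_append\<close>)
  hence 1: "Uw 0 i @ al' @ map lb (oss ! i) \<approx> Uw 0 i @ u i @ w"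
    using eq_ctx[of _ _ "Uw 0 i" "[]"] Uw_words by simp
  have "map lb (concat (take (Suc i) oss)) = map lb (concat (take i oss)) @ map lb (oss ! i)"
    using Suc.prems by (simp add: take_Suc_conv_app_nth)
  also have "\<dots> \<approx> (Uw 0 i @ al') @ map lb (oss ! i)" using eq_app[OF al'(2) eq_refl] rd_words[OF k] by blast
  also have "\<dots> \<approx> Uw 0 (Suc i) @ w" using 1 by simp
  finally show ?case using w by blast
qed

lemma chain_word: "map lb (concat oss) \<approx> Uw 0 (length oss)"
proof -
  define i where "i = length oss - 1"
  have i: "i < length oss" "length oss = Suc i" using k3 by (auto simp: i_def)
  obtain al' where al': "rdd (a i) al' (e i)" "map lb (concat (take i oss)) \<approx> Uw 0 i @ al'" using chain_words[OF i(1)] by blast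
  have k: "rdd (e i) (map lb (oss ! i)) (b i)" using chainpD(1)[OF ch i(1)] kp_rd xk i_def by simp
  have "al' @ map lb (oss ! i) \<approx> u i"
    by (rule rd_same_eq[of "a i" _ "b i"]) (use al' k ub[of i] in \<open>auto simp: rd_append\<close>)
  hence 1: "Uw 0 i @ al' @ map lb (oss ! i) \<approx> Uw 0 i @ u i"
    using eq_ctx[of _ _ "Uw 0 i" "[]"] Uw_words by simp
  have "oss = take i oss @ [oss ! i]" using i by (metis take_Suc_conv_app_nth take_all order_refl)
  hence "map lb (concat oss) = map lb (concat (take i oss)) @ map lb (oss ! i)" by (metis concat_append concat.simps append_Nil2 map_append)
  also have "\<dots> \<approx> (Uw 0 i @ al') @ map lb (oss ! i)" using eq_app[OF al'(2) eq_refl] rd_words[OF k] by blast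
  also have "\<dots> \<approx> Uw 0 (length oss)" using 1 i by simp
  finally show ?thesis .
qed

lemma block_pos:
  assumes i: "i < length oss" and y: "y \<in> set (oss ! i)"
  obtains al' where "rdd (a i) al' (lv y)" "length al' \<le> Bd" "ps y \<approx> ps (hd os) @ Uw 0 i @ al'"
proof -
  obtain A B where AB: "oss ! i = A @ y # B" using y by (auto simp: in_set_conv_decomp)
  have "os = (concat (take i oss) @ A) @ y # (B @ concat (drop (Suc i) oss) @ gs)" using concat_nth[OF i] AB by simp
  hence 1: "ps y \<approx> ps (hd os) @ map lb (concat (take i oss)) @ map lb A" using pos by fastforce
  obtain al' where al': "rdd (a i) al' (e i)" "map lb (concat (take i oss)) \<approx> Uw 0 i @ al'" using chain_words[OF i] by blast
  have kA: "rdd (e i) (map lb A) (lv y)" using chainpD(1)[OF ch i] AB kp_rd kp_mid by metis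
  hence r: "rdd (a i) (al' @ map lb A) (lv y)" using al' by (auto simp: rd_append)
  then obtain w where w: "length w \<le> Bd" "rdd (a i) w (lv y)" using Bd(1) by blast
  have "map lb (concat (take i oss)) @ map lb A \<approx> (Uw 0 i @ al') @ map lb A" using eq_app[OF al'(2) eq_refl] rd_words[OF kA] by blast
  also have "(Uw 0 i @ al') @ map lb A \<approx> Uw 0 i @ w"
    using eq_app[OF eq_refl[OF Uw_words[of 0 i]] rd_same_eq[OF r w(2)]] by simp
  finally have "ps (hd os) @ map lb (concat (take i oss)) @ map lb A \<approx> ps (hd os) @ Uw 0 i @ w"
    using eq_app[OF eq_refl[OF hd_words]] by blast
  thus ?thesis using that w eq_trans[OF 1] by blast
qed

lemma gs_pos: assumes "gs = A @ y # B" shows "ps y \<approx> ps (hd os) @ Uw 0 (length oss) @ map lb A"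
proof -
  have os: "os = (concat oss @ A) @ y # B" using assms by simp
  have "map lb A \<in> words S" by (rule lbS) (use os osD in auto)
  hence "map lb (concat oss) @ map lb A \<approx> Uw 0 (length oss) @ map lb A" using eq_app[OF chain_word eq_refl] by blast
  hence "ps (hd os) @ map lb (concat oss) @ map lb A \<approx> ps (hd os) @ Uw 0 (length oss) @ map lb A"
    using eq_app[OF eq_refl[OF hd_words]] by blast
  thus ?thesis using eq_trans[of "ps y"] pos[OF os] by simp
qed

lemma face_path:
  assumes y: "y \<in> inn" and y': "y' \<in> cls {ph} y"
  shows "\<exists>w. length w \<le> card (cls {ph} y) \<and> ps y' \<approx> ps y @ w"
proof -
  have yD: "y \<in> D" using y by blast
  obtain xs where xs: "cyc ph (y # xs)" "set (y # xs) = cls {ph} y" using cyc_exists[OF pmap_perms(1)[OF M] yD] by blast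
  obtain A B where AB: "y # xs = A @ y' # B" using y' xs(2) by (metis in_set_conv_decomp)
  have len: "length A \<le> card (cls {ph} y)"
    using xs distinct_card[of "y # xs"] arg_cong[OF AB, of length] by (simp add: cyc_def)
  have "set (y # xs) \<subseteq> D" using xs(2) cls_sub[OF pmap_perms(1)[OF M] yD] by simp
  hence "ps y' \<approx> ps (hd (y # xs)) @ map lb A" using dg_pos[OF d, of A y' B] xs(1) unfolding AB by simp
  thus ?thesis using len by (intro exI[of _ "map lb A"]) simp
qed

text \<open>The start of block \<open>i\<close> is close to the geodesic sides.\<close>

definition near :: "nat \<Rightarrow> bool" where
  "near i \<longleftrightarrow> (\<exists>dl rh et. map lb gs = dl @ rh \<and> length et \<le> 13 * Bd + 2 \<and> Uw 0 (length oss) @ dl @ et \<approx> Uw 0 i)"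

text \<open>The radius \<open>13 * Bd + 2\<close> is made up of at most \<open>Bd\<close> from the
  start of the block to \<open>y\<close>, at most \<open>12 * Bd\<close> around a small face, and an
  edge at either end of that way.\<close>

lemma nearI:
  assumes i: "i < length oss" and y: "y \<in> set (oss ! i)" and g: "g \<in> set gs" "ps g \<approx> ps y @ w" "length w \<le> 12 * Bd + 2"
  shows "near i"
proof -
  obtain A B where AB: "gs = A @ g # B" using g(1) by (auto simp: in_set_conv_decomp)
  obtain al' where al': "rdd (a i) al' (lv y)" "length al' \<le> Bd" "ps y \<approx> ps (hd os) @ Uw 0 i @ al'" using block_pos[OF i y] .
  have wS: "w \<in> words S" using eq_words(2)[OF g(2)] by simp
  have "ps g \<approx> ps (hd os) @ Uw 0 (length oss) @ map lb A" by (rule gs_pos[OF AB])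
  hence "ps (hd os) @ Uw 0 (length oss) @ map lb A \<approx> ps y @ w" using eq_sym eq_trans g(2) by blast
  also have "ps y @ w \<approx> (ps (hd os) @ Uw 0 i @ al') @ w" by (rule eq_app[OF al'(3) eq_refl[OF wS]])
  finally have "Uw 0 (length oss) @ map lb A \<approx> Uw 0 i @ (al' @ w)" using eq_cancel_left by simp
  hence "Uw 0 i @ (al' @ w) \<approx> Uw 0 (length oss) @ map lb A" by (rule eq_sym)
  from eq_inv_move[OF this] have "Uw 0 (length oss) @ map lb A @ inv_word (al' @ w) \<approx> Uw 0 i" using eq_sym by simp
  thus ?thesis unfolding near_def
    by (intro exI[of _ "map lb A"] exI[of _ "map lb (g # B)"] exI[of _ "inv_word (al' @ w)"]) (use AB al'(2) g(3) in auto)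
qed

end

section \<open>Weights of faces and the number of far blocks\<close>

context polygon
begin

text \<open>Here \<open>n\<close> is the length of a face, and \<open>m\<close> and \<open>c\<close>
  are its numbers of arcs on the chain and on the geodesics. The bounds say that an arc on the chain
  is made of two pieces, each inside one block, and that an arc on a geodesic is at most half of the
  face. Faces with \<open>m = c = 1\<close> can follow both sides at weight 1; but if
  \<open>n\<close> exceeds \<open>12 * B\<close>, their arc on the chain is too short for
  \<open>Ni \<le> 2\<close>.\<close>

lemma face_arith:
  fixes W :: real and m c n Ni B :: nat
  assumes "6 * n \<le> Ni * (n - 1) + (m * min (2 * (n - 1)) (12 * B) + c * (3 * n))" "(n::nat) > 0"
    and W: "W \<ge> real (m + c) / 3 + real Ni / 6" "W \<ge> real (m + c) / 2"
  shows "W \<ge> 1" "c = 0 \<or> 12 * B < n \<and> m \<ge> 1 \<Longrightarrow> W \<ge> 7 / 6"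
proof -
  have "W \<ge> 1 \<and> (c = 0 \<or> 12 * B < n \<and> m \<ge> 1 \<longrightarrow> W \<ge> 7 / 6)"
  proof (cases "c = 0")
    case True
    have 1: "m * min (2 * (n - 1)) (12 * B) \<le> m * (2 * (n - 1))" by (intro mult_le_mono2) simp
    have "6 * n \<le> Ni * (n - 1) + m * min (2 * (n - 1)) (12 * B)" using assms(1) True by simp
    also have "\<dots> \<le> Ni * (n - 1) + m * (2 * (n - 1))" using 1 by (rule add_left_mono)
    finally have "6 * n \<le> Ni * (n - 1) + m * (2 * (n - 1))" .
    hence "Ni + 2 * m \<ge> 7" using face_arith0 assms(2) by blast
    hence "real (Ni + 2 * m) \<ge> 7" using of_nat_mono[of 7 "Ni + 2 * m", where 'a = real] by simp
    thus ?thesis using W(1) True by simp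
  next
    case c: False
    consider "m + c \<ge> 3" | "m = 1" "c = 1" | "m = 0" "c = 2" | "m = 0" "c = 1" using c by linarith
    thus ?thesis
    proof cases
      case 1
      hence "real (m + c) \<ge> 3" using of_nat_mono[of 3 "m + c", where 'a = real] by simp
      thus ?thesis using W(2) by simp
    next
      case 2
      have "W \<ge> 7 / 6" if n: "12 * B < n"
      proof -
        have "Ni \<ge> 3"
        proof (rule ccontr)
          assume "\<not> Ni \<ge> 3"
          hence "Ni * (n - 1) \<le> 2 * (n - 1)" by (intro mult_le_mono1) simp
          moreover have "min (2 * (n - 1)) (12 * B) \<le> 12 * B" by simp
          moreover have "6 * n \<le> Ni * (n - 1) + (min (2 * (n - 1)) (12 * B) + 3 * n)" using assms(1) 2 by simp
          ultimately have "6 * n \<le> 2 * (n - 1) + (12 * B + 3 * n)" by linarith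
          thus False using n by linarith
        qed
        hence "real Ni \<ge> 3" by simp
        thus ?thesis using W(1) 2 by simp
      qed
      moreover have "W \<ge> 1" using W(2) 2 by simp
      ultimately show ?thesis using c by blast
    next
      case 3 thus ?thesis using W(2) by simp
    next
      case 4
      have "Ni \<ge> 4"
      proof (rule ccontr)
        assume "\<not> Ni \<ge> 4"
        hence "Ni * (n - 1) \<le> 3 * (n - 1)" by (intro mult_le_mono1) simp
        moreover have "6 * n \<le> Ni * (n - 1) + 3 * n" using assms(1) 4 by simp
        ultimately show False using assms(2) by linarith
      qed
      hence "real Ni \<ge> 4" by simp
      thus ?thesis using W(1) 4 by simp
    qed
  qed
  thus "W \<ge> 1" "c = 0 \<or> 12 * B < n \<and> m \<ge> 1 \<Longrightarrow> W \<ge> 7 / 6" by blast+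
qed

definition "segs = [concat oss, g1, g2, g3]"
text \<open>The corners of the polygon. The bounds for runs hold where no corner is passed, which
  exempts at most four faces.\<close>

definition "Zs = hd ` (set segs - {[]})"

lemma os_segs: "os = concat segs" by (simp add: segs_def gs)

lemma Zs_card: "finite Zs" "card Zs \<le> 4"
proof -
  show "finite Zs" by (simp add: Zs_def)
  have "card Zs \<le> card (set segs - {[]})" unfolding Zs_def by (rule card_image_le) simp
  also have "\<dots> \<le> card (set segs)" by (intro card_mono) auto
  also have "\<dots> \<le> length segs" by (rule card_length)
  finally show "card Zs \<le> 4" by (simp add: segs_def)
qed

lemma cne: "concat oss \<noteq> []" using chain_ne[OF ch k3] .

lemma hdZ: "hd os \<in> Zs" using cne by (auto simp: Zs_def segs_def)

lemma segsD: "q \<in> set segs \<Longrightarrow> q = concat oss \<or> q \<in> {g1, g2, g3}" by (auto simp: segs_def)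

lemma geoD: "q \<in> {g1, g2, g3} \<Longrightarrow> geodesic (map lb q)" using geo by auto

lemma seg_pred:
  assumes q: "q \<in> set segs" and y: "y \<in> set q" "y \<noteq> hd q"
  shows "\<exists>A p B. q = A @ p # y # B \<and> ph p = y"
proof -
  obtain A' B where AB: "q = A' @ y # B" using y(1) by (auto simp: in_set_conv_decomp)
  hence "A' \<noteq> []" using y(2) by auto
  then obtain A p where A: "A' = A @ [p]" by (metis append_butlast_last_id)
  obtain s1 s2 where s: "segs = s1 @ q # s2" using q by (auto simp: in_set_conv_decomp)
  have "os = (concat s1 @ A) @ p # y # (B @ concat s2)" using os_segs s AB A by simp
  hence "ph p = y" using cyc_next cyco by metis
  thus ?thesis using AB A by auto
qed

lemma geo_red: assumes "geodesic (A @ l @ B)" "l \<approx> l'" "A \<in> words S" "B \<in> words S" shows "length l \<le> length l'"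
proof -
  have "A @ l' @ B \<approx> A @ l @ B" using eq_ctx[OF eq_sym[OF assms(2)] assms(3,4)] .
  thus ?thesis using assms(1) unfolding geodesic_def by fastforce
qed

text \<open>Away from the corners a spur is a backtrack inside one side. On the chain this
  contradicts \<open>unmatched\<close>, and a geodesic could be shortened.\<close>

lemma spurs: "card {y \<in> set os. ph (al y) = y} \<le> 4"
proof -
  have "{y \<in> set os. ph (al y) = y} \<subseteq> Zs"
  proof
    fix y assume "y \<in> {y \<in> set os. ph (al y) = y}"
    hence y: "y \<in> set os" "ph (al y) = y" by blast+
    then obtain q where q: "q \<in> set segs" "y \<in> set q" using os_segs by auto
    show "y \<in> Zs"
    proof (cases "y = hd q")
      case True thus ?thesis using q by (auto simp: Zs_def)
    next
      case False
      obtain A p B where A: "q = A @ p # y # B" "ph p = y" using seg_pred[OF q False] by blast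
      have qD: "set q \<subseteq> D" using q(1) os_segs osD by auto
      have xD: "y \<in> D" "p \<in> D" using qD A by auto
      have p: "p = al y" using pmap_inj[OF M xD(2) pmap_al[OF M xD(1)]] A(2) y(2) by simp
      from segsD[OF q(1)] show ?thesis
      proof
        assume "q = concat oss"
        hence "set (concat oss) = set (A @ p # y # B)" using A(1) by simp
        hence "y \<in> set (concat oss)" "al y \<in> set (concat oss)" using p by auto
        thus ?thesis using unmatched by blast
      next
        assume "q \<in> {g1, g2, g3}"
        hence g: "geodesic (map lb A @ [lb p, lb y] @ map lb B)" using geoD A(1) by fastforce
        have AB: "map lb A \<in> words S" "map lb B \<in> words S" using lbS qD A(1) by auto
        have "[lb p, lb y] = inv_word [lb y] @ [lb y]" using p lb_al[OF xD(1)] by simp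
        hence "[lb p, lb y] \<approx> []" using eq_inv_left[of "[lb y]"] pdgD(4)[OF P xD(1)] by simp
        from geo_red[OF g this AB] show ?thesis by simp
      qed
    qed
  qed
  from card_mono[OF Zs_card(1) this] show ?thesis using Zs_card(2) by linarith
qed

lemma clean_seg:
  assumes r: "run al ph zs" and I: "set zs \<subseteq> inn" and o: "al ` set zs \<subseteq> set os" and h: "Zs \<inter> al ` set (butlast zs) = {}"
  shows "\<exists>q\<in>set segs. \<exists>A B. q = A @ rev (map al zs) @ B"
proof -
  have zs: "zs \<noteq> []" using r by (simp add: run_def)
  have "hd os \<notin> al ` set (butlast zs)" using h hdZ by blast
  from run_contig[OF r I o this] obtain P' Q' where "concat segs = P' @ rev (map al zs) @ Q'" using os_segs by auto
  thus ?thesis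
  proof (rule seg_contig)
    have "tl (rev (map al zs)) = rev (map al (butlast zs))" using zs by (cases zs rule: rev_cases) auto
    thus "\<forall>q\<in>set segs. q \<noteq> [] \<longrightarrow> hd q \<notin> set (tl (rev (map al zs)))" using h by (auto simp: Zs_def)
  qed (use zs in simp)
qed

text \<open>Each vertex of the component of \<open>a i\<close> is passed at most once: two darts of
  the block with the same lift have the same position, so the arc of the face between them is
  trivial in the group, hence closed in the graph, and a simple face has no such proper arc.\<close>

lemma in_block_short:
  assumes zs: "distinct zs" "set zs \<subseteq> f" and f: "f = cls {ph} x0" "x0 \<in> inn"
    and i: "i < length oss" "al ` set zs \<subseteq> set (oss ! i)"
  shows "length zs \<le> Bd"
proof -
  have fI: "f \<subseteq> inn" using inner_closed(2)[OF d f(2)] f(1) by simp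
  have in1: "z = z'" if z: "z \<in> set zs" "z' \<in> set zs" "lv (al z) = lv (al z')" for z z'
  proof -
    have zI: "z \<in> inn" "z' \<in> inn" using z zs(2) fI by auto
    hence zD: "z \<in> D" "z' \<in> D" by auto
    have b: "al z \<in> set (oss ! i)" "al z' \<in> set (oss ! i)" using z i(2) by auto
    obtain w where w: "rdd (a i) w (lv (al z))" "ps (al z) \<approx> ps (hd os) @ Uw 0 i @ w" using block_pos[OF i(1) b(1)] by metis
    obtain w' where w': "rdd (a i) w' (lv (al z'))" "ps (al z') \<approx> ps (hd os) @ Uw 0 i @ w'" using block_pos[OF i(1) b(2)] by metis
    have ww: "w \<approx> w'" using rd_same_eq[OF w(1)] w'(1) z(3) by simp
    have "ps (hd os) @ Uw 0 i \<in> words S" using hd_words Uw_words by simp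
    hence "(ps (hd os) @ Uw 0 i) @ w \<approx> (ps (hd os) @ Uw 0 i) @ w'" using eq_app[OF eq_refl ww] by blast
    hence q: "ps (hd os) @ Uw 0 i @ w \<approx> ps (hd os) @ Uw 0 i @ w'" by simp
    have e: "ps (al z) \<approx> ps (al z')" by (rule eq_trans[OF w(2) eq_trans[OF q eq_sym[OF w'(2)]]])
    have pp: "ps (ph y) \<approx> ps (al y)" if "y \<in> D" for y using pdgD(6,7)[OF P that] eq_sym eq_trans by blast
    have "cls {ph} z = f" using face_cls[OF d f(2)] z(1) zs(2) f(1) by blast
    moreover have pI: "ph z \<in> inn" using inner_closed(1)[OF d zI(1)] .
    moreover have "cls {ph} (ph z) = cls {ph} z" by (rule face_cls[OF d zI(1)], rule cls_step[OF cls_refl]) simp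
    moreover have "ph z' \<in> f" using cls_step[of z' "{ph}" x0 ph] z zs(2) f(1) by auto
    ultimately have c: "ph z' \<in> cls {ph} (ph z)" by simp
    obtain v where v: "rdd (lv (ph z)) v (lv (ph z'))" "ps (ph z') \<approx> ps (ph z) @ v" using face_rd[OF d pI c] by blast
    have "ps (ph z) \<approx> ps (ph z')" by (rule eq_trans[OF pp[OF zD(1)] eq_trans[OF e eq_sym[OF pp[OF zD(2)]]]])
    hence "ps (ph z) @ [] \<approx> ps (ph z) @ v" using eq_trans[OF _ v(2)] by simp
    hence "v \<approx> []" using eq_cancel_left eq_sym by blast
    hence "lv (ph z) = lv (ph z')" using loop_closed[OF v(1)] by simp
    hence "ph z = ph z'" using face_lv_inj[OF d ok pI c] by simp
    thus ?thesis using pmap_inj[OF M zD] by simp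
  qed
  have "card ((\<lambda>z. lv (al z)) ` set zs) = card (set zs)" by (rule card_image) (auto simp: inj_on_def intro: in1)
  moreover have "(\<lambda>z. lv (al z)) ` set zs \<subseteq> {v. \<exists>w. rdd (a i) w v}"
  proof
    fix v assume "v \<in> (\<lambda>z. lv (al z)) ` set zs"
    then obtain z where z: "z \<in> set zs" "v = lv (al z)" by blast
    hence "al z \<in> set (oss ! i)" using i(2) by auto
    thus "v \<in> {v. \<exists>w. rdd (a i) w v}" using block_pos[OF i(1)] z(2) by blast
  qed
  ultimately have "card (set zs) \<le> card {v. \<exists>w. rdd (a i) w v}" using card_mono[OF fin] by metis
  thus ?thesis using Bd(2)[of i] distinct_card[OF zs(1)] by simp
qed

lemma L_short:
  assumes r: "run al ph zs" and f: "f = cls {ph} x0" "x0 \<in> inn" "set zs \<subseteq> f"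
    and o: "al ` set zs \<subseteq> set (concat oss)" and h: "hd os \<notin> al ` set (butlast zs)"
  shows "length zs \<le> 2 * Bd"
proof -
  have I: "set zs \<subseteq> inn" using inner_closed(2)[OF d f(2)] f(1,3) by blast
  obtain z1 z2 i j A B A' B' where z: "zs = z1 @ z2" and
    1: "z1 = [] \<or> i < length oss \<and> oss ! i = A @ rev (map al z1) @ B" and
    2: "z2 = [] \<or> j < length oss \<and> oss ! j = A' @ rev (map al z2) @ B'" using two_pieces[OF r I o h] by metis
  have dz: "distinct z1" "distinct z2" "set z1 \<subseteq> f" "set z2 \<subseteq> f" using r z f(3) by (auto simp: run_def)
  have "length z1 \<le> Bd" using 1 in_block_short[OF dz(1,3) f(1,2), of i] by (cases "z1 = []") auto
  moreover have "length z2 \<le> Bd" using 2 in_block_short[OF dz(2,4) f(1,2), of j] by (cases "z2 = []") auto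
  ultimately show ?thesis using z by simp
qed

text \<open>The rest of the face joins the same two points, and the geodesic is not longer than
  it.\<close>

lemma g_run:
  assumes r: "run al ph zs" and f: "f = cls {ph} x0" "x0 \<in> inn" "set zs \<subseteq> f"
    and g: "g \<in> {g1, g2, g3}" "g = A @ rev (map al zs) @ B"
  shows "2 * length zs \<le> card f"
proof -
  have fI: "f \<subseteq> inn" using inner_closed(2)[OF d f(2)] f(1) by simp
  have zs: "zs \<noteq> []" "distinct zs" "successively (\<lambda>a b. b = ph a) zs"
    using r by (auto simp: run_def elim: successively_mono)
  have hf: "hd zs \<in> f" using zs(1) f(3) by (meson hd_in_set subsetD)
  hence hD: "hd zs \<in> D" using fI by blast
  have cf: "cls {ph} (hd zs) = f" using face_cls[OF d f(2)] hf f(1) by blast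
  obtain xs where xs: "cyc ph (hd zs # xs)" "set (hd zs # xs) = f"
    using cyc_exists[OF pmap_perms(1)[OF M] hD] cf by metis
  obtain rest where rest: "hd zs # xs = zs @ rest" using run_prefix[OF zs xs(1)] by auto
  have len: "card f = length zs + length rest" using xs distinct_card[of "zs @ rest"] unfolding rest by (simp add: cyc_def)
  have m: "map ph (hd zs # xs) = tl (hd zs # xs) @ [hd zs]" using xs(1) by (simp add: cyc_Cons)
  have "\<forall>z\<in>set (hd zs # xs). ps (ph z) \<approx> ps z @ [lb z]" using xs(2) fI pdgD(6)[OF P] by blast
  from path_ps[OF this m] have "ps (hd zs) \<approx> ps (hd zs) @ map lb (zs @ rest)" unfolding rest by (metis list.sel(1) rest list.distinct(1))
  hence "ps (hd zs) @ map lb (zs @ rest) \<approx> ps (hd zs) @ []" using eq_sym by simp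
  hence tr: "map lb zs @ map lb rest \<approx> []" using eq_cancel_left by fastforce
  have fD: "set zs \<subseteq> D" "set rest \<subseteq> D" using xs(2) fI unfolding rest by auto
  have "map lb (rev (map al zs)) = inv_word (map lb zs)"
    using fD(1) lb_al by (auto simp: inv_word_def rev_map)
  moreover have "inv_word (map lb zs) \<approx> map lb rest"
  proof -
    have w: "inv_word (map lb zs) \<in> words S" "map lb rest \<in> words S" using lbS fD by auto
    have "inv_word (map lb zs) @ map lb zs @ map lb rest \<approx> inv_word (map lb zs) @ []" using eq_app[OF eq_refl[OF w(1)] tr] .
    moreover have "(inv_word (map lb zs) @ map lb zs) @ map lb rest \<approx> [] @ map lb rest"
      using eq_app[OF eq_inv_left eq_refl[OF w(2)]] lbS[OF fD(1)] by blast
    ultimately show ?thesis using eq_sym eq_trans by (metis append.assoc append_Nil append_Nil2)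
  qed
  ultimately have e: "map lb (rev (map al zs)) \<approx> map lb rest" by simp
  have gD: "set g \<subseteq> D" using g(1) osD by (auto simp: gs)
  have "map lb A \<in> words S" "map lb B \<in> words S" using gD g(2) lbS by auto
  from geo_red[OF _ e this] have "length (map lb (rev (map al zs))) \<le> length (map lb rest)"
    using geoD[OF g(1)] g(2) by simp
  thus ?thesis using len by simp
qed

text \<open>The excess 1/6 over a flat face in the last bound is what makes far blocks countable.
  Off the corners it can fail, for a face with an arc on the chain, only if the face is small and
  touches a geodesic, and the blocks behind which such a face lies are near.\<close>

lemma face_main:
  assumes x0: "x0 \<in> inn" and f: "f = cls {ph} x0"
  defines "W \<equiv> \<Sum>y\<in>f. wgt al ph inn y" and "A \<equiv> card {y \<in> f. dgr al ph y \<noteq> 2 \<and> al y \<in> set (concat oss)}"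
  shows "W \<ge> real A / 2"
    and "\<forall>y\<in>f. al y \<notin> Zs \<Longrightarrow> W \<ge> 1"
    and "\<forall>y\<in>f. al y \<notin> Zs \<Longrightarrow> (\<forall>y\<in>f. al y \<notin> set gs) \<or> 12 * Bd < card f \<and> A \<ge> 1 \<Longrightarrow> W \<ge> 7 / 6"
proof -
  have fI: "f \<subseteq> inn" using inner_closed(2)[OF d x0] f by simp
  have finf: "finite f" using fI dgD(8)[OF d] by (meson finite_Diff finite_subset)
  let ?E = "{y \<in> f. dgr al ph y \<noteq> 2 \<and> al y \<in> set os}"
  let ?EL = "{y \<in> f. dgr al ph y \<noteq> 2 \<and> al y \<in> set (concat oss)}" and ?EG = "{y \<in> f. dgr al ph y \<noteq> 2 \<and> al y \<in> set gs}"
  have E: "?E = ?EL \<union> ?EG" "?EL \<inter> ?EG = {}" "finite ?EL" "finite ?EG" using dist_os finf by auto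
  define c where "c = card ?EG"
  have Ne: "card ?E = A + c" unfolding E(1) A_def c_def by (rule card_Un_disjoint[OF E(3,4,2)])
  have six: "6 * length zs \<le> 6 * card f" if "run al ph zs" "set zs \<subseteq> f" "al (hd zs) \<in> set os" for zs
    using run_card[OF that(1,2) finf] by simp
  note fc = face_count[OF d ok R2 x0 f, of "\<lambda>_. 6 * card f", folded W_def, unfolded Ne]
  have FC: "card f > 0" "W \<ge> real (A + c) / 3 + real (card {y \<in> f. dgr al ph y \<noteq> 2 \<and> al y \<notin> set os}) / 6" "W \<ge> real (A + c) / 2"
    by (rule fc, rule six; assumption)+
  show "W \<ge> real A / 2" using FC(3) by simp
  have cl: "W \<ge> 1 \<and> ((\<forall>y\<in>f. al y \<notin> set gs) \<or> 12 * Bd < card f \<and> A \<ge> 1 \<longrightarrow> W \<ge> 7 / 6)" if Z: "\<forall>y\<in>f. al y \<notin> Zs"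
  proof -
    let ?n = "card f"
    define Hx where "Hx y = (if al y \<in> set (concat oss) then min (2 * (?n - 1)) (12 * Bd) else 3 * ?n)" for y
    have ext: "6 * length zs \<le> Hx (hd zs)" if r: "run al ph zs" and sub: "set zs \<subseteq> f" and eo: "al (hd zs) \<in> set os" for zs
    proof -
      have zI: "set zs \<subseteq> inn" using sub fI by blast
      have zne: "zs \<noteq> []" using r by (simp add: run_def)
      have alo: "al ` set zs \<subseteq> set os" using run_outer[OF d ok r zI] eo by blast
      have ZZ: "Zs \<inter> al ` set (butlast zs) = {}" using Z sub by (auto dest: in_set_butlastD)
      obtain q A' B' where q: "q \<in> set segs" "q = A' @ rev (map al zs) @ B'" using clean_seg[OF r zI alo ZZ] by blast
      have alq: "al ` set zs \<subseteq> set q" unfolding q(2) by auto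
      have hz: "al (hd zs) \<in> set q" using alq zne by auto
      from segsD[OF q(1)] show ?thesis
      proof
        assume qL: "q = concat oss"
        have h: "hd os \<notin> al ` set (butlast zs)" using ZZ hdZ by blast
        have L: "al ` set zs \<subseteq> set (concat oss)" using alq qL by simp
        show ?thesis using clean_run[OF r f x0 sub L h] L_short[OF r f x0 sub L h] hz qL by (simp add: Hx_def)
      next
        assume qg: "q \<in> {g1, g2, g3}"
        hence "al (hd zs) \<in> set gs" using hz by (auto simp: gs)
        hence "al (hd zs) \<notin> set (concat oss)" using dist_os by auto
        thus ?thesis using g_run[OF r f x0 sub qg q(2)] by (simp add: Hx_def)
      qed
    qed
    let ?Ni = "card {y \<in> f. dgr al ph y \<noteq> 2 \<and> al y \<notin> set os}"
    have sm: "(\<Sum>y\<in>?E. Hx y) = A * min (2 * (?n - 1)) (12 * Bd) + c * (3 * ?n)"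
    proof -
      have "(\<Sum>y\<in>?EL. Hx y) = (\<Sum>y\<in>?EL. min (2 * (?n - 1)) (12 * Bd))" by (rule sum.cong) (auto simp: Hx_def)
      moreover have "(\<Sum>y\<in>?EG. Hx y) = (\<Sum>y\<in>?EG. 3 * ?n)" by (rule sum.cong) (use dist_os in \<open>auto simp: Hx_def\<close>)
      ultimately show ?thesis unfolding E(1) using sum.union_disjoint[OF E(3,4,2), of Hx] by (simp only: sum_constant A_def c_def of_nat_id)
    qed
    \<comment> \<open>Rules out the first alternative of \<open>face_count(5)\<close>, a face
      bounded by a single run.\<close>
    have Hn: "Hx y < 6 * ?n" for y 
    proof (cases "al y \<in> set (concat oss)")
      case True
      have "min (2 * (?n - 1)) (12 * Bd) \<le> 2 * (?n - 1)" by simp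
      thus ?thesis using True FC(1) unfolding Hx_def by (simp only: if_True)
    qed (use FC(1) in \<open>simp add: Hx_def\<close>)
    have "6 * ?n \<le> ?Ni * (?n - 1) + (A * min (2 * (?n - 1)) (12 * Bd) + c * (3 * ?n))"
      
    proof -
      have "(\<exists>y\<in>f. al y \<in> set os \<and> 6 * card f \<le> Hx y) \<and> (\<forall>y\<in>f. dgr al ph y = 2) \<or>
        (\<exists>y\<in>f. dgr al ph y \<noteq> 2) \<and> 6 * card f \<le> ?Ni * (card f - 1) + (\<Sum>y\<in>?E. Hx y)"
        by (rule face_count(5)[OF d ok R2 x0 f], rule ext; assumption)
      thus ?thesis using Hn unfolding sm by (meson not_le)
    qed
    note FA = face_arith[OF this FC(1,2,3)]
    have "c = 0" if "\<forall>y\<in>f. al y \<notin> set gs"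
    proof -
      have "?EG = {}" using that by blast
      thus ?thesis unfolding c_def by (simp only: card.empty)
    qed
    thus ?thesis using FA by blast
  qed
  show "\<forall>y\<in>f. al y \<notin> Zs \<Longrightarrow> W \<ge> 1" 
    "\<forall>y\<in>f. al y \<notin> Zs \<Longrightarrow> (\<forall>y\<in>f. al y \<notin> set gs) \<or> 12 * Bd < card f \<and> A \<ge> 1 \<Longrightarrow> W \<ge> 7 / 6"
    using cl by blast+
qed

text \<open>No edge of a far block is matched with a geodesic, and the block does not lie behind a
  single run (\<open>full_block\<close>). So there is a vertex inside it at which the path behind
  breaks, and an arc begins there. Its face is not both small and in contact with a geodesic, for
  the block would be near.\<close>

lemma far_break:
  assumes i: "0 < i" "Suc i < length oss" and far: "\<not> near i"
  shows "\<exists>y\<in>inn. dgr al ph y \<noteq> 2 \<and> al y \<in> set (oss ! i) \<and>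
    \<not> (card (cls {ph} y) \<le> 12 * Bd \<and> (\<exists>y'\<in>cls {ph} y. al y' \<in> set gs))"
proof -
  have il: "i < length oss" using i by simp
  have bs: "set (oss ! i) \<subseteq> set (concat oss)" using block_sub[OF il] .
  have bD: "y \<in> D" if "y \<in> set (oss ! i)" for y using that bs osD by auto
  have alI: "al y \<in> inn" if y: "y \<in> set (oss ! i)" for y
  proof -
    have "al y \<notin> set gs"
    proof
      assume g: "al y \<in> set gs"
      have "ps (al y) \<approx> ps y @ [lb y]" using pdgD(7)[OF P bD[OF y]] .
      from nearI[OF il y g this] show False using far by simp
    qed
    moreover have "al y \<notin> set (concat oss)" using unmatched y bs by blast
    ultimately show ?thesis using pmap_al[OF M bD[OF y]] by simp
  qed
  have "\<not> successively (\<lambda>y y'. ph (al y') = al y) (oss ! i)" using full_block[OF i] alI by blast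
  from not_successively[OF this] obtain A o1 o2 B where AB: "oss ! i = A @ o1 # o2 # B" and nl: "ph (al o2) \<noteq> al o1" by blast
  have o12: "o1 \<in> set (oss ! i)" "o2 \<in> set (oss ! i)" using AB by auto
  have "os = (concat (take i oss) @ A) @ o1 # o2 # (B @ concat (drop (Suc i) oss) @ gs)" using concat_nth[OF il] AB by simp
  hence p12: "ph o1 = o2" using cyc_next cyco by metis
  have O: "\<forall>x\<in>set os. ph x \<in> set os" "set os \<subseteq> D" using cyc_set[OF cyco] dgD(3)[OF d] by blast+
  let ?y = "al o1"
  have yI: "?y \<in> inn" using alI o12 by blast
  have "dgr al ph ?y \<noteq> 2"
  proof
    assume two: "dgr al ph ?y = 2"
    define p where "p = al o2"
    have pI: "p \<in> inn" "ph p \<in> inn" using alI o12 inner_closed(1)[OF d] by (auto simp: p_def)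
    have alp: "al p = o2" using alal bD o12 by (simp add: p_def)
    have s1: "sgm al ph ?y = o2" using alal bD o12 p12 by (simp add: sgm_def)
    have s2: "sgm al ph o2 = ph p" by (simp add: sgm_def p_def)
    have c1: "o2 \<in> cls {sgm al ph} ?y" using cls_step[OF cls_refl, of "sgm al ph" "{sgm al ph}" ?y] s1 by simp
    have c2: "ph p \<in> cls {sgm al ph} ?y" using cls_step[OF c1, of "sgm al ph"] s2 by simp
    have yD: "?y \<in> D" using yI by blast
    have "cls {sgm al ph} (ph p) = cls {sgm al ph} ?y" by (rule cls_eq[OF pmap_perms(3)[OF M] yD c2])
    hence "dgr al ph (ph p) = 2" using two by (simp add: dgr_def)
    hence "ph (al (ph p)) = al p"
      using corner_weight(3)[OF M O HOL.refl pI inner_deg[OF d ok pI(2)]] alp bs o12 by auto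
    hence "al (ph p) = o1" using pmap_inj[OF M, of "al (ph p)" o1] alp p12 bD o12 pI pmap_al[OF M] by auto
    hence "ph p = al o1" using alal[of "ph p"] pI by auto
    thus False using nl p_def by simp
  qed
  moreover have "al ?y \<in> set (oss ! i)" using alal bD o12 by simp
  moreover have "\<not> (card (cls {ph} ?y) \<le> 12 * Bd \<and> (\<exists>y'\<in>cls {ph} ?y. al y' \<in> set gs))"
  proof
    assume "card (cls {ph} ?y) \<le> 12 * Bd \<and> (\<exists>y'\<in>cls {ph} ?y. al y' \<in> set gs)"
    then obtain y' where y': "card (cls {ph} ?y) \<le> 12 * Bd" "y' \<in> cls {ph} ?y" "al y' \<in> set gs" by blast
    obtain w where w: "length w \<le> card (cls {ph} ?y)" "ps y' \<approx> ps ?y @ w" using face_path[OF yI y'(2)] by blast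
    have y'D: "y' \<in> D" using inner_closed(2)[OF d yI] y'(2) by blast
    have wS: "w \<in> words S" using eq_words(2)[OF w(2)] by simp
    have lS: "[lb y'] \<in> words S" using pdgD(4)[OF P y'D] by simp
    have "ps (al y') \<approx> ps y' @ [lb y']" using pdgD(7)[OF P y'D] .
    also have "\<dots> \<approx> (ps ?y @ w) @ [lb y']" using eq_app[OF w(2) eq_refl[OF lS]] .
    also have "(ps ?y @ w) @ [lb y'] \<approx> ((ps o1 @ [lb o1]) @ w) @ [lb y']"
      using eq_app[OF eq_app[OF pdgD(7)[OF P bD[OF o12(1)]] eq_refl[OF wS]] eq_refl[OF lS]] .
    finally have "ps (al y') \<approx> ps o1 @ (lb o1 # w @ [lb y'])" by simp
    from nearI[OF il o12(1) y'(3) this] show False using far w(1) y'(1) by simp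
  qed
  ultimately show ?thesis using yI by blast
qed

lemma sum_faces: 
  fixes h :: "nat \<Rightarrow> real"
  shows "sum h inn = (\<Sum>f\<in>cls {ph} ` inn. sum h f)"
proof -
  have "\<forall>f\<in>{ph}. \<forall>x\<in>set os. f x \<in> set os" using cyc_set[OF cyco] by blast
  from sum_cls[OF perms_closed_compl(2)[OF pmap_perms(1)[OF M] dgD(3)[OF d] this]] show ?thesis .
qed

text \<open>Each far middle block is charged to an arc on a face that is not both small and in
  contact with a geodesic. Off the corners such a face has at most \<open>2 * W\<close> arcs on the
  chain, and \<open>2 * W \<le> 14 * (W - 1)\<close> holds exactly from \<open>W = 7 / 6\<close> on:
  hence the factor 14. Four corner faces cost \<open>14 * 4\<close>, the total curvature with at
  most four spurs is at least -1 and costs 14 more, and the first and the last block bring 70 to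
  72.\<close>

theorem few_far: "card {i. i < length oss \<and> \<not> near i} \<le> 72"
proof -
  define gd where "gd f \<longleftrightarrow> card f \<le> 12 * Bd \<and> (\<exists>y'\<in>f. al y' \<in> set gs)" for f
  define Y where "Y = {y \<in> inn. dgr al ph y \<noteq> 2 \<and> al y \<in> set (concat oss) \<and> \<not> gd (cls {ph} y)}"
  define F where "F = cls {ph} ` inn"
  define W where "W f = (\<Sum>y\<in>f. wgt al ph inn y)" for f
  let ?Z = "\<lambda>f. \<exists>y\<in>f. al y \<in> Zs"
  have finI: "finite inn" using dgD(8)[OF d] by blast
  have finY: "finite Y" unfolding Y_def using finI by simp
  define J where "J = {i. 0 < i \<and> Suc i < length oss \<and> \<not> near i}"
  have finJ: "finite J" unfolding J_def by (rule finite_subset[of _ "{..<length oss}"]) auto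
  have "card J \<le> card Y"
  proof -
    have "\<exists>y. y \<in> Y \<and> al y \<in> set (oss ! i)" if i: "i \<in> J" for i
    proof -
      have i': "0 < i" "Suc i < length oss" "\<not> near i" using i by (auto simp: J_def)
      hence sub: "set (oss ! i) \<subseteq> set (concat oss)" using block_sub by simp
      show ?thesis using far_break[OF i'] sub unfolding Y_def gd_def by blast
    qed
    then obtain g where g: "\<And>i. i \<in> J \<Longrightarrow> g i \<in> Y \<and> al (g i) \<in> set (oss ! i)" by metis
    have "inj_on g J"
    proof (rule inj_onI)
      fix i j assume ij: "i \<in> J" "j \<in> J" "g i = g j"
      have dis: "distinct (concat oss)" using dist_os by simp
      show "i = j"
      proof (rule ccontr)
        assume ne: "i \<noteq> j"
        have l: "i < length oss" "j < length oss" using ij by (auto simp: J_def)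
        have c: "al (g i) \<in> set (oss ! i)" "al (g i) \<in> set (oss ! j)" using g ij by metis+
        show False
        proof -
          have key: False if "p < q" "q < length oss" "z \<in> set (oss ! p)" "z \<in> set (oss ! q)" for p q z
          proof -
            have "concat oss = concat (take q oss) @ oss ! q @ concat (drop (Suc q) oss)" using concat_nth that by blast
            hence "set (concat (take q oss)) \<inter> set (oss ! q) = {}" using dis by (metis distinct_append Int_Un_distrib set_append Un_empty)
            moreover have "oss ! p \<in> set (take q oss)" using that by (metis in_set_conv_nth length_take min.absorb2 nth_take less_imp_le)
            ultimately show False using that by auto
          qed
          show False using key[of i j] key[of j i] c l ne by (meson linorder_neqE_nat)
        qed
      qed
    qed
    moreover have "g ` J \<subseteq> Y" using g by blast
    ultimately show ?thesis using card_inj_on_le finY by blast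
  qed
  moreover have "card Y \<le> 70"
  proof -
    define h :: "nat \<Rightarrow> real" where "h y = of_bool (y \<in> Y)" for y
    have "real (card Y) = sum h inn"
    proof -
      have "inn \<inter> {y. y \<in> Y} = Y" by (auto simp: Y_def)
      thus ?thesis using finI by (simp add: h_def sum.inter_restrict[symmetric] of_bool_def sum.If_cases)
    qed
    also have "\<dots> = (\<Sum>f\<in>F. sum h f)" unfolding F_def by (rule sum_faces)
    also have "\<dots> \<le> (\<Sum>f\<in>F. 14 * of_bool (?Z f) - 14 * (1 - W f))"
    proof (rule sum_mono)
      fix f assume "f \<in> F"
      then obtain x0 where x0: "x0 \<in> inn" "f = cls {ph} x0" by (auto simp: F_def)
      have fI: "f \<subseteq> inn" using inner_closed(2)[OF d x0(1)] x0(2) by simp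
      have finf: "finite f" using fI finI by (meson finite_subset)
      have cf: "cls {ph} y = f" if "y \<in> f" for y using face_cls[OF d x0(1)] x0(2) that by blast
      let ?A = "card {y \<in> f. dgr al ph y \<noteq> 2 \<and> al y \<in> set (concat oss)}"
      have sh: "sum h f = (if gd f then 0 else real ?A)"
      proof (cases "gd f")
        case True
        have "h y = 0" if "y \<in> f" for y using cf[OF that] True by (simp add: h_def Y_def)
        thus ?thesis using True by simp
      next
        case False
        have "sum h f = (\<Sum>y\<in>f. of_bool (dgr al ph y \<noteq> 2 \<and> al y \<in> set (concat oss)))"
          by (rule sum.cong[OF HOL.refl]) (use cf False fI in \<open>auto simp: h_def Y_def\<close>)
        also have "\<dots> = real ?A" using finf by (simp add: Int_def)
        finally show ?thesis using False by simp
      qed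
      note FM = face_main[OF x0, folded W_def]
      show "sum h f \<le> 14 * of_bool (?Z f) - 14 * (1 - W f)"
      proof (cases "?Z f")
        case True
        thus ?thesis using FM(1) sh by (cases "gd f") simp_all
      next
        case False
        hence Z: "\<forall>y\<in>f. al y \<notin> Zs" by blast
        have W1: "W f \<ge> 1" using FM(2)[OF Z] .
        show ?thesis
        proof (cases "gd f \<or> ?A = 0")
          case True thus ?thesis using W1 False sh by auto
        next
          case ng: False
          hence "(\<forall>y\<in>f. al y \<notin> set gs) \<or> 12 * Bd < card f \<and> ?A \<ge> 1" unfolding gd_def by auto
          from FM(3)[OF Z this] show ?thesis using FM(1) ng False sh by simp
        qed
      qed
    qed
    also have "\<dots> = 14 * (\<Sum>f\<in>F. of_bool (?Z f)) - 14 * (\<Sum>f\<in>F. 1 - W f)"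
      by (simp add: sum_subtractf sum_distrib_left)
    also have "\<dots> \<le> 14 * 4 - 14 * (-1)"
    proof -
      have finF: "finite F" using finI by (simp add: F_def)
      have "(\<Sum>f\<in>F. of_bool (?Z f)) = real (card {f \<in> F. ?Z f})" using finF by (simp add: Int_def)
      moreover have "card {f \<in> F. ?Z f} \<le> card ((\<lambda>z. cls {ph} (al z)) ` Zs)"
      proof (rule card_mono)
        show "finite ((\<lambda>z. cls {ph} (al z)) ` Zs)" using Zs_card by simp
        show "{f \<in> F. ?Z f} \<subseteq> (\<lambda>z. cls {ph} (al z)) ` Zs"
        proof
          fix f assume "f \<in> {f \<in> F. ?Z f}"
          then obtain x0 y where x0: "x0 \<in> inn" "f = cls {ph} x0" "y \<in> f" "al y \<in> Zs" by (auto simp: F_def)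
          have "y \<in> inn" using inner_closed(2)[OF d x0(1)] x0(2,3) by blast
          hence "al (al y) = y" using alal by blast
          moreover have "cls {ph} y = f" using face_cls[OF d x0(1)] x0(2,3) by blast
          ultimately show "f \<in> (\<lambda>z. cls {ph} (al z)) ` Zs" using x0(4) by (intro image_eqI[of _ _ "al y"]) simp_all
        qed
      qed
      moreover have "card ((\<lambda>z. cls {ph} (al z)) ` Zs) \<le> 4" using card_image_le[OF Zs_card(1)] Zs_card(2) le_trans by blast
      ultimately have "(\<Sum>f\<in>F. of_bool (?Z f)) \<le> (4::real)" by simp
      moreover have "(\<Sum>f\<in>F. 1 - W f) \<ge> 1 - real (card {x \<in> set os. ph (al x) = x}) / 2"
        using dg_curvature[OF d ok] unfolding F_def W_def .
      moreover have "real (card {x \<in> set os. ph (al x) = x}) \<le> 4" using spurs by simp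
      ultimately show ?thesis by simp
    qed
    finally show ?thesis by simp
  qed
  moreover have "card {i. i < length oss \<and> \<not> near i} \<le> card J + 2"
  proof -
    have "{i. i < length oss \<and> \<not> near i} \<subseteq> J \<union> {0, length oss - 1}" by (auto simp: J_def)
    hence "card {i. i < length oss \<and> \<not> near i} \<le> card (J \<union> {0, length oss - 1})" using finJ by (intro card_mono) auto
    also have "\<dots> \<le> card J + card {0, length oss - 1}" by (rule card_Un_le)
    also have "\<dots> \<le> card J + 2" by (simp add: card_insert_if)
    finally show ?thesis .
  qed
  ultimately show ?thesis by linarith
qed

end

context chain
begin

text \<open>Nearness is stated in terms of the original word and the geodesics, not of the diagram.
  So it is unaffected by the reductions, which keep the number of blocks, the geodesic sides and the
  outermost ends.\<close>

lemma few_far_dg: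
  assumes Bd: "\<And>j w v. rdd (a j) w v \<Longrightarrow> \<exists>w'. length w' \<le> Bd \<and> rdd (a j) w' v" "\<And>j. card {v. \<exists>w. rdd (a j) w v} \<le> Bd"
    and k: "k \<ge> 3" and gs: "gs = g1 @ g2 @ g3" and geo: "geodesic (map lb g1)" "geodesic (map lb g2)" "geodesic (map lb g3)"
  shows "dg D al ph lb ps lv (concat oss @ gs) \<Longrightarrow> chainp lb lv 0 oss e x \<Longrightarrow> length oss = k \<Longrightarrow> e 0 = a 0 \<Longrightarrow>
    x (k - 1) = b (k - 1) \<Longrightarrow>
    card {i. i < k \<and> \<not> (\<exists>dl rh et. map lb gs = dl @ rh \<and> length et \<le> 13 * Bd + 2 \<and> Uw 0 k @ dl @ et \<approx> Uw 0 i)} \<le> 72"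
proof (induction "mu D ph" arbitrary: D al ph lv oss e x rule: less_induct)
  case less
  have k3: "length oss \<ge> 3" using less.prems k by simp
  show ?case
  proof (cases "cgood D al ph lb lv (concat oss @ gs) oss")
    case True
    interpret C: polygon st aut S R a b u D al ph lb ps lv 0 oss e x gs g1 g2 g3 Bd
      by unfold_locales (use True less.prems k3 gs geo Bd in auto)
    show ?thesis using C.few_far less.prems(3) unfolding C.near_def by simp
  next
    case False
    obtain D' al' ph' lv' oss' e' x' where "dg D' al' ph' lb ps lv' (concat oss' @ gs)" "chainp lb lv' 0 oss' e' x'"
      "length oss' = length oss" "e' 0 = e 0" "x' (length oss - 1) = x (length oss - 1)" "mu D' ph' < mu D ph"
      using chain_reduce[OF less.prems(1,2) k3 False] by metis
    thus ?thesis using less.hyps[of D' ph' al' lv' oss' e' x'] less.prems by simp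
  qed
qed

theorem far_blocks:
  assumes Bd: "\<And>j w v. rdd (a j) w v \<Longrightarrow> \<exists>w'. length w' \<le> Bd \<and> rdd (a j) w' v" "\<And>j. card {v. \<exists>w. rdd (a j) w v} \<le> Bd"
    and geo: "geodesic c1" "geodesic c2" "geodesic c3" and w: "Uw 0 k @ c1 @ c2 @ c3 \<approx> []"
  shows "card {i. i < k \<and> \<not> (\<exists>dl rh et. c1 @ c2 @ c3 = dl @ rh \<and> length et \<le> 13 * Bd + 2 \<and> Uw 0 k @ dl @ et \<approx> Uw 0 i)} \<le> 72"
proof (cases "k \<ge> 3")
  case True
  have "Uw 0 k @ c1 @ c2 @ c3 \<noteq> []" using Uw_ne[of k 0] True by simp
  then obtain D al ph lb ps lv oss gs e x where h: "dg D al ph lb ps lv (concat oss @ gs)" "chainp lb lv 0 oss e x"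
    "length oss = k" "e 0 = a 0" "x (k - 1) = b (0 + (k - 1))" and gs: "map lb gs = c1 @ c2 @ c3"
    using chain_dg[OF w] True by (metis gr0I not_numeral_le_zero)
  from iffD1[OF map_eq_append_conv gs] obtain g1 r where 1: "gs = g1 @ r" "c1 = map lb g1" "map lb r = c2 @ c3" by metis
  from iffD1[OF map_eq_append_conv 1(3)] obtain g2 g3 where 2: "r = g2 @ g3" "c2 = map lb g2" "map lb g3 = c3" by metis
  have "gs = g1 @ g2 @ g3" "geodesic (map lb g1)" "geodesic (map lb g2)" "geodesic (map lb g3)" using 1 2 geo by auto
  from few_far_dg[OF Bd True this h(1-4)] h(5) gs show ?thesis by simp
next
  case False
  have "card {i. i < k \<and> \<not> (\<exists>dl rh et. c1 @ c2 @ c3 = dl @ rh \<and> length et \<le> 13 * Bd + 2 \<and> Uw 0 k @ dl @ et \<approx> Uw 0 i)} \<le> card {..<k}"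
    by (intro card_mono) auto
  thus ?thesis using False by simp
qed

end

context scg
begin

abbreviation "pw w n \<equiv> concat (replicate n w)"
abbreviation "dd \<equiv> cay_dist S R"

subsection \<open>Projections to a cyclic subgroup\<close>

lemma dd_le: "w \<in> words S \<Longrightarrow> u @ w \<approx> v \<Longrightarrow> dd u v \<le> length w"
  unfolding cay_dist_def eqw_def by (rule Least_le) blast

lemma eq_move_left: assumes "u \<in> words S" "v \<in> words S" shows "u @ (inv_word u @ v) \<approx> v"
proof -
  have "(u @ inv_word u) @ v \<approx> [] @ v" by (rule eq_app[OF eq_inv_right eq_refl]) (use assms in auto)
  thus ?thesis by simp
qed

lemma dd_ex:
  assumes "u \<in> words S" "v \<in> words S"
  obtains w where "w \<in> words S" "length w = dd u v" "u @ w \<approx> v"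
proof -
  have "\<exists>n. \<exists>w\<in>words S. length w = n \<and> (u @ w, v) \<in> word_eq S R"
    using eq_move_left[OF assms] assms unfolding eqw_def by (meson words_simps(2,4))
  from LeastI_ex[OF this] show ?thesis using that unfolding cay_dist_def eqw_def by blast
qed

lemma dd_sym: assumes "u \<in> words S" "v \<in> words S" shows "dd u v = dd v u"
proof -
  have 1: "dd v u \<le> dd u v" if uv: "u \<in> words S" "v \<in> words S" for u v
  proof -
    obtain w where w: "w \<in> words S" "length w = dd u v" "u @ w \<approx> v" using dd_ex[OF uv] .
    have "v @ inv_word w \<approx> u" using eq_inv_move[OF w(3)] eq_sym by blast
    thus ?thesis using dd_le[of "inv_word w"] w by fastforce
  qed
  show ?thesis using 1[OF assms] 1[OF assms(2,1)] by simp
qed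

lemma dd_tri: assumes "u \<in> words S" "v \<in> words S" "w \<in> words S" shows "dd u w \<le> dd u v + dd v w"
proof -
  obtain p where p: "p \<in> words S" "length p = dd u v" "u @ p \<approx> v" using dd_ex[OF assms(1,2)] .
  obtain q where q: "q \<in> words S" "length q = dd v w" "v @ q \<approx> w" using dd_ex[OF assms(2,3)] .
  have "(u @ p) @ q \<approx> v @ q" using eq_app[OF p(3) eq_refl[OF q(1)]] .
  hence "u @ (p @ q) \<approx> w" using eq_trans q(3) by simp
  thus ?thesis using dd_le[of "p @ q" u w] p q by simp
qed

lemma geo_dd:
  assumes "u \<in> words S" "v \<in> words S"
  obtains w where "w \<in> words S" "length w = dd u v" "u @ w \<approx> v" "geodesic w"
proof -
  obtain w where w: "w \<in> words S" "length w = dd u v" "u @ w \<approx> v" using dd_ex[OF assms] .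
  have "length w \<le> length w'" if "w' \<approx> w" for w'
  proof -
    have "u @ w' \<approx> v" using eq_app[OF eq_refl[OF assms(1)] that] w(3) eq_trans by blast
    thus ?thesis using dd_le eq_words(1)[OF that] w(2) by simp
  qed
  thus ?thesis using that w by (simp add: geodesic_def)
qed

lemma pw_words: "w \<in> words S \<Longrightarrow> pw w n \<in> words S" by (induction n) auto

lemma pw_Suc: "pw w (Suc n) = pw w n @ w"
  by (metis append_Nil2 concat.simps(1) concat.simps(2) concat_append replicate_Suc replicate_append_same)

lemma zp_Suc: assumes w: "w \<in> words S" shows "word_zpow w s @ w \<approx> word_zpow w (s + 1)"
proof (cases "s \<ge> 0")
  case True
  hence "nat (s + 1) = Suc (nat s)" by simp
  hence "word_zpow w (s + 1) = word_zpow w s @ w" using True pw_Suc[of "nat s" w] by (simp add: word_zpow_def)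
  thus ?thesis using eq_refl w pw_words[OF w] True by (simp add: word_zpow_def)
next
  case False
  define n where "n = nat (- s - 1)"
  have s: "s = - 1 - int n" using False by (simp add: n_def)
  have 1: "word_zpow w s = pw (inv_word w) n @ inv_word w" using pw_Suc[of n "inv_word w"] by (simp add: word_zpow_def s nat_add_distrib)
  have 2: "word_zpow w (s + 1) = pw (inv_word w) n" by (cases n) (auto simp: word_zpow_def s nat_add_distrib)
  have "pw (inv_word w) n @ (inv_word w @ w) \<approx> pw (inv_word w) n @ []"
    by (rule eq_app[OF eq_refl eq_inv_left[OF w]]) (use w pw_words in simp)
  thus ?thesis using 1 2 by simp
qed

lemma zp_words: "w \<in> words S \<Longrightarrow> word_zpow w s \<in> words S"
  by (auto simp: word_zpow_def pw_words)

lemma zp_pw: assumes w: "w \<in> words S" shows "word_zpow w s @ pw w n \<approx> word_zpow w (s + int n)"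
proof (induction n)
  case 0 thus ?case using eq_refl[OF zp_words[OF w]] by simp
next
  case (Suc n)
  have "(word_zpow w s @ pw w n) @ w \<approx> word_zpow w (s + int n) @ w" by (rule eq_app[OF Suc eq_refl[OF w]])
  also have "\<dots> \<approx> word_zpow w (s + int n + 1)" by (rule zp_Suc[OF w])
  finally show ?case by (simp add: pw_Suc add.assoc add.commute[of 1] del: replicate.simps)
qed

definition near_pw :: "('s \<times> bool) list \<Rightarrow> nat \<Rightarrow> nat \<Rightarrow> ('s \<times> bool) list \<Rightarrow> nat \<Rightarrow> bool" where
  "near_pw w r k c j \<longleftrightarrow> (\<exists>dl rh et. c = dl @ rh \<and> length et \<le> r \<and> pw w k @ dl @ et \<approx> pw w j)"

lemma pw_inj:
  assumes io: "infinite_order S R w" and e: "pw w i \<approx> pw w j"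
  shows "i = j"
proof -
  have 1: False if "i < j" "pw w i \<approx> pw w j" for i j
  proof -
    have "pw w j = pw w i @ pw w (j - i)" using that(1) by (metis concat_append le_add_diff_inverse less_imp_le replicate_add)
    hence "pw w i @ [] \<approx> pw w i @ pw w (j - i)" using that(2) by simp
    hence "pw w (j - i) \<approx> []" using eq_cancel_left eq_sym by blast
    moreover have "word_zpow w (int (j - i)) = pw w (j - i)" by (simp add: word_zpow_def)
    ultimately show False using io that(1) unfolding infinite_order_def eqw_def by (metis of_nat_eq_0_iff zero_less_diff less_numeral_extra(3))
  qed
  show ?thesis using 1[of i j] 1[of j i] e eq_sym by (meson linorder_neqE_nat)
qed

lemma count_near:
  assumes finS: "finite S" and w: "w \<in> words S" and io: "infinite_order S R w" and c: "c \<in> words S" and z: "z \<in> words S"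
  shows "card {j. j < k \<and> dd c (z @ pw w j) \<le> m} \<le> card {v \<in> words S. length v \<le> m}"
proof -
  have "\<exists>v. v \<in> words S \<and> length v \<le> m \<and> c @ v \<approx> z @ pw w j" if "dd c (z @ pw w j) \<le> m" for j
  proof -
    have "z @ pw w j \<in> words S" using z pw_words[OF w] by simp
    from dd_ex[OF c this] show ?thesis using that by metis
  qed
  then obtain g where g: "\<And>j. dd c (z @ pw w j) \<le> m \<Longrightarrow> g j \<in> words S \<and> length (g j) \<le> m \<and> c @ g j \<approx> z @ pw w j" by metis
  have fw: "finite {v \<in> words S. length v \<le> m}"
  proof (rule finite_subset)
    show "{v \<in> words S. length v \<le> m} \<subseteq> {v. set v \<subseteq> S \<times> UNIV \<and> length v \<le> m}" by (auto simp: words_def)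
    show "finite {v. set v \<subseteq> S \<times> (UNIV :: bool set) \<and> length v \<le> m}" by (rule finite_lists_length_le) (use finS in simp)
  qed
  show ?thesis
  proof (rule card_inj_on_le[OF _ _ fw])
    show "inj_on g {j. j < k \<and> dd c (z @ pw w j) \<le> m}"
    proof (rule inj_onI)
      fix i j assume i: "i \<in> {j. j < k \<and> dd c (z @ pw w j) \<le> m}" and j: "j \<in> {j. j < k \<and> dd c (z @ pw w j) \<le> m}" and e: "g i = g j"
      have "c @ g i \<approx> z @ pw w i" "c @ g i \<approx> z @ pw w j" using g[of i] g[of j] i j e by auto
      hence "z @ pw w i \<approx> z @ pw w j" using eq_sym eq_trans by blast
      hence "pw w i \<approx> pw w j" by (rule eq_cancel_left)
      thus "i = j" by (rule pw_inj[OF io])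
    qed
  qed (use g in auto)
qed

lemma set_dist_le: "y \<in> Y \<Longrightarrow> set_dist S R p Y \<le> dd p y"
  unfolding set_dist_def by (rule Least_le) blast

text \<open>Of the \<open>k\<close> powers between the two projections all but \<open>Mx\<close> are
  within \<open>r\<close> of one of the three geodesics, and each of these is within
  \<open>4 * r\<close> of \<open>y\<close> or \<open>y'\<close>. Different powers are different
  elements, so two balls of radius \<open>4 * r\<close> bound their number and hence
  \<open>k\<close>.\<close>

lemma proj_core:
  assumes finS: "finite S" and w: "w \<in> words S" and io: "infinite_order S R w"
    and H: "\<And>k c1 c2 c3. geodesic c1 \<Longrightarrow> geodesic c2 \<Longrightarrow> geodesic c3 \<Longrightarrow> pw w k @ c1 @ c2 @ c3 \<approx> [] \<Longrightarrow>
       card {j. j < k \<and> \<not> near_pw w r k (c1 @ c2 @ c3) j} \<le> Mx"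
    and p: "p \<in> words S" "p' \<in> words S" and Y: "Y = cyclic_sub S R w"
    and hyp: "dd p' p \<le> set_dist S R p' Y \<or> dd p' p \<le> set_dist S R p Y"
    and y: "y \<in> closest_proj S R Y p" "y \<approx> word_zpow w s" and y': "y' \<in> closest_proj S R Y p'" "y' \<approx> word_zpow w t"
    and st: "s \<le> t"
  shows "dd y y' \<le> (Mx + 2 * card {v \<in> words S. length v \<le> 4 * r}) * length w"
proof -
  have yW: "y \<in> words S" "y' \<in> words S" using eq_words(1) y(2) y'(2) by blast+
  define k where "k = nat (t - s)"
  have t: "t = s + int k" using st by (simp add: k_def)
  have ypw: "y @ pw w j \<approx> word_zpow w (s + int j)" for j
    using eq_app[OF y(2) eq_refl[OF pw_words[OF w]]] zp_pw[OF w] eq_trans by blast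
  have ykW: "y @ pw w j \<in> words S" for j using yW pw_words[OF w] by simp
  have yk: "y @ pw w k \<approx> y'" using ypw[of k] y'(2) t eq_sym eq_trans by metis
  have zY: "y @ pw w j \<in> Y" for j unfolding Y cyclic_sub_def using ypw[of j] ykW[of j] unfolding eqw_def by blast
  have c1: "dd p y \<le> dd p z" "set_dist S R p Y \<le> dd p z" if "z \<in> Y" for z
    using set_dist_le[OF that] y(1) by (auto simp: closest_proj_def)
  have c2: "dd p' y' \<le> dd p' z" "set_dist S R p' Y \<le> dd p' z" if "z \<in> Y" for z
    using set_dist_le[OF that] y'(1) by (auto simp: closest_proj_def)
  obtain g1 where g1: "g1 \<in> words S" "length g1 = dd y' p'" "y' @ g1 \<approx> p'" "geodesic g1"
    using geo_dd[OF yW(2) p(2)] .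
  obtain g2 where g2: "g2 \<in> words S" "length g2 = dd p' p" "p' @ g2 \<approx> p" "geodesic g2"
    using geo_dd[OF p(2,1)] .
  obtain g3 where g3: "g3 \<in> words S" "length g3 = dd p y" "p @ g3 \<approx> y" "geodesic g3"
    using geo_dd[OF p(1) yW(1)] .
  have e12: "y' @ g1 @ g2 \<approx> p" using eq_app[OF g1(3) eq_refl[OF g2(1)]] g2(3) eq_trans by fastforce
  have "y @ (pw w k @ g1 @ g2 @ g3) \<approx> y @ []"
  proof -
    have "(y @ pw w k) @ (g1 @ g2 @ g3) \<approx> y' @ (g1 @ g2 @ g3)" by (rule eq_app[OF yk eq_refl]) (use g1 g2 g3 in simp)
    also have "y' @ (g1 @ g2 @ g3) \<approx> p @ g3" using eq_app[OF e12 eq_refl[OF g3(1)]] by simp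
    also have "p @ g3 \<approx> y" by (rule g3(3))
    finally show ?thesis by simp
  qed
  hence closed: "pw w k @ g1 @ g2 @ g3 \<approx> []" by (rule eq_cancel_left)
  have "card {j. j < k \<and> \<not> near_pw w r k (g1 @ g2 @ g3) j} \<le> Mx"
    by (rule H[OF _ _ _ closed]) (use g1(4) g2(4) g3(4) in auto)
  moreover have "dd y' (y @ pw w j) \<le> 4 * r \<or> dd y (y @ pw w j) \<le> 4 * r" if "near_pw w r k (g1 @ g2 @ g3) j" for j
  proof -
    let ?z = "y @ pw w j"
    obtain dl rh et where ne: "g1 @ g2 @ g3 = dl @ rh" "length et \<le> r" "pw w k @ dl @ et \<approx> pw w j"
      using \<open>near_pw w r k (g1 @ g2 @ g3) j\<close> unfolding near_pw_def by blast
    have dlW: "dl \<in> words S" "rh \<in> words S" "et \<in> words S"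
    proof -
      have "dl @ rh \<in> words S" using g1 g2 g3 by (simp flip: ne(1))
      thus "dl \<in> words S" "rh \<in> words S" by simp_all
      show "et \<in> words S" using eq_words(1)[OF ne(3)] by simp
    qed
    let ?q = "y' @ dl"
    have qW: "?q \<in> words S" using yW dlW by simp
    have "y' @ (dl @ et) \<approx> (y @ pw w k) @ (dl @ et)" by (rule eq_app[OF eq_sym[OF yk] eq_refl]) (use dlW in simp)
    also have "(y @ pw w k) @ (dl @ et) \<approx> y @ pw w j" using eq_app[OF eq_refl[OF yW(1)] ne(3)] by simp
    finally have qz: "?q @ et \<approx> ?z" by simp
    have dqz: "dd ?q ?z \<le> r" using dd_le[OF dlW(3) qz] ne(2) by simp
    note W = yW p qW ykW[of j]
    have tri: "dd u1 u3 \<le> dd u1 u2 + dd u2 u3" if "u1 \<in> {y, y', p, p', ?q, ?z}" "u2 \<in> {y, y', p, p', ?q, ?z}" "u3 \<in> {y, y', p, p', ?q, ?z}" for u1 u2 u3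
      by (rule dd_tri) (use that W in auto)
    have sym: "dd u1 u2 = dd u2 u1" if "u1 \<in> {y, y', p, p', ?q, ?z}" "u2 \<in> {y, y', p, p', ?q, ?z}" for u1 u2
      by (rule dd_sym) (use that W in auto)
    have "g1 @ (g2 @ g3) = dl @ rh" using ne(1) by simp
    then consider (a) us where "g1 = dl @ us" | (bc) us where "dl = g1 @ us" "g2 @ g3 = us @ rh"
      by (auto simp: append_eq_append_conv2)
    then consider (a) us where "g1 = dl @ us" | (b) us vs where "dl = g1 @ us" "g2 = us @ vs" | (c) us where "dl = g1 @ g2 @ us" "g3 = us @ rh"
    proof cases
      case bc
      then consider vs where "g2 = us @ vs" | vs where "us = g2 @ vs" "g3 = vs @ rh" by (auto simp: append_eq_append_conv2)
      thus thesis using bc b c by cases auto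
    qed (use a in blast)
    thus ?thesis
    proof cases
      case a
      have "?q @ us \<approx> p'" using g1(3) a by simp
      hence "dd ?q p' \<le> length us" using dd_le g1(1) a by simp
      moreover have "dd y' ?q \<le> length dl" using dd_le[OF dlW(1) eq_refl[OF qW]] .
      moreover have "length dl + length us = dd y' p'" using g1(2) a by simp
      moreover have "dd p' y' \<le> dd p' ?z" using c2(1)[OF zY] .
      moreover have "dd p' ?z \<le> dd p' ?q + dd ?q ?z" "dd y' ?z \<le> dd y' ?q + dd ?q ?z" by (rule tri; simp)+
      moreover have "dd p' y' = dd y' p'" "dd p' ?q = dd ?q p'" by (rule sym; simp)+
      ultimately have "dd y' ?z \<le> 4 * r" using dqz by linarith
      thus ?thesis ..
    next
      \<comment> \<open>The near point \<open>y' @ dl\<close> lies between \<open>p'\<close> and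
        \<open>p\<close>. If this side is no longer than the distance of \<open>p'\<close> from
        \<open>Y\<close>, the near point is within \<open>r\<close> of \<open>p\<close>, so the
        power is within \<open>2 * r\<close> of \<open>p\<close> and, as \<open>y\<close> is closest
        to \<open>p\<close>, within \<open>4 * r\<close> of \<open>y\<close>. The other alternative
        of \<open>hyp\<close> is symmetric.\<close>
      case b
      have usW: "us \<in> words S" "vs \<in> words S" using b g2(1) by auto
      have "p' @ us \<approx> y' @ g1 @ us" using eq_app[OF eq_sym[OF g1(3)] eq_refl[OF usW(1)]] by simp
      hence "p' @ us \<approx> ?q" using b by simp
      hence 1: "dd p' ?q \<le> length us" using dd_le usW by blast
      have "?q @ vs \<approx> p" using e12 b by simp
      hence 2: "dd ?q p \<le> length vs" using dd_le usW by blast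
      have 3: "length us + length vs = dd p' p" using g2(2) b by simp
      have T: "dd p' ?z \<le> dd p' ?q + dd ?q ?z" "dd p ?z \<le> dd p ?q + dd ?q ?z" "dd y' ?z \<le> dd y' p' + dd p' ?z" "dd y ?z \<le> dd y p + dd p ?z"
        by (rule tri; simp)+
      have Sy: "dd p ?q = dd ?q p" "dd y' p' = dd p' y'" "dd y p = dd p y" by (rule sym; simp)+
      from hyp show ?thesis
      proof
        assume "dd p' p \<le> set_dist S R p' Y"
        hence "dd p' p \<le> dd p' ?z" using c2(2)[OF zY[of j]] by linarith
        hence "dd y ?z \<le> 4 * r" using c1(1)[OF zY[of j]] 1 2 3 T Sy dqz by linarith
        thus ?thesis ..
      next
        assume "dd p' p \<le> set_dist S R p Y"
        hence "dd p' p \<le> dd p ?z" using c1(2)[OF zY[of j]] by linarith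
        hence "dd y' ?z \<le> 4 * r" using c2(1)[OF zY[of j]] 1 2 3 T Sy dqz by linarith
        thus ?thesis ..
      qed
    next
      case c
      have usW: "us \<in> words S" using c g3(1) by auto
      have "p @ us \<approx> (y' @ g1 @ g2) @ us" using eq_app[OF eq_sym[OF e12] eq_refl[OF usW]] .
      hence pq: "p @ us \<approx> ?q" using c by simp
      hence 1: "dd p ?q \<le> length us" using dd_le usW by blast
      have "?q @ rh \<approx> (p @ us) @ rh" by (rule eq_app[OF eq_sym[OF pq] eq_refl[OF dlW(2)]])
      hence "?q @ rh \<approx> y" using g3(3) c eq_trans by fastforce
      hence 2: "dd ?q y \<le> length rh" using dd_le dlW by blast
      have 3: "length us + length rh = dd p y" using g3(2) c by simp
      have T: "dd p ?z \<le> dd p ?q + dd ?q ?z" "dd y ?z \<le> dd y ?q + dd ?q ?z" by (rule tri; simp)+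
      have Sy: "dd y ?q = dd ?q y" by (rule sym; simp)
      have "dd y ?z \<le> 4 * r" using c1(1)[OF zY[of j]] 1 2 3 T Sy dqz by linarith
      thus ?thesis ..
    qed
  qed
  moreover have "card {j. j < k \<and> dd y' (y @ pw w j) \<le> 4 * r} \<le> card {v \<in> words S. length v \<le> 4 * r}"
    "card {j. j < k \<and> dd y (y @ pw w j) \<le> 4 * r} \<le> card {v \<in> words S. length v \<le> 4 * r}"
    by (rule count_near[OF finS w io]; rule yW)+
  ultimately have cnt: "card {j. j < k \<and> \<not> near_pw w r k (g1 @ g2 @ g3) j} + (card {j. j < k \<and> dd y' (y @ pw w j) \<le> 4 * r} +
     card {j. j < k \<and> dd y (y @ pw w j) \<le> 4 * r}) \<le> Mx + 2 * card {v \<in> words S. length v \<le> 4 * r}"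
    and cov: "{..<k} \<subseteq> {j. j < k \<and> \<not> near_pw w r k (g1 @ g2 @ g3) j} \<union> ({j. j < k \<and> dd y' (y @ pw w j) \<le> 4 * r} \<union>
     {j. j < k \<and> dd y (y @ pw w j) \<le> 4 * r})" by (linarith, auto)
  have "k = card {..<k}" by simp
  also have "\<dots> \<le> card ({j. j < k \<and> \<not> near_pw w r k (g1 @ g2 @ g3) j} \<union> ({j. j < k \<and> dd y' (y @ pw w j) \<le> 4 * r} \<union>
     {j. j < k \<and> dd y (y @ pw w j) \<le> 4 * r}))" by (rule card_mono[OF _ cov]) simp
  also have "\<dots> \<le> card {j. j < k \<and> \<not> near_pw w r k (g1 @ g2 @ g3) j} + (card {j. j < k \<and> dd y' (y @ pw w j) \<le> 4 * r} +
     card {j. j < k \<and> dd y (y @ pw w j) \<le> 4 * r})" by (rule order_trans[OF card_Un_le]) (simp add: card_Un_le)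
  finally have kb: "k \<le> Mx + 2 * card {v \<in> words S. length v \<le> 4 * r}" using cnt by linarith
  have "dd y y' \<le> length (pw w k)" by (rule dd_le[OF pw_words[OF w] yk])
  moreover have "length (pw w k) = k * length w" by (simp add: length_concat sum_list_replicate)
  ultimately have "dd y y' \<le> k * length w" by simp
  also have "\<dots> \<le> (Mx + 2 * card {v \<in> words S. length v \<le> 4 * r}) * length w" using kb by (rule mult_le_mono1)
  finally show ?thesis .
qed

text \<open>The two projected points may belong to the same point; the side between is then trivial
  and \<open>hyp\<close> holds with distance 0. The exponents \<open>s\<close> and \<open>t\<close>
  may come in either order, and exchanging the roles is possible because \<open>hyp\<close> is a
  disjunction.\<close>

theorem contracting:
  assumes finS: "finite S" and w: "w \<in> words S" and io: "infinite_order S R w"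
    and H: "\<And>k c1 c2 c3. geodesic c1 \<Longrightarrow> geodesic c2 \<Longrightarrow> geodesic c3 \<Longrightarrow> pw w k @ c1 @ c2 @ c3 \<approx> [] \<Longrightarrow>
       card {j. j < k \<and> \<not> near_pw w r k (c1 @ c2 @ c3) j} \<le> Mx"
  shows "strongly_contracting S R (cyclic_sub S R w)"
  unfolding strongly_contracting_def
proof (intro exI ballI impI)
  let ?Y = "cyclic_sub S R w"
  fix p p' y y' assume p: "p \<in> words S" "p' \<in> words S" and le: "dd p p' \<le> set_dist S R p ?Y"
    and y: "y \<in> closest_proj S R ?Y p \<union> closest_proj S R ?Y p'" "y' \<in> closest_proj S R ?Y p \<union> closest_proj S R ?Y p'"
  obtain s where s: "y \<approx> word_zpow w s" using y(1) by (auto simp: closest_proj_def cyclic_sub_def eqw_def)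
  obtain t where t: "y' \<approx> word_zpow w t" using y(2) by (auto simp: closest_proj_def cyclic_sub_def eqw_def)
  obtain q where q: "q \<in> {p, p'}" "y \<in> closest_proj S R ?Y q" using y(1) by blast
  obtain q' where q': "q' \<in> {p, p'}" "y' \<in> closest_proj S R ?Y q'" using y(2) by blast
  have W: "q \<in> words S" "q' \<in> words S" using q q' p by auto
  have "dd q q = 0" if "q \<in> words S" for q using dd_le[of "[]" q q] eq_refl[OF that] by simp
  hence hyp: "dd q' q \<le> set_dist S R q' ?Y \<or> dd q' q \<le> set_dist S R q ?Y"
    using q(1) q'(1) le dd_sym[OF p] p by auto
  hence hyp2: "dd q q' \<le> set_dist S R q ?Y \<or> dd q q' \<le> set_dist S R q' ?Y" using dd_sym[OF W] by auto
  have yW: "y \<in> words S" "y' \<in> words S" using eq_words(1) s t by blast+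
  show "dd y y' \<le> (Mx + 2 * card {v \<in> words S. length v \<le> 4 * r}) * length w"
  proof (cases "s \<le> t")
    case True
    show ?thesis by (rule proj_core[OF finS w io H W HOL.refl hyp q(2) s q'(2) t True])
  next
    case False
    hence "t \<le> s" by simp
    have "dd y' y \<le> (Mx + 2 * card {v \<in> words S. length v \<le> 4 * r}) * length w"
      by (rule proj_core[OF finS w io H W(2,1) HOL.refl hyp2 q'(2) t q(2) s \<open>t \<le> s\<close>])
    thus ?thesis using dd_sym[OF yW] by simp
  qed
qed

end

context scg
begin

subsection \<open>Half cycles\<close>

definition "nx v x = (THE u. st v x u)"

lemma nx: "st v x u \<Longrightarrow> nx v x = u"
  unfolding nx_def by (rule the_equality) (auto dest: st_det)

text \<open>The visited vertices without the last one, so that a simple cycle is a closed path with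
  distinct \<open>sv\<close>.\<close>

primrec sv :: "'v \<Rightarrow> ('s \<times> bool) list \<Rightarrow> 'v list" where
  "sv v [] = []"
| "sv v (x # w) = v # sv (nx v x) w"

lemma sv_append: "rdd v w u \<Longrightarrow> sv v (w @ w') = sv v w @ sv u w'"
  by (induction w arbitrary: v) (auto simp: nx)

lemma length_sv [simp]: "length (sv v w) = length w" by (induction w arbitrary: v) auto

lemma sv_split:
  "rdd v w u \<Longrightarrow> z \<in> set (sv v w) \<Longrightarrow> \<exists>A C. w = A @ C \<and> C \<noteq> [] \<and> rdd v A z \<and> rdd z C u"
proof (induction w arbitrary: v)
  case (Cons x w)
  then obtain v1 where v1: "st v x v1" "rdd v1 w u" by auto
  show ?case
  proof (cases "z = v")
    case True thus ?thesis using Cons.prems by (intro exI[of _ "[]"] exI[of _ "x # w"]) auto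
  next
    case False
    hence "z \<in> set (sv v1 w)" using Cons.prems nx[OF v1(1)] by simp
    from Cons.IH[OF v1(2) this] obtain A C where "w = A @ C" "C \<noteq> []" "rdd v1 A z" "rdd z C u" by blast
    thus ?thesis using v1 by (intro exI[of _ "x # A"] exI[of _ C]) auto
  qed
qed simp

lemma sv_take: "rdd v (take i w) t \<Longrightarrow> i < length w \<Longrightarrow> sv v w ! i = t"
proof (induction i arbitrary: v w)
  case 0 thus ?case by (cases w) auto
next
  case (Suc i) thus ?case by (cases w) (auto simp: nx)
qed

lemma rd_take: "rdd v w u \<Longrightarrow> \<exists>t. rdd v (take i w) t"
  by (metis append_take_drop_id rd_append)

lemma scyc_sv: "scyc st v w \<longleftrightarrow> w \<noteq> [] \<and> rdd v w v \<and> distinct (sv v w) \<and> (\<forall>x. w \<noteq> [x, inv_letter x])"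
proof -
  have "distinct (sv v w) \<longleftrightarrow> (\<forall>i j u. i < j \<longrightarrow> j < length w \<longrightarrow> rdd v (take i w) u \<longrightarrow> \<not> rdd v (take j w) u)"
    if r: "rdd v w v"
  proof
    assume d: "distinct (sv v w)"
    show "\<forall>i j u. i < j \<longrightarrow> j < length w \<longrightarrow> rdd v (take i w) u \<longrightarrow> \<not> rdd v (take j w) u"
    proof (intro allI impI notI)
      fix i j u assume ij: "i < j" "j < length w" "rdd v (take i w) u" "rdd v (take j w) u"
      hence "sv v w ! i = sv v w ! j" using sv_take[OF ij(3)] sv_take[OF ij(4)] by simp
      thus False using d ij by (simp add: nth_eq_iff_index_eq)
    qed
  next
    assume a: "\<forall>i j u. i < j \<longrightarrow> j < length w \<longrightarrow> rdd v (take i w) u \<longrightarrow> \<not> rdd v (take j w) u"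
    have ne: "sv v w ! i \<noteq> sv v w ! j" if "i < j" "j < length w" for i j
    proof -
      obtain t where t: "rdd v (take i w) t" using rd_take[OF r] by blast
      obtain t' where t': "rdd v (take j w) t'" using rd_take[OF r] by blast
      show ?thesis using a that t t' sv_take[OF t] sv_take[OF t'] by (metis less_trans)
    qed
    show "distinct (sv v w)" unfolding distinct_conv_nth
    proof (intro allI impI)
      fix i j assume "i < length (sv v w)" "j < length (sv v w)" "i \<noteq> j"
      thus "sv v w ! i \<noteq> sv v w ! j" using ne[of i j] ne[of j i] by (metis length_sv linorder_neqE_nat)
    qed
  qed
  thus ?thesis unfolding scyc_def by blast
qed

lemma scyc_rot:
  assumes c: "scyc st v (A @ B)" and A: "rdd v A v'"
  shows "scyc st v' (B @ A)"
proof -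
  have h: "rdd v (A @ B) v" "distinct (sv v (A @ B))" "A @ B \<noteq> []" "\<forall>x. A @ B \<noteq> [x, inv_letter x]"
    using c unfolding scyc_sv by blast+
  have B: "rdd v' B v" using h(1) A rd_det by (auto simp: rd_append)
  have "sv v (A @ B) = sv v A @ sv v' B" "sv v' (B @ A) = sv v' B @ sv v A" using sv_append A B by blast+
  hence "distinct (sv v' (B @ A))" using h(2) by auto
  moreover have "rdd v' (B @ A) v'" using A B by (auto simp: rd_append)
  moreover have "B @ A \<noteq> [x, inv_letter x]" for x
  proof
    assume e: "B @ A = [x, inv_letter x]"
    consider "A = []" | "B = []" | "B = [x]" "A = [inv_letter x]" using e by (cases B) (auto simp: Cons_eq_append_conv append_eq_Cons_conv)
    thus False
    proof cases
      case 1 thus False using e h(4) by auto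
    next
      case 2 thus False using e h(4) by auto
    next
      case 3 thus False using h(4)[rule_format, of "inv_letter x"] by simp
    qed
  qed
  ultimately show ?thesis unfolding scyc_sv using h(3) by blast
qed

lemma sv_inv: "rdd v w u \<Longrightarrow> sv u (inv_word w) @ [v] = u # rev (sv v w)"
proof (induction w arbitrary: v)
  case (Cons x w)
  then obtain v1 where v1: "st v x v1" "rdd v1 w u" by auto
  have "sv u (inv_word (x # w)) = sv u (inv_word w) @ sv v1 [inv_letter x]"
    unfolding inv_word_cons by (rule sv_append[OF rd_inv[OF v1(2)]])
  thus ?case using Cons.IH[OF v1(2)] nx[OF v1(1)] by simp
qed simp

lemma scyc_inv:
  assumes "scyc st v w" shows "scyc st v (inv_word w)"
proof -
  have h: "rdd v w v" "distinct (sv v w)" "w \<noteq> []" "\<forall>x. w \<noteq> [x, inv_letter x]" using assms unfolding scyc_sv by blast+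
  have e: "sv v (inv_word w) @ [v] = v # rev (sv v w)" by (rule sv_inv[OF h(1)])
  moreover obtain s' where s': "sv v w = v # s'" using h(3) by (cases w) auto
  ultimately have "sv v (inv_word w) = v # rev s'" by simp
  hence "distinct (sv v (inv_word w))" using h(2) s' by simp
  moreover have "inv_word w \<noteq> [x, inv_letter x]" for x
  proof
    assume "inv_word w = [x, inv_letter x]"
    hence "w = inv_word [x, inv_letter x]" by (metis inv_word_inv)
    thus False using h(4) by (simp add: inv_word_def)
  qed
  moreover have "inv_word w \<noteq> []" using h(3) by (metis inv_word_inv inv_word_nil)
  ultimately show ?thesis unfolding scyc_sv using rd_inv[OF h(1)] by blast
qed

text \<open>\<open>w\<close> is a product of \<open>Suc m\<close> pieces, and the first of these can also be read from \<open>y\<close>.\<close>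

primrec np :: "nat \<Rightarrow> 'v \<Rightarrow> 'v \<Rightarrow> ('s \<times> bool) list \<Rightarrow> 'v \<Rightarrow> bool" where
  "np 0 y v w u \<longleftrightarrow> rdd v w u \<and> (\<exists>t. rdd y w t)"
| "np (Suc m) y v w u \<longleftrightarrow> (\<exists>w1 w2 v1 y1. w = w1 @ w2 \<and> rdd v w1 v1 \<and> (\<exists>t. rdd y w1 t) \<and> \<not> vq v1 y1 \<and> np m y1 v1 w2 u)"

lemma rd_suff: "rdd v (A @ B) u \<Longrightarrow> rdd v A v' \<Longrightarrow> rdd v' B u"
  by (metis rd_append rd_det)

lemma np_rd: "np m y v w u \<Longrightarrow> rdd v w u"
proof (induction m arbitrary: y v w)
  case (Suc m)
  then obtain w1 w2 v1 y1 where "w = w1 @ w2" "rdd v w1 v1" "np m y1 v1 w2 u" by auto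
  thus ?case using Suc.IH by (auto simp: rd_append)
qed simp

lemma np_nil: "\<not> vq v y \<Longrightarrow> np m y v [] v"
proof (induction m arbitrary: y)
  case (Suc m) thus ?case by (auto intro!: exI[of _ y])
qed simp

lemma np_Suc: "np m y1 v w u \<Longrightarrow> \<not> vq v y1 \<Longrightarrow> np (Suc m) y v w u"
  unfolding np.simps by (rule exI[of _ "[]"], rule exI[of _ w], rule exI[of _ v], rule exI[of _ y1]) (auto intro: exI[of _ y])

lemma copy_end: "rdd v A v' \<Longrightarrow> rdd y (A @ B) t \<Longrightarrow> \<not> vq v y \<Longrightarrow> \<exists>y'. rdd y A y' \<and> rdd y' B t \<and> \<not> vq v' y'"
  using rd_vq_end by (auto simp: rd_append)

text \<open>Cutting through a piece leaves a piece: the second reading moves along with the first,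
  and the vertices reached stay inequivalent (\<open>rd_vq_end\<close>).\<close>

lemma np_suffix:
  "np m y v (A @ B) u \<Longrightarrow> rdd v A v' \<Longrightarrow> \<not> vq v y \<Longrightarrow> \<exists>y'. \<not> vq v' y' \<and> np m y' v' B u"
proof (induction m arbitrary: y v A)
  case 0
  then obtain t where t: "rdd y (A @ B) t" by auto
  have "rdd v' B u" using 0(1,2) rd_det by (auto simp: rd_append)
  thus ?case using copy_end[OF 0(2) t 0(3)] by auto
next
  case (Suc m)
  then obtain w1 w2 v1 y1 where w: "A @ B = w1 @ w2" "rdd v w1 v1" "\<exists>t. rdd y w1 t" "\<not> vq v1 y1" "np m y1 v1 w2 u"
    using Suc.prems(1) unfolding np.simps(2) by blast
  from iffD1[OF append_eq_append_conv2 w(1)] obtain us where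
    "A = w1 @ us \<and> us @ B = w2 \<or> A @ us = w1 \<and> B = us @ w2" by blast
  thus ?case
  proof
    assume a: "A = w1 @ us \<and> us @ B = w2"
    hence "rdd v1 us v'" using Suc.prems(2) w(2) rd_det by (auto simp: rd_append)
    then obtain y' where "\<not> vq v' y'" "np m y' v' B u" using Suc.IH[of y1 v1 us] w(4,5) a by auto
    thus ?thesis using np_Suc by blast
  next
    assume a: "A @ us = w1 \<and> B = us @ w2"
    obtain t where "rdd y (A @ us) t" using w(3) a by auto
    then obtain y' where y': "rdd y' us t" "\<not> vq v' y'" using copy_end[OF Suc.prems(2) _ Suc.prems(3)] by blast
    moreover have "rdd v' us v1" using rd_suff[of v A us v1] w(2) a Suc.prems(2) by simp
    ultimately have "np (Suc m) y' v' B u" using w(4,5) a by auto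
    thus ?thesis using y' by blast
  qed
qed

lemma np_prefix:
  "np m y v (A @ B) u \<Longrightarrow> rdd v A v' \<Longrightarrow> \<not> vq v y \<Longrightarrow> np m y v A v'"
proof (induction m arbitrary: y v A)
  case 0
  thus ?case by (auto simp: rd_append)
next
  case (Suc m)
  then obtain w1 w2 v1 y1 where w: "A @ B = w1 @ w2" "rdd v w1 v1" "\<exists>t. rdd y w1 t" "\<not> vq v1 y1" "np m y1 v1 w2 u"
    using Suc.prems(1) unfolding np.simps(2) by blast
  from iffD1[OF append_eq_append_conv2 w(1)] obtain us where
    "A = w1 @ us \<and> us @ B = w2 \<or> A @ us = w1 \<and> B = us @ w2" by blast
  thus ?case
  proof
    assume a: "A = w1 @ us \<and> us @ B = w2"
    hence "rdd v1 us v'" using Suc.prems(2) w(2) rd_det by (auto simp: rd_append)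
    hence "np m y1 v1 us v'" using Suc.IH[of y1 v1 us] w(4,5) a by auto
    thus ?thesis using w a by auto
  next
    assume a: "A @ us = w1 \<and> B = us @ w2"
    obtain t where t: "rdd y (A @ us) t" using w(3) a by auto
    obtain y' where y': "rdd y A y'" "\<not> vq v' y'" using copy_end[OF Suc.prems(2) t Suc.prems(3)] by blast
    have "np m y' v' [] v'" using np_nil[OF y'(2)] .
    have "A = A @ []" by simp
    thus ?thesis using y' Suc.prems(2) \<open>np m y' v' [] v'\<close> unfolding np.simps by blast
  qed
qed

section \<open>Shortening products of pieces\<close>

lemma rd_back: "rdd y ([x, inv_letter x] @ C) t \<Longrightarrow> rdd y C t"
  using st_det st_inv by (simp add: rd_append) metis

text \<open>A whole simple cycle is no piece, as it would be shorter than a sixth of itself. So the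
  part cut out is a backtrack, and this can be removed from the second reading too.\<close>

lemma copy_cut:
  assumes nv: "\<not> vq v y" and r: "rdd v A v'" "rdd v' B v'" and B: "scyc st v' B \<or> (\<exists>x. B = [x, inv_letter x])"
    and t: "rdd y (A @ B @ C) t"
  shows "rdd y (A @ C) t"
proof -
  obtain y' where y': "rdd y A y'" "rdd y' (B @ C) t" "\<not> vq v' y'" using copy_end[OF r(1) t nv] by blast
  have "\<not> scyc st v' B"
  proof
    assume c: "scyc st v' B"
    obtain t2 where "rdd y' B t2" using y'(2) by (auto simp: rd_append)
    hence "6 * length B < length (B @ [])" using small[of v' B "[]" v' y' t2] c r(2) y'(3) by simp
    thus False by simp
  qed
  then obtain x where "B = [x, inv_letter x]" using B by blast
  hence "rdd y' C t" using y'(2) rd_back by blast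
  thus ?thesis using y' by (auto simp: rd_append)
qed

text \<open>The number of pieces is kept: a closed part inside a piece is removed by
  \<open>copy_cut\<close>, and one that crosses the end of a piece leaves a shorter piece followed
  by a suffix (\<open>np_suffix\<close>). So a shortest product of pieces between two vertices is
  simple.\<close>

lemma np_cut:
  assumes "\<not> vq v y" "np m y v (A @ B @ C) u" "rdd v A v'" "rdd v' B v'" "scyc st v' B \<or> (\<exists>x. B = [x, inv_letter x])"
  shows "\<exists>w'. length w' < length (A @ B @ C) \<and> np m y v w' u"
  using assms
proof (induction m arbitrary: y v A)
  case base: 0
  have "rdd v (A @ B @ C) u" using base(2) by simp
  hence "rdd v' C u" using rd_suff base(3,4) by metis
  hence "rdd v (A @ C) u" using base(3) by (auto simp: rd_append)
  moreover have "\<exists>t. rdd y (A @ C) t" using base(2) copy_cut[OF base(1,3-5)] unfolding np.simps(1) by blast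
  ultimately have "np 0 y v (A @ C) u" by simp
  moreover have "B \<noteq> []" using base(5) by (auto simp: scyc_def)
  ultimately show ?case by (intro exI[of _ "A @ C"]) auto
next
  case (Suc m)
  have Bne: "B \<noteq> []" using Suc.prems(5) by (auto simp: scyc_def)
  obtain w1 w2 v1 y1 where w: "A @ (B @ C) = w1 @ w2" "rdd v w1 v1" "\<exists>t. rdd y w1 t" "\<not> vq v1 y1" "np m y1 v1 w2 u"
    using Suc.prems(2) unfolding np.simps(2) by blast
  from iffD1[OF append_eq_append_conv2 w(1)] consider (r) us where "A = w1 @ us" "us @ B @ C = w2" | (l) us where "A @ us = w1" "B @ C = us @ w2" by blast
  thus ?case
  proof cases
    case r
    hence "rdd v1 us v'" using Suc.prems(3) w(2) rd_det by (auto simp: rd_append)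
    then obtain w' where "length w' < length (us @ B @ C)" "np m y1 v1 w' u" using Suc.IH[of v1 y1 us] w r Suc.prems by auto
    thus ?thesis using w r by (intro exI[of _ "w1 @ w'"]) auto
  next
    case l
    from iffD1[OF append_eq_append_conv2 l(2)] consider (a) vs where "B = us @ vs" "vs @ C = w2" | (b) vs where "B @ vs = us" "C = vs @ w2" by blast
    thus ?thesis
    proof cases
      case a
      obtain t where t: "rdd y (A @ us) t" using w(3) l by auto
      have r1: "rdd v' us v1" using rd_suff[of v A us v1 v'] w(2) l(1) Suc.prems(3) by simp
      have r2: "rdd v1 vs v'" using rd_suff[of v' us vs v' v1] Suc.prems(4) a(1) r1 by simp
      obtain y' where "\<not> vq v' y'" "np m y' v' C u" using np_suffix[of m y1 v1 vs C u v'] w(4,5) a r2 by auto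
      moreover have "\<exists>t. rdd y A t" using t by (auto simp: rd_append)
      ultimately have "np (Suc m) y v (A @ C) u" using Suc.prems(3) by auto
      thus ?thesis using Bne by (intro exI[of _ "A @ C"]) auto
    next
      case b
      obtain t where t: "rdd y (A @ B @ vs) t" using w(3) l b by auto
      have "\<exists>t. rdd y (A @ vs) t" using copy_cut[OF Suc.prems(1,3-5) t] by blast
      moreover have "rdd v' vs v1" using w(2) l(1) Suc.prems(3,4) rd_det unfolding l(1)[THEN HOL.sym] b(1)[THEN HOL.sym] rd_append by metis
      hence "rdd v (A @ vs) v1" using Suc.prems(3) by (auto simp: rd_append)
      ultimately have "np (Suc m) y v ((A @ vs) @ w2) u" using w(4,5) unfolding np.simps by blast
      thus ?thesis using Bne b by (intro exI[of _ "(A @ vs) @ w2"]) auto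
    qed
  qed
qed

lemma not_simple:
  "rdd v w u \<Longrightarrow> \<not> distinct (sv v w @ [u]) \<Longrightarrow>
    \<exists>A B C v'. w = A @ B @ C \<and> rdd v A v' \<and> rdd v' B v' \<and> (scyc st v' B \<or> (\<exists>x. B = [x, inv_letter x]))"
proof (induction w arbitrary: v)
  case (Cons x w)
  then obtain v1 where v1: "st v x v1" "rdd v1 w u" by auto
  have s: "sv v (x # w) = v # sv v1 w" using nx[OF v1(1)] by simp
  show ?case
  proof (cases "distinct (sv v1 w @ [u])")
    case False
    from Cons.IH[OF v1(2) this] obtain A B C v' where "w = A @ B @ C" "rdd v1 A v'" "rdd v' B v'" "scyc st v' B \<or> (\<exists>x. B = [x, inv_letter x])" by blast
    thus ?thesis using v1 by (intro exI[of _ "x # A"] exI[of _ B] exI[of _ C] exI[of _ v']) auto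
  next
    case True
    hence "v \<in> set (sv v1 w) \<or> v = u" using Cons.prems(2) s by auto
    then obtain A C where AC: "w = A @ C" "rdd v1 A v" "v \<notin> set (sv v1 A)"
    proof
      assume "v \<in> set (sv v1 w)"
      from sv_split[OF v1(2) this] obtain A C where AC: "w = A @ C" "C \<noteq> []" "rdd v1 A v" by blast
      hence "sv v1 w = sv v1 A @ v # tl (sv v C)" using sv_append by (cases C) auto
      thus thesis using that AC True by auto
    next
      assume "v = u"
      thus thesis using that[of w "[]"] v1 True by auto
    qed
    have r: "rdd v (x # A) v" using v1(1) AC(2) by auto
    have "distinct (sv v1 A)" using True AC sv_append by auto
    hence "distinct (sv v (x # A))" using AC(3) nx[OF v1(1)] by simp
    hence "scyc st v (x # A) \<or> (\<exists>y. x # A = [y, inv_letter y])" unfolding scyc_sv using r by blast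
    thus ?thesis using AC(1) r by (intro exI[of _ "[]"] exI[of _ "x # A"] exI[of _ C] exI[of _ v]) auto
  qed
qed simp

lemma np_simple:
  assumes "\<not> vq v y" "np m y v w u"
  obtains w' where "np m y v w' u" "distinct (sv v w' @ [u])"
proof -
  let ?P = "\<lambda>w. np m y v w u"
  obtain w' where w': "?P w'" "\<And>w''. ?P w'' \<Longrightarrow> length w' \<le> length w''"
    using ex_has_least_nat[of ?P w length] assms(2) by auto
  have "distinct (sv v w' @ [u])"
  proof (rule ccontr)
    assume "\<not> distinct (sv v w' @ [u])"
    from not_simple[OF np_rd[OF w'(1)] this] obtain A B C v' where
      "w' = A @ B @ C" "rdd v A v'" "rdd v' B v'" "scyc st v' B \<or> (\<exists>x. B = [x, inv_letter x])" by blast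
    thus False using np_cut[OF assms(1), of m A B C u v'] w' by (metis not_less)
  qed
  thus ?thesis using that w' by blast
qed

text \<open>Every piece is compared with the same cycle, rotated so that it begins with this
  piece.\<close>

lemma np_size:
  "np m y v w u \<Longrightarrow> \<not> vq v y \<Longrightarrow> scyc st v (w @ W) \<Longrightarrow> 6 * length w \<le> Suc m * (length (w @ W) - 1)"
proof (induction m arbitrary: y v w W)
  case 0
  then obtain t where "rdd v w u" "rdd y w t" by auto
  from small[OF 0(3) this 0(2)] show ?case by simp
next
  case (Suc m)
  then obtain w1 w2 v1 y1 t where w: "w = w1 @ w2" "rdd v w1 v1" "rdd y w1 t" "\<not> vq v1 y1" "np m y1 v1 w2 u" by auto
  have c: "scyc st v (w1 @ (w2 @ W))" using Suc.prems(3) w by simp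
  have 1: "6 * length w1 < length (w1 @ w2 @ W)" using small[OF c w(2,3) Suc.prems(2)] .
  have "scyc st v1 (w2 @ (W @ w1))" using scyc_rot[OF c w(2)] by simp
  from Suc.IH[OF w(5,4) this] have "6 * length w2 \<le> Suc m * (length (w @ W) - 1)" using w(1) by (simp add: add.commute add.left_commute)
  thus ?case using 1 w(1) by simp
qed

section \<open>Shortest cycles through a vertex\<close>

definition "mcyc z c \<longleftrightarrow> scyc st z c \<and> length c \<ge> 2 \<and> (\<forall>c'. scyc st z c' \<longrightarrow> length c' \<ge> 2 \<longrightarrow> length c \<le> length c')"

lemma mcyc_inv: "mcyc z c \<Longrightarrow> mcyc z (inv_word c)"
  unfolding mcyc_def using scyc_inv by simp

text \<open>An excursion away from a shortest cycle is longer than the arc that it bypasses, but as a product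
  of three pieces it is shorter than half of the cycle that it forms with this arc.\<close>

lemma theta:
  assumes c: "mcyc z (A @ B @ C)" and r: "rdd z A p" "rdd p B p'" "rdd p' C z" and B: "B \<noteq> []" and C: "C \<noteq> []"
    and sg: "np 2 y p sg p'" "\<not> vq p y" "distinct (sv p sg)" "set (tl (sv p sg)) \<inter> set (sv z (A @ B @ C)) = {}"
    and ne: "sg \<noteq> []" "hd sg \<noteq> hd B" "A = [] \<Longrightarrow> hd sg \<noteq> hd (inv_word C)"
  shows False
proof -
  have cc: "scyc st z (A @ B @ C)" "\<And>c'. scyc st z c' \<Longrightarrow> length c' \<ge> 2 \<Longrightarrow> length (A @ B @ C) \<le> length c'" using c by (auto simp: mcyc_def)
  have rs: "rdd p sg p'" by (rule np_rd[OF sg(1)])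
  have svc: "sv z (A @ B @ C) = sv z A @ sv p B @ sv p' C" using sv_append r by metis
  have dc: "distinct (sv z A @ sv p B @ sv p' C)" using cc(1) unfolding scyc_sv svc by blast
  obtain sB where sB: "sv p B = p # sB" using B by (cases B) auto
  obtain sC where sC: "sv p' C = p' # sC" using C by (cases C) auto
  obtain ss where ss: "sv p sg = p # ss" using ne(1) by (cases sg) auto
  have off: "set ss \<inter> set (sv z A @ sv p B @ sv p' C) = {}" using sg(4) unfolding svc ss by simp
  have pp: "p \<noteq> p'" using dc sB sC by auto
  have s1: "scyc st z (A @ sg @ C)"
    unfolding scyc_sv
  proof (intro conjI allI)
    show "A @ sg @ C \<noteq> []" using ne by simp
    show "rdd z (A @ sg @ C) z" using r rs by (auto simp: rd_append)
    have "sv z (A @ sg @ C) = sv z A @ sv p sg @ sv p' C" using sv_append r rs by metis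
    thus "distinct (sv z (A @ sg @ C))" using dc off sg(3) ss sB by auto
    fix x show "A @ sg @ C \<noteq> [x, inv_letter x]"
    proof
      assume e: "A @ sg @ C = [x, inv_letter x]"
      have "length A + length sg + length C = 2" using arg_cong[OF e, of length] by simp
      moreover have "length sg \<ge> 1" "length C \<ge> 1" using ne C by (auto simp: Suc_le_eq)
      ultimately have "length A = 0" "length sg = 1" by linarith+
      hence "A = []" "length sg = 1" by auto
      hence "sg = [x]" "C = [inv_letter x]" using e by (cases sg; auto)+
      thus False using ne(3) \<open>A = []\<close> by simp
    qed
  qed
  have s2: "scyc st p (sg @ inv_word B)"
    unfolding scyc_sv
  proof (intro conjI allI)
    show "sg @ inv_word B \<noteq> []" using ne by simp
    show "rdd p (sg @ inv_word B) p" using rs rd_inv[OF r(2)] by (auto simp: rd_append)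
    have e: "sv p (sg @ inv_word B) = sv p sg @ sv p' (inv_word B)" using sv_append rs by metis
    have "sv p' (inv_word B) @ [p] = p' # rev (sv p B)" by (rule sv_inv[OF r(2)])
    hence "sv p' (inv_word B) = p' # rev sB" using sB by simp
    thus "distinct (sv p (sg @ inv_word B))" unfolding e using dc off sg(3) ss sB sC pp by auto
    fix x show "sg @ inv_word B \<noteq> [x, inv_letter x]"
    proof
      assume e: "sg @ inv_word B = [x, inv_letter x]"
      have "length sg + length B = 2" using arg_cong[OF e, of length] by simp
      moreover have "length sg \<ge> 1" "length B \<ge> 1" using ne B by (auto simp: Suc_le_eq)
      ultimately have "length sg = 1" by linarith
      hence "sg = [x]" "inv_word B = [inv_letter x]" using e by (cases sg; auto)+
      hence "B = [x]" using inv_word_inv[of B] by simp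
      thus False using ne(2) \<open>sg = [x]\<close> by simp
    qed
  qed
  have l1: "length sg \<ge> 1" "length C \<ge> 1" using ne C by (auto simp: Suc_le_eq)
  have "length (A @ B @ C) \<le> length (A @ sg @ C)" using cc(2)[OF s1] l1 by simp
  moreover have "6 * length sg \<le> 3 * (length (sg @ inv_word B) - 1)" using np_size[OF sg(1,2) s2] by (simp add: numeral_3_eq_3)
  ultimately show False using l1 by simp
qed

lemma hd_neq_inv:
  assumes "scyc st z c" "length c \<ge> 2" shows "hd c \<noteq> hd (inv_word c)"
proof
  assume e: "hd c = hd (inv_word c)"
  obtain x c' y where c: "c = x # c' @ [y]"
    using assms(2) by (cases c; cases "tl c" rule: rev_cases) auto
  have "x = inv_letter y" using e c by (simp add: inv_word_def)
  hence xy: "y = inv_letter x" by simp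
  have h: "rdd z c z" "distinct (sv z c)" "c \<noteq> [x, inv_letter x]" using assms(1) unfolding scyc_sv by blast+
  have c'ne: "c' \<noteq> []" using h(3) c xy by auto
  obtain z1 z2 where z: "st z x z1" "rdd z1 c' z2" "st z2 y z" using h(1) c by (auto simp: rd_append)
  have "z2 = z1" using st_inv[OF z(3)] z(1) xy st_det by simp
  moreover have "sv z c = z # sv z1 c' @ [z2]" using c nx[OF z(1)] sv_append[OF z(2)] by simp
  moreover have "z1 \<in> set (sv z1 c')" using c'ne by (cases c') auto
  ultimately show False using h(2) by auto
qed

lemma common_prefix: "\<exists>A t2 c2. t = A @ t2 \<and> c = A @ c2 \<and> (t2 = [] \<or> c2 = [] \<or> hd t2 \<noteq> hd c2)"
proof (induction t arbitrary: c)
  case Nil thus ?case by (intro exI[of _ "[]"] exI[of _ c]) auto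
next
  case (Cons x t)
  show ?case
  proof (cases "c \<noteq> [] \<and> hd c = x")
    case True
    then obtain c' where c: "c = x # c'" by (cases c) auto
    from Cons.IH[of c'] obtain A t2 c2 where "t = A @ t2 \<and> c' = A @ c2 \<and> (t2 = [] \<or> c2 = [] \<or> hd t2 \<noteq> hd c2)" by blast
    thus ?thesis using c by (intro exI[of _ "x # A"] exI[of _ t2] exI[of _ c2]) auto
  next
    case False thus ?thesis by (intro exI[of _ "[]"] exI[of _ "x # t"] exI[of _ c]) auto
  qed
qed

lemma first_hit:
  "rdd p t u \<Longrightarrow> u \<in> X \<Longrightarrow> t \<noteq> [] \<Longrightarrow> \<exists>sg r q. t = sg @ r \<and> sg \<noteq> [] \<and> rdd p sg q \<and> rdd q r u \<and> q \<in> X \<and> set (tl (sv p sg)) \<inter> X = {}"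
proof (induction t arbitrary: p)
  case (Cons x t)
  then obtain p1 where p1: "st p x p1" "rdd p1 t u" by auto
  show ?case
  proof (cases "p1 \<in> X")
    case True thus ?thesis using p1 by (intro exI[of _ "[x]"] exI[of _ t] exI[of _ p1]) auto
  next
    case False
    hence "t \<noteq> []" using p1 Cons.prems(2) by auto
    from Cons.IH[OF p1(2) Cons.prems(2) this] obtain sg r q where
      s: "t = sg @ r" "sg \<noteq> []" "rdd p1 sg q" "rdd q r u" "q \<in> X" "set (tl (sv p1 sg)) \<inter> X = {}" by blast
    have "tl (sv p (x # sg)) = sv p1 sg" using nx[OF p1(1)] by simp
    moreover have "sv p1 sg = p1 # tl (sv p1 sg)" using s(2) by (cases sg) auto
    ultimately have "set (tl (sv p (x # sg))) \<inter> X = {}" using s(6) False by (metis Int_insert_left_if0 list.simps(15))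
    thus ?thesis using s p1 by (intro exI[of _ "x # sg"] exI[of _ r] exI[of _ q]) auto
  qed
qed simp

text \<open>A simple path that leaves the cycle has to return to it. The excursion up to the first
  return is part of a product of three pieces, hence such a product itself, and \<open>theta\<close>
  excludes it. The condition on \<open>hd t\<close> fixes the direction; a path that starts
  backwards is treated with the reversed cycle.\<close>

lemma follow:
  assumes c: "mcyc z (P @ Q)" and P: "rdd z P f" "P \<noteq> []" "Q \<noteq> []"
    and t: "np 2 y z t f" "\<not> vq z y" "distinct (sv z t @ [f])" and h: "t = [] \<or> hd t \<noteq> hd (inv_word (P @ Q))"
  shows "t = P"
proof -
  have cc: "scyc st z (P @ Q)" using c by (simp add: mcyc_def)
  have rc: "rdd z (P @ Q) z" and dc: "distinct (sv z (P @ Q))" using cc unfolding scyc_sv by blast+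
  have rQ: "rdd f Q z" using rd_suff[OF rc P(1)] .
  have rt: "rdd z t f" by (rule np_rd[OF t(1)])
  have svc: "sv z (P @ Q) = sv z P @ sv f Q" using sv_append P(1) by blast
  have fC: "f \<in> set (sv z (P @ Q))" unfolding svc using P(3) by (cases Q) auto
  have zP: "z \<in> set (sv z P)" using P(2) by (cases P) auto
  have fQ: "f \<in> set (sv f Q)" using P(3) by (cases Q) auto
  have zf: "z \<noteq> f" using dc zP fQ unfolding svc by auto
  have uniq: "A = P" if A: "P @ Q = A @ R" "R \<noteq> []" "rdd z A f" for A R
  proof -
    have "sv z (P @ Q) ! length A = f" by (rule sv_take) (use A in auto)
    moreover have "sv z (P @ Q) ! length P = f" by (rule sv_take) (use P in auto)
    ultimately have "length A = length P" using dc A(1,2) P(3) by (metis length_append length_greater_0_conv length_sv less_add_same_cancel1 nth_eq_iff_index_eq)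
    thus ?thesis using A(1) by simp
  qed
  obtain A t2 c2 where AT: "t = A @ t2" "P @ Q = A @ c2" "t2 = [] \<or> c2 = [] \<or> hd t2 \<noteq> hd c2" using common_prefix by blast
  have c2: "c2 \<noteq> []"
  proof
    assume e: "c2 = []"
    hence A: "A = P @ Q" using AT by simp
    hence "sv z t = sv z (P @ Q) @ sv z t2" using sv_append[OF rc] AT(1) by simp
    thus False using fC t(3) by auto
  qed
  show ?thesis
  proof (cases "t2 = []")
    case True
    thus ?thesis using uniq[OF AT(2) c2] rt AT(1) by simp
  next
    case t2: False
    hence hne: "hd t2 \<noteq> hd c2" using AT(3) c2 by blast
    obtain p where p: "rdd z A p" "rdd p t2 f" using rt AT(1) by (auto simp: rd_append)
    obtain sg r p' where s: "t2 = sg @ r" "sg \<noteq> []" "rdd p sg p'" "rdd p' r f" "p' \<in> set (sv z (P @ Q))"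
      "set (tl (sv p sg)) \<inter> set (sv z (P @ Q)) = {}" using first_hit[OF p(2) fC t2] by blast
    have svt: "sv z t @ [f] = sv z A @ sv p sg @ sv p' r @ [f]" using AT(1) s(1) sv_append p(1) s(3) by simp
    have p'in: "p' \<in> set (sv p' r @ [f])" using s(4) by (cases r) auto
    have p'A: "p' \<notin> set (sv z A)" "p' \<notin> set (sv p sg)" using t(3) p'in unfolding svt by auto
    have pp: "p' \<noteq> p" using p'A(2) s(2) by (cases sg) auto
    have svc2: "sv z (P @ Q) = sv z A @ sv p c2" using AT(2) sv_append p(1) by simp
    hence pin: "p' \<in> set (sv p c2)" using s(5) p'A(1) by auto
    have rc2: "rdd p c2 z" using rd_suff[of z A c2 z p] rc AT(2) p(1) by simp
    obtain B C where BC: "c2 = B @ C" "C \<noteq> []" "rdd p B p'" "rdd p' C z" using sv_split[OF rc2 pin] by blast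
    have Bne: "B \<noteq> []" using BC(3) pp by auto
    obtain y' where y': "\<not> vq p y'" "np 2 y' p t2 f" using np_suffix[of 2 y z A t2 f p] t(1,2) AT(1) p(1) by auto
    have npsg: "np 2 y' p sg p'" using np_prefix[of 2 y' p sg r f p'] y' s(1,3) by simp
    have mc: "mcyc z (A @ B @ C)" using c AT(2) BC(1) by simp
    have off: "set (tl (sv p sg)) \<inter> set (sv z (A @ B @ C)) = {}" using s(6) AT(2) BC(1) by simp
    have dsg: "distinct (sv p sg)" using t(3) unfolding svt by simp
    have hsg: "hd sg = hd t2" using s(1,2) by simp
    have hB: "hd sg \<noteq> hd B" using hsg hne BC(1) Bne by simp
    have hC: "hd sg \<noteq> hd (inv_word C)" if "A = []"
    proof -
      have "inv_word (P @ Q) = inv_word C @ inv_word B" using AT(2) BC(1) that by simp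
      moreover have "inv_word C \<noteq> []" using BC(2) by (metis inv_word_inv inv_word_nil)
      ultimately have "hd (inv_word (P @ Q)) = hd (inv_word C)" by simp
      moreover have "hd t = hd t2" "t \<noteq> []" using AT(1) that t2 by auto
      ultimately show ?thesis using h hsg by simp
    qed
    have False by (rule theta[OF mc p(1) BC(3,4) Bne BC(2) npsg y'(1) dsg off s(2) hB hC])
    thus ?thesis ..
  qed
qed

text \<open>Pieces have length less than \<open>n / 6\<close>, so a half cycle of length \<open>n div 2\<close> can be a product of three of
  them only if \<open>n = 6 * m + 1\<close>; this case is excluded by the choice of the direction of the cycle.\<close>

definition "okb y z c \<longleftrightarrow> (\<forall>m t. length c = Suc (6 * m) \<longrightarrow> \<not> rdd y (take m c) t)"

text \<open>If both directions fail, the first \<open>m\<close> letters of the cycle can be read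
  from \<open>y\<close> forwards and backwards. Together they form a piece of length
  \<open>2 * m\<close> in a cycle of length \<open>6 * m + 1\<close>, which forces
  \<open>m = 0\<close>, a loop.\<close>

lemma okb_dir:
  assumes c: "scyc st z c" and n: "length c \<ge> 2" and y: "\<not> vq z y"
  shows "okb y z c \<or> okb y z (inv_word c)"
proof (rule ccontr)
  assume "\<not> (okb y z c \<or> okb y z (inv_word c))"
  then obtain m t m' t' where m: "length c = Suc (6 * m)" "rdd y (take m c) t" "length c = Suc (6 * m')" "rdd y (take m' (inv_word c)) t'"
    unfolding okb_def by auto
  hence mm: "m' = m" by simp
  define P L where "P = take (length c - m) c" and "L = drop (length c - m) c"
  have cPL: "c = P @ L" by (simp add: P_def L_def)
  have lL: "length L = m" using m(1) by (simp add: L_def)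
  have "take m (inv_word c) = inv_word L" using lL by (simp add: cPL)
  hence t'L: "rdd t' L y" using m(4) mm rd_inv by fastforce
  have rc: "rdd z c z" using c by (simp add: scyc_def)
  obtain p where p: "rdd z P p" "rdd p L z" using rc cPL by (auto simp: rd_append)
  have c': "scyc st p (L @ P)" using scyc_rot[of z P L p] c cPL p by simp
  have lP: "length P = Suc (5 * m)" using m(1) by (simp add: P_def)
  have tP: "take m c = take m P" unfolding cPL using lP by simp
  have LP: "L @ P = (L @ take m P) @ drop m P" by simp
  obtain q where q: "rdd z (take m P) q" using rd_take[OF p(1)] by blast
  have 1: "rdd p (L @ take m P) q" using p q by (auto simp: rd_append)
  have 2: "rdd t' (L @ take m P) t" using t'L m(2) tP by (auto simp: rd_append)
  have 3: "\<not> vq p t'" using rd_vq_end[OF p(2) t'L] y by simp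
  have "scyc st p ((L @ take m P) @ drop m P)" using c' unfolding LP .
  from small[OF this 1 2 3] have "6 * length (L @ take m P) < length ((L @ take m P) @ drop m P)" .
  thus False using lL lP m(1) n by simp
qed

text \<open>Let \<open>n = length c\<close>. By \<open>follow\<close> a simple product of three
  pieces from \<open>z\<close> to \<open>f\<close> is one of the two arcs of the cycle. The backward
  arc has length at least \<open>n / 2\<close>, too much for three pieces of length at most
  \<open>(n - 1) / 6\<close>. The forward arc of length \<open>n div 2\<close> leaves only
  \<open>n = 6 * m + 1\<close> with a first piece of length \<open>m\<close>, which
  \<open>okb\<close> forbids.\<close>

theorem no_three:
  assumes c: "mcyc z c" and y: "\<not> vq z y" and ok: "okb y z c" and f: "rdd z (take (length c div 2) c) f"
  shows "\<not> np 2 y z t f"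
proof
  assume "np 2 y z t f"
  then obtain t where t: "np 2 y z t f" "distinct (sv z t @ [f])" using np_simple[OF y] by blast
  define q P Q where "q = length c div 2" and "P = take q c" and "Q = drop q c"
  have cPQ: "c = P @ Q" by (simp add: P_def Q_def)
  have n: "length c \<ge> 2" and cy: "scyc st z c" using c by (auto simp: mcyc_def)
  have ne: "P \<noteq> []" "Q \<noteq> []" using n by (auto simp: P_def Q_def q_def)
  have lP: "length P = q" "length Q = length c - q" using n by (auto simp: P_def Q_def q_def)
  have rP: "rdd z P f" using f by (simp add: P_def q_def)
  have rc: "rdd z c z" using cy by (simp add: scyc_def)
  have rQ: "rdd f Q z" using rd_suff[of z P Q z f] rc rP cPQ by simp
  have sz: "6 * length t \<le> 3 * (length c - 1)" if "scyc st z (t @ W)" "length (t @ W) = length c" for W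
    using np_size[OF t(1) y that(1)] that(2) by (simp add: numeral_3_eq_3)
  show False
  proof (cases "t = [] \<or> hd t \<noteq> hd (inv_word c)")
    case True
    hence tP: "t = P" using follow[of z P Q f y t] c cPQ rP ne t y by simp
    obtain w1 w2 v1 y1 u1 where w: "t = w1 @ w2" "rdd z w1 v1" "rdd y w1 u1" "\<not> vq v1 y1" "np 1 y1 v1 w2 f"
      using t(1) unfolding numeral_2_eq_2 np.simps(2)[of "Suc 0"] One_nat_def by blast
    have Pw: "P = w1 @ w2" using tP w(1) by simp
    have c1: "scyc st z (w1 @ (w2 @ Q))" using cy cPQ by (simp add: Pw)
    have "6 * length w1 < length (w1 @ w2 @ Q)" using small[OF c1 w(2,3) y] .
    hence s1: "6 * length w1 \<le> length c - 1" using cPQ by (simp add: Pw)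
    have "scyc st v1 (w2 @ (Q @ w1))" using scyc_rot[OF c1 w(2)] by simp
    from np_size[OF w(5,4) this] have s2: "6 * length w2 \<le> 2 * (length c - 1)" using cPQ by (simp add: Pw add.commute add.left_commute)
    have "length w1 + length w2 = q" using tP w(1) lP by (metis length_append)
    hence "length c = Suc (6 * length w1)" using s1 s2 n unfolding q_def by linarith
    moreover have "take (length w1) c = w1" using cPQ by (simp add: Pw)
    ultimately show False using ok w(3) unfolding okb_def by metis
  next
    case False
    let ?c = "inv_word Q @ inv_word P"
    have ci: "?c = inv_word c" using cPQ by simp
    have mc: "mcyc z ?c" unfolding ci by (rule mcyc_inv[OF c])
    have nei: "inv_word Q \<noteq> []" "inv_word P \<noteq> []" using ne by (metis inv_word_inv inv_word_nil)+
    have "inv_word ?c = c" using cPQ by simp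
    hence "t = [] \<or> hd t \<noteq> hd (inv_word ?c)" using False hd_neq_inv[OF cy n] by simp
    from follow[OF mc rd_inv[OF rQ] nei t(1) y t(2) this] have tQ: "t = inv_word Q" .
    have tc: "scyc st z (t @ inv_word P)" using mc tQ by (simp add: mcyc_def)
    have "length (t @ inv_word P) = length Q + length P" using tQ by simp
    hence "length (t @ inv_word P) = length c" using cPQ by simp
    from sz[OF tc this] have "6 * length t \<le> 3 * (length c - 1)" .
    thus False using tQ lP n unfolding q_def by simp
  qed
qed

end

context scg
begin

section \<open>From periodic chains to contracting elements\<close>

lemma inv_pw: "inv_word (pw w n) = pw (inv_word w) n"
proof (induction n)
  case (Suc n)
  have "inv_word (pw w (Suc n)) = pw (inv_word w) n @ inv_word w" using Suc by simp
  thus ?case unfolding pw_Suc .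
qed simp

lemma infinite_orderI:
  assumes w: "w \<in> words S" and n: "\<And>n. n > 0 \<Longrightarrow> \<not> pw w n \<approx> []"
  shows "infinite_order S R w"
  unfolding infinite_order_def
proof (intro allI impI notI)
  fix k :: int assume k: "k \<noteq> 0" and e: "(word_zpow w k, []) \<in> word_eq S R"
  show False
  proof (cases "k \<ge> 0")
    case True
    thus False using e n[of "nat k"] k by (simp add: word_zpow_def eqw_def)
  next
    case False
    hence "pw (inv_word w) (nat (- k)) \<approx> []" using e by (simp add: word_zpow_def eqw_def)
    hence "inv_word (pw (inv_word w) (nat (- k))) \<approx> []" using eq_inv by fastforce
    thus False using n[of "nat (- k)"] False by (simp add: inv_pw)
  qed
qed

lemma bound_ex: "\<exists>B. (\<forall>w v. rdd z w v \<longrightarrow> (\<exists>w'. length w' \<le> B \<and> rdd z w' v)) \<and> card {v. \<exists>w. rdd z w v} \<le> B"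
proof -
  let ?V = "{v. \<exists>w. rdd z w v}"
  have "\<forall>v\<in>?V. \<exists>w. rdd z w v" by blast
  from bchoice[OF this] obtain g where "\<forall>v\<in>?V. rdd z (g v) v" by blast
  hence g: "\<And>v. v \<in> ?V \<Longrightarrow> rdd z (g v) v" by blast
  have f: "finite ?V" by (rule fin)
  have "\<exists>w'. length w' \<le> card ?V + (\<Sum>v\<in>?V. length (g v)) \<and> rdd z w' v" if "rdd z w v" for w v
  proof -
    have v: "v \<in> ?V" using that by blast
    hence "length (g v) \<le> (\<Sum>v\<in>?V. length (g v))" using f by (intro member_le_sum) simp_all
    thus ?thesis using g[OF v] by (intro exI[of _ "g v"]) simp
  qed
  thus ?thesis by (intro exI[of _ "card ?V + (\<Sum>v\<in>?V. length (g v))"]) simp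
qed

end

context chain
begin

lemma Uw_add: "Uw s (k + l) = Uw s k @ Uw (s + k) l"
  by (induction l) (simp_all add: add.assoc)

theorem periodic_result:
  assumes finS: "finite S" and p: "p > 0" and per: "\<And>j. a (j + p) = a j" "\<And>j. u (j + p) = u j"
  shows "infinite_order S R (Uw 0 p)" "strongly_contracting S R (cyclic_sub S R (Uw 0 p))"
proof -
  let ?w = "Uw 0 p"
  have sh: "Uw (s + p) k = Uw s k" for s k
  proof (induction k)
    case (Suc k)
    have "s + p + k = s + k + p" by simp
    thus ?case using Suc per(2)[of "s + k"] by (simp only: Uw_simps)
  qed simp
  have pw: "pw ?w n = Uw 0 (n * p)" for n
  proof (induction n)
    case (Suc n)
    have "Uw 0 (p + n * p) = Uw 0 p @ Uw (0 + p) (n * p)" by (rule Uw_add)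
    thus ?case using Suc sh[of 0 "n * p"] by simp
  qed simp
  have wS: "?w \<in> words S" by (rule Uw_words)
  show io: "infinite_order S R ?w"
  proof (rule infinite_orderI[OF wS])
    fix n :: nat assume n: "n > 0"
    show "\<not> pw ?w n \<approx> []"
    proof
      assume e: "pw ?w n \<approx> []"
      \<comment> \<open>Three copies, because \<open>chain_closed\<close> asks for three blocks and
        one copy may have fewer.\<close>
      have "pw ?w n @ pw ?w n @ pw ?w n \<approx> [] @ [] @ []" using eq_app[OF e eq_app[OF e e]] .
      moreover have "pw ?w n @ pw ?w n @ pw ?w n = pw ?w (n + (n + n))" by (simp add: replicate_add)
      ultimately have "Uw 0 ((n + (n + n)) * p) \<approx> []" unfolding pw[symmetric] by simp
      moreover have "(n + (n + n)) * p \<ge> 3 * 1" using n p by (intro mult_le_mono) auto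
      ultimately show False using chain_closed by simp
    qed
  qed
  let ?Q = "\<lambda>B j. (\<forall>w v. rdd (a j) w v \<longrightarrow> (\<exists>w'. length w' \<le> B \<and> rdd (a j) w' v)) \<and> card {v. \<exists>w. rdd (a j) w v} \<le> B"
  have "\<forall>j. \<exists>B. ?Q B j" using bound_ex by blast
  from choice[OF this] obtain Bj where "\<forall>j. ?Q (Bj j) j" by blast
  hence Bj: "\<And>j. ?Q (Bj j) j" by blast
  define Bd where "Bd = (\<Sum>j<p. Bj j)"
  have am: "a j = a (j mod p)" for j
  proof (induction j rule: less_induct)
    case (less j)
    show ?case
    proof (cases "j < p")
      case False
      hence "a j = a (j - p)" using per(1)[of "j - p"] by simp
      also have "\<dots> = a ((j - p) mod p)" using less.IH[of "j - p"] False p by simp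
      finally show ?thesis using False by (simp add: le_mod_geq)
    qed simp
  qed
  have Bm: "?Q Bd j" for j
  proof -
    have le: "Bj (j mod p) \<le> Bd" unfolding Bd_def by (rule member_le_sum) (use p in auto)
    show ?thesis using Bj[of "j mod p"] le unfolding am[of j] by (meson le_trans)
  qed
  let ?r = "13 * Bd + 2"
  show "strongly_contracting S R (cyclic_sub S R ?w)"
  proof (rule contracting[OF finS wS io])
    fix n c1 c2 c3 assume g: "geodesic c1" "geodesic c2" "geodesic c3" and e: "pw ?w n @ c1 @ c2 @ c3 \<approx> []"
    have e': "Uw 0 (n * p) @ c1 @ c2 @ c3 \<approx> []" using e unfolding pw .
    let ?F = "{i. i < n * p \<and> \<not> (\<exists>dl rh et. c1 @ c2 @ c3 = dl @ rh \<and> length et \<le> ?r \<and> Uw 0 (n * p) @ dl @ et \<approx> Uw 0 i)}"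
    \<comment> \<open>Only block starts at multiples of the period are powers of the word, so far
      powers inject into far blocks.\<close>
    have "card {j. j < n \<and> \<not> near_pw ?w ?r n (c1 @ c2 @ c3) j} \<le> card ?F"
    proof (rule card_inj_on_le[of "\<lambda>j. j * p"])
      show "inj_on (\<lambda>j. j * p) {j. j < n \<and> \<not> near_pw ?w ?r n (c1 @ c2 @ c3) j}" using p by (auto simp: inj_on_def)
      show "(\<lambda>j. j * p) ` {j. j < n \<and> \<not> near_pw ?w ?r n (c1 @ c2 @ c3) j} \<subseteq> ?F"
        using p unfolding near_pw_def pw by auto
      show "finite ?F" by simp
    qed
    also have "\<dots> \<le> 72" by (rule far_blocks[OF _ _ g e']) (use Bm in auto)
    finally show "card {j. j < n \<and> \<not> near_pw ?w ?r n (c1 @ c2 @ c3) j} \<le> 72" .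
  qed
qed

end

context scg
begin

abbreviation "result \<equiv> \<exists>w\<in>words S. infinite_order S R w \<and> strongly_contracting S R (cyclic_sub S R w)"

text \<open>The end of a half cycle is inequivalent to one of \<open>z1\<close> and
  \<open>z2\<close>, and one direction of the cycle chosen there satisfies \<open>okb\<close>. So
  the next state is a function of the present one. There are at most four states, hence the sequence
  becomes periodic, and shifting the index removes the part before the period.\<close>

lemma chain_from:
  assumes finS: "finite S" and C: "\<And>z. z \<in> {z1, z2} \<Longrightarrow> mcyc z (C z)" and ne: "\<not> vq z1 z2"
  shows result
proof -
  define X where "X = (\<Union>z\<in>{z1, z2}. {(z, C z), (z, inv_word (C z))})"
  have finX: "finite X" by (simp add: X_def)
  have Xm: "mcyc (fst s) (snd s)" if "s \<in> X" for s using that C mcyc_inv by (auto simp: X_def)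
  define hw where "hw s = take (length (snd s) div 2) (snd s)" for s :: "'v \<times> ('s \<times> bool) list"
  define en where "en s = (SOME f. rdd (fst s) (hw s) f)" for s
  have en: "rdd (fst s) (hw s) (en s)" if "s \<in> X" for s
  proof -
    have "rdd (fst s) (snd s) (fst s)" using Xm[OF that] by (simp add: mcyc_def scyc_def)
    from rd_take[OF this] show ?thesis unfolding en_def hw_def by (rule someI_ex)
  qed
  have "\<exists>s'. s' \<in> X \<and> \<not> vq (fst s') y \<and> okb y (fst s') (snd s')" for y
  proof -
    obtain z where z: "z \<in> {z1, z2}" "\<not> vq z y" using ne vq_trans vq_sym by (metis insertCI)
    have m: "scyc st z (C z)" "length (C z) \<ge> 2" using C[OF z(1)] by (auto simp: mcyc_def)
    from okb_dir[OF m z(2)] show ?thesis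
    proof
      assume "okb y z (C z)" thus ?thesis using z by (intro exI[of _ "(z, C z)"]) (auto simp: X_def)
    next
      assume "okb y z (inv_word (C z))" thus ?thesis using z by (intro exI[of _ "(z, inv_word (C z))"]) (auto simp: X_def)
    qed
  qed
  then obtain nt where nt: "\<And>y. nt y \<in> X \<and> \<not> vq (fst (nt y)) y \<and> okb y (fst (nt y)) (snd (nt y))" by metis
  define T where "T j = ((\<lambda>s. nt (en s)) ^^ j) (z1, C z1)" for j
  have T0: "T 0 \<in> X" by (simp add: T_def X_def)
  have TS: "T (Suc j) = nt (en (T j))" for j by (simp add: T_def)
  have TX: "T j \<in> X" for j using T0 TS nt by (cases j) auto
  have "\<not> inj T"
  proof
    assume "inj T"
    hence "finite (UNIV :: nat set)" using TX finX by (metis finite_imageD finite_subset image_subsetI)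
    thus False by simp
  qed
  then obtain i j where ij: "i < j" "T i = T j" by (auto simp: inj_def) (metis linorder_neqE_nat)
  define p where "p = j - i"
  have p: "p > 0" "T (i + p) = T i" using ij by (auto simp: p_def)
  define Q where "Q k = T (i + k)" for k
  have per: "Q (k + p) = Q k" for k
    by (induction k) (use p(2) TS in \<open>simp_all add: Q_def\<close>)
  define a b u where "a = (\<lambda>k. fst (Q k))" and "b = (\<lambda>k. en (Q k))" and "u = (\<lambda>k. hw (Q k))"
  have QX: "Q k \<in> X" for k using TX by (simp add: Q_def)
  have QS: "Q (Suc k) = nt (b k)" for k using TS by (simp add: Q_def b_def)
  interpret chain st aut S R a b u
  proof unfold_locales
    show "rdd (a j) (u j) (b j)" for j using en[OF QX] by (simp add: a_def b_def u_def)
    fix j w1 x0 x1 w2 x2 w3 x3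
    assume w1: "rdd (b j) w1 x0" "rdd (a (Suc j)) w1 x1" and w2: "rdd x1 w2 x2" "w2 = [] \<or> (\<exists>y1 y2. \<not> vq x1 y1 \<and> rdd y1 w2 y2)"
      and w3: "rdd (b (Suc j)) w3 x2" "rdd (a (Suc (Suc j))) w3 x3"
    have n1: "\<not> vq (a (Suc j)) (b j)" for j using nt QS by (simp add: a_def)
    have ok: "okb (b j) (a (Suc j)) (snd (Q (Suc j)))" using nt QS by (simp add: a_def)
    have m: "mcyc (a (Suc j)) (snd (Q (Suc j)))" using Xm[OF QX] by (simp add: a_def)
    have f: "rdd (a (Suc j)) (take (length (snd (Q (Suc j))) div 2) (snd (Q (Suc j)))) (b (Suc j))"
      using en[OF QX] by (simp add: a_def b_def hw_def)
    have "\<not> vq x1 x0" using rd_vq_end[OF w1(2,1)] n1 by simp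
    \<comment> \<open>An empty \<open>w2\<close> is a piece as well, with \<open>x0\<close> as the
      second vertex. With \<open>w1\<close> before it and \<open>inv_word w3\<close> after it, the
      half cycle would be replaced by a product of three pieces, against
      \<open>no_three\<close>.\<close>
    then obtain y1 y2 where y: "\<not> vq x1 y1" "rdd y1 w2 y2" using w2(2) by (metis rd.simps(1))
    have "\<not> vq x2 x3" using rd_vq_end[OF w3] n1 vq_sym by blast
    hence "np 0 x3 x2 (inv_word w3) (b (Suc j))" using rd_inv[OF w3(1)] rd_inv[OF w3(2)] by auto
    hence "np 1 y1 x1 (w2 @ inv_word w3) (b (Suc j))" using w2(1) y(2) \<open>\<not> vq x2 x3\<close> unfolding One_nat_def np.simps(2) by blast
    hence "np 2 (b j) (a (Suc j)) (w1 @ (w2 @ inv_word w3)) (b (Suc j))"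
      using w1 y(1) unfolding numeral_2_eq_2 np.simps(2)[of "Suc 0"] One_nat_def by blast
    thus False using no_three[OF m n1 ok f] by blast
  qed
  have pr: "a (j + p) = a j" "u (j + p) = u j" for j using per by (simp_all add: a_def u_def)
  show ?thesis using periodic_result[OF finS p(1) pr] Uw_words by blast
qed

text \<open>Loops are left out, because half of a loop is the empty word.\<close>

definition "onc v \<longleftrightarrow> (\<exists>w. scyc st v w \<and> length w \<ge> 2)"

lemma onc_mcyc: assumes "onc v" obtains c where "mcyc v c"
proof -
  let ?P = "\<lambda>c. scyc st v c \<and> length c \<ge> 2"
  obtain w where "?P w" using assms by (auto simp: onc_def)
  from ex_has_least_nat[of ?P w length, OF this] show ?thesis using that by (auto simp: mcyc_def)
qed

lemma letter_cases:
  assumes c: "scyc st v w" and x: "x \<in> set w"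
  shows "[x] \<approx> [] \<or> (\<exists>v1 v2. onc v1 \<and> onc v2 \<and> st v1 x v2)"
proof (cases "length w \<ge> 2")
  case True
  obtain A B where w: "w = A @ x # B" using x by (auto simp: in_set_conv_decomp)
  have "rdd v w v" using c by (simp add: scyc_def)
  then obtain v1 v2 where v: "rdd v A v1" "st v1 x v2" using w by (auto simp: rd_append)
  have c1: "scyc st v1 ([x] @ (B @ A))" using scyc_rot[of v A "x # B" v1] c w v by simp
  have "rdd v1 [x] v2" using v by simp
  from scyc_rot[OF c1 this] have "scyc st v2 ((B @ A) @ [x])" .
  moreover have "length ((B @ A) @ [x]) \<ge> 2" "length ([x] @ B @ A) \<ge> 2" using True w by auto
  ultimately show ?thesis using c1 v(2) unfolding onc_def by blast
next
  case False
  have "w \<noteq> []" using x by auto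
  hence "length w > 0" by simp
  hence "length w = 1" using False by linarith
  hence "w = [x]" using x by (auto simp: length_Suc_conv)
  thus ?thesis using closed_trivial c by (simp add: scyc_def)
qed

text \<open>Otherwise every element of the group is represented by a word readable from a single vertex, and
  its component is finite.\<close>

lemma two_classes:
  assumes fs: "infinite (group_elems S R)" and cov: "\<And>s. s \<in> S \<Longrightarrow> \<exists>v w x. scyc st v w \<and> x \<in> set w \<and> fst x = s"
  obtains z1 z2 where "onc z1" "onc z2" "\<not> vq z1 z2"
proof (rule ccontr)
  assume "\<not> thesis"
  hence all: "onc z1 \<Longrightarrow> onc z2 \<Longrightarrow> vq z1 z2" for z1 z2 using that by blast
  obtain z where z: "(\<exists>v. onc v) \<longrightarrow> onc z" by blast
  have letter: "[x] \<approx> [] \<or> (\<exists>v1 v2. vq z v1 \<and> vq z v2 \<and> st v1 x v2)" if xS: "fst x \<in> S" for x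
  proof -
    obtain v w y where y: "scyc st v w" "y \<in> set w" "fst y = fst x" using cov[OF xS] by blast
    have "x = y \<or> x = inv_letter y" using y(3) by (cases x; cases y) (auto simp: inv_letter_def)
    moreover have "[inv_letter y] \<approx> []" if "[y] \<approx> []" using eq_inv[OF that] by simp
    ultimately show ?thesis using letter_cases[OF y(1,2)] all z st_inv by metis
  qed
  have nf: "\<exists>w' v. rdd z w' v \<and> vq z v \<and> w \<approx> w'" if "w \<in> words S" for w
    using that
  proof (induction w rule: rev_induct)
    case Nil show ?case using eq_refl[of "[]"] by (intro exI[of _ "[]"] exI[of _ z]) simp
  next
    case (snoc x w)
    then obtain w' v where w': "rdd z w' v" "vq z v" "w \<approx> w'" by auto
    have xS: "fst x \<in> S" using snoc.prems by simp
    from letter[OF xS] show ?case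
    proof
      assume "[x] \<approx> []"
      hence "w @ [x] \<approx> w' @ []" by (rule eq_app[OF w'(3)])
      thus ?thesis using w' by auto
    next
      assume "\<exists>v1 v2. vq z v1 \<and> vq z v2 \<and> st v1 x v2"
      then obtain v1 v2 where v: "vq z v1" "vq z v2" "st v1 x v2" by blast
      have "vq v1 v" using vq_trans[OF vq_sym[OF v(1)] w'(2)] .
      moreover have "rdd v1 [x] v2" using v(3) by simp
      ultimately obtain v3 where v3: "rdd v [x] v3" "vq v2 v3" using rd_vq by blast
      have "rdd z (w' @ [x]) v3" using w'(1) v3(1) unfolding rd_append by blast
      moreover have "w @ [x] \<approx> w' @ [x]" by (rule eq_app[OF w'(3) eq_refl]) (use xS in simp)
      ultimately show ?thesis using vq_trans[OF v(2) v3(2)] by blast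
    qed
  qed
  let ?Q = "{v. \<exists>w. rdd z w v}"
  have "\<forall>v\<in>?Q. \<exists>w. rdd z w v" by blast
  from bchoice[OF this] obtain r where "\<forall>v\<in>?Q. rdd z (r v) v" by blast
  hence r: "\<And>v. v \<in> ?Q \<Longrightarrow> rdd z (r v) v" by blast
  have "group_elems S R \<subseteq> (\<lambda>v. word_eq S R `` {r v}) ` ?Q"
  proof
    fix X assume "X \<in> group_elems S R"
    then obtain w where w: "w \<in> words S" "X = word_eq S R `` {w}" by (auto simp: group_elems_def quotient_def)
    obtain w' v where w': "rdd z w' v" "w \<approx> w'" using nf[OF w(1)] by blast
    have v: "v \<in> ?Q" using w' by blast
    have "w \<approx> r v" using eq_trans[OF w'(2) rd_same_eq[OF w'(1) r[OF v]]] .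
    hence "word_eq S R `` {w} = word_eq S R `` {r v}" using eq_sym eq_trans unfolding eqw_def by blast
    thus "X \<in> (\<lambda>v. word_eq S R `` {r v}) ` ?Q" using v w(2) by blast
  qed
  thus False using fs finite_subset[OF _ finite_imageI[OF fin]] by blast
qed

section \<open>Generators on no simple cycle\<close>

definition esum :: "'s \<Rightarrow> ('s \<times> bool) list \<Rightarrow> int" where
  "esum s w = sum_list (map (\<lambda>x. if fst x = s then (if snd x then 1 else - 1) else 0) w)"

lemma esum_simps [simp]: "esum s [] = 0" "esum s (u @ v) = esum s u + esum s v"
  "esum s (x # w) = (if fst x = s then (if snd x then 1 else - 1) else 0) + esum s w"
  by (auto simp: esum_def)

lemma esum_none: "\<forall>x\<in>set w. fst x \<noteq> s \<Longrightarrow> esum s w = 0"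
  by (induction w) auto

lemma esum_back: "esum s [x, inv_letter x] = 0" by (simp add: inv_letter_def)

text \<open>A closed path can be emptied by removing simple cycles, which avoid \<open>s\<close>,
  and backtracks, in which the signs cancel. So the exponent sum is well defined on the group and
  shows that \<open>s\<close> has infinite order.\<close>

lemma esum_closed:
  assumes no: "\<And>v w x. scyc st v w \<Longrightarrow> x \<in> set w \<Longrightarrow> fst x \<noteq> s"
  shows "rdd v w v \<Longrightarrow> esum s w = 0"
proof (induction "length w" arbitrary: w rule: less_induct)
  case less
  show ?case
  proof (cases "w = []")
    case False
    have "\<not> distinct (sv v w @ [v])" using False by (cases w) auto
    from not_simple[OF less.prems this] obtain A B C v' where
      h: "w = A @ B @ C" "rdd v A v'" "rdd v' B v'" "scyc st v' B \<or> (\<exists>x. B = [x, inv_letter x])" by blast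
    have "rdd v' (B @ C) v" using rd_suff less.prems h(1,2) by blast
    hence "rdd v' C v" using rd_suff h(3) by blast
    hence "rdd v (A @ C) v" using h(2) by (auto simp: rd_append)
    moreover have "length (A @ C) < length w" using h(1,4) by (auto simp: scyc_def)
    ultimately have "esum s (A @ C) = 0" using less.hyps by blast
    moreover have "esum s B = 0" using h(4) no esum_none esum_back by metis
    ultimately show ?thesis using h(1) by simp
  qed simp
qed

lemma esum_eq:
  assumes no: "\<And>v w x. scyc st v w \<Longrightarrow> x \<in> set w \<Longrightarrow> fst x \<noteq> s"
  shows "u \<approx> v \<Longrightarrow> esum s u = esum s v"
  unfolding eqw_def
proof (induction rule: word_eq.induct)
  case (cancel u v x) thus ?case by (simp add: inv_letter_def)
next
  case (relator u v r)
  obtain z where "rdd z r z" using rel_rd[OF relator(3)] by blast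
  from esum_closed[OF no this] show ?case by simp
qed auto

text \<open>In a reduced diagram every edge labelled by such a letter has the outer face on both sides, so
  the edges of the power are matched with edges of the geodesics.\<close>

lemma free_letter:
  assumes finS: "finite S" and s: "s \<in> S" and no: "\<And>v w x. scyc st v w \<Longrightarrow> x \<in> set w \<Longrightarrow> fst x \<noteq> s"
  shows result
proof -
  let ?w = "[(s, True)]"
  have wS: "?w \<in> words S" using s by simp
  have es: "esum s (pw ?w n) = int n" for n by (induction n) auto
  have io: "infinite_order S R ?w"
  proof (rule infinite_orderI[OF wS])
    fix n :: nat assume n: "n > 0"
    show "\<not> pw ?w n \<approx> []" using esum_eq[OF no, where u = "pw ?w n" and v = "[]"] es[of n] n by auto
  qed
  have dgi: "\<exists>D al ph lv. dg D al ph lb ps lv os \<and> inner_ok D ph lb lv os" if "dg D al ph lb ps lv os" for D al ph lb ps lv os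
    using that
  proof (induction "mu D ph" arbitrary: D al ph rule: less_induct)
    case less
    show ?case
    proof (cases "inner_ok D ph lb lv os")
      case False
      from simple_or_reduce[OF less.prems False] show ?thesis using less.hyps by metis
    qed (use less.prems in blast)
  qed
  have "strongly_contracting S R (cyclic_sub S R ?w)"
  proof (rule contracting[OF finS wS io])
    fix k c1 c2 c3 assume "geodesic c1" "geodesic c2" "geodesic c3" and e: "pw ?w k @ c1 @ c2 @ c3 \<approx> []"
    define c where "c = c1 @ c2 @ c3"
    have "near_pw ?w 1 k c j" if j: "j < k" for j
    proof -
      have ne: "pw ?w k @ c \<noteq> []" using j by (cases k) auto
      obtain D0 al0 ph0 lb ps lv0 os where d0: "dg D0 al0 ph0 lb ps lv0 os" and os: "map lb os = pw ?w k @ c"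
        using diagram_exists[OF _ ne] e c_def by metis
      obtain D al ph lv where d: "dg D al ph lb ps lv os" and ok: "inner_ok D ph lb lv os" using dgi[OF d0] by blast
      note M = dgD(6)[OF d] and P = dgD(1)[OF d]
      have rep: "pw ?w n = replicate n (s, True)" for n by (induction n) auto
      obtain L gs where L: "os = L @ gs" "map lb L = replicate k (s, True)" "map lb gs = c"
        using iffD1[OF map_eq_append_conv os[unfolded rep]] by metis
      have lL: "length L = k" using arg_cong[OF L(2), of length] by simp
      define y where "y = L ! j"
      have Ls: "L = take j L @ y # drop (Suc j) L" using j lL by (simp add: y_def id_take_nth_drop)
      have tj: "map lb (take j L) = replicate j (s, True)" using L(2) j by (metis min.strict_order_iff take_map take_replicate)
      have yD: "y \<in> D" using dgD(3)[OF d] L(1) j lL by (auto simp: y_def)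
      have lby: "lb y = (s, True)" using L(2) j lL by (metis nth_map nth_replicate y_def)
      have lal: "lb (al y) = (s, False)" using pdgD(3)[OF P yD] lby by (simp add: inv_letter_def)
      have "al y \<in> set os"
      proof (rule ccontr)
        assume n: "al y \<notin> set os"
        hence I: "al y \<in> D - set os" using pmap_al[OF M yD] by blast
        obtain xs where xs: "cyc ph (al y # xs)" using cyc_exists[OF pmap_perms(1)[OF M]] I by blast
        hence "scyc st (lv (al y)) (map lb (al y # xs))" using ok I unfolding inner_ok_def by blast
        from no[OF this, of "lb (al y)"] show False using lal by simp
      qed
      moreover have "al y \<notin> set L"
      proof
        assume "al y \<in> set L"
        hence "lb (al y) \<in> set (map lb L)" by auto
        thus False using L(2) lal by auto
      qed
      ultimately have "al y \<in> set gs" using L(1) by simp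
      then obtain A B where AB: "gs = A @ al y # B" by (auto simp: in_set_conv_decomp)
      have py: "ps y \<approx> ps (hd os) @ replicate j (s, True)"
      proof -
        have "os = take j L @ y # (drop (Suc j) L @ gs)" using Ls L(1) by (metis append.assoc append_Cons)
        thus ?thesis using dg_pos[OF d, of "take j L" y] dgD(2,3)[OF d] tj by simp
      qed
      have "os = (L @ A) @ al y # B" using AB L(1) by simp
      hence pa: "ps (al y) \<approx> ps (hd os) @ (replicate k (s, True) @ map lb A)"
        using dg_pos[OF d, of "L @ A" "al y" B] dgD(2,3)[OF d] L(2) by simp
      have pay: "ps (al y) \<approx> ps y @ ?w" using pdgD(7)[OF P yD] lby by simp
      have "ps (hd os) @ (replicate k (s, True) @ map lb A) \<approx> ps y @ ?w" using eq_trans[OF eq_sym[OF pa] pay] .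
      also have "ps y @ ?w \<approx> (ps (hd os) @ replicate j (s, True)) @ ?w" by (rule eq_app[OF py eq_refl[OF wS]])
      finally have "ps (hd os) @ (replicate k (s, True) @ map lb A) \<approx> ps (hd os) @ (replicate j (s, True) @ ?w)" by simp
      hence "replicate k (s, True) @ map lb A \<approx> replicate j (s, True) @ ?w" by (rule eq_cancel_left)
      hence "replicate j (s, True) @ ?w \<approx> replicate k (s, True) @ map lb A" by (rule eq_sym)
      from eq_inv_move[OF this] have "pw ?w k @ map lb A @ inv_word ?w \<approx> pw ?w j" using eq_sym by (simp add: rep)
      moreover have "c = map lb A @ map lb (al y # B)" using L(3) AB by simp
      ultimately show ?thesis unfolding near_pw_def by (intro exI[of _ "map lb A"] exI[of _ "map lb (al y # B)"] exI[of _ "inv_word ?w"]) simp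
    qed
    hence "{j. j < k \<and> \<not> near_pw ?w 1 k (c1 @ c2 @ c3) j} = {}" by (auto simp: c_def)
    thus "card {j. j < k \<and> \<not> near_pw ?w 1 k (c1 @ c2 @ c3) j} \<le> 0" by (simp only: card.empty)
  qed
  thus ?thesis using wS io by blast
qed

theorem scg_contracting:
  assumes finS: "finite S" and inf: "infinite (group_elems S R)"
  shows result
proof (cases "\<exists>s\<in>S. \<forall>v w x. scyc st v w \<longrightarrow> x \<in> set w \<longrightarrow> fst x \<noteq> s")
  case True
  thus ?thesis using free_letter[OF finS] by blast
next
  case False
  then obtain z1 z2 where z: "onc z1" "onc z2" "\<not> vq z1 z2" using two_classes[OF inf] by metis
  obtain c1 where c1: "mcyc z1 c1" using onc_mcyc[OF z(1)] .
  obtain c2 where c2: "mcyc z2 c2" using onc_mcyc[OF z(2)] .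
  have "mcyc z (if z = z1 then c1 else c2)" if "z \<in> {z1, z2}" for z using that c1 c2 by auto
  from chain_from[OF finS this z(3)] show ?thesis .
qed

end

subsection \<open>Labelled graphs\<close>

definition lstep :: "('v, 'e, 's) lgraph \<Rightarrow> 'v \<Rightarrow> 's \<times> bool \<Rightarrow> 'v \<Rightarrow> bool" where
  "lstep G v x u \<longleftrightarrow> (\<exists>e\<in>edges G. ofrom G (e, snd x) = v \<and> oto G (e, snd x) = u \<and> lab G e = fst x)"

text \<open>The vertex maps are fixed to be the identity off the graph, so that they have inverses
  as functions on the whole type. In a reduced labelling the vertex map determines the edge
  map.\<close>

definition lauts :: "('v, 'e, 's) lgraph \<Rightarrow> ('v \<Rightarrow> 'v) set" where
  "lauts G = {f. (\<exists>fe. lab_aut G f fe) \<and> (\<forall>v. v \<notin> verts G \<longrightarrow> f v = v)}"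

lemma walk_verts_ne [simp]: "walk_verts G v es \<noteq> []" by (cases es) auto

lemma length_walk_verts [simp]: "length (walk_verts G v es) = Suc (length es)"
  by (induction es arbitrary: v) auto

lemma walk_verts_0 [simp]: "walk_verts G v es ! 0 = v" by (cases es) auto

lemma hd_walk_verts [simp]: "hd (walk_verts G v es) = v" by (cases es) auto

lemma walk_end_simps [simp]: "walk_end G v [] = v" "walk_end G v (eb # es) = walk_end G (oto G eb) es"
  by (auto simp: walk_end_def)

lemma walk_rd: "walk G v es \<Longrightarrow> rd (lstep G) v (read_word G es) (walk_end G v es)"
proof (induction es arbitrary: v)
  case (Cons eb es)
  have "lstep G v (lab G (fst eb), snd eb) (oto G eb)" using Cons.prems by (cases eb) (auto simp: lstep_def)
  thus ?case using Cons by (auto simp: read_word_def split: prod.splits)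
qed (simp add: read_word_def)

lemma walk_rd_take: "walk G v es \<Longrightarrow> i \<le> length es \<Longrightarrow> rd (lstep G) v (take i (read_word G es)) (walk_verts G v es ! i)"
proof (induction es arbitrary: v i)
  case (Cons eb es)
  have st: "lstep G v (lab G (fst eb), snd eb) (oto G eb)" using Cons.prems by (cases eb) (auto simp: lstep_def)
  show ?case
  proof (cases i)
    case (Suc i')
    hence "rd (lstep G) (oto G eb) (take i' (read_word G es)) (walk_verts G (oto G eb) es ! i')" using Cons by auto
    thus ?thesis using st Suc by (auto simp: read_word_def split: prod.splits)
  qed simp
qed (simp add: read_word_def)

lemma rd_walk:
  assumes wf: "wf_lgraph G S"
  shows "rd (lstep G) v w u \<Longrightarrow> v \<in> verts G \<Longrightarrow> \<exists>es. walk G v es \<and> read_word G es = w \<and> walk_end G v es = u"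
proof (induction w arbitrary: v)
  case Nil thus ?case by (intro exI[of _ "[]"]) (simp add: read_word_def)
next
  case (Cons x w)
  then obtain z where z: "lstep G v x z" "rd (lstep G) z w u" by auto
  obtain e where e: "e \<in> edges G" "ofrom G (e, snd x) = v" "oto G (e, snd x) = z" "lab G e = fst x" using z(1) by (auto simp: lstep_def)
  have "z \<in> verts G" using wf e(1,3) by (auto simp: wf_lgraph_def oto_def)
  from Cons.IH[OF z(2) this] obtain es where "walk G z es" "read_word G es = w" "walk_end G z es = u" by blast
  thus ?case using e Cons.prems(2) by (intro exI[of _ "(e, snd x) # es"]) (auto simp: read_word_def)
qed

lemma lstep_verts: "wf_lgraph G S \<Longrightarrow> lstep G v x u \<Longrightarrow> v \<in> verts G"
  by (auto simp: wf_lgraph_def lstep_def ofrom_def)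

lemma walk_take: "walk G v es \<Longrightarrow> walk G v (take n es)"
proof (induction es arbitrary: v n)
  case (Cons eb es) thus ?case by (cases n) auto
qed simp

lemma walk_step: "walk G v es \<Longrightarrow> i < length es \<Longrightarrow> ofrom G (es ! i) = walk_verts G v es ! i \<and> oto G (es ! i) = walk_verts G v es ! Suc i"
proof (induction es arbitrary: v i)
  case (Cons eb es)
  show ?case
  proof (cases i)
    case 0 thus ?thesis using Cons.prems by auto
  next
    case (Suc i') thus ?thesis using Cons by auto
  qed
qed simp

lemma walk_end_nth: "walk_end G v es = walk_verts G v es ! length es"
  by (simp add: walk_end_def last_conv_nth)

text \<open>If no vertex is repeated, an edge can only be repeated in the opposite direction and in
  the very next step, so the cycle is a walk along one edge and back, which \<open>scyc\<close>
  excludes.\<close>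

lemma scyc_simple_cycle:
  assumes wf: "wf_lgraph G S" and c: "scyc (lstep G) v w"
  shows "\<exists>es. simple_cycle G v es \<and> read_word G es = w"
proof -
  let ?st = "lstep G"
  have wne: "w \<noteq> []" and r: "rd ?st v w v" and nb: "\<And>x. w \<noteq> [x, inv_letter x]"
    and inj: "\<And>i j u. i < j \<Longrightarrow> j < length w \<Longrightarrow> rd ?st v (take i w) u \<Longrightarrow> \<not> rd ?st v (take j w) u"
    using c by (auto simp: scyc_def)
  obtain x w' where "w = x # w'" using wne by (cases w) auto
  then obtain y where "lstep G v x y" using r by auto
  hence vV: "v \<in> verts G" by (rule lstep_verts[OF wf])
  obtain es where es: "walk G v es" "read_word G es = w" "walk_end G v es = v" using rd_walk[OF wf r vV] by blast
  let ?V = "walk_verts G v es"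
  have len: "length es = length w" using es(2) by (auto simp: read_word_def)
  have ne: "?V ! i \<noteq> ?V ! j" if "i < j" "j < length w" for i j
  proof
    assume e: "?V ! i = ?V ! j"
    have "rd ?st v (take i w) (?V ! i)" "rd ?st v (take j w) (?V ! j)"
      using walk_rd_take[OF es(1), of i] walk_rd_take[OF es(1), of j] es(2) len that by auto
    thus False using inj[OF that] e by simp
  qed
  have ne2: "i = j" if "?V ! i = ?V ! j" "i < length w" "j < length w" for i j
    using ne[of i j] ne[of j i] that by (cases i j rule: linorder_cases) auto
  have "distinct (butlast ?V)"
    unfolding distinct_conv_nth using ne2 len by (auto simp: nth_butlast)
  moreover have "distinct (map fst es)"
  proof -
    have key: False if ij: "i < j" "j < length w" "fst (es ! i) = fst (es ! j)" for i j
    proof -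
      have si: "ofrom G (es ! i) = ?V ! i" "oto G (es ! i) = ?V ! Suc i" using walk_step[OF es(1), of i] ij len by auto
      have sj: "ofrom G (es ! j) = ?V ! j" "oto G (es ! j) = ?V ! Suc j" using walk_step[OF es(1), of j] ij len by auto
      show False
      proof (cases "snd (es ! i) = snd (es ! j)")
        case True
        hence "es ! i = es ! j" using ij(3) by (simp add: prod_eq_iff)
        thus False using ne[OF ij(1,2)] si sj by simp
      next
        case False
        hence "ofrom G (es ! i) = oto G (es ! j)" "oto G (es ! i) = ofrom G (es ! j)" using ij(3)
          by (auto simp: ofrom_def oto_def)
        hence e: "?V ! i = ?V ! Suc j" "?V ! Suc i = ?V ! j" using si sj by auto
        have j: "Suc i = j" using ne2[OF e(2)] ij by simp
        have "Suc j = length w"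
        proof (rule ccontr)
          assume "Suc j \<noteq> length w"
          thus False using ne2[OF e(1)] ij by simp
        qed
        hence "?V ! Suc j = ?V ! 0" using es(3) walk_end_nth[of G v es] len by simp
        hence i0: "i = 0" using ne2[of i 0] e(1) ij wne by simp
        have l2: "length es = 2" using \<open>Suc j = length w\<close> j i0 len by simp
        then obtain e1 e2 where e12: "es = [e1, e2]" by (auto simp: numeral_2_eq_2 length_Suc_conv)
        have "fst e1 = fst e2" "snd e1 \<noteq> snd e2" using ij(3) False j i0 e12 by auto
        hence "w = [(lab G (fst e1), snd e1), inv_letter (lab G (fst e1), snd e1)]"
          using es(2) e12 by (cases e1; cases e2) (auto simp: read_word_def inv_letter_def)
        thus False using nb by blast
      qed
    qed
    show ?thesis unfolding distinct_conv_nth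
    proof (intro allI impI)
      fix i j assume "i < length (map fst es)" "j < length (map fst es)" "i \<noteq> j"
      thus "map fst es ! i \<noteq> map fst es ! j" using key[of i j] key[of j i] len by (auto simp: neq_iff)
    qed
  qed
  moreover have "es \<noteq> []" using len wne by auto
  ultimately show ?thesis using es unfolding simple_cycle_def by blast
qed

lemma simple_cycle_rd: "simple_cycle G v es \<Longrightarrow> rd (lstep G) v (read_word G es) v"
  using walk_rd[of G v es] by (simp add: simple_cycle_def)

lemma lauts_inv:
  assumes wf: "wf_lgraph G S" and f: "f \<in> lauts G"
  shows "\<exists>g\<in>lauts G. \<forall>v. g (f v) = v"
proof -
  obtain fe where fe: "lab_aut G f fe" and out: "\<And>v. v \<notin> verts G \<Longrightarrow> f v = v" using f by (auto simp: lauts_def)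
  have bv: "bij_betw f (verts G) (verts G)" and be: "bij_betw fe (edges G) (edges G)"
    and h: "\<And>e. e \<in> edges G \<Longrightarrow> src G (fe e) = f (src G e) \<and> tgt G (fe e) = f (tgt G e) \<and> lab G (fe e) = lab G e"
    using fe by (auto simp: lab_aut_def)
  define g where "g v = (if v \<in> verts G then inv_into (verts G) f v else v)" for v
  define ge where "ge = inv_into (edges G) fe"
  have gf: "g (f v) = v" for v
  proof (cases "v \<in> verts G")
    case True
    thus ?thesis using bv by (simp add: g_def bij_betw_inv_into_left bij_betwE)
  qed (simp add: g_def out)
  have "bij_betw (inv_into (verts G) f) (verts G) (verts G)" by (rule bij_betw_inv_into[OF bv])
  hence bg: "bij_betw g (verts G) (verts G)" by (rule iffD1[OF bij_betw_cong, rotated]) (simp add: g_def)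
  have bge: "bij_betw ge (edges G) (edges G)" unfolding ge_def by (rule bij_betw_inv_into[OF be])
  have "lab_aut G g ge"
    unfolding lab_aut_def
  proof (intro conjI ballI bg bge)
    fix e assume e: "e \<in> edges G"
    have ge: "ge e \<in> edges G" "fe (ge e) = e" using bge be e by (auto simp: ge_def bij_betw_inv_into_right bij_betwE)
    show "src G (ge e) = g (src G e)" "tgt G (ge e) = g (tgt G e)" "lab G (ge e) = lab G e"
      using h[OF ge(1)] ge(2) gf by auto
  qed
  hence "g \<in> lauts G" by (auto simp: lauts_def g_def)
  thus ?thesis using gf by blast
qed

text \<open>The main point is \<open>small\<close>: the readings of \<open>w1\<close> from
  \<open>v\<close> and from \<open>v2\<close> are two maps of one path graph, and an automorphism
  carrying the first to the second would map \<open>v\<close> to \<open>v2\<close>. So they form a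
  piece.\<close>

lemma scg_graph:
  assumes wf: "wf_lgraph G S" and red: "reduced G" and fc: "finite_components G" and gr: "Gr_sixth G"
  shows "scg (lstep G) (lauts G) S (relators G)"
proof
  fix v x u u' assume s: "lstep G v x u"
  show "fst x \<in> S" using s wf by (auto simp: lstep_def wf_lgraph_def)
  show "lstep G u (inv_letter x) v" using s by (auto simp: lstep_def inv_letter_def ofrom_def oto_def)
  assume s': "lstep G v x u'"
  obtain e where e: "e \<in> edges G" "ofrom G (e, snd x) = v" "oto G (e, snd x) = u" "lab G e = fst x" using s by (auto simp: lstep_def)
  obtain e' where e': "e' \<in> edges G" "ofrom G (e', snd x) = v" "oto G (e', snd x) = u'" "lab G e' = fst x" using s' by (auto simp: lstep_def)
  have "lab G e = lab G e'" using e(4) e'(4) by simp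
  moreover have "src G e = src G e' \<or> tgt G e = tgt G e'" using e(2) e'(2) by (cases "snd x") (simp_all add: ofrom_def)
  ultimately have "e = e'" using red e(1) e'(1) unfolding reduced_def by blast
  thus "u = u'" using e(3) e'(3) by simp
next
  have "lab_aut G (\<lambda>v. v) (\<lambda>e. e)" by (auto simp: lab_aut_def bij_betw_def)
  thus "(\<lambda>v. v) \<in> lauts G" by (auto simp: lauts_def)
next
  fix f g assume "f \<in> lauts G" "g \<in> lauts G"
  then obtain fe ge where h: "lab_aut G f fe" "lab_aut G g ge" "\<forall>v. v \<notin> verts G \<longrightarrow> f v = v" "\<forall>v. v \<notin> verts G \<longrightarrow> g v = v"
    by (auto simp: lauts_def)
  have "bij_betw (\<lambda>v. f (g v)) (verts G) (verts G)" "bij_betw (\<lambda>e. fe (ge e)) (edges G) (edges G)"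
    using h bij_betw_trans[of g "verts G" "verts G" f "verts G"] bij_betw_trans[of ge "edges G" "edges G" fe "edges G"]
    by (auto simp: lab_aut_def comp_def)
  moreover have "ge e \<in> edges G" if "e \<in> edges G" for e using h(2) that by (auto simp: lab_aut_def bij_betwE)
  ultimately have "lab_aut G (\<lambda>v. f (g v)) (\<lambda>e. fe (ge e))" using h(1,2) by (auto simp: lab_aut_def)
  thus "(\<lambda>v. f (g v)) \<in> lauts G" using h(3,4) by (auto simp: lauts_def)
next
  fix f assume "f \<in> lauts G"
  thus "\<exists>g\<in>lauts G. \<forall>v. g (f v) = v" by (rule lauts_inv[OF wf])
next
  fix f v x u assume "f \<in> lauts G" "lstep G v x u"
  then obtain fe e where fe: "lab_aut G f fe" and e: "e \<in> edges G" "ofrom G (e, snd x) = v" "oto G (e, snd x) = u" "lab G e = fst x"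
    by (auto simp: lauts_def lstep_def)
  have "fe e \<in> edges G" using fe e(1) by (auto simp: lab_aut_def bij_betwE)
  thus "lstep G (f v) x (f u)" using fe e unfolding lstep_def
    by (intro bexI[of _ "fe e"]) (auto simp: lab_aut_def ofrom_def oto_def)
next
  fix r assume "r \<in> relators G"
  then obtain v es where "r = read_word G es" "simple_cycle G v es" by (auto simp: relators_def)
  thus "\<exists>v. rd (lstep G) v r v" using simple_cycle_rd[of G v es] by blast
next
  fix v w assume "scyc (lstep G) v w"
  thus "w \<in> relators G" using scyc_simple_cycle[OF wf] by (fastforce simp: relators_def)
next
  fix v w1 w2 u v2 u2
  assume c: "scyc (lstep G) v (w1 @ w2)" and r2: "rd (lstep G) v2 w1 u2" and ne: "\<not> veq (lauts G) v v2"
  show "6 * length w1 < length (w1 @ w2)"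
  proof (cases w1)
    case Nil thus ?thesis using c by (auto simp: scyc_def)
  next
    case (Cons x w)
    obtain y where "lstep G v2 x y" using r2 Cons by auto
    hence v2: "v2 \<in> verts G" by (rule lstep_verts[OF wf])
    obtain es where es: "simple_cycle G v es" "read_word G es = w1 @ w2" using scyc_simple_cycle[OF wf c] by blast
    obtain es2 where es2: "walk G v2 es2" "read_word G es2 = w1" using rd_walk[OF wf r2 v2] by blast
    define es1 where "es1 = take (length w1) es"
    have len: "length es = length (w1 @ w2)" "length es2 = length w1" using arg_cong[OF es(2), of length] arg_cong[OF es2(2), of length] by (simp_all add: read_word_def)
    have rw1: "read_word G es1 = w1" using es(2) by (simp add: es1_def read_word_def take_map[symmetric])
    have l1: "length es1 = length w1" using len by (simp add: es1_def)
    have sn: "map snd es = map snd (read_word G es)" for es by (auto simp: read_word_def)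
    have "piece G v es1 v2 es2"
      unfolding piece_def
    proof (intro conjI notI)
      show "walk G v es1" unfolding es1_def using es(1) by (intro walk_take) (simp add: simple_cycle_def)
      show "map snd es1 = map snd es2" using sn[of es1] sn[of es2] rw1 es2(2) by simp
      assume "\<exists>fv fe. lab_aut G fv fe \<and> map fv (walk_verts G v es1) = walk_verts G v2 es2 \<and> map fe (map fst es1) = map fst es2"
      then obtain fv fe where a: "lab_aut G fv fe" "map fv (walk_verts G v es1) = walk_verts G v2 es2" by blast
      have "fv v = v2" using arg_cong[OF a(2), of hd] by (simp add: hd_map)
      define f where "f y = (if y \<in> verts G then fv y else y)" for y
      have vV: "v \<in> verts G" using es(1) by (cases es) (auto simp: simple_cycle_def)
      have "lab_aut G f fe"
      proof -
        have "bij_betw f (verts G) (verts G)"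
          by (rule iffD1[OF bij_betw_cong, of _ fv]) (use a(1) in \<open>auto simp: f_def lab_aut_def\<close>)
        thus ?thesis using a(1) wf by (auto simp: lab_aut_def f_def wf_lgraph_def)
      qed
      hence "f \<in> lauts G" by (auto simp: lauts_def f_def)
      thus False using ne vV \<open>fv v = v2\<close> by (auto simp: veq_def f_def)
    qed (use es2 rw1 l1 len in auto)
    moreover have "subpath_of_cycle G v es1 v es"
      unfolding subpath_of_cycle_def
      \<comment> \<open>Offset 0 suffices: pieces elsewhere on a cycle are brought to its beginning
        by \<open>scyc_rot\<close>.\<close>
      by (intro exI[of _ 0]) (use len Cons in \<open>auto simp: es1_def\<close>)
    ultimately have "real (length es1) < real (length es) / 6" using gr es(1) unfolding Gr_sixth_def by blast
    thus ?thesis using l1 len by linarith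
  qed
next
  fix v
  show "finite {u. \<exists>w. rd (lstep G) v w u}"
  proof (cases "v \<in> verts G")
    case True
    have "{u. \<exists>w. rd (lstep G) v w u} \<subseteq> component G v" using rd_walk[OF wf _ True] unfolding component_def by blast
    moreover have "finite (component G v)" using fc True by (simp add: finite_components_def)
    ultimately show ?thesis by (rule finite_subset)
  next
    case False
    have "u = v" if "rd (lstep G) v w u" for u w using that False lstep_verts[OF wf, of v] by (cases w) (simp_all, blast)
    hence "{u. \<exists>w. rd (lstep G) v w u} \<subseteq> {v}" by blast
    thus ?thesis by (rule finite_subset) simp
  qed
qed

theorem theorem5p1:
  fixes G :: "('v, 'e, 's) lgraph" and S :: "'s set"
  assumes "wf_lgraph G S"
    and "reduced G"
    and "finite S"
    and "finite_components G"
    and "Gr_sixth G"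
    and "infinite (group_elems S (relators G))"
  shows "\<exists>w\<in>words S. infinite_order S (relators G) w \<and>
           strongly_contracting S (relators G) (cyclic_sub S (relators G) w)"
  using scg.scg_contracting[OF scg_graph[OF assms(1,2,4,5)] assms(3,6)] .

end
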